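(* Let $p$ be an odd prime, $q$ a prime dividing $p-1$, and $\mathbb{A}\in\{\mathbb{F}_p,\mathbb{Z}_p\}$. Let $G$ be a finitely generated noncommutative free pro-$p$ group and let $\Delta\subset\mathrm{Aut}(G)$ be a cyclic subgroup of order $q$. Then every eigenspace $\mathcal{L}(\mathbb{A},G)[\chi]$, $\chi\in\mathrm{Irr}(\Delta)$, is infinite dimensional (i.e. of infinite rank over $\mathbb{A}$).
   Context: $Al(\mathbb{A},G):=\varprojlim_U \mathbb{A}[G/U]$ ($U$ open normal in $G$) is the completed group algebra and $Al_n(\mathbb{A},G)$ the $n$-th power of its augmentation ideal. $G_n(\mathbb{A}):=\{g\in G: g-1\in Al_n(\mathbb{A},G)\}$, $\mathcal{L}_n(\mathbb{A},G):=G_n(\mathbb{A})/G_{n+1}(\mathbb{A})$, and $\mathcal{L}(\mathbb{A},G):=\bigoplus_{n\ge1}\mathcal{L}_n(\mathbb{A},G)$; for $G$ free this is torsion-free over $\mathbb{A}$. $\mathrm{Irr}(\Delta)$ is the group of characters $\chi:\Delta\to\mathbb{A}^\times$ (cyclic of order $q$); for an $\mathbb{A}[\Delta]$-module $M$, $M[\chi]:=\{x\in M:\delta(x)=\chi(\delta)x\ \forall\delta\in\Delta\}$. *)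

theory Defs
  imports
    "HOL-Algebra.Bij"
    "HOL-Algebra.Elementary_Groups"
    "HOL-Algebra.Ideal_Product"
    "HOL-Algebra.Module"
    "HOL-Analysis.Abstract_Topological_Spaces"
    "HOL-Number_Theory.Residues"
begin

section \<open>Pro-p groups\<close>

definition top_group :: "'g monoid \<Rightarrow> 'g topology \<Rightarrow> bool" where
  "top_group G T \<longleftrightarrow> group G \<and> topspace T = carrier G \<and>
     continuous_map (prod_topology T T) T (\<lambda>(x, y). x \<otimes>\<^bsub>G\<^esub> y) \<and>
     continuous_map T T (\<lambda>x. inv\<^bsub>G\<^esub> x)"

definition totally_disconnected :: "'g topology \<Rightarrow> bool" where
  "totally_disconnected T \<longleftrightarrow> (\<forall>S. connectedin T S \<longrightarrow> (\<exists>x. S \<subseteq> {x}))"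

definition profinite_group :: "'g monoid \<Rightarrow> 'g topology \<Rightarrow> bool" where
  "profinite_group G T \<longleftrightarrow>
     top_group G T \<and> compact_space T \<and> Hausdorff_space T \<and> totally_disconnected T"

definition open_normal :: "'g monoid \<Rightarrow> 'g topology \<Rightarrow> 'g set set" where
  "open_normal G T = {U. U \<lhd> G \<and> openin T U}"

definition pro_p_group :: "nat \<Rightarrow> 'g monoid \<Rightarrow> 'g topology \<Rightarrow> bool" where
  "pro_p_group p G T \<longleftrightarrow>
     profinite_group G T \<and> (\<forall>U \<in> open_normal G T. \<exists>k. order (G Mod U) = p ^ k)"

definition top_finitely_generated :: "'g monoid \<Rightarrow> 'g topology \<Rightarrow> bool" where
  "top_finitely_generated G T \<longleftrightarrow>
     (\<exists>S. finite S \<and> S \<subseteq> carrier G \<and> T closure_of (generate G S) = carrier G)"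

definition cont_hom ::
  "'g monoid \<Rightarrow> 'g topology \<Rightarrow> 'h monoid \<Rightarrow> 'h topology \<Rightarrow> ('g \<Rightarrow> 'h) set" where
  "cont_hom G T H S = {f \<in> hom G H. continuous_map T S f}"

definition converges_to_one ::
  "'x set \<Rightarrow> ('x \<Rightarrow> 'h) \<Rightarrow> 'h monoid \<Rightarrow> 'h topology \<Rightarrow> bool" where
  "converges_to_one X \<mu> H S \<longleftrightarrow> (\<forall>U \<in> open_normal H S. finite {x \<in> X. \<mu> x \<notin> U})"

text \<open>
  The universal property of a free pro-p group on a set converging to 1. A definition in HOL
  cannot quantify over all types of targets; \<^typ>\<open>nat \<Rightarrow> nat\<close> loses nothing. It
  contains a copy of every finite p-group, and the property for finite targets gives it for an
  arbitrary pro-p group H, which is the inverse limit of its finite quotients: the extensions to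
  these quotients exist and, being unique, are compatible.
\<close>

definition free_pro_p_on :: "nat \<Rightarrow> 'g monoid \<Rightarrow> 'g topology \<Rightarrow> 'g set \<Rightarrow> bool" where
  "free_pro_p_on p G T X \<longleftrightarrow>
     pro_p_group p G T \<and> X \<subseteq> carrier G \<and> converges_to_one X (\<lambda>x. x) G T \<and>
     (\<forall>(H :: (nat \<Rightarrow> nat) monoid) S. pro_p_group p H S \<longrightarrow>
        (\<forall>\<mu> \<in> X \<rightarrow> carrier H. converges_to_one X \<mu> H S \<longrightarrow>
           (\<exists>f \<in> cont_hom G T H S. (\<forall>x \<in> X. f x = \<mu> x) \<and>
              (\<forall>f' \<in> cont_hom G T H S. (\<forall>x \<in> X. f' x = \<mu> x) \<longrightarrow>
                 (\<forall>g \<in> carrier G. f' g = f g)))))"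

definition free_pro_p_group :: "nat \<Rightarrow> 'g monoid \<Rightarrow> 'g topology \<Rightarrow> bool" where
  "free_pro_p_group p G T \<longleftrightarrow> (\<exists>X. free_pro_p_on p G T X)"

text \<open>As in \<^const>\<open>AutoGroup\<close>, automorphisms are extensional functions on the carrier.\<close>

definition top_AutoGroup :: "'g monoid \<Rightarrow> 'g topology \<Rightarrow> ('g \<Rightarrow> 'g) monoid" where
  "top_AutoGroup G T = (AutoGroup G)\<lparr>carrier := {f \<in> auto G. homeomorphic_map T T f}\<rparr>"

definition aut_subgroup ::
  "'g monoid \<Rightarrow> 'g topology \<Rightarrow> ('g \<Rightarrow> 'g) set \<Rightarrow> ('g \<Rightarrow> 'g) monoid" where
  "aut_subgroup G T \<Delta> = (top_AutoGroup G T)\<lparr>carrier := \<Delta>\<rparr>"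


section \<open>Coefficient rings\<close>

text \<open>
  The p-adic integers as the inverse limit of the rings \<open>\<int>/p\<^sup>n\<close>, where \<open>n \<ge> 1\<close>: the component
  with index k is a residue modulo \<open>p ^ Suc k\<close>. (The zero ring is avoided because
  \<^term>\<open>residue_ring 1\<close> is not a ring: its unit 1 lies outside its carrier.)
\<close>

definition padic_int_ring :: "nat \<Rightarrow> (nat \<Rightarrow> int) ring" where
  "padic_int_ring p =
     \<lparr>carrier = {a. \<forall>k. a k \<in> carrier (residue_ring (int p ^ Suc k)) \<and>
                       a (Suc k) mod int p ^ Suc k = a k},
      monoid.mult = (\<lambda>a b k. a k \<otimes>\<^bsub>residue_ring (int p ^ Suc k)\<^esub> b k),
      one = (\<lambda>k. \<one>\<^bsub>residue_ring (int p ^ Suc k)\<^esub>),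
      zero = (\<lambda>k. \<zero>\<^bsub>residue_ring (int p ^ Suc k)\<^esub>),
      add = (\<lambda>a b k. a k \<oplus>\<^bsub>residue_ring (int p ^ Suc k)\<^esub> b k)\<rparr>"


section \<open>The completed group algebra\<close>

definition group_algebra :: "'r ring \<Rightarrow> 'h monoid \<Rightarrow> ('h \<Rightarrow> 'r) ring" where
  "group_algebra A H =
     \<lparr>carrier = carrier H \<rightarrow>\<^sub>E carrier A,
      monoid.mult = (\<lambda>f g. \<lambda>x \<in> carrier H.
        (\<Oplus>\<^bsub>A\<^esub>y \<in> carrier H. f y \<otimes>\<^bsub>A\<^esub> g (inv\<^bsub>H\<^esub> y \<otimes>\<^bsub>H\<^esub> x))),
      one = (\<lambda>x \<in> carrier H. if x = \<one>\<^bsub>H\<^esub> then \<one>\<^bsub>A\<^esub> else \<zero>\<^bsub>A\<^esub>),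
      zero = (\<lambda>x \<in> carrier H. \<zero>\<^bsub>A\<^esub>),
      add = (\<lambda>f g. \<lambda>x \<in> carrier H. f x \<oplus>\<^bsub>A\<^esub> g x)\<rparr>"

text \<open>
  For \<open>U \<subseteq> V\<close>, the A-linear extension of the projection \<open>G/U \<rightarrow> G/V\<close>; the cosets of U mapped to
  a coset C of V are those contained in C.
\<close>

definition group_algebra_proj ::
  "'r ring \<Rightarrow> 'g monoid \<Rightarrow> 'g set \<Rightarrow> 'g set \<Rightarrow> ('g set \<Rightarrow> 'r) \<Rightarrow> ('g set \<Rightarrow> 'r)" where
  "group_algebra_proj A G U V f =
     (\<lambda>C \<in> carrier (G Mod V). \<Oplus>\<^bsub>A\<^esub>D \<in> {D \<in> carrier (G Mod U). D \<subseteq> C}. f D)"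

type_synonym ('g, 'r) completed = "'g set \<Rightarrow> 'g set \<Rightarrow> 'r"

definition completed_algebra ::
  "'r ring \<Rightarrow> 'g monoid \<Rightarrow> 'g topology \<Rightarrow> ('g, 'r) completed ring" where
  "completed_algebra A G T =
     \<lparr>carrier = {f \<in> (\<Pi>\<^sub>E U \<in> open_normal G T. carrier (group_algebra A (G Mod U))).
                  \<forall>U \<in> open_normal G T. \<forall>V \<in> open_normal G T. U \<subseteq> V \<longrightarrow>
                    group_algebra_proj A G U V (f U) = f V},
      monoid.mult = (\<lambda>f g. \<lambda>U \<in> open_normal G T. f U \<otimes>\<^bsub>group_algebra A (G Mod U)\<^esub> g U),
      one = (\<lambda>U \<in> open_normal G T. \<one>\<^bsub>group_algebra A (G Mod U)\<^esub>),
      zero = (\<lambda>U \<in> open_normal G T. \<zero>\<^bsub>group_algebra A (G Mod U)\<^esub>),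
      add = (\<lambda>f g. \<lambda>U \<in> open_normal G T. f U \<oplus>\<^bsub>group_algebra A (G Mod U)\<^esub> g U)\<rparr>"

definition completed_smult ::
  "'r ring \<Rightarrow> 'g monoid \<Rightarrow> 'g topology \<Rightarrow> 'r \<Rightarrow> ('g, 'r) completed \<Rightarrow> ('g, 'r) completed" where
  "completed_smult A G T a f =
     (\<lambda>U \<in> open_normal G T. \<lambda>C \<in> carrier (G Mod U). a \<otimes>\<^bsub>A\<^esub> f U C)"

definition group_element ::
  "'r ring \<Rightarrow> 'g monoid \<Rightarrow> 'g topology \<Rightarrow> 'g \<Rightarrow> ('g, 'r) completed" where
  "group_element A G T g =
     (\<lambda>U \<in> open_normal G T. \<lambda>C \<in> carrier (G Mod U).
        if C = U #>\<^bsub>G\<^esub> g then \<one>\<^bsub>A\<^esub> else \<zero>\<^bsub>A\<^esub>)"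

text \<open>
  The augmentation sums the coefficients of the component at any U; at \<open>U = G\<close> there is a single
  coset, so that component is its coefficient at \<open>G\<close>.
\<close>

definition augmentation :: "'g monoid \<Rightarrow> ('g, 'r) completed \<Rightarrow> 'r" where
  "augmentation G f = f (carrier G) (carrier G)"

definition aug_ideal :: "'r ring \<Rightarrow> 'g monoid \<Rightarrow> 'g topology \<Rightarrow> ('g, 'r) completed set" where
  "aug_ideal A G T = {f \<in> carrier (completed_algebra A G T). augmentation G f = \<zero>\<^bsub>A\<^esub>}"

primrec Al :: "'r ring \<Rightarrow> 'g monoid \<Rightarrow> 'g topology \<Rightarrow> nat \<Rightarrow> ('g, 'r) completed set" where
  "Al A G T 0 = carrier (completed_algebra A G T)"
| "Al A G T (Suc n) = Al A G T n \<cdot>\<^bsub>completed_algebra A G T\<^esub> aug_ideal A G T"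


section \<open>The filtration of G and its graded module\<close>

definition minus_one :: "'r ring \<Rightarrow> 'g monoid \<Rightarrow> 'g topology \<Rightarrow> 'g \<Rightarrow> ('g, 'r) completed" where
  "minus_one A G T g =
     group_element A G T g \<ominus>\<^bsub>completed_algebra A G T\<^esub> \<one>\<^bsub>completed_algebra A G T\<^esub>"

definition filtr :: "'r ring \<Rightarrow> 'g monoid \<Rightarrow> 'g topology \<Rightarrow> nat \<Rightarrow> 'g set" where
  "filtr A G T n = {g \<in> carrier G. minus_one A G T g \<in> Al A G T n}"

definition Lie_layer :: "'r ring \<Rightarrow> 'g monoid \<Rightarrow> 'g topology \<Rightarrow> nat \<Rightarrow> 'g set monoid" where
  "Lie_layer A G T n = G\<lparr>carrier := filtr A G T n\<rparr> Mod filtr A G T (Suc n)"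

text \<open>
  The action of A on the layers is the one for which the embedding
  \<open>g G\<^sub>n\<^sub>+\<^sub>1 \<mapsto> g - 1 + Al\<^sub>n\<^sub>+\<^sub>1\<close> of the n-th layer into \<open>Al\<^sub>n / Al\<^sub>n\<^sub>+\<^sub>1\<close> is A-linear. So \<open>a \<cdot> C\<close> is the
  coset of all h with \<open>h - 1 \<equiv> a (g - 1)\<close> modulo \<open>Al\<^sub>n\<^sub>+\<^sub>1\<close>, for g in C; it is the coset of
  the power \<open>g\<^sup>a\<close>.
\<close>

definition layer_smult ::
  "'r ring \<Rightarrow> 'g monoid \<Rightarrow> 'g topology \<Rightarrow> nat \<Rightarrow> 'r \<Rightarrow> 'g set \<Rightarrow> 'g set" where
  "layer_smult A G T n a C =
     {h \<in> filtr A G T n. \<exists>g \<in> C.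
        minus_one A G T h \<ominus>\<^bsub>completed_algebra A G T\<^esub> completed_smult A G T a (minus_one A G T g)
          \<in> Al A G T (Suc n)}"

text \<open>
  The direct sum of the layers as an A-module. The fields \<open>mult\<close> and \<open>one\<close> of the record type are
  irrelevant for modules and left unspecified.
\<close>

definition Lie_module ::
  "'r ring \<Rightarrow> 'g monoid \<Rightarrow> 'g topology \<Rightarrow> ('r, nat \<Rightarrow> 'g set) module" where
  "Lie_module A G T =
     \<lparr>carrier = {x \<in> (\<Pi>\<^sub>E n \<in> {1..}. carrier (Lie_layer A G T n)).
                  finite {n \<in> {1..}. x n \<noteq> \<one>\<^bsub>Lie_layer A G T n\<^esub>}},
      monoid.mult = (\<lambda>x y. undefined),
      one = undefined,
      zero = (\<lambda>n \<in> {1..}. \<one>\<^bsub>Lie_layer A G T n\<^esub>),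
      add = (\<lambda>x y. \<lambda>n \<in> {1..}. x n \<otimes>\<^bsub>Lie_layer A G T n\<^esub> y n),
      smult = (\<lambda>a x. \<lambda>n \<in> {1..}. layer_smult A G T n a (x n))\<rparr>"

definition Lie_action :: "('g \<Rightarrow> 'g) \<Rightarrow> (nat \<Rightarrow> 'g set) \<Rightarrow> (nat \<Rightarrow> 'g set)" where
  "Lie_action \<delta> x = (\<lambda>n \<in> {1..}. \<delta> ` x n)"


section \<open>Eigenspaces and rank\<close>

definition Irr :: "'r ring \<Rightarrow> 'd monoid \<Rightarrow> ('d \<Rightarrow> 'r) set" where
  "Irr A D = hom D (units_of A)"

definition eigenspace ::
  "('r, 'm) module \<Rightarrow> 'd monoid \<Rightarrow> ('d \<Rightarrow> 'm \<Rightarrow> 'm) \<Rightarrow> ('d \<Rightarrow> 'r) \<Rightarrow> ('r, 'm) module" where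
  "eigenspace M D act chi =
     M\<lparr>carrier := {x \<in> carrier M. \<forall>\<delta> \<in> carrier D. act \<delta> x = chi \<delta> \<odot>\<^bsub>M\<^esub> x}\<rparr>"

definition linearly_independent :: "'r ring \<Rightarrow> ('r, 'm) module \<Rightarrow> 'm set \<Rightarrow> bool" where
  "linearly_independent A M S \<longleftrightarrow> S \<subseteq> carrier M \<and>
     (\<forall>F c. finite F \<and> F \<subseteq> S \<and> c \<in> F \<rightarrow> carrier A \<and> (\<Oplus>\<^bsub>M\<^esub>x \<in> F. c x \<odot>\<^bsub>M\<^esub> x) = \<zero>\<^bsub>M\<^esub> \<longrightarrow>
        (\<forall>x \<in> F. c x = \<zero>\<^bsub>A\<^esub>))"

definition infinite_rank :: "'r ring \<Rightarrow> ('r, 'm) module \<Rightarrow> bool" where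
  "infinite_rank A M \<longleftrightarrow> (\<exists>S. infinite S \<and> linearly_independent A M S)"

end

theory Submission
  imports Defs "HOL-Algebra.Group_Action" "HOL-Algebra.Weak_Morphisms"
    "HOL-Number_Theory.Residue_Primitive_Roots"
begin

text \<open>
  On \<open>G/G\<^sub>2\<close> the generator \<open>\<delta>\<close> of \<open>\<Delta>\<close> is diagonalizable, since q is invertible in A and A contains the
  q-th roots of unity. As \<open>\<delta>\<close> is a nontrivial automorphism of order prime to p, it acts nontrivially on
  the Frattini quotient, so some eigenvector y has an eigenvalue \<open>\<eta> \<noteq> 1\<close>. As G is not commutative, there
  is an eigenvector x independent of y modulo p, with eigenvalue \<open>\<psi>\<close> say. The commutator
  \<open>[y, [y, \<dots> [y, x]]]\<close> with b letters y lies in \<open>G\<^sub>b\<^sub>+\<^sub>1\<close> and has the eigenvalue \<open>\<eta>\<^sup>b \<psi>\<close>, which is any prescribed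
  q-th root of unity for infinitely many b. Its class in the graded module has no A-torsion: G is free,
  so it has unitriangular representations over \<open>\<int>/p\<^sup>k\<close> of size b + 2 with prescribed superdiagonal
  characters modulo p, and one of them maps the commutator to a matrix whose corner entry is a unit.
\<close>

section \<open>Coefficient rings\<close>

text \<open>Nothing is known about how \<Delta> acts on a free basis, and no adapted basis is
  sought. Linear forms replace coordinates: y and x only have to be separated by two continuous
  homomorphisms l and m to Z/p, and a representation with these forms on its superdiagonal exists
  because a continuous homomorphism to Z/p is determined by its values on the given basis. Knowing
  the superdiagonal modulo p is enough: a corner entry that is nonzero modulo p is a unit modulo
  every power of p, which excludes torsion over the p-adic integers as well. A unitriangular matrix
  of size n + 1 detects degree n, because the augmentation ideal becomes strictly upper triangular,
  so the corner entry vanishes on its power n + 1. The vectors found lie in pairwise different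
  degrees, so linear independence reduces to each of them being torsion free. Both coefficient rings
  are treated at once by replacing identities in A with congruences between integers modulo all
  \<open>p ^ e k\<close>.\<close>

text \<open>
  The common features of \<open>\<int>/p\<close> (with e constant) and \<open>\<int>\<^sub>p\<close> (with \<open>e = Suc\<close>): red k is the reduction
  modulo \<open>p ^ e k\<close>.
\<close>

locale coeff_ring =
  fixes A :: "'r ring" and p :: nat and e :: "nat \<Rightarrow> nat" and red :: "nat \<Rightarrow> 'r \<Rightarrow> int"
  assumes prime_p: "prime p"
    and e_mono: "mono e" and e_0: "e 0 = 1"
    and zero_in: "\<zero>\<^bsub>A\<^esub> \<in> carrier A" and one_in: "\<one>\<^bsub>A\<^esub> \<in> carrier A"
    and add_in: "\<lbrakk>a \<in> carrier A; b \<in> carrier A\<rbrakk> \<Longrightarrow> a \<oplus>\<^bsub>A\<^esub> b \<in> carrier A"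
    and mult_in: "\<lbrakk>a \<in> carrier A; b \<in> carrier A\<rbrakk> \<Longrightarrow> a \<otimes>\<^bsub>A\<^esub> b \<in> carrier A"
    and red_range: "a \<in> carrier A \<Longrightarrow> red k a mod (int p ^ e k) = red k a"
    and red_zero: "red k \<zero>\<^bsub>A\<^esub> = 0" and red_one: "red k \<one>\<^bsub>A\<^esub> = 1"
    and red_add: "\<lbrakk>a \<in> carrier A; b \<in> carrier A\<rbrakk> \<Longrightarrow>
      red k (a \<oplus>\<^bsub>A\<^esub> b) = (red k a + red k b) mod (int p ^ e k)"
    and red_mult: "\<lbrakk>a \<in> carrier A; b \<in> carrier A\<rbrakk> \<Longrightarrow>
      red k (a \<otimes>\<^bsub>A\<^esub> b) = (red k a * red k b) mod (int p ^ e k)"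
    and red_Suc: "a \<in> carrier A \<Longrightarrow> red (Suc k) a mod (int p ^ e k) = red k a"
    and red_inj: "\<lbrakk>a \<in> carrier A; b \<in> carrier A; \<And>k. red k a = red k b\<rbrakk> \<Longrightarrow> a = b"
    and red_complete: "(\<And>k. s (Suc k) mod (int p ^ e k) = s k mod (int p ^ e k)) \<Longrightarrow>
      \<exists>a\<in>carrier A. \<forall>k. red k a = s k mod (int p ^ e k)"
    and nat_approx: "a \<in> carrier A \<Longrightarrow> \<exists>j::nat \<Rightarrow> nat.
      (\<forall>r s. r \<le> s \<longrightarrow> [int (j r) = int (j s)] (mod int p ^ r)) \<and>
      (\<forall>k r. e k \<le> r \<longrightarrow> [int (j r) = red k a] (mod int p ^ e k))"
begin

abbreviation md :: "nat \<Rightarrow> int" where "md k \<equiv> int p ^ e k"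

lemma p_gt_1: "int p > 1"
  using prime_gt_1_nat[OF prime_p] by simp

lemma e_ge_1: "e k \<ge> 1"
  using monoD[OF e_mono, of 0 k] e_0 by simp

lemma md_gt_1: "md k > 1"
  using one_less_power[of "int p" "e k"] p_gt_1 e_ge_1[of k] by auto

lemma one_mod_md [simp]: "1 mod md k = 1"
  using md_gt_1[of k] by simp

lemma p_dvd_md: "int p dvd md k"
  using e_ge_1[of k] by (simp add: dvd_power)

lemma md_dvd: "k \<le> l \<Longrightarrow> md k dvd md l"
  using e_mono by (simp add: le_imp_power_dvd monoD)

lemma red_le: "\<lbrakk>a \<in> carrier A; k \<le> l\<rbrakk> \<Longrightarrow> red l a mod md k = red k a"
proof (induction l)
  case (Suc l)
  show ?case
  proof (cases "k = Suc l")
    case True thus ?thesis using Suc red_range by simp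
  next
    case False
    hence "k \<le> l" using Suc by simp
    hence "red (Suc l) a mod md k = red (Suc l) a mod md l mod md k"
      using md_dvd by (simp add: mod_mod_cancel)
    thus ?thesis using Suc \<open>k \<le> l\<close> red_Suc by simp
  qed
qed (simp add: red_range)

text \<open>The ring axioms are congruences between integers, tested by \<open>red_inj\<close> after
  every reduction. Only the additive inverse has to be constructed, as the limit of the residues of
  \<open>- red k x\<close>.\<close>

lemma cring: "cring A"
proof (rule cringI)
  show "abelian_group A"
  proof (rule abelian_groupI)
    fix x assume x: "x \<in> carrier A"
    obtain y where y: "y \<in> carrier A" "\<And>k. red k y = (- red k x) mod md k"
    proof -
      have "(- red (Suc k) x) mod md k = (- red k x) mod md k" for k
        using red_Suc[OF x, of k] by (metis mod_minus_eq)
      thus ?thesis using red_complete[of "\<lambda>k. - red k x"] that by blast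
    qed
    have "y \<oplus>\<^bsub>A\<^esub> x = \<zero>\<^bsub>A\<^esub>"
      by (rule red_inj) (use x y in \<open>auto simp: add_in zero_in red_add red_zero mod_simps\<close>)
    thus "\<exists>y\<in>carrier A. y \<oplus>\<^bsub>A\<^esub> x = \<zero>\<^bsub>A\<^esub>" using y by blast
  qed (auto simp: add_in zero_in intro!: red_inj,
       auto simp: add_in zero_in red_add red_zero red_range mod_simps algebra_simps)
  show "Group.comm_monoid A"
    by (rule comm_monoidI; (rule red_inj)?)
       (auto simp: mult_in one_in red_mult red_one red_range mod_simps algebra_simps)
qed (rule red_inj, auto simp: add_in mult_in red_add red_mult mod_simps algebra_simps)

sublocale A: cring A by (rule cring)

lemma red_finsum:
  assumes "finite S" "f \<in> S \<rightarrow> carrier A"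
  shows "red k (finsum A f S) = (\<Sum>x\<in>S. red k (f x)) mod md k"
  using assms
proof (induction S)
  case (insert x S)
  thus ?case
    by (simp add: A.finsum_insert red_add A.finsum_closed mod_simps)
qed (simp add: red_zero)

text \<open>The term of index \<open>e k\<close> already fixes the limit modulo
  \<open>p ^ e k\<close>. With \<open>e\<close> constant the same statement says that the sequence
  has a constant residue modulo p from index 1 on.\<close>

lemma red_limit:
  assumes "\<And>r s. r \<le> s \<Longrightarrow> [c r = c s] (mod int p ^ r)"
  shows "\<exists>a\<in>carrier A. \<forall>k r. e k \<le> r \<longrightarrow> [c r = red k a] (mod md k)"
proof -
  have "c (e (Suc k)) mod md k = c (e k) mod md k" for k
    using assms[of "e k" "e (Suc k)"] e_mono by (auto simp: cong_def monoD)
  then obtain a where a: "a \<in> carrier A" "\<And>k. red k a = c (e k) mod md k"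
    using red_complete[of "\<lambda>k. c (e k)"] by blast
  have "[c r = red k a] (mod md k)" if "e k \<le> r" for k r
    using assms[OF that] a(2)[of k] by (simp add: cong_def)
  thus ?thesis using a by blast
qed

end

text \<open>All reductions coincide, so compatibility in \<open>red_complete\<close> makes the
  sequence constant modulo p. A residue is approximated by the constant sequence of its natural
  representative.\<close>

lemma coeff_ring_residue_ring:
  assumes "prime p"
  shows "coeff_ring (residue_ring (int p)) p (\<lambda>_. 1) (\<lambda>_ a. a)"
proof -
  interpret residues "int p" "residue_ring (int p)"
    by unfold_locales (use prime_gt_1_nat[OF assms] in auto)
  show ?thesis
  proof
    fix s :: "nat \<Rightarrow> int" assume s: "\<And>k. s (Suc k) mod int p ^ 1 = s k mod int p ^ 1"
    have "s k mod int p = s 0 mod int p" for k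
      by (induction k) (use s in auto)
    thus "\<exists>a\<in>carrier (residue_ring (int p)). \<forall>k. a = s k mod int p ^ 1"
      by (intro bexI[of _ "s 0 mod int p"]) (metis power_one_right, simp)
  next
    fix a assume "a \<in> carrier (residue_ring (int p))"
    thus "\<exists>j::nat \<Rightarrow> nat. (\<forall>r s. r \<le> s \<longrightarrow> [int (j r) = int (j s)] (mod int p ^ r)) \<and>
      (\<forall>k r. 1 \<le> r \<longrightarrow> [int (j r) = a] (mod int p ^ 1))"
      by (intro exI[of _ "\<lambda>_. nat a"]) (auto simp: res_carrier_eq)
  qed (use assms in \<open>auto simp: res_carrier_eq res_add_eq res_mult_eq res_zero_eq res_one_eq mono_def prime_gt_0_nat prime_gt_1_nat[unfolded One_nat_def]\<close>)
qed

text \<open>The component with index k lives modulo \<open>p ^ Suc k\<close>, hence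
  \<open>e = Suc\<close>. The natural numbers approximating a are its own components, which are
  canonical and therefore nonnegative residues; the r-th one is even correct modulo
  \<open>p ^ Suc r\<close>.\<close>

lemma coeff_ring_padic_int_ring:
  assumes "prime p"
  shows "coeff_ring (padic_int_ring p) p Suc (\<lambda>k a. a k)"
proof -
  have p: "int p > 1" using prime_gt_1_nat[OF assms] by simp
  have gt: "int p ^ Suc k > 1" for k using p by (simp only: one_less_power)
  note gt' = gt[unfolded power_Suc]
  have R: "residues (int p ^ Suc k)" for k
    by unfold_locales (use gt in auto)
  note rs = residues.res_carrier_eq[OF R] residues.res_add_eq[OF R] residues.res_mult_eq[OF R]
    residues.res_zero_eq[OF R] residues.res_one_eq[OF R]
  have mm: "x mod int p ^ Suc (Suc k) mod int p ^ Suc k = x mod int p ^ Suc k" for x k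
    by (simp add: mod_mod_cancel)
  note mm' = mm[unfolded power_Suc]
  have carr: "a \<in> carrier (padic_int_ring p) \<longleftrightarrow>
      (\<forall>k. a k mod int p ^ Suc k = a k \<and> a (Suc k) mod int p ^ Suc k = a k)" for a
  proof -
    have "0 < int p ^ Suc k" for k using gt[of k] by linarith
    then have "x \<in> {0..int p ^ Suc k - 1} \<longleftrightarrow> x mod int p ^ Suc k = x" for x k
      by (smt (verit, best) atLeastAtMost_iff mod_pos_pos_trivial pos_mod_bound pos_mod_sign)
    thus ?thesis unfolding padic_int_ring_def by (simp only: rs partial_object.select_convs mem_Collect_eq)
  qed
  have ops: "(a \<oplus>\<^bsub>padic_int_ring p\<^esub> b) k = (a k + b k) mod int p ^ Suc k"
     "(a \<otimes>\<^bsub>padic_int_ring p\<^esub> b) k = (a k * b k) mod int p ^ Suc k"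
     "\<zero>\<^bsub>padic_int_ring p\<^esub> k = 0" "\<one>\<^bsub>padic_int_ring p\<^esub> k = 1" for a b k
    unfolding padic_int_ring_def by (simp_all only: rs ring_record_simps)
  show ?thesis
  proof
    show "\<zero>\<^bsub>padic_int_ring p\<^esub> \<in> carrier (padic_int_ring p)" "\<one>\<^bsub>padic_int_ring p\<^esub> \<in> carrier (padic_int_ring p)"
      unfolding carr ops using gt by simp_all
  next
    fix a b assume ab: "a \<in> carrier (padic_int_ring p)" "b \<in> carrier (padic_int_ring p)"
    have "(a (Suc k) + b (Suc k)) mod int p ^ Suc k = (a k + b k) mod int p ^ Suc k"
         "(a (Suc k) * b (Suc k)) mod int p ^ Suc k = (a k * b k) mod int p ^ Suc k" for k
      using ab unfolding carr by (metis mod_add_eq, metis mod_mult_eq)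
    thus "a \<oplus>\<^bsub>padic_int_ring p\<^esub> b \<in> carrier (padic_int_ring p)" "a \<otimes>\<^bsub>padic_int_ring p\<^esub> b \<in> carrier (padic_int_ring p)"
      unfolding carr ops mm by simp_all
  next
    fix s :: "nat \<Rightarrow> int" assume s: "\<And>k. s (Suc k) mod int p ^ Suc k = s k mod int p ^ Suc k"
    show "\<exists>a\<in>carrier (padic_int_ring p). \<forall>k. a k = s k mod int p ^ Suc k"
      by (rule bexI[of _ "\<lambda>k. s k mod int p ^ Suc k"]) (simp_all only: carr mm s mod_mod_trivial simp_thms)
  next
    fix a assume a: "a \<in> carrier (padic_int_ring p)"
    have step: "[a r = a s] (mod int p ^ Suc r)" if "r \<le> s" for r s
      using that
    proof (induction s rule: dec_induct)
      case (step n)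
      have "[a n = a (Suc n)] (mod int p ^ Suc n)"
        using a unfolding carr cong_def by metis
      hence "[a n = a (Suc n)] (mod int p ^ Suc r)"
        by (rule cong_dvd_modulus) (use step in \<open>simp add: le_imp_power_dvd del: power_Suc\<close>)
      thus ?case using step cong_trans by blast
    qed simp
    have nn: "a r \<ge> 0" for r
    proof -
      have "a r = a r mod int p ^ Suc r" using a unfolding carr by simp
      also have "\<dots> \<ge> 0" using gt[of r] by (intro pos_mod_sign) linarith
      finally show ?thesis .
    qed
    have "[int (nat (a r)) = int (nat (a s))] (mod int p ^ r)" if "r \<le> s" for r s
      using step[OF that] nn cong_dvd_modulus[of "a r" "a s" "int p ^ Suc r" "int p ^ r"] by simp
    moreover have "[int (nat (a r)) = a k] (mod int p ^ Suc k)" if "Suc k \<le> r" for k r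
      using step[of k r] nn that by (simp add: cong_sym_eq)
    ultimately show "\<exists>j::nat \<Rightarrow> nat. (\<forall>r s. r \<le> s \<longrightarrow> [int (j r) = int (j s)] (mod int p ^ r)) \<and>
      (\<forall>k r. Suc k \<le> r \<longrightarrow> [int (j r) = a k] (mod int p ^ Suc k))"
      by (intro exI[of _ "\<lambda>r. nat (a r)"]) blast
  qed (use assms in \<open>auto simp: ops carr mono_def simp del: power_Suc\<close>)
qed


section \<open>Finite p-groups\<close>

text \<open>Each orbit outside the fixed points has a size dividing \<open>r ^ k\<close> and
  different from 1, hence divisible by r. The action is any function satisfying the action laws on
  \<open>E\<close>; the restriction \<open>\<psi>\<close> turns it into the extensional permutations
  demanded by \<open>group_action\<close>.\<close>

lemma p_group_card_fixed_points:
  assumes "group G" and r: "prime r" "order G = r ^ k" and E: "finite E"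
    and closed: "\<And>g x. \<lbrakk>g \<in> carrier G; x \<in> E\<rbrakk> \<Longrightarrow> \<phi> g x \<in> E"
    and one: "\<And>x. x \<in> E \<Longrightarrow> \<phi> \<one>\<^bsub>G\<^esub> x = x"
    and mult: "\<And>g h x. \<lbrakk>g \<in> carrier G; h \<in> carrier G; x \<in> E\<rbrakk> \<Longrightarrow> \<phi> (g \<otimes>\<^bsub>G\<^esub> h) x = \<phi> g (\<phi> h x)"
  shows "[card {x \<in> E. \<forall>g\<in>carrier G. \<phi> g x = x} = card E] (mod r)"
proof -
  interpret group G by fact
  define \<psi> where "\<psi> = (\<lambda>g. restrict (\<phi> g) E)"
  have inv: "\<phi> (inv\<^bsub>G\<^esub> g) (\<phi> g x) = x" "\<phi> g (\<phi> (inv\<^bsub>G\<^esub> g) x) = x" if "g \<in> carrier G" "x \<in> E" for g x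
    using mult[of "inv\<^bsub>G\<^esub> g" g x] mult[of g "inv\<^bsub>G\<^esub> g" x] that one by auto
  have bij: "\<psi> g \<in> Bij E" if "g \<in> carrier G" for g
    using that inv closed unfolding \<psi>_def Bij_def
    by (auto intro!: bij_betw_byWitness[where f' = "\<phi> (inv\<^bsub>G\<^esub> g)"])
  have "group_action G E \<psi>"
  proof (unfold group_action_def group_hom_def group_hom_axioms_def, intro conjI)
    show "\<psi> \<in> hom G (BijGroup E)"
      using bij closed mult by (auto simp: hom_def BijGroup_def compose_def \<psi>_def fun_eq_iff)
  qed (auto simp: group_BijGroup)
  then interpret act: group_action G E \<psi> .
  define F where "F = {x \<in> E. \<forall>g\<in>carrier G. \<phi> g x = x}"
  define C where "C = orbit G \<psi> ` (E - F)"
  have orb_sub: "orbit G \<psi> x \<subseteq> E - F" if x: "x \<in> E - F" for x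
  proof
    fix y assume "y \<in> orbit G \<psi> x"
    then obtain g where g: "g \<in> carrier G" "y = \<phi> g x"
      using x by (auto simp: orbit_def \<psi>_def)
    have "y \<in> E" using g x closed by auto
    moreover have "y \<notin> F"
    proof
      assume y: "y \<in> F"
      have "\<phi> h x = x" if h: "h \<in> carrier G" for h
      proof -
        have "x = \<phi> (inv\<^bsub>G\<^esub> g) y" using g x inv by auto
        hence xy: "x = y" using y g by (auto simp: F_def)
        show ?thesis using y h by (auto simp: F_def xy)
      qed
      thus False using x by (auto simp: F_def)
    qed
    ultimately show "y \<in> E - F" by blast
  qed
  have U: "\<Union>C = E - F"
    using orb_sub act.orbit_refl unfolding C_def by blast
  have dvd: "r dvd card c" if c: "c \<in> C" for c
  proof -
    obtain x where x: "x \<in> E - F" "c = orbit G \<psi> x" using c by (auto simp: C_def)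
    have "card c * card (stabilizer G \<psi> x) = r ^ k"
      using act.orbit_stabilizer_theorem[of x] x r by simp
    hence "card c dvd r ^ k" by (metis dvd_triv_left)
    then obtain i where i: "card c = r ^ i"
      using r(1) by (meson divides_primepow_nat)
    have "i \<noteq> 0"
    proof
      assume "i = 0"
      then obtain z where z: "c = {z}" using i card_1_singletonE by auto
      have "\<phi> g x = x" if "g \<in> carrier G" for g
      proof -
        have "\<phi> g x \<in> c" "x \<in> c"
          using that x act.orbit_refl[of x] by (auto simp: orbit_def \<psi>_def)
        thus ?thesis using z by simp
      qed
      thus False using x by (auto simp: F_def)
    qed
    thus ?thesis using i by (simp add: dvd_power)
  qed
  have disj: "c \<inter> d = {}" if "c \<in> C" "d \<in> C" "c \<noteq> d" for c d
  proof -
    have "c \<in> orbits G E \<psi>" "d \<in> orbits G E \<psi>"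
      using that by (auto simp: C_def orbits_def)
    thus ?thesis using act.disjoint_union[of c d] that(3) by auto
  qed
  have "r dvd card (\<Union>C)"
    by (rule dvd_partition) (use U E dvd disj in \<open>auto simp: C_def\<close>)
  moreover have "card E = card F + card (E - F)"
    using card_Diff_subset[of F E] card_mono[of E F] finite_subset[of F E] E by (auto simp: F_def)
  ultimately show ?thesis
    unfolding F_def[symmetric] U
    by (metis add.right_neutral cong_0_iff cong_add_lcancel_nat cong_sym)
qed

text \<open>Iterating d is an action of the group Z/q on S. The prime here is q, the order of the
  automorphism, whereas the sets it will be applied to come from p-groups.\<close>

lemma card_fixed_points_of_period_prime:
  assumes q: "prime q" and S: "finite S" and closed: "\<And>x. x \<in> S \<Longrightarrow> d x \<in> S"
    and period: "\<And>x. x \<in> S \<Longrightarrow> (d ^^ q) x = x"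
  shows "[card {x \<in> S. d x = x} = card S] (mod q)"
proof -
  define Z where "Z = integer_mod_group q"
  have q0: "q > 0" using q prime_gt_0_nat by simp
  have Z: "group Z" "carrier Z = {0..<int q}" "order Z = q ^ 1"
    using q0 unfolding Z_def by (auto simp: carrier_integer_mod_group order_def)
  have it: "(d ^^ n) x \<in> S" if "x \<in> S" for n x
    by (induction n) (use that closed in auto)
  have itq: "(d ^^ (n * q)) x = x" if "x \<in> S" for n x
    by (induction n) (use that period in \<open>auto simp: funpow_add\<close>)
  have itmod: "(d ^^ (n mod q)) x = (d ^^ n) x" if "x \<in> S" for n x
  proof -
    have "(d ^^ n) x = (d ^^ (n mod q + n div q * q)) x" by simp
    also have "\<dots> = (d ^^ (n mod q)) x" by (simp only: funpow_add o_apply itq[OF that])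
    finally show ?thesis ..
  qed
  have "[card {x \<in> S. \<forall>g\<in>carrier Z. (d ^^ nat g) x = x} = card S] (mod q)"
  proof (rule p_group_card_fixed_points[OF Z(1) q Z(3) S])
    fix g h x assume g: "g \<in> carrier Z" and h: "h \<in> carrier Z" and x: "x \<in> S"
    have "nat ((g + h) mod int q) = (nat g + nat h) mod q"
      using g h Z by (simp add: nat_mod_distrib nat_add_distrib)
    thus "(d ^^ nat (g \<otimes>\<^bsub>Z\<^esub> h)) x = (d ^^ nat g) ((d ^^ nat h) x)"
      using itmod[OF x, of "nat g + nat h"] g h
      by (simp add: Z_def mult_integer_mod_group funpow_add)
  qed (auto simp: it Z_def)
  moreover have "{x \<in> S. \<forall>g\<in>carrier Z. (d ^^ nat g) x = x} = {x \<in> S. d x = x}"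
  proof -
    have "(d ^^ n) x = x" if "d x = x" for n x
      by (induction n) (use that in auto)
    moreover have "1 \<in> carrier Z" using Z q prime_gt_1_nat by auto
    ultimately show ?thesis by fastforce
  qed
  ultimately show ?thesis by simp
qed

text \<open>A homomorphism to Z/p through integer lifts of its values. With additivity only modulo
  p, a superdiagonal entry of a matrix over Z/p^k is such a function as it stands.\<close>

definition mod_hom :: "nat \<Rightarrow> ('g, 'b) monoid_scheme \<Rightarrow> ('g \<Rightarrow> int) \<Rightarrow> bool" where
  "mod_hom p G l \<longleftrightarrow> (\<forall>x\<in>carrier G. \<forall>y\<in>carrier G. [l (x \<otimes>\<^bsub>G\<^esub> y) = l x + l y] (mod int p))"

text \<open>
  The finite p-group acts on the \<open>\<int>/p\<close>-valued functions on the right cosets of the subgroup modulo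
  constants. The number of fixed points of this action is divisible by p, so there is a nonzero
  one, and it is a homomorphism.
\<close>

lemma (in group) proper_subgroup_killed_by_mod_hom:
  assumes p: "prime p" "order G = p ^ k" and C: "subgroup C G" "C \<noteq> carrier G"
  obtains l where "mod_hom p G l" "\<And>c. c \<in> C \<Longrightarrow> l c = 0" "\<exists>x\<in>carrier G. \<not> int p dvd l x"
proof -
  interpret C: subgroup C G by fact
  have fin: "finite (carrier G)"
    using p prime_gt_0_nat[OF p(1)] order_gt_0_iff_finite by simp
  define R where "R = rcosets C"
  have finR: "finite R" using fin by (simp add: R_def RCOSETS_def)
  have CR: "C \<in> R" unfolding R_def by (rule C.subgroup_in_rcosets) (rule group_axioms)
  have RM: "K #> g \<in> R" if "K \<in> R" "g \<in> carrier G" for K g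
    using that unfolding R_def RCOSETS_def by (auto simp: coset_mult_assoc C.subset)
  have RA: "K #> g #> h = K #> (g \<otimes> h)" if "K \<in> R" "g \<in> carrier G" "h \<in> carrier G" for K g h
    using that unfolding R_def by (metis C.rcosets_carrier coset_mult_assoc group_axioms)
  have R1: "K #> \<one> = K" if "K \<in> R" for K
    using that unfolding R_def by (metis C.rcosets_carrier coset_mult_one group_axioms)
  obtain y where y: "y \<in> carrier G" "y \<notin> C" using C C.subset by blast
  have "C #> y \<noteq> C" using y rcos_self[OF y(1) C.subgroup_axioms] by metis
  hence R2: "C #> y \<in> R - {C}" using RM[OF CR y(1)] by blast
  \<comment> \<open>A function modulo constants is represented by the one that vanishes at the coset
    C; \<open>\<phi> g\<close> translates by g and subtracts the value at \<open>C #> g\<close> to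
    restore this normalization.\<close>
  define E where "E = (\<Pi>\<^sub>E K\<in>R. if K = C then {0} else {0..<int p})"
  define \<phi> where "\<phi> = (\<lambda>g f. \<lambda>K\<in>R. (f (K #> g) - f (C #> g)) mod int p)"
  have p0: "int p > 0" using prime_gt_0_nat[OF p(1)] by simp
  have Emod: "f K mod int p = f K" if "f \<in> E" "K \<in> R" for f K
  proof -
    have "f K \<in> (if K = C then {0} else {0..<int p})" using that unfolding E_def by (rule PiE_mem)
    thus ?thesis by (simp split: if_splits)
  qed
  have EC: "f C = 0" if "f \<in> E" for f
    using PiE_mem[OF that[unfolded E_def] CR] by simp
  have Eext: "f = f'" if "f \<in> E" "f' \<in> E" "\<And>K. K \<in> R \<Longrightarrow> f K = f' K" for f f'
    using that unfolding E_def by (rule PiE_ext)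
  have Eclosed: "\<phi> g f \<in> E" if "f \<in> E" "g \<in> carrier G" for f g
    unfolding E_def \<phi>_def using p0 by auto
  have "finite E" unfolding E_def by (rule finite_PiE) (use finR in auto)
  hence "[card {f \<in> E. \<forall>g\<in>carrier G. \<phi> g f = f} = card E] (mod p)"
  proof (rule p_group_card_fixed_points[OF group_axioms p])
    fix f assume f: "f \<in> E"
    show "\<phi> \<one> f = f"
      by (rule Eext) (use f in \<open>auto simp: Eclosed\<close>, auto simp: \<phi>_def R1 CR EC Emod)
    fix g h assume g: "g \<in> carrier G" and h: "h \<in> carrier G"
    show "\<phi> (g \<otimes> h) f = \<phi> g (\<phi> h f)"
    proof (rule Eext)
      fix K assume K: "K \<in> R"
      show "\<phi> (g \<otimes> h) f K = \<phi> g (\<phi> h f) K"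
        using K g h CR RM by (simp add: \<phi>_def RA mod_simps)
    qed (use f g h in \<open>auto simp: Eclosed\<close>)
  qed (auto simp: Eclosed)
  \<comment> \<open>The coset \<open>C #> y\<close> differs from C, as C is proper, and contributes
    a factor p to the product.\<close>
  moreover have "p dvd card E"
  proof -
    have "card E = (\<Prod>K\<in>R. card (if K = C then {0} else {0..<int p}))"
      unfolding E_def using finR by (rule card_PiE)
    moreover have "card (if C #> y = C then {0} else {0..<int p}) dvd (\<Prod>K\<in>R. card (if K = C then {0} else {0..<int p}))"
      by (rule dvd_prodI) (use finR R2 in auto)
    ultimately show ?thesis using R2 by auto
  qed
  ultimately have dvd: "p dvd card {f \<in> E. \<forall>g\<in>carrier G. \<phi> g f = f}"
    by (simp add: cong_dvd_iff)
  define z where "z = (\<lambda>K\<in>R. 0::int)"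
  have z: "z \<in> {f \<in> E. \<forall>g\<in>carrier G. \<phi> g f = f}"
    using p0 by (auto simp: z_def E_def \<phi>_def fun_eq_iff RM CR)
  have "\<exists>f\<in>{f \<in> E. \<forall>g\<in>carrier G. \<phi> g f = f}. f \<noteq> z"
  proof (rule ccontr)
    assume "\<not> ?thesis"
    hence "{f \<in> E. \<forall>g\<in>carrier G. \<phi> g f = f} = {z}" using z by blast
    hence "card {f \<in> E. \<forall>g\<in>carrier G. \<phi> g f = f} = card {z}" by (rule arg_cong)
    hence "p dvd 1" using dvd by simp
    thus False using p prime_gt_1_nat by auto
  qed
  then obtain f where f: "f \<in> E" "\<And>g. g \<in> carrier G \<Longrightarrow> \<phi> g f = f" "f \<noteq> z" by blast
  have fz: "\<exists>K\<in>R. f K \<noteq> 0"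
  proof (rule ccontr)
    assume "\<not> ?thesis"
    hence "f = z" using f(1) z by (intro Eext) (simp_all add: z_def)
    thus False using f by simp
  qed
  \<comment> \<open>Invariance of f under g, read at the coset K. For \<open>K = C #> x\<close> this
    is additivity of \<open>\<lambda>x. f (C #> x)\<close>.\<close>
  have step: "[f (K #> g) = f K + f (C #> g)] (mod int p)" if "K \<in> R" "g \<in> carrier G" for K g
  proof -
    have "f K = (f (K #> g) - f (C #> g)) mod int p"
      using fun_cong[OF f(2)[OF that(2)], of K] that by (simp add: \<phi>_def)
    hence "[f K = f (K #> g) - f (C #> g)] (mod int p)" by (simp add: cong_def)
    hence "[f K + f (C #> g) = f (K #> g)] (mod int p)" 
      by (metis cong_add_rcancel diff_add_cancel)
    thus ?thesis by (rule cong_sym)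
  qed
  show thesis
  proof
    show "mod_hom p G (\<lambda>x. f (C #> x))"
      unfolding mod_hom_def using step RM[OF CR] by (simp add: RA[OF CR, symmetric])
    show "f (C #> c) = 0" if "c \<in> C" for c
      using that EC[OF f(1)] by (simp add: coset_join2 C.mem_carrier C.subgroup_axioms)
    obtain K x where "K \<in> R" "f K \<noteq> 0" "x \<in> carrier G" "K = C #> x"
      using fz unfolding R_def RCOSETS_def by blast
    thus "\<exists>x\<in>carrier G. \<not> int p dvd f (C #> x)"
      using Emod[OF f(1)] by (metis dvd_imp_mod_0)
  qed
qed

section \<open>Open normal subgroups of a pro-p group\<close>

locale pro_p = group G for G :: "'g monoid" (structure) +
  fixes p :: nat and T :: "'g topology"
  assumes p_prime: "prime p" and pro_p: "pro_p_group p G T"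
begin

abbreviation ON :: "'g set set" where "ON \<equiv> open_normal G T"

lemma topspace: "topspace T = carrier G"
  and cont_mult: "continuous_map (prod_topology T T) T (\<lambda>(x, y). x \<otimes> y)"
  and compact: "compact_space T" and Hausdorff: "Hausdorff_space T"
  and tot_disc: "totally_disconnected T"
  using pro_p by (auto simp: pro_p_group_def profinite_group_def top_group_def)

lemma ON_D: "U \<in> ON \<Longrightarrow> U \<lhd> G" "U \<in> ON \<Longrightarrow> openin T U" "U \<in> ON \<Longrightarrow> subgroup U G"
  "U \<in> ON \<Longrightarrow> group (G Mod U)"
  by (auto simp: open_normal_def normal_imp_subgroup normal.factorgroup_is_group)

lemma ON_one: "U \<in> ON \<Longrightarrow> \<one> \<in> U"
  using ON_D(3) subgroup.one_closed by blast

lemma ON_sub: "U \<in> ON \<Longrightarrow> U \<subseteq> carrier G"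
  using ON_D(3) subgroup.subset by blast

lemma order_quotient: "U \<in> ON \<Longrightarrow> \<exists>k. order (G Mod U) = p ^ k"
  using pro_p by (auto simp: pro_p_group_def)

lemma finite_quotient: "U \<in> ON \<Longrightarrow> finite (carrier (G Mod U))"
  using order_quotient[of U] prime_gt_0_nat[OF p_prime]
  by (metis ON_D(4) group.is_monoid monoid.order_gt_0_iff_finite zero_less_power)

lemma carrier_ON: "carrier G \<in> ON"
proof -
  have "carrier G \<lhd> G"
    by (rule normal_invI) (auto simp: subgroup_self)
  thus ?thesis using topspace openin_topspace[of T] by (simp add: open_normal_def)
qed

lemma Int_ON: "U \<in> ON \<Longrightarrow> V \<in> ON \<Longrightarrow> U \<inter> V \<in> ON"
  by (auto simp: open_normal_def normal_subgroup_intersect)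

lemma finite_INT_ON: "finite I \<Longrightarrow> I \<noteq> {} \<Longrightarrow> (\<And>i. i \<in> I \<Longrightarrow> U i \<in> ON) \<Longrightarrow> (\<Inter>i\<in>I. U i) \<in> ON"
  by (induction I rule: finite_ne_induct) (auto intro: Int_ON)

lemma cont_mult_fun:
  assumes "continuous_map X T f" "continuous_map X T g"
  shows "continuous_map X T (\<lambda>x. f x \<otimes> g x)"
  using continuous_map_compose[OF continuous_map_pairedI[OF assms] cont_mult]
  by (simp add: o_def)

lemma coset_eq_vimage:
  assumes "subgroup U G" "g \<in> carrier G"
  shows "U #> g = {x \<in> topspace T. x \<otimes> inv g \<in> U}"
  using assms subgroup.rcos_module[OF assms(1) group_axioms assms(2)]
  by (auto simp: topspace) (meson r_coset_subset_G subgroup.subset subsetD)+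

lemma coset_open: "U \<in> ON \<Longrightarrow> g \<in> carrier G \<Longrightarrow> openin T (U #> g)"
  unfolding coset_eq_vimage[OF ON_D(3)]
  by (rule openin_continuous_map_preimage[OF cont_mult_fun])
     (auto simp: topspace ON_D(2))

lemma coset_closed: 
  assumes "U \<in> ON" "g \<in> carrier G"
  shows "closedin T (U #> g)"
proof -
  have "topspace T - (U #> g) = \<Union>{U #> h | h. h \<in> carrier G \<and> U #> h \<noteq> U #> g}"
  proof (intro equalityI subsetI)
    fix x assume "x \<in> topspace T - (U #> g)"
    hence x: "x \<in> carrier G" "x \<notin> U #> g" by (auto simp: topspace)
    have "x \<in> U #> x" using x(1) ON_D(3)[OF assms(1)] by (rule rcos_self)
    thus "x \<in> \<Union>{U #> h | h. h \<in> carrier G \<and> U #> h \<noteq> U #> g}"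
      using x by blast
  next
    fix x assume "x \<in> \<Union>{U #> h | h. h \<in> carrier G \<and> U #> h \<noteq> U #> g}"
    then obtain h where h: "h \<in> carrier G" "U #> h \<noteq> U #> g" "x \<in> U #> h" by blast
    have "x \<in> carrier G" using h ON_sub[OF assms(1)] r_coset_subset_G by blast
    moreover have "x \<notin> U #> g"
      using h assms repr_independence[OF _ _ ON_D(3)[OF assms(1)]] by metis
    ultimately show "x \<in> topspace T - (U #> g)" by (simp add: topspace)
  qed
  moreover have "openin T (\<Union>{U #> h | h. h \<in> carrier G \<and> U #> h \<noteq> U #> g})"
    using coset_open[OF assms(1)] by blast
  moreover have "U #> g \<subseteq> topspace T"
    using assms r_coset_subset_G ON_sub topspace by metis
  ultimately show ?thesis by (simp add: closedin_def)
qed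

lemma mem_coset: "U \<in> ON \<Longrightarrow> h \<in> U #> g \<Longrightarrow> g \<in> carrier G \<Longrightarrow> U #> h = U #> g"
  using repr_independence[OF _ _ ON_D(3)] by metis

lemma coset_eq_iff: "U \<in> ON \<Longrightarrow> g \<in> carrier G \<Longrightarrow> h \<in> carrier G \<Longrightarrow> U #> g = U #> h \<longleftrightarrow> g \<otimes> inv h \<in> U"
  using subgroup.rcos_module[OF ON_D(3) group_axioms] mem_coset rcos_self[OF _ ON_D(3)] by metis

lemma coset_mult: "U \<in> ON \<Longrightarrow> g \<in> carrier G \<Longrightarrow> h \<in> carrier G \<Longrightarrow> (U #> g) <#> (U #> h) = U #> (g \<otimes> h)"
  using normal.rcos_sum[OF ON_D(1)] by blast

text \<open>
  The clopen sets separate points. If W is clopen, then the normal subgroup of those n for which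
  deleting n from any product \<open>a n b\<close> does not affect membership in W is open by compactness.
\<close>

lemma open_normal_separates:
  assumes "g \<in> carrier G" "g \<noteq> \<one>"
  obtains U where "U \<in> ON" "g \<notin> U"
proof -
  \<comment> \<open>In a compact Hausdorff space quasi-components are connected components, so here
    they are points; two points in different quasi-components are separated by a clopen set, which
    becomes \<open>W\<close>.\<close>
  have "\<not> quasi_component_of T \<one> g"
  proof
    assume "quasi_component_of T \<one> g"
    moreover have "quasi_components_of T = connected_components_of T"
      using quasi_eq_connected_components_of compact Hausdorff by blast
    ultimately have "connected_component_of T \<one> g"
      by (simp add: quasi_eq_connected_components_of_pointwise_alt)
    then obtain S where "connectedin T S" "\<one> \<in> S" "g \<in> S"
      by (auto simp: connected_component_of_def)
    thus False using tot_disc assms(2) unfolding totally_disconnected_def by blast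
  qed
  then obtain W where W: "closedin T W" "openin T W" "\<one> \<in> W" "g \<notin> W"
    using assms by (auto simp: quasi_component_of topspace)
  define N where "N = {n \<in> carrier G. \<forall>a\<in>carrier G. \<forall>b\<in>carrier G. a \<otimes> n \<otimes> b \<in> W \<longleftrightarrow> a \<otimes> b \<in> W}"
  define X where "X = prod_topology T (prod_topology T T)"
  define F where "F = (\<lambda>z. fst (snd z) \<otimes> fst z \<otimes> snd (snd z))"
  define H where "H = (\<lambda>z::'g \<times> 'g \<times> 'g. fst (snd z) \<otimes> snd (snd z))"
  have proj: "continuous_map X T fst" "continuous_map X T (\<lambda>z. fst (snd z))" "continuous_map X T (\<lambda>z. snd (snd z))"
    unfolding X_def
    using continuous_map_fst continuous_map_compose[OF continuous_map_snd continuous_map_fst]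
      continuous_map_compose[OF continuous_map_snd continuous_map_snd]
    by (simp_all add: o_def)
  have FH: "continuous_map X T F" "continuous_map X T H"
    unfolding F_def H_def by (intro cont_mult_fun proj)+
  \<comment> \<open>\<open>B\<close> collects the triples (n, a, b) for which deleting n changes
    membership in W. It is closed since W and its complement are, and its projection to n is closed
    because the other two factors are compact.\<close>
  define B where "B = ({z \<in> topspace X. F z \<in> W} \<inter> {z \<in> topspace X. H z \<in> topspace T - W}) \<union>
     ({z \<in> topspace X. F z \<in> topspace T - W} \<inter> {z \<in> topspace X. H z \<in> W})"
  have cW: "closedin T (topspace T - W)" using W by (simp add: openin_closedin_eq)
  have "closedin X B" unfolding B_def
    by (intro closedin_Un closedin_Int closedin_continuous_map_preimage[OF FH(1)]
        closedin_continuous_map_preimage[OF FH(2)] W cW)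
  hence "closedin T (fst ` B)"
    using closed_map_fst[of "prod_topology T T" T] compact
    by (simp add: closed_map_def X_def compact_space_prod_topology)
  moreover have "N = topspace T - fst ` B"
  proof -
    have "(n, a, b) \<in> B \<longleftrightarrow> n \<in> carrier G \<and> a \<in> carrier G \<and> b \<in> carrier G \<and>
        (a \<otimes> n \<otimes> b \<in> W) \<noteq> (a \<otimes> b \<in> W)" for n a b
      by (auto simp: B_def X_def F_def H_def topspace)
    hence "n \<in> fst ` B \<longleftrightarrow> n \<in> carrier G \<and> (\<exists>a\<in>carrier G. \<exists>b\<in>carrier G. 
        (a \<otimes> n \<otimes> b \<in> W) \<noteq> (a \<otimes> b \<in> W))" for n
      unfolding image_iff split_paired_Bex_Sigma Bex_def by auto
    thus ?thesis by (auto simp: N_def topspace)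
  qed
  ultimately have "openin T N" using openin_diff[OF openin_topspace] by simp
  have NI: "n \<in> N" if "n \<in> carrier G" "\<And>a b. a \<in> carrier G \<Longrightarrow> b \<in> carrier G \<Longrightarrow> a \<otimes> n \<otimes> b \<in> W \<longleftrightarrow> a \<otimes> b \<in> W" for n
    using that by (auto simp: N_def)
  have ND: "n \<in> carrier G" "a \<in> carrier G \<Longrightarrow> b \<in> carrier G \<Longrightarrow> a \<otimes> n \<otimes> b \<in> W \<longleftrightarrow> a \<otimes> b \<in> W" if "n \<in> N" for n a b
    using that by (auto simp: N_def)
  have "subgroup N G"
  proof
    fix n m assume n: "n \<in> N" and m: "m \<in> N"
    note c = ND(1)[OF n] ND(1)[OF m]
    show "n \<otimes> m \<in> N"
    proof (rule NI)
      fix a b assume ab: "a \<in> carrier G" "b \<in> carrier G"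
      show "a \<otimes> (n \<otimes> m) \<otimes> b \<in> W \<longleftrightarrow> a \<otimes> b \<in> W"
        using ND(2)[OF m, of "a \<otimes> n" b] ND(2)[OF n, of a b] ab c by (simp add: m_assoc)
    qed (use c in auto)
    show "inv n \<in> N"
    proof (rule NI)
      fix a b assume ab: "a \<in> carrier G" "b \<in> carrier G"
      show "a \<otimes> inv n \<otimes> b \<in> W \<longleftrightarrow> a \<otimes> b \<in> W"
        using ND(2)[OF n, of "a \<otimes> inv n" b] ab c by (simp add: m_assoc)
    qed (use c in auto)
  qed (auto simp: N_def)
  hence "N \<lhd> G"
  proof (rule normal_invI)
    fix x n assume x: "x \<in> carrier G" and n: "n \<in> N"
    show "x \<otimes> n \<otimes> inv x \<in> N"
    proof (rule NI)
      fix a b assume ab: "a \<in> carrier G" "b \<in> carrier G"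
      have "a \<otimes> x \<otimes> (inv x \<otimes> b) = a \<otimes> b" using ab x by (simp add: m_assoc[symmetric]) (simp add: m_assoc)
      thus "a \<otimes> (x \<otimes> n \<otimes> inv x) \<otimes> b \<in> W \<longleftrightarrow> a \<otimes> b \<in> W"
        using ND(2)[OF n, of "a \<otimes> x" "inv x \<otimes> b"] ab x ND(1)[OF n] by (simp add: m_assoc)
    qed (use x ND(1)[OF n] in auto)
  qed
  hence "N \<in> ON" using \<open>openin T N\<close> by (simp add: open_normal_def)
  moreover have "g \<notin> N" using ND(2)[of g \<one> \<one>] W assms by auto
  ultimately show thesis using that by blast
qed

text \<open>The cosets in which the sequence finally stays have the finite intersection property,
  and they are closed in a compact space. A common point is a limit, because lying in a coset of U
  means having this coset.\<close>

lemma eventually_constant_limit: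
  assumes x: "\<And>n. x n \<in> carrier G"
    and ev: "\<And>U. U \<in> ON \<Longrightarrow> \<exists>n0. \<forall>n\<ge>n0. U #> x n = U #> x n0"
  shows "\<exists>h\<in>carrier G. \<forall>U\<in>ON. \<exists>n0::nat. \<forall>n\<ge>n0. U #> x n = U #> h"
proof -
  define \<U> where "\<U> = {U #> x n0 | U n0. U \<in> ON \<and> (\<forall>n\<ge>n0. U #> x n = U #> x n0)}"
  have "\<forall>C\<in>\<U>. closedin T C" using coset_closed x by (auto simp: \<U>_def)
  moreover have "\<Inter>\<F> \<noteq> {}" if F: "finite \<F>" "\<F> \<subseteq> \<U>" for \<F>
  proof -
    have "\<exists>n0. \<forall>n\<ge>n0. x n \<in> \<Inter>\<F>" using F
    proof (induction \<F>)
      case (insert C \<F>)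
      obtain n1 where n1: "\<forall>n\<ge>n1. x n \<in> \<Inter>\<F>" using insert by auto
      obtain U n0 where U: "C = U #> x n0" "U \<in> ON" "\<forall>n\<ge>n0. U #> x n = U #> x n0"
        using insert.prems unfolding \<U>_def by blast
      have "x n \<in> C" if "n \<ge> n0" for n
        using U that rcos_self[OF x[of n] ON_D(3)[OF U(2)]] by metis
      thus ?case using n1 by (intro exI[of _ "max n0 n1"]) auto
    qed auto
    thus ?thesis by blast
  qed
  ultimately have "\<Inter>\<U> \<noteq> {}" 
    by (intro compact[unfolded compact_space_fip, rule_format]) simp
  then obtain h where h: "h \<in> \<Inter>\<U>" by blast
  have hU: "\<exists>n0. \<forall>n\<ge>n0. U #> x n = U #> h" if U: "U \<in> ON" for U
  proof -
    obtain n0 where n0: "\<forall>n\<ge>n0. U #> x n = U #> x n0" using ev[OF U] by blast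
    hence "U #> x n0 \<in> \<U>" using U unfolding \<U>_def by blast
    hence "U #> h = U #> x n0" using h U mem_coset[OF U _ x] by blast
    thus ?thesis using n0 by metis
  qed
  obtain n0 where "carrier G #> x n0 \<in> \<U>"
    using ev[OF carrier_ON] carrier_ON unfolding \<U>_def by blast
  hence "h \<in> carrier G" using h r_coset_subset_G[OF _ x[of n0], of "carrier G"] by auto
  thus ?thesis using hU by blast
qed

section \<open>Continuous automorphisms and their effect on open normal subgroups\<close>

definition cont_aut :: "('g \<Rightarrow> 'g) \<Rightarrow> bool" where
  "cont_aut \<gamma> \<longleftrightarrow> \<gamma> \<in> auto G \<and> homeomorphic_map T T \<gamma>"

lemma cont_autD:
  assumes "cont_aut \<gamma>"
  shows "\<gamma> \<in> hom G G" "inj_on \<gamma> (carrier G)" "\<gamma> ` carrier G = carrier G" "homeomorphic_map T T \<gamma>"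
    "g \<in> carrier G \<Longrightarrow> \<gamma> g \<in> carrier G"
    "g \<in> carrier G \<Longrightarrow> h \<in> carrier G \<Longrightarrow> \<gamma> (g \<otimes> h) = \<gamma> g \<otimes> \<gamma> h"
    "g \<in> carrier G \<Longrightarrow> \<gamma> (inv g) = inv (\<gamma> g)" "\<gamma> \<one> = \<one>" "\<gamma> \<in> extensional (carrier G)"
proof -
  show h: "\<gamma> \<in> hom G G" "inj_on \<gamma> (carrier G)" "\<gamma> ` carrier G = carrier G" "homeomorphic_map T T \<gamma>"
    "\<gamma> \<in> extensional (carrier G)"
    using assms by (auto simp: cont_aut_def auto_def Bij_def bij_betw_def)
  interpret h: group_hom G G \<gamma> by unfold_locales (rule h)
  show "g \<in> carrier G \<Longrightarrow> \<gamma> g \<in> carrier G" "g \<in> carrier G \<Longrightarrow> h \<in> carrier G \<Longrightarrow> \<gamma> (g \<otimes> h) = \<gamma> g \<otimes> \<gamma> h"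
    "g \<in> carrier G \<Longrightarrow> \<gamma> (inv g) = inv (\<gamma> g)" "\<gamma> \<one> = \<one>" by auto
qed

lemma cont_aut_coset:
  assumes "cont_aut \<gamma>" "U \<subseteq> carrier G" "g \<in> carrier G"
  shows "\<gamma> ` (U #> g) = \<gamma> ` U #> \<gamma> g"
  using assms cont_autD(6)[OF assms(1)] by (force simp: r_coset_def image_iff)

lemma cont_aut_ON:
  assumes g: "cont_aut \<gamma>" and U: "U \<in> ON"
  shows "\<gamma> ` U \<in> ON"
proof -
  interpret h: group_hom G G \<gamma> by unfold_locales (rule cont_autD(1)[OF g])
  have "\<gamma> ` U \<lhd> G"
  proof (rule normal_invI)
    show "subgroup (\<gamma> ` U) G" using h.subgroup_img_is_subgroup ON_D(3)[OF U] by blast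
    fix x n assume x: "x \<in> carrier G" and "n \<in> \<gamma> ` U"
    then obtain u y where u: "u \<in> U" "n = \<gamma> u" "y \<in> carrier G" "x = \<gamma> y"
      using cont_autD(3)[OF g] by (metis image_iff)
    have "x \<otimes> n \<otimes> inv x = \<gamma> (y \<otimes> u \<otimes> inv y)"
      using u ON_sub[OF U] by (simp add: subset_iff)
    thus "x \<otimes> n \<otimes> inv x \<in> \<gamma> ` U"
      using normal.inv_op_closed2[OF ON_D(1)[OF U] u(3) u(1)] by simp
  qed
  moreover have "openin T (\<gamma> ` U)"
    using homeomorphic_map_openness_eq cont_autD(4)[OF g] ON_D(2)[OF U]
    by (meson homeomorphic_imp_open_map open_map_def)
  ultimately show ?thesis by (simp add: open_normal_def)
qed

end

section \<open>The completed group algebra is a ring\<close>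

lemma bij_betw_l_mult_vimage:
  assumes "group H" "group K" "\<pi> \<in> hom H K" "y \<in> carrier H" "c \<in> carrier K"
  shows "bij_betw (\<lambda>x. inv\<^bsub>H\<^esub> y \<otimes>\<^bsub>H\<^esub> x) {x \<in> carrier H. \<pi> x = c} {x \<in> carrier H. \<pi> x = inv\<^bsub>K\<^esub> (\<pi> y) \<otimes>\<^bsub>K\<^esub> c}"
proof -
  interpret H: group H by fact
  interpret K: group K by fact
  interpret \<pi>: group_hom H K \<pi> by unfold_locales fact
  show ?thesis
    by (rule bij_betw_byWitness[where f' = "\<lambda>x. y \<otimes>\<^bsub>H\<^esub> x"])
       (use assms in \<open>auto simp: H.m_assoc[symmetric] K.m_assoc[symmetric]\<close>)
qed

text \<open>The push-forward of functions along \<open>\<pi>\<close> is multiplicative for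
  convolution: left translation by the inverse of y carries the fibre over c to the fibre over
  \<open>\<pi>(y)\<close>-inverse times c. Stated for integer values because it is applied to
  reductions of coefficients.\<close>

lemma sum_convolution_vimage:
  fixes f g :: "'h \<Rightarrow> int"
  assumes H: "group H" "finite (carrier H)" and K: "group K" "finite (carrier K)"
    and hom: "\<pi> \<in> hom H K" and c: "c \<in> carrier K"
  shows "(\<Sum>x\<in>{x \<in> carrier H. \<pi> x = c}. \<Sum>y\<in>carrier H. f y * g (inv\<^bsub>H\<^esub> y \<otimes>\<^bsub>H\<^esub> x)) =
    (\<Sum>k\<in>carrier K. (\<Sum>y\<in>{y \<in> carrier H. \<pi> y = k}. f y) *
        (\<Sum>x\<in>{x \<in> carrier H. \<pi> x = inv\<^bsub>K\<^esub> k \<otimes>\<^bsub>K\<^esub> c}. g x))"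
proof -
  have "(\<Sum>x\<in>{x \<in> carrier H. \<pi> x = c}. \<Sum>y\<in>carrier H. f y * g (inv\<^bsub>H\<^esub> y \<otimes>\<^bsub>H\<^esub> x)) =
      (\<Sum>y\<in>carrier H. f y * (\<Sum>x\<in>{x \<in> carrier H. \<pi> x = c}. g (inv\<^bsub>H\<^esub> y \<otimes>\<^bsub>H\<^esub> x)))"
    by (subst sum.swap) (simp add: sum_distrib_left)
  also have "\<dots> = (\<Sum>y\<in>carrier H. f y * (\<Sum>x\<in>{x \<in> carrier H. \<pi> x = inv\<^bsub>K\<^esub> (\<pi> y) \<otimes>\<^bsub>K\<^esub> c}. g x))"
    by (intro sum.cong refl arg_cong2[of _ _ _ _ "(*)"]
        sum.reindex_bij_betw[OF bij_betw_l_mult_vimage[OF H(1) K(1) hom _ c]])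
  also have "\<dots> = (\<Sum>k\<in>carrier K. \<Sum>y\<in>{y \<in> carrier H. \<pi> y = k}.
      f y * (\<Sum>x\<in>{x \<in> carrier H. \<pi> x = inv\<^bsub>K\<^esub> (\<pi> y) \<otimes>\<^bsub>K\<^esub> c}. g x))"
    using hom by (intro sum.group[symmetric] H K) (auto simp: hom_def)
  also have "\<dots> = (\<Sum>k\<in>carrier K. (\<Sum>y\<in>{y \<in> carrier H. \<pi> y = k}. f y) *
        (\<Sum>x\<in>{x \<in> carrier H. \<pi> x = inv\<^bsub>K\<^esub> k \<otimes>\<^bsub>K\<^esub> c}. g x))"
    by (auto simp: sum_distrib_right intro!: sum.cong)
  finally show ?thesis .
qed

lemma group_algebra_ops [simp]:
  "x \<in> carrier H \<Longrightarrow> (f \<oplus>\<^bsub>group_algebra A H\<^esub> g) x = f x \<oplus>\<^bsub>A\<^esub> g x"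
  "x \<in> carrier H \<Longrightarrow> \<zero>\<^bsub>group_algebra A H\<^esub> x = \<zero>\<^bsub>A\<^esub>"
  "x \<in> carrier H \<Longrightarrow> \<one>\<^bsub>group_algebra A H\<^esub> x = (if x = \<one>\<^bsub>H\<^esub> then \<one>\<^bsub>A\<^esub> else \<zero>\<^bsub>A\<^esub>)"
  by (auto simp: group_algebra_def)

lemma group_algebra_mem: "f \<in> carrier (group_algebra A H) \<Longrightarrow> x \<in> carrier H \<Longrightarrow> f x \<in> carrier A"
  by (auto simp: group_algebra_def)

context coeff_ring
begin

text \<open>The form in which equalities in A are proved from here on: both sides become integer
  expressions modulo every \<open>md k\<close>, where sums can be exchanged and reindexed by the
  lemmas for \<open>sum\<close>.\<close>

lemma cong_red_eq:
  assumes "a \<in> carrier A" "b \<in> carrier A" "\<And>k. [red k a = red k b] (mod md k)"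
  shows "a = b"
  using assms red_range by (intro red_inj) (auto simp: cong_def)

lemma red_add_cong: "\<lbrakk>a \<in> carrier A; b \<in> carrier A\<rbrakk> \<Longrightarrow> [red k (a \<oplus>\<^bsub>A\<^esub> b) = red k a + red k b] (mod md k)"
  and red_mult_cong: "\<lbrakk>a \<in> carrier A; b \<in> carrier A\<rbrakk> \<Longrightarrow> [red k (a \<otimes>\<^bsub>A\<^esub> b) = red k a * red k b] (mod md k)"
  and red_finsum_cong: "\<lbrakk>finite S; f \<in> S \<rightarrow> carrier A\<rbrakk> \<Longrightarrow> [red k (finsum A f S) = (\<Sum>x\<in>S. red k (f x))] (mod md k)"
  by (simp_all add: red_add red_mult red_finsum cong_def)

lemma group_algebra_eqI:
  assumes "f \<in> carrier (group_algebra A H)" "g \<in> carrier (group_algebra A H)"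
    "\<And>x k. x \<in> carrier H \<Longrightarrow> [red k (f x) = red k (g x)] (mod md k)"
  shows "f = g"
proof -
  have "f x = g x" if "x \<in> carrier H" for x
    using assms(3)[OF that]
    by (intro cong_red_eq group_algebra_mem[OF assms(1) that] group_algebra_mem[OF assms(2) that])
  thus ?thesis
    using assms(1,2) unfolding group_algebra_def partial_object.select_convs by (intro PiE_ext)
qed

lemma group_algebra_add_closed:
  assumes "f \<in> carrier (group_algebra A H)" "g \<in> carrier (group_algebra A H)"
  shows "f \<oplus>\<^bsub>group_algebra A H\<^esub> g \<in> carrier (group_algebra A H)"
  using group_algebra_mem[OF assms(1)] group_algebra_mem[OF assms(2)]
  by (simp add: group_algebra_def)

lemma group_algebra_mult_closed:
  assumes "group H" "f \<in> carrier (group_algebra A H)" "g \<in> carrier (group_algebra A H)"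
  shows "f \<otimes>\<^bsub>group_algebra A H\<^esub> g \<in> carrier (group_algebra A H)"
proof -
  interpret H: group H by fact
  show ?thesis
    using group_algebra_mem[OF assms(2)] group_algebra_mem[OF assms(3)]
    unfolding group_algebra_def by (auto intro!: A.finsum_closed)
qed

lemma group_algebra_zero_one_closed:
  "\<zero>\<^bsub>group_algebra A H\<^esub> \<in> carrier (group_algebra A H)"
  "\<one>\<^bsub>group_algebra A H\<^esub> \<in> carrier (group_algebra A H)"
  by (simp_all add: group_algebra_def)

lemmas group_algebra_closed =
  group_algebra_add_closed group_algebra_mult_closed group_algebra_zero_one_closed

lemma red_group_algebra_mult:
  assumes "group H" "finite (carrier H)" "f \<in> carrier (group_algebra A H)" "g \<in> carrier (group_algebra A H)"
    "x \<in> carrier H"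
  shows "[red k ((f \<otimes>\<^bsub>group_algebra A H\<^esub> g) x) =
    (\<Sum>y\<in>carrier H. red k (f y) * red k (g (inv\<^bsub>H\<^esub> y \<otimes>\<^bsub>H\<^esub> x)))] (mod md k)"
proof -
  interpret H: group H by fact
  have "[red k ((f \<otimes>\<^bsub>group_algebra A H\<^esub> g) x) =
      (\<Sum>y\<in>carrier H. red k (f y \<otimes>\<^bsub>A\<^esub> g (inv\<^bsub>H\<^esub> y \<otimes>\<^bsub>H\<^esub> x)))] (mod md k)"
    using assms by (simp add: group_algebra_def) (auto intro!: red_finsum_cong)
  also have "[(\<Sum>y\<in>carrier H. red k (f y \<otimes>\<^bsub>A\<^esub> g (inv\<^bsub>H\<^esub> y \<otimes>\<^bsub>H\<^esub> x))) =
     (\<Sum>y\<in>carrier H. red k (f y) * red k (g (inv\<^bsub>H\<^esub> y \<otimes>\<^bsub>H\<^esub> x)))] (mod md k)"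
    using assms by (intro cong_sum red_mult_cong) (auto intro: group_algebra_mem)
  finally show ?thesis .
qed

lemma ring_group_algebra:
  assumes H: "group H" "finite (carrier H)"
  shows "ring (group_algebra A H)"
proof -
  interpret H: group H by fact
  let ?R = "group_algebra A H"
  note [simp] = group_algebra_add_closed group_algebra_mult_closed[OF H(1)] group_algebra_zero_one_closed group_algebra_mem[where H = H]
  show ?thesis
  proof (rule ringI)
    show "abelian_group ?R"
    proof (rule abelian_groupI)
      fix f assume f: "f \<in> carrier ?R"
      define g where "g = (\<lambda>x\<in>carrier H. \<ominus>\<^bsub>A\<^esub> f x)"
      have g: "g \<in> carrier ?R" using f unfolding g_def by (auto simp: group_algebra_def)
      have "g \<oplus>\<^bsub>?R\<^esub> f = \<zero>\<^bsub>?R\<^esub>"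
        by (rule group_algebra_eqI[where H = H]) (use f g in \<open>simp_all add: g_def A.l_neg\<close>)
      thus "\<exists>g\<in>carrier ?R. g \<oplus>\<^bsub>?R\<^esub> f = \<zero>\<^bsub>?R\<^esub>" using g by blast
    qed (auto intro!: group_algebra_eqI[where H = H] simp: A.a_ac)
    show "Group.monoid ?R"
    proof (rule monoidI)
      fix f g h assume f: "f \<in> carrier ?R" and g: "g \<in> carrier ?R" and h: "h \<in> carrier ?R"
      show "f \<otimes>\<^bsub>?R\<^esub> g \<otimes>\<^bsub>?R\<^esub> h = f \<otimes>\<^bsub>?R\<^esub> (g \<otimes>\<^bsub>?R\<^esub> h)"
      proof (rule group_algebra_eqI)
        fix x k assume x: "x \<in> carrier H"
        have cancel: "a \<otimes>\<^bsub>H\<^esub> y \<otimes>\<^bsub>H\<^esub> inv\<^bsub>H\<^esub> y = a" if "a \<in> carrier H" "y \<in> carrier H" for a y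
          using that by (simp add: H.m_assoc)
        \<comment> \<open>Substitution z = y w in the inner sum; with an exchange of the two sums it
          gives associativity.\<close>
        have eq: "(\<Sum>z\<in>carrier H. red k (g (inv\<^bsub>H\<^esub> y \<otimes>\<^bsub>H\<^esub> z)) * red k (h (inv\<^bsub>H\<^esub> z \<otimes>\<^bsub>H\<^esub> x))) =
            (\<Sum>w\<in>carrier H. red k (g w) * red k (h (inv\<^bsub>H\<^esub> w \<otimes>\<^bsub>H\<^esub> (inv\<^bsub>H\<^esub> y \<otimes>\<^bsub>H\<^esub> x))))"
          if y: "y \<in> carrier H" for y
          by (rule sum.reindex_bij_witness[of _ "\<lambda>w. y \<otimes>\<^bsub>H\<^esub> w" "\<lambda>z. inv\<^bsub>H\<^esub> y \<otimes>\<^bsub>H\<^esub> z"])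
             (use x y cancel in \<open>auto simp: H.m_assoc[symmetric] H.inv_mult_group\<close>)
        have "[red k ((f \<otimes>\<^bsub>?R\<^esub> g \<otimes>\<^bsub>?R\<^esub> h) x) =
            (\<Sum>z\<in>carrier H. red k ((f \<otimes>\<^bsub>?R\<^esub> g) z) * red k (h (inv\<^bsub>H\<^esub> z \<otimes>\<^bsub>H\<^esub> x)))] (mod md k)"
          using f g h x by (intro red_group_algebra_mult H) auto
        also have "[(\<Sum>z\<in>carrier H. red k ((f \<otimes>\<^bsub>?R\<^esub> g) z) * red k (h (inv\<^bsub>H\<^esub> z \<otimes>\<^bsub>H\<^esub> x))) =
            (\<Sum>z\<in>carrier H. (\<Sum>y\<in>carrier H. red k (f y) * red k (g (inv\<^bsub>H\<^esub> y \<otimes>\<^bsub>H\<^esub> z))) * red k (h (inv\<^bsub>H\<^esub> z \<otimes>\<^bsub>H\<^esub> x)))] (mod md k)"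
          using f g h x by (intro cong_sum cong_mult red_group_algebra_mult H cong_refl)
        also have "(\<Sum>z\<in>carrier H. (\<Sum>y\<in>carrier H. red k (f y) * red k (g (inv\<^bsub>H\<^esub> y \<otimes>\<^bsub>H\<^esub> z))) * red k (h (inv\<^bsub>H\<^esub> z \<otimes>\<^bsub>H\<^esub> x)))
            = (\<Sum>y\<in>carrier H. red k (f y) * (\<Sum>z\<in>carrier H. red k (g (inv\<^bsub>H\<^esub> y \<otimes>\<^bsub>H\<^esub> z)) * red k (h (inv\<^bsub>H\<^esub> z \<otimes>\<^bsub>H\<^esub> x))))"
          by (simp add: sum_distrib_left sum_distrib_right mult.assoc) (rule sum.swap)
        also have "\<dots> = (\<Sum>y\<in>carrier H. red k (f y) * (\<Sum>w\<in>carrier H. red k (g w) * red k (h (inv\<^bsub>H\<^esub> w \<otimes>\<^bsub>H\<^esub> (inv\<^bsub>H\<^esub> y \<otimes>\<^bsub>H\<^esub> x)))))"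
          using eq by (auto intro!: sum.cong)
        also have "[\<dots> = (\<Sum>y\<in>carrier H. red k (f y) * red k ((g \<otimes>\<^bsub>?R\<^esub> h) (inv\<^bsub>H\<^esub> y \<otimes>\<^bsub>H\<^esub> x)))] (mod md k)"
          using f g h x by (intro cong_sum cong_mult cong_sym[OF red_group_algebra_mult] H cong_refl) auto
        also have "[(\<Sum>y\<in>carrier H. red k (f y) * red k ((g \<otimes>\<^bsub>?R\<^esub> h) (inv\<^bsub>H\<^esub> y \<otimes>\<^bsub>H\<^esub> x))) = red k ((f \<otimes>\<^bsub>?R\<^esub> (g \<otimes>\<^bsub>?R\<^esub> h)) x)] (mod md k)"
          using f g h x by (intro cong_sym[OF red_group_algebra_mult] H) auto
        finally show "[red k ((f \<otimes>\<^bsub>?R\<^esub> g \<otimes>\<^bsub>?R\<^esub> h) x) = red k ((f \<otimes>\<^bsub>?R\<^esub> (g \<otimes>\<^bsub>?R\<^esub> h)) x)] (mod md k)" .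
      qed (use f g h in auto)
    next
      fix f assume f: "f \<in> carrier ?R"
      show "\<one>\<^bsub>?R\<^esub> \<otimes>\<^bsub>?R\<^esub> f = f"
      proof (rule group_algebra_eqI)
        fix x k assume x: "x \<in> carrier H"
        have "[red k ((\<one>\<^bsub>?R\<^esub> \<otimes>\<^bsub>?R\<^esub> f) x) = (\<Sum>y\<in>carrier H. red k (\<one>\<^bsub>?R\<^esub> y) * red k (f (inv\<^bsub>H\<^esub> y \<otimes>\<^bsub>H\<^esub> x)))] (mod md k)"
          using f x by (intro red_group_algebra_mult H) auto
        also have "(\<Sum>y\<in>carrier H. red k (\<one>\<^bsub>?R\<^esub> y) * red k (f (inv\<^bsub>H\<^esub> y \<otimes>\<^bsub>H\<^esub> x)))
           = (\<Sum>y\<in>carrier H. if y = \<one>\<^bsub>H\<^esub> then red k (f x) else 0)"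
          using x by (intro sum.cong) (auto simp: red_one red_zero)
        finally show "[red k ((\<one>\<^bsub>?R\<^esub> \<otimes>\<^bsub>?R\<^esub> f) x) = red k (f x)] (mod md k)" using H by simp
      qed (use f in auto)
      show "f \<otimes>\<^bsub>?R\<^esub> \<one>\<^bsub>?R\<^esub> = f"
      proof (rule group_algebra_eqI)
        fix x k assume x: "x \<in> carrier H"
        have iff: "inv\<^bsub>H\<^esub> y \<otimes>\<^bsub>H\<^esub> x = \<one>\<^bsub>H\<^esub> \<longleftrightarrow> y = x" if "y \<in> carrier H" for y
          using that x by (metis H.inv_closed H.inv_equality H.inv_inv H.l_inv)
        have "[red k ((f \<otimes>\<^bsub>?R\<^esub> \<one>\<^bsub>?R\<^esub>) x) = (\<Sum>y\<in>carrier H. red k (f y) * red k (\<one>\<^bsub>?R\<^esub> (inv\<^bsub>H\<^esub> y \<otimes>\<^bsub>H\<^esub> x)))] (mod md k)"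
          using f x by (intro red_group_algebra_mult H) auto
        also have "(\<Sum>y\<in>carrier H. red k (f y) * red k (\<one>\<^bsub>?R\<^esub> (inv\<^bsub>H\<^esub> y \<otimes>\<^bsub>H\<^esub> x)))
           = (\<Sum>y\<in>carrier H. if y = x then red k (f x) else 0)"
          using x by (intro sum.cong) (auto simp: red_one red_zero iff)
        finally show "[red k ((f \<otimes>\<^bsub>?R\<^esub> \<one>\<^bsub>?R\<^esub>) x) = red k (f x)] (mod md k)" using H x by simp
      qed (use f in auto)
    qed auto
  next
    fix f g h assume f: "f \<in> carrier ?R" and g: "g \<in> carrier ?R" and h: "h \<in> carrier ?R"
    show "(f \<oplus>\<^bsub>?R\<^esub> g) \<otimes>\<^bsub>?R\<^esub> h = f \<otimes>\<^bsub>?R\<^esub> h \<oplus>\<^bsub>?R\<^esub> g \<otimes>\<^bsub>?R\<^esub> h"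
    proof (rule group_algebra_eqI)
      fix x k assume x: "x \<in> carrier H"
      have "[red k (((f \<oplus>\<^bsub>?R\<^esub> g) \<otimes>\<^bsub>?R\<^esub> h) x) = (\<Sum>y\<in>carrier H. red k ((f \<oplus>\<^bsub>?R\<^esub> g) y) * red k (h (inv\<^bsub>H\<^esub> y \<otimes>\<^bsub>H\<^esub> x)))] (mod md k)"
        using f g h x by (intro red_group_algebra_mult H) auto
      also have "[(\<Sum>y\<in>carrier H. red k ((f \<oplus>\<^bsub>?R\<^esub> g) y) * red k (h (inv\<^bsub>H\<^esub> y \<otimes>\<^bsub>H\<^esub> x))) = (\<Sum>y\<in>carrier H. (red k (f y) + red k (g y)) * red k (h (inv\<^bsub>H\<^esub> y \<otimes>\<^bsub>H\<^esub> x)))] (mod md k)"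
        using f g h x by (intro cong_sum cong_mult cong_refl) (simp add: red_add_cong)
      also have "(\<Sum>y\<in>carrier H. (red k (f y) + red k (g y)) * red k (h (inv\<^bsub>H\<^esub> y \<otimes>\<^bsub>H\<^esub> x))) =
          (\<Sum>y\<in>carrier H. red k (f y) * red k (h (inv\<^bsub>H\<^esub> y \<otimes>\<^bsub>H\<^esub> x))) + (\<Sum>y\<in>carrier H. red k (g y) * red k (h (inv\<^bsub>H\<^esub> y \<otimes>\<^bsub>H\<^esub> x)))"
        by (simp add: sum.distrib distrib_right)
      also have "[\<dots> = red k ((f \<otimes>\<^bsub>?R\<^esub> h) x) + red k ((g \<otimes>\<^bsub>?R\<^esub> h) x)] (mod md k)"
        using f g h x by (intro cong_add cong_sym[OF red_group_algebra_mult] H) auto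
      also have "[red k ((f \<otimes>\<^bsub>?R\<^esub> h) x) + red k ((g \<otimes>\<^bsub>?R\<^esub> h) x) = red k ((f \<otimes>\<^bsub>?R\<^esub> h \<oplus>\<^bsub>?R\<^esub> g \<otimes>\<^bsub>?R\<^esub> h) x)] (mod md k)"
        using f g h x by (auto intro!: cong_sym[OF red_add_cong] simp del: One_nat_def)
      finally show "[red k (((f \<oplus>\<^bsub>?R\<^esub> g) \<otimes>\<^bsub>?R\<^esub> h) x) = red k ((f \<otimes>\<^bsub>?R\<^esub> h \<oplus>\<^bsub>?R\<^esub> g \<otimes>\<^bsub>?R\<^esub> h) x)] (mod md k)" .
    qed (use f g h in auto)
    show "h \<otimes>\<^bsub>?R\<^esub> (f \<oplus>\<^bsub>?R\<^esub> g) = h \<otimes>\<^bsub>?R\<^esub> f \<oplus>\<^bsub>?R\<^esub> h \<otimes>\<^bsub>?R\<^esub> g"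
    proof (rule group_algebra_eqI)
      fix x k assume x: "x \<in> carrier H"
      have "[red k ((h \<otimes>\<^bsub>?R\<^esub> (f \<oplus>\<^bsub>?R\<^esub> g)) x) = (\<Sum>y\<in>carrier H. red k (h y) * red k ((f \<oplus>\<^bsub>?R\<^esub> g) (inv\<^bsub>H\<^esub> y \<otimes>\<^bsub>H\<^esub> x)))] (mod md k)"
        using f g h x by (intro red_group_algebra_mult H) auto
      also have "[(\<Sum>y\<in>carrier H. red k (h y) * red k ((f \<oplus>\<^bsub>?R\<^esub> g) (inv\<^bsub>H\<^esub> y \<otimes>\<^bsub>H\<^esub> x))) = (\<Sum>y\<in>carrier H. red k (h y) * (red k (f (inv\<^bsub>H\<^esub> y \<otimes>\<^bsub>H\<^esub> x)) + red k (g (inv\<^bsub>H\<^esub> y \<otimes>\<^bsub>H\<^esub> x))))] (mod md k)"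
        using f g h x by (intro cong_sum cong_mult cong_refl) (simp add: red_add_cong)
      also have "(\<Sum>y\<in>carrier H. red k (h y) * (red k (f (inv\<^bsub>H\<^esub> y \<otimes>\<^bsub>H\<^esub> x)) + red k (g (inv\<^bsub>H\<^esub> y \<otimes>\<^bsub>H\<^esub> x)))) =
          (\<Sum>y\<in>carrier H. red k (h y) * red k (f (inv\<^bsub>H\<^esub> y \<otimes>\<^bsub>H\<^esub> x))) + (\<Sum>y\<in>carrier H. red k (h y) * red k (g (inv\<^bsub>H\<^esub> y \<otimes>\<^bsub>H\<^esub> x)))"
        by (simp add: sum.distrib distrib_left)
      also have "[\<dots> = red k ((h \<otimes>\<^bsub>?R\<^esub> f) x) + red k ((h \<otimes>\<^bsub>?R\<^esub> g) x)] (mod md k)"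
        using f g h x by (intro cong_add cong_sym[OF red_group_algebra_mult] H) auto
      also have "[red k ((h \<otimes>\<^bsub>?R\<^esub> f) x) + red k ((h \<otimes>\<^bsub>?R\<^esub> g) x) = red k ((h \<otimes>\<^bsub>?R\<^esub> f \<oplus>\<^bsub>?R\<^esub> h \<otimes>\<^bsub>?R\<^esub> g) x)] (mod md k)"
        using f g h x by (auto intro!: cong_sym[OF red_add_cong] simp del: One_nat_def)
      finally show "[red k ((h \<otimes>\<^bsub>?R\<^esub> (f \<oplus>\<^bsub>?R\<^esub> g)) x) = red k ((h \<otimes>\<^bsub>?R\<^esub> f \<oplus>\<^bsub>?R\<^esub> h \<otimes>\<^bsub>?R\<^esub> g) x)] (mod md k)" .
    qed (use f g h in auto)
  qed
qed

end

section \<open>Elements of a group algebra supported at one point\<close>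

definition group_algebra_single :: "'r ring \<Rightarrow> 'h monoid \<Rightarrow> 'h \<Rightarrow> 'r \<Rightarrow> 'h \<Rightarrow> 'r" where
  "group_algebra_single A H h a = (\<lambda>x\<in>carrier H. if x = h then a else \<zero>\<^bsub>A\<^esub>)"

context coeff_ring
begin

lemma group_algebra_single_closed:
  "a \<in> carrier A \<Longrightarrow> group_algebra_single A H h a \<in> carrier (group_algebra A H)"
  by (simp add: group_algebra_single_def group_algebra_def)

lemma group_algebra_single_mult:
  assumes H: "group H" "finite (carrier H)" and f: "f \<in> carrier (group_algebra A H)"
    and h: "h \<in> carrier H" and a: "a \<in> carrier A" and x: "x \<in> carrier H"
  shows "(group_algebra_single A H h a \<otimes>\<^bsub>group_algebra A H\<^esub> f) x = a \<otimes>\<^bsub>A\<^esub> f (inv\<^bsub>H\<^esub> h \<otimes>\<^bsub>H\<^esub> x)"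
    and "(f \<otimes>\<^bsub>group_algebra A H\<^esub> group_algebra_single A H h a) x = a \<otimes>\<^bsub>A\<^esub> f (x \<otimes>\<^bsub>H\<^esub> inv\<^bsub>H\<^esub> h)"
proof -
  interpret H: group H by fact
  let ?s = "group_algebra_single A H h a"
  have s: "?s \<in> carrier (group_algebra A H)" using a by (rule group_algebra_single_closed)
  have s1: "red k (?s y) = (if y = h then red k a else 0)" if "y \<in> carrier H" for y k
    using that by (simp add: group_algebra_single_def red_zero)
  have m: "f (inv\<^bsub>H\<^esub> h \<otimes>\<^bsub>H\<^esub> x) \<in> carrier A" "f (x \<otimes>\<^bsub>H\<^esub> inv\<^bsub>H\<^esub> h) \<in> carrier A"
    using h x by (simp_all add: group_algebra_mem[OF f])
  have iff: "inv\<^bsub>H\<^esub> y \<otimes>\<^bsub>H\<^esub> x = h \<longleftrightarrow> y = x \<otimes>\<^bsub>H\<^esub> inv\<^bsub>H\<^esub> h" if "y \<in> carrier H" for y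
    using that x h by (metis H.inv_closed H.inv_inv H.inv_mult_group H.inv_solve_left H.inv_solve_right')
  show "(?s \<otimes>\<^bsub>group_algebra A H\<^esub> f) x = a \<otimes>\<^bsub>A\<^esub> f (inv\<^bsub>H\<^esub> h \<otimes>\<^bsub>H\<^esub> x)"
  proof (rule cong_red_eq)
    fix k
    have "(\<Sum>y\<in>carrier H. red k (?s y) * red k (f (inv\<^bsub>H\<^esub> y \<otimes>\<^bsub>H\<^esub> x))) =
        (\<Sum>y\<in>carrier H. if y = h then red k a * red k (f (inv\<^bsub>H\<^esub> h \<otimes>\<^bsub>H\<^esub> x)) else 0)"
      by (intro sum.cong) (auto simp: s1)
    thus "[red k ((?s \<otimes>\<^bsub>group_algebra A H\<^esub> f) x) = red k (a \<otimes>\<^bsub>A\<^esub> f (inv\<^bsub>H\<^esub> h \<otimes>\<^bsub>H\<^esub> x))] (mod md k)"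
      using red_group_algebra_mult[OF H s f x, of k] red_mult_cong[OF a m(1), of k] H h
      by (simp add: cong_def)
  qed (use group_algebra_mem[OF group_algebra_mult_closed[OF H(1) s f] x] m a in auto)
  show "(f \<otimes>\<^bsub>group_algebra A H\<^esub> ?s) x = a \<otimes>\<^bsub>A\<^esub> f (x \<otimes>\<^bsub>H\<^esub> inv\<^bsub>H\<^esub> h)"
  proof (rule cong_red_eq)
    fix k
    have "(\<Sum>y\<in>carrier H. red k (f y) * red k (?s (inv\<^bsub>H\<^esub> y \<otimes>\<^bsub>H\<^esub> x))) =
        (\<Sum>y\<in>carrier H. if y = x \<otimes>\<^bsub>H\<^esub> inv\<^bsub>H\<^esub> h then red k a * red k (f (x \<otimes>\<^bsub>H\<^esub> inv\<^bsub>H\<^esub> h)) else 0)"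
      using x by (intro sum.cong) (auto simp: s1 iff)
    thus "[red k ((f \<otimes>\<^bsub>group_algebra A H\<^esub> ?s) x) = red k (a \<otimes>\<^bsub>A\<^esub> f (x \<otimes>\<^bsub>H\<^esub> inv\<^bsub>H\<^esub> h))] (mod md k)"
      using red_group_algebra_mult[OF H f s x, of k] red_mult_cong[OF a m(2), of k] H h x
      by (simp add: cong_def)
  qed (use group_algebra_mem[OF group_algebra_mult_closed[OF H(1) f s] x] m a in auto)
qed

end

section \<open>The inverse limit over the open normal subgroups\<close>

locale completed = coeff_ring A p e red + pro_p G p T
  for A :: "'r ring" and p e red and G :: "'g monoid" (structure) and T
begin

abbreviation R :: "('g, 'r) completed ring" where "R \<equiv> completed_algebra A G T"
abbreviation ga :: "'g set \<Rightarrow> ('g set \<Rightarrow> 'r) ring" where "ga U \<equiv> group_algebra A (G Mod U)"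
abbreviation quot :: "'g set \<Rightarrow> 'g set set" where "quot U \<equiv> carrier (G Mod U)"

lemma ring_ga: "U \<in> ON \<Longrightarrow> ring (ga U)"
  by (rule ring_group_algebra[OF ON_D(4) finite_quotient])

lemma R_ops [simp]:
  "U \<in> ON \<Longrightarrow> (f \<oplus>\<^bsub>R\<^esub> g) U = f U \<oplus>\<^bsub>ga U\<^esub> g U"
  "U \<in> ON \<Longrightarrow> (f \<otimes>\<^bsub>R\<^esub> g) U = f U \<otimes>\<^bsub>ga U\<^esub> g U"
  "U \<in> ON \<Longrightarrow> \<zero>\<^bsub>R\<^esub> U = \<zero>\<^bsub>ga U\<^esub>"
  "U \<in> ON \<Longrightarrow> \<one>\<^bsub>R\<^esub> U = \<one>\<^bsub>ga U\<^esub>"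
  by (simp_all add: completed_algebra_def)

lemma R_carrier:
  "f \<in> carrier R \<longleftrightarrow> f \<in> extensional ON \<and> (\<forall>U\<in>ON. f U \<in> carrier (ga U)) \<and>
     (\<forall>U\<in>ON. \<forall>V\<in>ON. U \<subseteq> V \<longrightarrow> group_algebra_proj A G U V (f U) = f V)"
  by (auto simp: completed_algebra_def PiE_def)

lemma R_mem: "f \<in> carrier R \<Longrightarrow> U \<in> ON \<Longrightarrow> f U \<in> carrier (ga U)"
  by (simp add: R_carrier)

lemma R_mem2: "f \<in> carrier R \<Longrightarrow> U \<in> ON \<Longrightarrow> C \<in> quot U \<Longrightarrow> f U C \<in> carrier A"
  by (rule group_algebra_mem[OF R_mem])

lemma R_proj: "f \<in> carrier R \<Longrightarrow> U \<in> ON \<Longrightarrow> V \<in> ON \<Longrightarrow> U \<subseteq> V \<Longrightarrow> group_algebra_proj A G U V (f U) = f V"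
  by (simp add: R_carrier)

lemma R_eqI:
  assumes "f \<in> carrier R" "g \<in> carrier R" "\<And>U. U \<in> ON \<Longrightarrow> f U = g U"
  shows "f = g"
  using assms by (intro extensionalityI[of f ON g]) (auto simp: R_carrier)

lemma R_eqI2:
  assumes "f \<in> carrier R" "g \<in> carrier R" "\<And>U C. U \<in> ON \<Longrightarrow> C \<in> quot U \<Longrightarrow> f U C = g U C"
  shows "f = g"
proof (rule R_eqI[OF assms(1,2)])
  fix U assume U: "U \<in> ON"
  show "f U = g U"
    by (rule group_algebra_eqI[OF R_mem[OF assms(1) U] R_mem[OF assms(2) U]]) (simp add: assms(3) U)
qed

lemma quot_cases:
  assumes "C \<in> quot U"
  obtains g where "g \<in> carrier G" "C = U #> g"
  using assms by (auto simp: carrier_FactGroup)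

lemma quot_coset [simp]: "g \<in> carrier G \<Longrightarrow> U #> g \<in> quot U"
  by (auto simp: carrier_FactGroup)

lemma quot_self [simp]: "U \<in> ON \<Longrightarrow> U \<in> quot U"
  using group.is_monoid[OF ON_D(4)] monoid.one_closed by fastforce

lemma quot_inv: "U \<in> ON \<Longrightarrow> g \<in> carrier G \<Longrightarrow> inv\<^bsub>G Mod U\<^esub> (U #> g) = U #> inv g"
  using normal.inv_FactGroup[OF ON_D(1)] normal.rcos_inv[OF ON_D(1)] by simp

lemma coset_subset_iff:
  assumes U: "U \<in> ON" and V: "V \<in> ON" and UV: "U \<subseteq> V" and g: "g \<in> carrier G" and C: "C \<in> quot V"
  shows "U #> g \<subseteq> C \<longleftrightarrow> V #> g = C"
proof
  obtain h where h: "h \<in> carrier G" "C = V #> h" using C by (rule quot_cases)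
  show "V #> g = C" if "U #> g \<subseteq> C"
    using that rcos_self[OF g ON_D(3)[OF U]] h mem_coset[OF V] by blast
  show "U #> g \<subseteq> C" if "V #> g = C"
    using that UV by (auto simp: r_coset_def)
qed

lemma quot_hom:
  assumes U: "U \<in> ON" and V: "V \<in> ON" and UV: "U \<subseteq> V"
  shows "(\<lambda>D. V <#> D) \<in> hom (G Mod U) (G Mod V)"
    and "g \<in> carrier G \<Longrightarrow> V <#> (U #> g) = V #> g"
proof -
  have eq: "V <#> (U #> g) = V #> g" if g: "g \<in> carrier G" for g
  proof -
    have "V <#> U = V"
      using UV ON_one[OF U] ON_D(3)[OF V] ON_sub[OF V]
      by (auto simp: set_mult_def subgroup.m_closed subset_iff)
    thus ?thesis using setmult_rcos_assoc[OF ON_sub[OF V] ON_sub[OF U] g] by simp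
  qed
  thus "g \<in> carrier G \<Longrightarrow> V <#> (U #> g) = V #> g" .
  show "(\<lambda>D. V <#> D) \<in> hom (G Mod U) (G Mod V)"
  proof (rule homI)
    show "V <#> D \<in> quot V" if "D \<in> quot U" for D
      using that by (elim quot_cases) (simp add: eq)
    show "V <#> (D \<otimes>\<^bsub>G Mod U\<^esub> D') = (V <#> D) \<otimes>\<^bsub>G Mod V\<^esub> (V <#> D')"
      if "D \<in> quot U" "D' \<in> quot U" for D D'
      using that by (elim quot_cases) (simp add: eq coset_mult U V)
  qed
qed

text \<open>\<open>group_algebra_proj\<close> sums over an inclusion of cosets, while the
  convolution lemma needs the fibres of a homomorphism; both describe the quotient map from G/U to
  G/V.\<close>

lemma fibre_eq:
  assumes "U \<in> ON" "V \<in> ON" "U \<subseteq> V" "C \<in> quot V"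
  shows "{D \<in> quot U. D \<subseteq> C} = {D \<in> quot U. V <#> D = C}"
  using coset_subset_iff[OF assms(1-3) _ assms(4)] quot_hom(2)[OF assms(1-3)]
  by (auto elim!: quot_cases)

lemma proj_closed:
  assumes "U \<in> ON" "f \<in> carrier (ga U)"
  shows "group_algebra_proj A G U V f \<in> carrier (ga V)"
  using group_algebra_mem[OF assms(2)]
  by (auto simp: group_algebra_proj_def group_algebra_def intro!: A.finsum_closed)

lemma red_proj:
  assumes "U \<in> ON" "f \<in> carrier (ga U)" "C \<in> quot V"
  shows "[red k (group_algebra_proj A G U V f C) = (\<Sum>D\<in>{D \<in> quot U. D \<subseteq> C}. red k (f D))] (mod md k)"
  using assms(3) group_algebra_mem[OF assms(2)] finite_quotient[OF assms(1)]
  by (auto simp: group_algebra_proj_def intro!: red_finsum_cong)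

lemma proj_mult:
  assumes U: "U \<in> ON" and V: "V \<in> ON" and UV: "U \<subseteq> V" and f: "f \<in> carrier (ga U)" and g: "g \<in> carrier (ga U)"
  shows "group_algebra_proj A G U V (f \<otimes>\<^bsub>ga U\<^esub> g) = group_algebra_proj A G U V f \<otimes>\<^bsub>ga V\<^esub> group_algebra_proj A G U V g"
    (is "?P (f \<otimes>\<^bsub>ga U\<^esub> g) = ?P f \<otimes>\<^bsub>ga V\<^esub> ?P g")
proof (rule group_algebra_eqI)
  have fg: "f \<otimes>\<^bsub>ga U\<^esub> g \<in> carrier (ga U)"
    using f g by (intro group_algebra_mult_closed ON_D U)
  show "?P (f \<otimes>\<^bsub>ga U\<^esub> g) \<in> carrier (ga V)" by (rule proj_closed[OF U fg])
  show "?P f \<otimes>\<^bsub>ga V\<^esub> ?P g \<in> carrier (ga V)"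
    by (intro group_algebra_mult_closed proj_closed ON_D U V f g)
  fix C k assume C: "C \<in> quot V"
  have inC: "inv\<^bsub>G Mod V\<^esub> K \<otimes>\<^bsub>G Mod V\<^esub> C \<in> quot V" if "K \<in> quot V" for K
    using that C ON_D(4)[OF V] by (meson group.inv_closed group.is_monoid monoid.m_closed)
  have "[red k (?P (f \<otimes>\<^bsub>ga U\<^esub> g) C) = (\<Sum>D\<in>{D \<in> quot U. V <#> D = C}. red k ((f \<otimes>\<^bsub>ga U\<^esub> g) D))] (mod md k)"
    using red_proj[OF U fg C] fibre_eq[OF U V UV C] by simp
  moreover have "[(\<Sum>D\<in>{D \<in> quot U. V <#> D = C}. red k ((f \<otimes>\<^bsub>ga U\<^esub> g) D)) =
     (\<Sum>D\<in>{D \<in> quot U. V <#> D = C}. \<Sum>E\<in>quot U. red k (f E) * red k (g (inv\<^bsub>G Mod U\<^esub> E \<otimes>\<^bsub>G Mod U\<^esub> D)))] (mod md k)"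
    by (intro cong_sum red_group_algebra_mult ON_D U finite_quotient f g) simp
  moreover have "(\<Sum>D\<in>{D \<in> quot U. V <#> D = C}. \<Sum>E\<in>quot U. red k (f E) * red k (g (inv\<^bsub>G Mod U\<^esub> E \<otimes>\<^bsub>G Mod U\<^esub> D))) =
     (\<Sum>K\<in>quot V. (\<Sum>E\<in>{E \<in> quot U. V <#> E = K}. red k (f E)) *
       (\<Sum>D\<in>{D \<in> quot U. V <#> D = inv\<^bsub>G Mod V\<^esub> K \<otimes>\<^bsub>G Mod V\<^esub> C}. red k (g D)))"
    by (rule sum_convolution_vimage[OF _ _ _ _ quot_hom(1)[OF U V UV] C])
       (intro ON_D finite_quotient U V)+
  moreover have "[(\<Sum>K\<in>quot V. (\<Sum>E\<in>{E \<in> quot U. V <#> E = K}. red k (f E)) *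
       (\<Sum>D\<in>{D \<in> quot U. V <#> D = inv\<^bsub>G Mod V\<^esub> K \<otimes>\<^bsub>G Mod V\<^esub> C}. red k (g D))) =
     (\<Sum>K\<in>quot V. red k (?P f K) * red k (?P g (inv\<^bsub>G Mod V\<^esub> K \<otimes>\<^bsub>G Mod V\<^esub> C)))] (mod md k)"
  proof (intro cong_sum cong_mult)
    fix K assume K: "K \<in> quot V"
    show "[(\<Sum>E\<in>{E \<in> quot U. V <#> E = K}. red k (f E)) = red k (?P f K)] (mod md k)"
      using red_proj[OF U f K] fibre_eq[OF U V UV K] by (simp add: cong_sym)
    show "[(\<Sum>D\<in>{D \<in> quot U. V <#> D = inv\<^bsub>G Mod V\<^esub> K \<otimes>\<^bsub>G Mod V\<^esub> C}. red k (g D)) =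
        red k (?P g (inv\<^bsub>G Mod V\<^esub> K \<otimes>\<^bsub>G Mod V\<^esub> C))] (mod md k)"
      using red_proj[OF U g inC[OF K]] fibre_eq[OF U V UV inC[OF K]] by (simp add: cong_sym)
  qed
  moreover have "[red k ((?P f \<otimes>\<^bsub>ga V\<^esub> ?P g) C) =
     (\<Sum>K\<in>quot V. red k (?P f K) * red k (?P g (inv\<^bsub>G Mod V\<^esub> K \<otimes>\<^bsub>G Mod V\<^esub> C)))] (mod md k)"
    by (intro red_group_algebra_mult ON_D V finite_quotient proj_closed U f g C)
  ultimately show "[red k (?P (f \<otimes>\<^bsub>ga U\<^esub> g) C) = red k ((?P f \<otimes>\<^bsub>ga V\<^esub> ?P g) C)] (mod md k)"
    by (simp add: cong_def)
qed

lemma proj_add: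
  assumes U: "U \<in> ON" and f: "f \<in> carrier (ga U)" and g: "g \<in> carrier (ga U)"
  shows "group_algebra_proj A G U V (f \<oplus>\<^bsub>ga U\<^esub> g) = group_algebra_proj A G U V f \<oplus>\<^bsub>ga V\<^esub> group_algebra_proj A G U V g"
    (is "?P (f \<oplus>\<^bsub>ga U\<^esub> g) = ?P f \<oplus>\<^bsub>ga V\<^esub> ?P g")
proof (rule group_algebra_eqI)
  have fg: "f \<oplus>\<^bsub>ga U\<^esub> g \<in> carrier (ga U)"
    using f g by (rule group_algebra_add_closed)
  show "?P (f \<oplus>\<^bsub>ga U\<^esub> g) \<in> carrier (ga V)" by (rule proj_closed[OF U fg])
  show "?P f \<oplus>\<^bsub>ga V\<^esub> ?P g \<in> carrier (ga V)"
    by (intro group_algebra_add_closed proj_closed U f g)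
  fix C k assume C: "C \<in> quot V"
  have "[(\<Sum>D\<in>{D \<in> quot U. D \<subseteq> C}. red k ((f \<oplus>\<^bsub>ga U\<^esub> g) D)) = 
      (\<Sum>D\<in>{D \<in> quot U. D \<subseteq> C}. red k (f D) + red k (g D))] (mod md k)"
    by (intro cong_sum) (simp add: red_add_cong group_algebra_mem[OF f] group_algebra_mem[OF g])
  hence "[red k (?P (f \<oplus>\<^bsub>ga U\<^esub> g) C) = 
      (\<Sum>D\<in>{D \<in> quot U. D \<subseteq> C}. red k (f D)) + (\<Sum>D\<in>{D \<in> quot U. D \<subseteq> C}. red k (g D))] (mod md k)"
    using red_proj[OF U fg C, of k] by (simp add: sum.distrib cong_def)
  moreover have "[red k (?P f C) + red k (?P g C) =
      (\<Sum>D\<in>{D \<in> quot U. D \<subseteq> C}. red k (f D)) + (\<Sum>D\<in>{D \<in> quot U. D \<subseteq> C}. red k (g D))] (mod md k)"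
    by (intro cong_add red_proj U f g C)
  moreover have "[red k ((?P f \<oplus>\<^bsub>ga V\<^esub> ?P g) C) = red k (?P f C) + red k (?P g C)] (mod md k)"
    using C group_algebra_mem[OF proj_closed[OF U f] C] group_algebra_mem[OF proj_closed[OF U g] C]
    by (simp add: red_add_cong)
  ultimately show "[red k (?P (f \<oplus>\<^bsub>ga U\<^esub> g) C) = red k ((?P f \<oplus>\<^bsub>ga V\<^esub> ?P g) C)] (mod md k)"
    by (simp add: cong_def)
qed

lemma proj_single:
  assumes U: "U \<in> ON" and V: "V \<in> ON" and UV: "U \<subseteq> V" and g: "g \<in> carrier G" and a: "a \<in> carrier A"
  shows "group_algebra_proj A G U V (group_algebra_single A (G Mod U) (U #> g) a) = group_algebra_single A (G Mod V) (V #> g) a"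
proof (rule group_algebra_eqI)
  let ?s = "group_algebra_single A (G Mod U) (U #> g) a"
  have s: "?s \<in> carrier (ga U)" using a by (rule group_algebra_single_closed)
  show "group_algebra_proj A G U V ?s \<in> carrier (ga V)" by (rule proj_closed[OF U s])
  show "group_algebra_single A (G Mod V) (V #> g) a \<in> carrier (ga V)" using a by (rule group_algebra_single_closed)
  fix C k assume C: "C \<in> quot V"
  have "(\<Sum>D\<in>{D \<in> quot U. D \<subseteq> C}. red k (?s D)) = (\<Sum>D\<in>{D \<in> quot U. D \<subseteq> C}. if D = U #> g then red k a else 0)"
    by (intro sum.cong) (auto simp: group_algebra_single_def red_zero)
  also have "\<dots> = (if V #> g = C then red k a else 0)"
    using finite_quotient[OF U] g coset_subset_iff[OF U V UV g C] by simp
  also have "\<dots> = red k (group_algebra_single A (G Mod V) (V #> g) a C)"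
    using C by (auto simp: group_algebra_single_def red_zero)
  finally show "[red k (group_algebra_proj A G U V ?s C) = red k (group_algebra_single A (G Mod V) (V #> g) a C)] (mod md k)"
    using red_proj[OF U s C, of k] by simp
qed

lemma proj_zero: "U \<in> ON \<Longrightarrow> group_algebra_proj A G U V \<zero>\<^bsub>ga U\<^esub> = \<zero>\<^bsub>ga V\<^esub>"
  unfolding group_algebra_proj_def group_algebra_def ring_record_simps
  by (intro restrict_ext A.add.finprod_one_eqI) simp

lemma single_one: "U \<in> ON \<Longrightarrow> group_algebra_single A (G Mod U) (U #> \<one>) \<one>\<^bsub>A\<^esub> = \<one>\<^bsub>ga U\<^esub>"
  using coset_mult_one[OF ON_sub] by (simp add: group_algebra_single_def group_algebra_def)

lemma R_closed:
  "f \<in> carrier R \<Longrightarrow> g \<in> carrier R \<Longrightarrow> f \<oplus>\<^bsub>R\<^esub> g \<in> carrier R"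
  "f \<in> carrier R \<Longrightarrow> g \<in> carrier R \<Longrightarrow> f \<otimes>\<^bsub>R\<^esub> g \<in> carrier R"
  "\<zero>\<^bsub>R\<^esub> \<in> carrier R" "\<one>\<^bsub>R\<^esub> \<in> carrier R"
proof -
  have ext: "f \<oplus>\<^bsub>R\<^esub> g \<in> extensional ON" "f \<otimes>\<^bsub>R\<^esub> g \<in> extensional ON"
    "\<zero>\<^bsub>R\<^esub> \<in> extensional ON" "\<one>\<^bsub>R\<^esub> \<in> extensional ON" for f g
    by (simp_all add: completed_algebra_def)
  show "f \<in> carrier R \<Longrightarrow> g \<in> carrier R \<Longrightarrow> f \<oplus>\<^bsub>R\<^esub> g \<in> carrier R"
    using ext by (simp add: R_carrier group_algebra_add_closed proj_add)
  show "f \<in> carrier R \<Longrightarrow> g \<in> carrier R \<Longrightarrow> f \<otimes>\<^bsub>R\<^esub> g \<in> carrier R"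
    using ext by (simp add: R_carrier group_algebra_mult_closed ON_D proj_mult)
  show "\<zero>\<^bsub>R\<^esub> \<in> carrier R"
    using ext by (simp add: R_carrier group_algebra_closed proj_zero)
  show "\<one>\<^bsub>R\<^esub> \<in> carrier R"
    using ext proj_single[OF _ _ _ one_closed one_in]
    by (simp add: R_carrier group_algebra_closed single_one)
qed

lemma ring_R: "ring R"
proof (rule ringI)
  note [simp] = R_closed R_mem group_algebra_closed ON_D monoid.r_one[OF ring.is_monoid[OF ring_ga]]
    monoid.l_one[OF ring.is_monoid[OF ring_ga]]
  show "abelian_group R"
  proof (rule abelian_groupI)
    fix f assume f: "f \<in> carrier R"
    define g where "g = (\<lambda>U\<in>ON. \<ominus>\<^bsub>ga U\<^esub> f U)"
    have "group_algebra_proj A G U V (\<ominus>\<^bsub>ga U\<^esub> f U) = \<ominus>\<^bsub>ga V\<^esub> f V"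
      if U: "U \<in> ON" and V: "V \<in> ON" and UV: "U \<subseteq> V" for U V
    proof -
      interpret U: ring "ga U" by (rule ring_ga[OF U])
      interpret V: ring "ga V" by (rule ring_ga[OF V])
      have fU: "f U \<in> carrier (ga U)" using R_mem[OF f U] .
      have "group_algebra_proj A G U V (\<ominus>\<^bsub>ga U\<^esub> f U) \<oplus>\<^bsub>ga V\<^esub> f V = \<zero>\<^bsub>ga V\<^esub>"
        using proj_add[OF U U.a_inv_closed[OF fU] fU, of V] R_proj[OF f U V UV] proj_zero[OF U, of V] fU
        by (simp add: U.l_neg)
      thus ?thesis
        by (rule V.minus_equality[symmetric]) (rule R_mem[OF f V] proj_closed[OF U U.a_inv_closed[OF fU]])+
    qed
    hence g: "g \<in> carrier R" using f by (simp add: R_carrier g_def ring.ring_simprules[OF ring_ga])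
    have "g \<oplus>\<^bsub>R\<^esub> f = \<zero>\<^bsub>R\<^esub>"
      by (rule R_eqI) (use f g in \<open>simp_all add: g_def ring.ring_simprules(9)[OF ring_ga]\<close>)
    thus "\<exists>g\<in>carrier R. g \<oplus>\<^bsub>R\<^esub> f = \<zero>\<^bsub>R\<^esub>" using g by blast
  next
    fix f g h assume fgh: "f \<in> carrier R" "g \<in> carrier R" "h \<in> carrier R"
    show "f \<oplus>\<^bsub>R\<^esub> g \<oplus>\<^bsub>R\<^esub> h = f \<oplus>\<^bsub>R\<^esub> (g \<oplus>\<^bsub>R\<^esub> h)"
      by (rule R_eqI) (use fgh in \<open>simp_all add: ring.ring_simprules(7)[OF ring_ga]\<close>)
  next
    fix f g assume fg: "f \<in> carrier R" "g \<in> carrier R"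
    show "f \<oplus>\<^bsub>R\<^esub> g = g \<oplus>\<^bsub>R\<^esub> f"
      by (rule R_eqI) (use fg in \<open>simp_all add: ring.ring_simprules(10)[OF ring_ga]\<close>)
  next
    fix f assume f: "f \<in> carrier R"
    show "\<zero>\<^bsub>R\<^esub> \<oplus>\<^bsub>R\<^esub> f = f"
      by (rule R_eqI) (use f in \<open>simp_all add: ring.ring_simprules(8)[OF ring_ga]\<close>)
  qed simp_all
  show "Group.monoid R"
  proof (rule monoidI)
    fix f g h assume fgh: "f \<in> carrier R" "g \<in> carrier R" "h \<in> carrier R"
    show "f \<otimes>\<^bsub>R\<^esub> g \<otimes>\<^bsub>R\<^esub> h = f \<otimes>\<^bsub>R\<^esub> (g \<otimes>\<^bsub>R\<^esub> h)"
      by (rule R_eqI) (use fgh in \<open>simp_all add: ring.ring_simprules(11)[OF ring_ga]\<close>)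
  next
    fix f assume f: "f \<in> carrier R"
    show "\<one>\<^bsub>R\<^esub> \<otimes>\<^bsub>R\<^esub> f = f" "f \<otimes>\<^bsub>R\<^esub> \<one>\<^bsub>R\<^esub> = f"
      using f by (auto intro!: R_eqI)
  qed simp_all
  fix f g h assume fgh: "f \<in> carrier R" "g \<in> carrier R" "h \<in> carrier R"
  show "(f \<oplus>\<^bsub>R\<^esub> g) \<otimes>\<^bsub>R\<^esub> h = f \<otimes>\<^bsub>R\<^esub> h \<oplus>\<^bsub>R\<^esub> g \<otimes>\<^bsub>R\<^esub> h"
    by (rule R_eqI) (use fgh in \<open>simp_all add: ring.ring_simprules(13)[OF ring_ga]\<close>)
  show "h \<otimes>\<^bsub>R\<^esub> (f \<oplus>\<^bsub>R\<^esub> g) = h \<otimes>\<^bsub>R\<^esub> f \<oplus>\<^bsub>R\<^esub> h \<otimes>\<^bsub>R\<^esub> g"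
    by (rule R_eqI) (use fgh in \<open>simp_all add: ring.ring_simprules(23)[OF ring_ga]\<close>)
qed

sublocale R: ring R by (rule ring_R)

end

section \<open>Group elements, scalars, augmentation and the action of automorphisms\<close>

context completed
begin

text \<open>The multiple a g. One family contains both the group elements (\<open>ge\<close>, with a
  = 1) and the scalars (\<open>sc\<close>, with g = 1), and by \<open>el_mult\<close> it is closed
  under multiplication.\<close>

definition el :: "'g \<Rightarrow> 'r \<Rightarrow> ('g, 'r) completed" where
  "el g a = (\<lambda>U\<in>ON. group_algebra_single A (G Mod U) (U #> g) a)"

lemma el_apply [simp]: "U \<in> ON \<Longrightarrow> el g a U = group_algebra_single A (G Mod U) (U #> g) a"
  by (simp add: el_def)

lemma single_apply [simp]: "C \<in> quot U \<Longrightarrow> group_algebra_single A (G Mod U) D a C = (if C = D then a else \<zero>\<^bsub>A\<^esub>)"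
  by (simp add: group_algebra_single_def)

lemma el_closed [simp]: "g \<in> carrier G \<Longrightarrow> a \<in> carrier A \<Longrightarrow> el g a \<in> carrier R"
  by (simp add: R_carrier group_algebra_single_closed proj_single) (simp add: el_def)

lemma el_mult_apply:
  assumes U: "U \<in> ON" and g: "g \<in> carrier G" and y: "y \<in> carrier G" and a: "a \<in> carrier A" and f: "f \<in> carrier R"
  shows "(el g a \<otimes>\<^bsub>R\<^esub> f) U (U #> y) = a \<otimes>\<^bsub>A\<^esub> f U (U #> (inv g \<otimes> y))"
    and "(f \<otimes>\<^bsub>R\<^esub> el g a) U (U #> y) = a \<otimes>\<^bsub>A\<^esub> f U (U #> (y \<otimes> inv g))"
proof -
  note s = group_algebra_single_mult[OF ON_D(4)[OF U] finite_quotient[OF U] R_mem[OF f U]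
      quot_coset[OF g] a quot_coset[OF y]]
  show "(el g a \<otimes>\<^bsub>R\<^esub> f) U (U #> y) = a \<otimes>\<^bsub>A\<^esub> f U (U #> (inv g \<otimes> y))"
    using s(1) by (simp add: U quot_inv g y coset_mult)
  show "(f \<otimes>\<^bsub>R\<^esub> el g a) U (U #> y) = a \<otimes>\<^bsub>A\<^esub> f U (U #> (y \<otimes> inv g))"
    using s(2) by (simp add: U quot_inv g y coset_mult)
qed

lemma el_mult:
  assumes g: "g \<in> carrier G" and h: "h \<in> carrier G" and a: "a \<in> carrier A" and b: "b \<in> carrier A"
  shows "el g a \<otimes>\<^bsub>R\<^esub> el h b = el (g \<otimes> h) (a \<otimes>\<^bsub>A\<^esub> b)"
proof (rule R_eqI2)
  fix U C assume U: "U \<in> ON" and "C \<in> quot U"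
  then obtain y where y: "y \<in> carrier G" "C = U #> y" by (auto elim: quot_cases)
  have "U #> (inv g \<otimes> y) = U #> h \<longleftrightarrow> U #> y = U #> (g \<otimes> h)"
  proof
    assume "U #> (inv g \<otimes> y) = U #> h"
    hence "(U #> g) <#> (U #> (inv g \<otimes> y)) = (U #> g) <#> (U #> h)" by simp
    thus "U #> y = U #> (g \<otimes> h)" using g h y by (simp add: coset_mult U m_assoc[symmetric])
  next
    assume "U #> y = U #> (g \<otimes> h)"
    hence "(U #> inv g) <#> (U #> y) = (U #> inv g) <#> (U #> (g \<otimes> h))" by simp
    thus "U #> (inv g \<otimes> y) = U #> h" using g h y by (simp add: coset_mult U m_assoc[symmetric])
  qed
  thus "(el g a \<otimes>\<^bsub>R\<^esub> el h b) U C = el (g \<otimes> h) (a \<otimes>\<^bsub>A\<^esub> b) U C"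
    using el_mult_apply(1)[OF U g y(1) a el_closed[OF h b]] g h y a b U by simp
qed (use assms in \<open>auto simp: mult_in\<close>)

lemma el_one: "el \<one> \<one>\<^bsub>A\<^esub> = \<one>\<^bsub>R\<^esub>"
  by (rule R_eqI) (simp_all add: single_one one_in)

lemma el_zero: "g \<in> carrier G \<Longrightarrow> el g \<zero>\<^bsub>A\<^esub> = \<zero>\<^bsub>R\<^esub>"
  by (rule R_eqI2) simp_all

abbreviation ge :: "'g \<Rightarrow> ('g, 'r) completed" where "ge g \<equiv> el g \<one>\<^bsub>A\<^esub>"
abbreviation sc :: "'r \<Rightarrow> ('g, 'r) completed" where "sc a \<equiv> el \<one> a"

lemma group_element_eq: "group_element A G T g = ge g"
  by (simp add: group_element_def el_def group_algebra_single_def)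

lemma sc_comm:
  assumes "a \<in> carrier A" "f \<in> carrier R"
  shows "f \<otimes>\<^bsub>R\<^esub> sc a = sc a \<otimes>\<^bsub>R\<^esub> f"
proof (rule R_eqI2)
  fix U C assume U: "U \<in> ON" and "C \<in> quot U"
  then obtain y where y: "y \<in> carrier G" "C = U #> y" by (auto elim: quot_cases)
  show "(f \<otimes>\<^bsub>R\<^esub> sc a) U C = (sc a \<otimes>\<^bsub>R\<^esub> f) U C"
    using el_mult_apply[OF U one_closed y(1) assms] y by simp
qed (use assms in auto)

text \<open>Scalars act as left multiplication by the central elements \<open>sc a\<close>, so that
  the lemmas on ideals and congruences of R apply to \<open>layer_smult\<close>.\<close>

lemma completed_smult_eq:
  assumes "a \<in> carrier A" "f \<in> carrier R"
  shows "completed_smult A G T a f = sc a \<otimes>\<^bsub>R\<^esub> f"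
proof -
  have "completed_smult A G T a f U = (sc a \<otimes>\<^bsub>R\<^esub> f) U" if U: "U \<in> ON" for U
  proof
    fix C
    have fU: "(sc a \<otimes>\<^bsub>R\<^esub> f) U \<in> extensional (quot U)"
      using R_mem[OF R.m_closed[OF el_closed[OF one_closed assms(1)] assms(2)] U]
      by (simp add: group_algebra_def PiE_def)
    show "completed_smult A G T a f U C = (sc a \<otimes>\<^bsub>R\<^esub> f) U C"
    proof (cases "C \<in> quot U")
      case True
      then obtain y where y: "y \<in> carrier G" "C = U #> y" by (auto elim: quot_cases)
      show ?thesis using el_mult_apply(1)[OF U one_closed y(1) assms] y U True
        by (simp add: completed_smult_def)
    next
      case False
      thus ?thesis using fU U by (simp add: completed_smult_def extensional_def)
    qed
  qed
  moreover have "sc a \<otimes>\<^bsub>R\<^esub> f \<in> extensional ON" "completed_smult A G T a f \<in> extensional ON"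
    by (simp_all add: completed_algebra_def completed_smult_def)
  ultimately show ?thesis using extensionalityI by metis
qed

lemma quot_carrier: "quot (carrier G) = {carrier G}"
proof -
  have "carrier G #> g = carrier G" if "g \<in> carrier G" for g
    using that coset_join2 subgroup_self by blast
  thus ?thesis by (auto simp: carrier_FactGroup)
qed

lemma aug_closed [simp]: "f \<in> carrier R \<Longrightarrow> augmentation G f \<in> carrier A"
  unfolding augmentation_def by (rule R_mem2) (auto simp: carrier_ON quot_carrier)

lemma aug_add: "f \<in> carrier R \<Longrightarrow> g \<in> carrier R \<Longrightarrow> augmentation G (f \<oplus>\<^bsub>R\<^esub> g) = augmentation G f \<oplus>\<^bsub>A\<^esub> augmentation G g"
  unfolding augmentation_def by (simp add: carrier_ON quot_carrier)

lemma aug_mult: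
  assumes f: "f \<in> carrier R" and g: "g \<in> carrier R"
  shows "augmentation G (f \<otimes>\<^bsub>R\<^esub> g) = augmentation G f \<otimes>\<^bsub>A\<^esub> augmentation G g"
proof (rule cong_red_eq)
  let ?G = "carrier G"
  fix k
  have c: "inv\<^bsub>G Mod ?G\<^esub> ?G \<otimes>\<^bsub>G Mod ?G\<^esub> ?G = ?G"
    using group.inv_closed[OF ON_D(4)[OF carrier_ON], of ?G] set_mult_carrier_idem[OF subgroup_self]
    by (simp add: quot_carrier)
  have "[red k ((f \<otimes>\<^bsub>R\<^esub> g) ?G ?G) = red k (f ?G ?G) * red k (g ?G ?G)] (mod md k)"
    using red_group_algebra_mult[OF ON_D(4)[OF carrier_ON] finite_quotient[OF carrier_ON]
        R_mem[OF f carrier_ON] R_mem[OF g carrier_ON], of ?G k] c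
    by (simp add: carrier_ON quot_carrier)
  thus "[red k (augmentation G (f \<otimes>\<^bsub>R\<^esub> g)) = red k (augmentation G f \<otimes>\<^bsub>A\<^esub> augmentation G g)] (mod md k)"
    using red_mult_cong[OF aug_closed[OF f] aug_closed[OF g], of k]
    unfolding augmentation_def by (simp add: cong_def)
qed (use f g in auto)

lemma aug_el: "g \<in> carrier G \<Longrightarrow> augmentation G (el g a) = a"
  using coset_join2[OF _ subgroup_self, of g]
  by (simp add: augmentation_def carrier_ON quot_carrier)

lemma aug_neg: "f \<in> carrier R \<Longrightarrow> augmentation G (\<ominus>\<^bsub>R\<^esub> f) = \<ominus>\<^bsub>A\<^esub> augmentation G f"
proof -
  assume f: "f \<in> carrier R"
  have "augmentation G (\<ominus>\<^bsub>R\<^esub> f) \<oplus>\<^bsub>A\<^esub> augmentation G f = augmentation G \<zero>\<^bsub>R\<^esub>"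
    using f by (simp add: aug_add[symmetric] R.l_neg)
  also have "\<dots> = \<zero>\<^bsub>A\<^esub>" using aug_el[of \<one> "\<zero>\<^bsub>A\<^esub>"] el_zero[of \<one>] by simp
  finally show ?thesis using f by (intro A.minus_equality[symmetric]) auto
qed

abbreviation I :: "('g, 'r) completed set" where "I \<equiv> aug_ideal A G T"

lemma I_iff: "f \<in> I \<longleftrightarrow> f \<in> carrier R \<and> augmentation G f = \<zero>\<^bsub>A\<^esub>"
  by (simp add: aug_ideal_def)

lemma ideal_I: "ideal I R"
proof (rule idealI[OF ring_R])
  show "subgroup I (add_monoid R)"
  proof
    fix x assume "x \<in> I"
    thus "inv\<^bsub>add_monoid R\<^esub> x \<in> I"
      unfolding a_inv_def[symmetric] by (simp add: I_iff aug_neg)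
  next
    show "\<one>\<^bsub>add_monoid R\<^esub> \<in> I"
      using aug_el[of \<one> "\<zero>\<^bsub>A\<^esub>"] el_zero[of \<one>] by (simp add: I_iff)
  qed (auto simp: I_iff aug_add)
qed (auto simp: I_iff aug_mult)

text \<open>Pulling back coefficients along \<open>\<gamma>\<close> takes no inverse function but
  yields the ring automorphism induced by the inverse of \<open>\<gamma>\<close>: by
  \<open>act_el\<close> it sends the group element \<open>\<gamma> g\<close> to g. The effect of
  \<open>\<gamma>\<close> itself on group elements is therefore \<open>act\<close> of its inverse,
  see \<open>aut_pair_mo\<close>.\<close>

definition act :: "('g \<Rightarrow> 'g) \<Rightarrow> ('g, 'r) completed \<Rightarrow> ('g, 'r) completed" where
  "act \<gamma> f = (\<lambda>U\<in>ON. \<lambda>C\<in>quot U. f (\<gamma> ` U) (\<gamma> ` C))"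

lemma act_apply [simp]: "U \<in> ON \<Longrightarrow> C \<in> quot U \<Longrightarrow> act \<gamma> f U C = f (\<gamma> ` U) (\<gamma> ` C)"
  by (simp add: act_def)

context
  fixes \<gamma> assumes \<gamma>: "cont_aut \<gamma>"
begin

lemma image_coset: "U \<in> ON \<Longrightarrow> g \<in> carrier G \<Longrightarrow> \<gamma> ` (U #> g) = \<gamma> ` U #> \<gamma> g"
  by (rule cont_aut_coset[OF \<gamma> ON_sub])

lemma quot_sub: "U \<in> ON \<Longrightarrow> C \<in> quot U \<Longrightarrow> C \<subseteq> carrier G"
  using r_coset_subset_G[OF ON_sub] by (auto elim!: quot_cases)

lemma image_eq_iff: "C \<subseteq> carrier G \<Longrightarrow> D \<subseteq> carrier G \<Longrightarrow> \<gamma> ` C = \<gamma> ` D \<longleftrightarrow> C = D"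
  and image_sub_iff: "C \<subseteq> carrier G \<Longrightarrow> D \<subseteq> carrier G \<Longrightarrow> \<gamma> ` C \<subseteq> \<gamma> ` D \<longleftrightarrow> C \<subseteq> D"
  using inj_on_image_eq_iff[OF cont_autD(2)[OF \<gamma>]] inj_on_image_mem_iff[OF cont_autD(2)[OF \<gamma>]]
  by (blast, blast)

lemma image_quot: "U \<in> ON \<Longrightarrow> C \<in> quot U \<Longrightarrow> \<gamma> ` C \<in> quot (\<gamma> ` U)"
  using image_coset[of U] quot_coset[OF cont_autD(5)[OF \<gamma>], of _ "\<gamma> ` U"] by (auto elim!: quot_cases)

lemma image_quot_bij: "U \<in> ON \<Longrightarrow> bij_betw ((`) \<gamma>) (quot U) (quot (\<gamma> ` U))"
proof (rule bij_betw_imageI)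
  assume U: "U \<in> ON"
  show "inj_on ((`) \<gamma>) (quot U)"
  proof (rule inj_onI)
    fix C D assume "C \<in> quot U" "D \<in> quot U" "\<gamma> ` C = \<gamma> ` D"
    thus "C = D" using image_eq_iff[OF quot_sub[OF U] quot_sub[OF U]] by metis
  qed
  show "(`) \<gamma> ` quot U = quot (\<gamma> ` U)"
  proof (intro equalityI subsetI)
    fix D assume "D \<in> quot (\<gamma> ` U)"
    then obtain h where h: "h \<in> carrier G" "D = \<gamma> ` U #> h" by (rule quot_cases)
    then obtain g where g: "g \<in> carrier G" "h = \<gamma> g" using cont_autD(3)[OF \<gamma>] by blast
    hence "D = \<gamma> ` (U #> g)" using h image_coset[OF U] by simp
    thus "D \<in> (`) \<gamma> ` quot U" using quot_coset[OF g(1)] by (rule image_eqI)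
  next
    fix D assume "D \<in> (`) \<gamma> ` quot U"
    then obtain C where "D = \<gamma> ` C" "C \<in> quot U" by (rule imageE)
    thus "D \<in> quot (\<gamma> ` U)" using image_quot[OF U] by simp
  qed
qed

lemma image_mult:
  assumes "U \<in> ON" "C \<in> quot U" "D \<in> quot U"
  shows "\<gamma> ` (inv\<^bsub>G Mod U\<^esub> C \<otimes>\<^bsub>G Mod U\<^esub> D) = inv\<^bsub>G Mod (\<gamma> ` U)\<^esub> (\<gamma> ` C) \<otimes>\<^bsub>G Mod (\<gamma> ` U)\<^esub> (\<gamma> ` D)"
proof -
  obtain g where g: "g \<in> carrier G" "C = U #> g" using assms(2) by (rule quot_cases)
  obtain h where h: "h \<in> carrier G" "D = U #> h" using assms(3) by (rule quot_cases)
  note gh = g h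
  have c: "\<gamma> g \<in> carrier G" "\<gamma> h \<in> carrier G" using gh cont_autD(5)[OF \<gamma>] by auto
  show ?thesis
    using assms(1) gh c cont_aut_ON[OF \<gamma> assms(1)]
    by (simp add: quot_inv coset_mult image_coset cont_autD(6,7)[OF \<gamma>])
qed

lemma act_closed:
  assumes f: "f \<in> carrier R"
  shows "act \<gamma> f \<in> carrier R"
proof -
  have m: "f (\<gamma> ` U) (\<gamma> ` C) \<in> carrier A" if "U \<in> ON" "C \<in> quot U" for U C
    by (rule R_mem2[OF f cont_aut_ON[OF \<gamma> that(1)] image_quot[OF that]])
  have mm: "act \<gamma> f U \<in> carrier (ga U)" if U: "U \<in> ON" for U
    using m[OF U] U by (simp add: act_def group_algebra_def)
  have "group_algebra_proj A G U V (act \<gamma> f U) = act \<gamma> f V"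
    if U: "U \<in> ON" and V: "V \<in> ON" and UV: "U \<subseteq> V" for U V
  proof (rule group_algebra_eqI)
    have U': "\<gamma> ` U \<in> ON" and V': "\<gamma> ` V \<in> ON" using U V cont_aut_ON[OF \<gamma>] by auto
    fix C k assume C: "C \<in> quot V"
    have bij: "bij_betw ((`) \<gamma>) {D \<in> quot U. D \<subseteq> C} {D \<in> quot (\<gamma> ` U). D \<subseteq> \<gamma> ` C}"
    proof (rule bij_betw_subset[OF image_quot_bij[OF U]])
      have sub: "\<gamma> ` D \<subseteq> \<gamma> ` C \<longleftrightarrow> D \<subseteq> C" if "D \<in> quot U" for D
        by (rule image_sub_iff[OF quot_sub[OF U that] quot_sub[OF V C]])
      show "(`) \<gamma> ` {D \<in> quot U. D \<subseteq> C} = {D \<in> quot (\<gamma> ` U). D \<subseteq> \<gamma> ` C}"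
        unfolding bij_betw_imp_surj_on[OF image_quot_bij[OF U], symmetric] using sub by blast
    qed blast
    have "[red k (group_algebra_proj A G U V (act \<gamma> f U) C) = (\<Sum>D\<in>{D \<in> quot U. D \<subseteq> C}. red k (act \<gamma> f U D))] (mod md k)"
      by (rule red_proj[OF U mm[OF U] C])
    moreover have "(\<Sum>D\<in>{D \<in> quot U. D \<subseteq> C}. red k (act \<gamma> f U D)) = (\<Sum>D\<in>{D \<in> quot U. D \<subseteq> C}. red k (f (\<gamma> ` U) (\<gamma> ` D)))"
      using U by (intro sum.cong) auto
    moreover have "(\<Sum>D\<in>{D \<in> quot U. D \<subseteq> C}. red k (f (\<gamma> ` U) (\<gamma> ` D))) = (\<Sum>D\<in>{D \<in> quot (\<gamma> ` U). D \<subseteq> \<gamma> ` C}. red k (f (\<gamma> ` U) D))"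
      by (rule sum.reindex_bij_betw[OF bij])
    moreover have "[red k (group_algebra_proj A G (\<gamma> ` U) (\<gamma> ` V) (f (\<gamma> ` U)) (\<gamma> ` C)) =
        (\<Sum>D\<in>{D \<in> quot (\<gamma> ` U). D \<subseteq> \<gamma> ` C}. red k (f (\<gamma> ` U) D))] (mod md k)"
      by (rule red_proj[OF U' R_mem[OF f U'] image_quot[OF V C]])
    moreover have "group_algebra_proj A G (\<gamma> ` U) (\<gamma> ` V) (f (\<gamma> ` U)) = f (\<gamma> ` V)"
      using UV by (intro R_proj[OF f U' V']) auto
    ultimately show "[red k (group_algebra_proj A G U V (act \<gamma> f U) C) = red k (act \<gamma> f V C)] (mod md k)"
      using V C by (simp add: cong_def)
  qed (rule proj_closed[OF U mm[OF U]], rule mm[OF V])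
  thus ?thesis using mm by (simp add: R_carrier) (simp add: act_def)
qed

lemma act_add:
  assumes f: "f \<in> carrier R" and g: "g \<in> carrier R"
  shows "act \<gamma> (f \<oplus>\<^bsub>R\<^esub> g) = act \<gamma> f \<oplus>\<^bsub>R\<^esub> act \<gamma> g"
  by (rule R_eqI2) (use f g in \<open>simp_all add: act_closed image_quot cont_aut_ON[OF \<gamma>]\<close>)

lemma act_mult:
  assumes f: "f \<in> carrier R" and g: "g \<in> carrier R"
  shows "act \<gamma> (f \<otimes>\<^bsub>R\<^esub> g) = act \<gamma> f \<otimes>\<^bsub>R\<^esub> act \<gamma> g"
proof (rule R_eqI2)
  fix U C assume U: "U \<in> ON" and C: "C \<in> quot U"
  have U': "\<gamma> ` U \<in> ON" using U cont_aut_ON[OF \<gamma>] by auto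
  have fg: "act \<gamma> (f \<otimes>\<^bsub>R\<^esub> g) \<in> carrier R" "act \<gamma> f \<otimes>\<^bsub>R\<^esub> act \<gamma> g \<in> carrier R"
    using f g by (auto intro: act_closed)
  show "act \<gamma> (f \<otimes>\<^bsub>R\<^esub> g) U C = (act \<gamma> f \<otimes>\<^bsub>R\<^esub> act \<gamma> g) U C"
  proof (rule cong_red_eq[OF R_mem2[OF fg(1) U C] R_mem2[OF fg(2) U C]])
    fix k
    have "[red k (act \<gamma> (f \<otimes>\<^bsub>R\<^esub> g) U C) = (\<Sum>D\<in>quot (\<gamma> ` U). red k (f (\<gamma> ` U) D) *
        red k (g (\<gamma> ` U) (inv\<^bsub>G Mod (\<gamma> ` U)\<^esub> D \<otimes>\<^bsub>G Mod (\<gamma> ` U)\<^esub> \<gamma> ` C)))] (mod md k)"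
      using red_group_algebra_mult[OF ON_D(4)[OF U'] finite_quotient[OF U'] R_mem[OF f U'] R_mem[OF g U'] image_quot[OF U C]]
        U C U' by simp
    moreover have "(\<Sum>D\<in>quot (\<gamma> ` U). red k (f (\<gamma> ` U) D) *
        red k (g (\<gamma> ` U) (inv\<^bsub>G Mod (\<gamma> ` U)\<^esub> D \<otimes>\<^bsub>G Mod (\<gamma> ` U)\<^esub> \<gamma> ` C))) =
      (\<Sum>D\<in>quot U. red k (f (\<gamma> ` U) (\<gamma> ` D)) *
        red k (g (\<gamma> ` U) (inv\<^bsub>G Mod (\<gamma> ` U)\<^esub> (\<gamma> ` D) \<otimes>\<^bsub>G Mod (\<gamma> ` U)\<^esub> \<gamma> ` C)))"
      by (rule sum.reindex_bij_betw[OF image_quot_bij[OF U], symmetric])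
    moreover have "\<dots> = (\<Sum>D\<in>quot U. red k (act \<gamma> f U D) * red k (act \<gamma> g U (inv\<^bsub>G Mod U\<^esub> D \<otimes>\<^bsub>G Mod U\<^esub> C)))"
    proof (rule sum.cong)
      fix D assume D: "D \<in> quot U"
      have "inv\<^bsub>G Mod U\<^esub> D \<otimes>\<^bsub>G Mod U\<^esub> C \<in> quot U"
        using D C ON_D(4)[OF U] by (meson group.inv_closed group.is_monoid monoid.m_closed)
      thus "red k (f (\<gamma> ` U) (\<gamma> ` D)) * red k (g (\<gamma> ` U) (inv\<^bsub>G Mod (\<gamma> ` U)\<^esub> (\<gamma> ` D) \<otimes>\<^bsub>G Mod (\<gamma> ` U)\<^esub> \<gamma> ` C)) =
        red k (act \<gamma> f U D) * red k (act \<gamma> g U (inv\<^bsub>G Mod U\<^esub> D \<otimes>\<^bsub>G Mod U\<^esub> C))"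
        using U D by (simp add: image_mult[OF U D C] del: mult_FactGroup)
    qed simp
    moreover have "[red k ((act \<gamma> f \<otimes>\<^bsub>R\<^esub> act \<gamma> g) U C) =
      (\<Sum>D\<in>quot U. red k (act \<gamma> f U D) * red k (act \<gamma> g U (inv\<^bsub>G Mod U\<^esub> D \<otimes>\<^bsub>G Mod U\<^esub> C)))] (mod md k)"
      using red_group_algebra_mult[OF ON_D(4)[OF U] finite_quotient[OF U]
          R_mem[OF act_closed[OF f] U] R_mem[OF act_closed[OF g] U] C] U by simp
    ultimately show "[red k (act \<gamma> (f \<otimes>\<^bsub>R\<^esub> g) U C) = red k ((act \<gamma> f \<otimes>\<^bsub>R\<^esub> act \<gamma> g) U C)] (mod md k)"
      by (simp add: cong_def)
  qed
qed (use f g in \<open>auto intro: act_closed\<close>)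

lemma act_el: 
  assumes "g \<in> carrier G" "a \<in> carrier A"
  shows "act \<gamma> (el (\<gamma> g) a) = el g a"
proof (rule R_eqI2)
  fix U C assume U: "U \<in> ON" and C: "C \<in> quot U"
  have "\<gamma> ` C = \<gamma> ` U #> \<gamma> g \<longleftrightarrow> C = U #> g"
    using image_coset[OF U assms(1)] image_eq_iff[OF quot_sub[OF U C] quot_sub[OF U quot_coset[OF assms(1)]]]
    by simp
  thus "act \<gamma> (el (\<gamma> g) a) U C = el g a U C"
    using U C by (simp add: cont_aut_ON[OF \<gamma>] image_quot)
qed (use assms in \<open>auto intro!: act_closed el_closed cont_autD(5)[OF \<gamma>]\<close>)

lemma aug_act: "augmentation G (act \<gamma> f) = augmentation G f"
  using cont_autD(3)[OF \<gamma>] by (simp add: augmentation_def carrier_ON quot_carrier)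

end

end

section \<open>The filtration of G\<close>

context ring
begin

lemma mult_minus_one_expand:
  "\<lbrakk>a \<in> carrier R; b \<in> carrier R\<rbrakk> \<Longrightarrow> a \<otimes> b \<ominus> \<one> = (a \<ominus> \<one>) \<otimes> (b \<ominus> \<one>) \<oplus> (a \<ominus> \<one>) \<oplus> (b \<ominus> \<one>)"
  by (algebra, simp only: r_one, algebra)

lemma commutator_minus_one_expand:
  "\<lbrakk>a \<in> carrier R; b \<in> carrier R\<rbrakk> \<Longrightarrow>
    a \<otimes> b \<ominus> b \<otimes> a = (a \<ominus> \<one>) \<otimes> (b \<ominus> \<one>) \<ominus> (b \<ominus> \<one>) \<otimes> (a \<ominus> \<one>)"
  by (algebra, simp only: r_one, algebra)

lemma inverse_minus_one_expand:
  assumes "a \<in> carrier R" "b \<in> carrier R" "b \<otimes> a = \<one>"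
  shows "b \<ominus> \<one> = \<ominus> (b \<otimes> (a \<ominus> \<one>))"
proof -
  have "b \<otimes> (a \<ominus> \<one>) = b \<otimes> a \<ominus> b"
    using assms(1,2) by (simp add: minus_eq r_distr r_minus)
  thus ?thesis using assms by (simp add: minus_eq minus_add a_comm)
qed

lemma mult_diff_right:
  "\<lbrakk>a \<in> carrier R; b \<in> carrier R; c \<in> carrier R\<rbrakk> \<Longrightarrow> (a \<ominus> b) \<otimes> c = a \<otimes> c \<ominus> b \<otimes> c"
  by algebra

lemma mult_diff_left:
  "\<lbrakk>a \<in> carrier R; b \<in> carrier R; c \<in> carrier R\<rbrakk> \<Longrightarrow> c \<otimes> (a \<ominus> b) = c \<otimes> a \<ominus> c \<otimes> b"
  by algebra

lemma mult_diff_one: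
  "\<lbrakk>a \<in> carrier R; c \<in> carrier R\<rbrakk> \<Longrightarrow> a \<otimes> c \<ominus> a = a \<otimes> (c \<ominus> \<one>)"
  by (algebra, simp only: r_one, algebra)

lemma conj_minus_one:
  assumes "a \<in> carrier R" "b \<in> carrier R" "c \<in> carrier R" "a \<otimes> c = \<one>"
  shows "a \<otimes> b \<otimes> c \<ominus> \<one> = a \<otimes> (b \<ominus> \<one>) \<otimes> c"
proof -
  have "a \<otimes> (b \<ominus> \<one>) \<otimes> c = a \<otimes> b \<otimes> c \<ominus> a \<otimes> c" using assms(1-3) by algebra
  thus ?thesis using assms(4) by simp
qed

lemma diff_trans: "\<lbrakk>a \<in> carrier R; b \<in> carrier R; c \<in> carrier R\<rbrakk> \<Longrightarrow> a \<ominus> c = (a \<ominus> b) \<oplus> (b \<ominus> c)"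
  by algebra

lemma diff_sym: "\<lbrakk>a \<in> carrier R; b \<in> carrier R\<rbrakk> \<Longrightarrow> a \<ominus> b = \<ominus> (b \<ominus> a)"
  by algebra

lemma diff_add: "\<lbrakk>a \<in> carrier R; b \<in> carrier R; c \<in> carrier R; d \<in> carrier R\<rbrakk> \<Longrightarrow>
    (a \<oplus> b) \<ominus> (c \<oplus> d) = (a \<ominus> c) \<oplus> (b \<ominus> d)"
  by algebra

lemma diff_diff: "\<lbrakk>a \<in> carrier R; b \<in> carrier R; c \<in> carrier R; d \<in> carrier R\<rbrakk> \<Longrightarrow>
    (a \<ominus> b) \<ominus> (c \<ominus> d) = (a \<ominus> c) \<ominus> (b \<ominus> d)"
  by algebra

lemma diff_diff_cancel: "\<lbrakk>a \<in> carrier R; b \<in> carrier R; c \<in> carrier R\<rbrakk> \<Longrightarrow>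
    (a \<ominus> c) \<ominus> (b \<ominus> c) = a \<ominus> b"
  by algebra

lemma add_diff_cancel_left: "\<lbrakk>a \<in> carrier R; b \<in> carrier R\<rbrakk> \<Longrightarrow> (a \<oplus> b) \<ominus> b = a"
  by algebra

lemma ideal_diff: "\<lbrakk>ideal J R; x \<in> J; y \<in> J\<rbrakk> \<Longrightarrow> x \<ominus> y \<in> J"
  by (simp add: a_minus_def additive_subgroup.a_closed additive_subgroup.a_inv_closed ideal.axioms(1))

end

context completed
begin

abbreviation Aln :: "nat \<Rightarrow> ('g, 'r) completed set" where "Aln \<equiv> Al A G T"

lemma ideal_Al: "ideal (Aln n) R"
  by (induction n) (auto intro: R.oneideal R.ideal_prod_is_ideal ideal_I)

lemma Al_carrier: "x \<in> Aln n \<Longrightarrow> x \<in> carrier R"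
  using ideal.Icarr[OF ideal_Al] .

lemma Al_add: "x \<in> Aln n \<Longrightarrow> y \<in> Aln n \<Longrightarrow> x \<oplus>\<^bsub>R\<^esub> y \<in> Aln n"
  using additive_subgroup.a_closed[OF ideal.axioms(1)[OF ideal_Al]] .

lemma Al_neg: "x \<in> Aln n \<Longrightarrow> \<ominus>\<^bsub>R\<^esub> x \<in> Aln n"
  using additive_subgroup.a_inv_closed[OF ideal.axioms(1)[OF ideal_Al]] .

lemma Al_zero: "\<zero>\<^bsub>R\<^esub> \<in> Aln n"
  using additive_subgroup.zero_closed[OF ideal.axioms(1)[OF ideal_Al]] .

lemma Al_minus: "x \<in> Aln n \<Longrightarrow> y \<in> Aln n \<Longrightarrow> x \<ominus>\<^bsub>R\<^esub> y \<in> Aln n"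
  by (rule R.ideal_diff[OF ideal_Al])

lemma Al_l: "x \<in> Aln n \<Longrightarrow> r \<in> carrier R \<Longrightarrow> r \<otimes>\<^bsub>R\<^esub> x \<in> Aln n"
  and Al_r: "x \<in> Aln n \<Longrightarrow> r \<in> carrier R \<Longrightarrow> x \<otimes>\<^bsub>R\<^esub> r \<in> Aln n"
  using ideal.I_l_closed[OF ideal_Al] ideal.I_r_closed[OF ideal_Al] by auto

lemma Al_Suc_subset: "Aln (Suc n) \<subseteq> Aln n"
  using R.ideal_prod_inter[OF ideal_Al ideal_I] by auto

lemma Al_mono: "m \<le> n \<Longrightarrow> Aln n \<subseteq> Aln m"
  by (induction n rule: dec_induct) (use Al_Suc_subset in auto)

lemma Al_mult_I: "x \<in> Aln n \<Longrightarrow> y \<in> I \<Longrightarrow> x \<otimes>\<^bsub>R\<^esub> y \<in> Aln (Suc n)"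
  by (simp add: ideal_prod.prod)

lemma I_eq_Al: "I = Aln (Suc 0)"
proof
  show "I \<subseteq> Aln (Suc 0)"
  proof
    fix x assume x: "x \<in> I"
    hence "\<one>\<^bsub>R\<^esub> \<otimes>\<^bsub>R\<^esub> x \<in> Aln (Suc 0)" by (intro Al_mult_I) auto
    thus "x \<in> Aln (Suc 0)" using x by (simp add: I_iff)
  qed
  show "Aln (Suc 0) \<subseteq> I" using R.ideal_prod_inter[OF R.oneideal ideal_I] by auto
qed

text \<open>\<open>Al\<close> grows by factors from \<open>I\<close> on the right, so the induction
  is on the exponent of the right factor and reassociates the product.\<close>

lemma Al_mult: "x \<in> Aln m \<Longrightarrow> y \<in> Aln n \<Longrightarrow> x \<otimes>\<^bsub>R\<^esub> y \<in> Aln (m + n)"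
proof (induction n arbitrary: y)
  case 0
  thus ?case using Al_r by simp
next
  case (Suc n)
  have x: "x \<in> carrier R" using Suc Al_carrier by blast
  from Suc.prems(2) have "y \<in> Aln n \<cdot>\<^bsub>R\<^esub> I" by simp
  thus ?case
  proof (induction y rule: ideal_prod.induct)
    case (prod i j)
    have "(x \<otimes>\<^bsub>R\<^esub> i) \<otimes>\<^bsub>R\<^esub> j \<in> Aln (Suc (m + n))"
      using Suc.IH[OF Suc.prems(1) prod(1)] prod(2) by (rule Al_mult_I)
    thus ?case using x prod Al_carrier by (simp add: R.m_assoc I_iff del: Al.simps)
  next
    case (sum s1 s2)
    have "s1 \<in> carrier R" "s2 \<in> carrier R"
      using sum(1,2) R.ideal_prod_in_carrier[OF ideal_Al ideal_I] by auto
    thus ?case using x Al_add[OF sum(3,4)] by (simp add: R.r_distr del: Al.simps)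
  qed
qed

text \<open>A ring endomorphism that preserves the augmentation preserves \<open>I\<close> and with
  it all its powers.\<close>

lemma act_Al: 
  assumes "cont_aut \<gamma>"
  shows "x \<in> Aln n \<Longrightarrow> act \<gamma> x \<in> Aln n"
proof (induction n arbitrary: x)
  case 0
  thus ?case by (simp add: act_closed assms)
next
  case (Suc n)
  from Suc.prems have "x \<in> Aln n \<cdot>\<^bsub>R\<^esub> I" by simp
  thus ?case
  proof (induction x rule: ideal_prod.induct)
    case (prod i j)
    have "act \<gamma> i \<otimes>\<^bsub>R\<^esub> act \<gamma> j \<in> Aln (Suc n)"
      using Suc.IH[OF prod(1)] prod(2) assms
      by (intro Al_mult_I) (auto simp: I_iff act_closed aug_act)
    thus ?case using prod Al_carrier assms by (simp add: act_mult I_iff del: Al.simps)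
  next
    case (sum s1 s2)
    have "s1 \<in> carrier R" "s2 \<in> carrier R"
      using sum(1,2) R.ideal_prod_in_carrier[OF ideal_Al ideal_I] by auto
    thus ?case using Al_add[OF sum(3,4)] assms by (simp add: act_add del: Al.simps)
  qed
qed

text \<open>Congruence modulo a power of the augmentation ideal. Membership in the carrier is
  included so that symmetry, transitivity and the compatibility lemmas carry no side
  conditions.\<close>

definition cg :: "nat \<Rightarrow> ('g, 'r) completed \<Rightarrow> ('g, 'r) completed \<Rightarrow> bool" where
  "cg n x y \<longleftrightarrow> x \<in> carrier R \<and> y \<in> carrier R \<and> x \<ominus>\<^bsub>R\<^esub> y \<in> Aln n"

lemma cgD: "cg n x y \<Longrightarrow> x \<in> carrier R" "cg n x y \<Longrightarrow> y \<in> carrier R" "cg n x y \<Longrightarrow> x \<ominus>\<^bsub>R\<^esub> y \<in> Aln n"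
  by (simp_all add: cg_def)

lemma cg_refl: "x \<in> carrier R \<Longrightarrow> cg n x x"
  by (simp add: cg_def R.minus_eq R.r_neg Al_zero)

lemma cg_sym: "cg n x y \<Longrightarrow> cg n y x"
  using Al_neg[of "x \<ominus>\<^bsub>R\<^esub> y" n] R.diff_sym[of y x] by (simp add: cg_def)

lemma cg_trans: "cg n x y \<Longrightarrow> cg n y z \<Longrightarrow> cg n x z"
  using Al_add[of "x \<ominus>\<^bsub>R\<^esub> y" n "y \<ominus>\<^bsub>R\<^esub> z"] R.diff_trans[of x y z] by (simp add: cg_def)

lemma cg_add: "cg n x y \<Longrightarrow> cg n x' y' \<Longrightarrow> cg n (x \<oplus>\<^bsub>R\<^esub> x') (y \<oplus>\<^bsub>R\<^esub> y')"
  using Al_add[of "x \<ominus>\<^bsub>R\<^esub> y" n "x' \<ominus>\<^bsub>R\<^esub> y'"] R.diff_add[of x x' y y'] by (simp add: cg_def)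

lemma cg_diff: "cg n x y \<Longrightarrow> cg n x' y' \<Longrightarrow> cg n (x \<ominus>\<^bsub>R\<^esub> x') (y \<ominus>\<^bsub>R\<^esub> y')"
  using Al_minus[of "x \<ominus>\<^bsub>R\<^esub> y" n "x' \<ominus>\<^bsub>R\<^esub> y'"] R.diff_diff[of x x' y y'] by (simp add: cg_def)

lemma cg_mono: "cg n x y \<Longrightarrow> m \<le> n \<Longrightarrow> cg m x y"
  using subsetD[OF Al_mono[of m n]] by (simp add: cg_def)

lemma cg_mult_left: "r \<in> Aln m \<Longrightarrow> cg n x y \<Longrightarrow> cg (m + n) (r \<otimes>\<^bsub>R\<^esub> x) (r \<otimes>\<^bsub>R\<^esub> y)"
  using Al_mult[of r m "x \<ominus>\<^bsub>R\<^esub> y" n] R.mult_diff_left[of x y r] Al_carrier[of r m] by (simp add: cg_def)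

lemma cg_mult_right: "r \<in> Aln m \<Longrightarrow> cg n x y \<Longrightarrow> cg (n + m) (x \<otimes>\<^bsub>R\<^esub> r) (y \<otimes>\<^bsub>R\<^esub> r)"
  using Al_mult[of "x \<ominus>\<^bsub>R\<^esub> y" n r m] R.mult_diff_right[of x y r] Al_carrier[of r m] by (simp add: cg_def)

lemma cg_sc: "a \<in> carrier A \<Longrightarrow> cg n x y \<Longrightarrow> cg n (sc a \<otimes>\<^bsub>R\<^esub> x) (sc a \<otimes>\<^bsub>R\<^esub> y)"
  using cg_mult_left[of "sc a" 0 n x y] by simp

lemma cg_Al: "cg n x y \<Longrightarrow> x \<in> Aln n \<longleftrightarrow> y \<in> Aln n"
proof -
  have *: "x \<in> Aln n" if "cg n x y" "y \<in> Aln n" for x y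
  proof -
    have "x = (x \<ominus>\<^bsub>R\<^esub> y) \<oplus>\<^bsub>R\<^esub> y" using cgD[OF that(1)] by (simp add: R.minus_eq R.a_assoc R.l_neg)
    thus ?thesis using Al_add[OF cgD(3)[OF that(1)] that(2)] by simp
  qed
  show "cg n x y \<Longrightarrow> x \<in> Aln n \<longleftrightarrow> y \<in> Aln n"
    using *[of x y] *[of y x] cg_sym[of n x y] by metis
qed

lemma act_cg: "cont_aut \<gamma> \<Longrightarrow> cg n x y \<Longrightarrow> cg n (act \<gamma> x) (act \<gamma> y)"
proof -
  assume g: "cont_aut \<gamma>" and xy: "cg n x y"
  have "act \<gamma> x = act \<gamma> (x \<ominus>\<^bsub>R\<^esub> y) \<oplus>\<^bsub>R\<^esub> act \<gamma> y"
    using cgD[OF xy] act_add[OF g, of "x \<ominus>\<^bsub>R\<^esub> y" y] by (simp add: R.minus_eq R.a_assoc R.l_neg)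
  hence "act \<gamma> x \<ominus>\<^bsub>R\<^esub> act \<gamma> y = act \<gamma> (x \<ominus>\<^bsub>R\<^esub> y)"
    using cgD[OF xy] by (simp add: R.add_diff_cancel_left act_closed[OF g])
  thus ?thesis using act_Al[OF g cgD(3)[OF xy]] cgD[OF xy] by (simp add: cg_def act_closed[OF g])
qed

abbreviation mo :: "'g \<Rightarrow> ('g, 'r) completed" where "mo \<equiv> minus_one A G T"
abbreviation F :: "nat \<Rightarrow> 'g set" where "F \<equiv> filtr A G T"

lemma mo_def: "mo g = ge g \<ominus>\<^bsub>R\<^esub> \<one>\<^bsub>R\<^esub>"
  by (simp add: minus_one_def group_element_eq)

lemma ge_closed [simp]: "g \<in> carrier G \<Longrightarrow> ge g \<in> carrier R"
  by (simp add: one_in)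

lemma mo_closed [simp]: "g \<in> carrier G \<Longrightarrow> mo g \<in> carrier R"
  by (simp add: mo_def)

lemma ge_mult: "g \<in> carrier G \<Longrightarrow> h \<in> carrier G \<Longrightarrow> ge (g \<otimes> h) = ge g \<otimes>\<^bsub>R\<^esub> ge h"
  by (simp add: el_mult one_in)

lemma mo_I: "g \<in> carrier G \<Longrightarrow> mo g \<in> I"
  unfolding I_iff mo_def a_minus_def
  using aug_el[of \<one> "\<one>\<^bsub>A\<^esub>"] by (simp add: aug_add aug_neg aug_el el_one A.r_neg)

lemma mo_mult: "g \<in> carrier G \<Longrightarrow> h \<in> carrier G \<Longrightarrow>
    mo (g \<otimes> h) = mo g \<otimes>\<^bsub>R\<^esub> mo h \<oplus>\<^bsub>R\<^esub> mo g \<oplus>\<^bsub>R\<^esub> mo h"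
  unfolding mo_def by (subst ge_mult) (simp_all add: R.mult_minus_one_expand)

lemma mo_one: "mo \<one> = \<zero>\<^bsub>R\<^esub>"
  by (simp add: mo_def el_one R.minus_eq R.r_neg)

lemma mo_diff: "g \<in> carrier G \<Longrightarrow> h \<in> carrier G \<Longrightarrow> mo g \<ominus>\<^bsub>R\<^esub> mo h = ge g \<ominus>\<^bsub>R\<^esub> ge h"
  unfolding mo_def by (rule R.diff_diff_cancel) simp_all

lemma F_iff: "g \<in> F n \<longleftrightarrow> g \<in> carrier G \<and> mo g \<in> Aln n"
  by (simp add: filtr_def)

lemma F_carrier: "g \<in> F n \<Longrightarrow> g \<in> carrier G"
  by (simp add: F_iff)

lemma F_one: "F (Suc 0) = carrier G"
  using mo_I by (auto simp only: F_iff I_eq_Al[symmetric])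

text \<open>g h^(-1) - 1 = (g - h) h^(-1), where h is a unit. Hence the cosets of \<open>F n\<close>
  are the congruence classes of g - 1 modulo the ideal.\<close>

lemma F_mult_inv_iff:
  assumes g: "g \<in> carrier G" and h: "h \<in> carrier G"
  shows "g \<otimes> inv h \<in> F n \<longleftrightarrow> cg n (mo g) (mo h)"
proof -
  have 1: "mo (g \<otimes> inv h) = (ge g \<ominus>\<^bsub>R\<^esub> ge h) \<otimes>\<^bsub>R\<^esub> ge (inv h)"
    using g h by (simp add: R.mult_diff_right ge_mult[symmetric] el_one mo_def)
  have 2: "mo (g \<otimes> inv h) \<otimes>\<^bsub>R\<^esub> ge h = ge g \<ominus>\<^bsub>R\<^esub> ge h"
    using g h unfolding 1 by (simp add: R.m_assoc ge_mult[symmetric] el_one)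
  have "mo (g \<otimes> inv h) \<in> Aln n \<longleftrightarrow> ge g \<ominus>\<^bsub>R\<^esub> ge h \<in> Aln n"
    using Al_r[of _ n "ge h"] Al_r[of _ n "ge (inv h)"] g h 1 2 by (metis ge_closed inv_closed)
  thus ?thesis using g h by (simp add: F_iff cg_def mo_diff)
qed

lemma F_normal: "F n \<lhd> G"
proof (rule normal_invI)
  show "subgroup (F n) G"
  proof
    fix g h assume "g \<in> F n" "h \<in> F n"
    thus "g \<otimes> h \<in> F n" by (simp add: F_iff mo_mult Al_add Al_l)
  next
    fix g assume g: "g \<in> F n"
    have "ge (inv g) \<otimes>\<^bsub>R\<^esub> ge g = \<one>\<^bsub>R\<^esub>" using g by (simp add: F_iff ge_mult[symmetric] el_one)
    hence "mo (inv g) = \<ominus>\<^bsub>R\<^esub> (ge (inv g) \<otimes>\<^bsub>R\<^esub> mo g)"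
      using g R.inverse_minus_one_expand[of "ge g" "ge (inv g)"] by (simp add: F_iff mo_def)
    thus "inv g \<in> F n" using g by (simp add: F_iff Al_neg Al_l)
  qed (auto simp: F_iff mo_one Al_zero)
  fix x g assume x: "x \<in> carrier G" and g: "g \<in> F n"
  have "mo (x \<otimes> g \<otimes> inv x) = ge x \<otimes>\<^bsub>R\<^esub> mo g \<otimes>\<^bsub>R\<^esub> ge (inv x)"
    using x g R.conj_minus_one[of "ge x" "ge g" "ge (inv x)"]
    by (simp add: F_iff mo_def ge_mult[symmetric] el_one)
  thus "x \<otimes> g \<otimes> inv x \<in> F n" using x g by (simp add: F_iff Al_l Al_r)
qed

lemma F_subgroup: "subgroup (F n) G"
  by (rule normal_imp_subgroup[OF F_normal])

text \<open>The commutator [g, h] written as gh (hg)^(-1): then [g, h] - 1 = (gh - hg) (hg)^(-1),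
  with a single inverse to remove.\<close>

definition comm :: "'g \<Rightarrow> 'g \<Rightarrow> 'g" where
  "comm g h = g \<otimes> h \<otimes> inv (h \<otimes> g)"

lemma comm_closed [simp]: "g \<in> carrier G \<Longrightarrow> h \<in> carrier G \<Longrightarrow> comm g h \<in> carrier G"
  by (simp add: comm_def)

text \<open>gh - hg = (g-1)(h-1) - (h-1)(g-1) lies in \<open>Aln (m + n)\<close>, and the remaining
  factor (hg)^(-1) is congruent to 1 modulo \<open>I\<close>, so it changes this only by an element
  of the next power.\<close>

lemma mo_comm:
  assumes g: "g \<in> F m" and h: "h \<in> F n"
  shows "cg (Suc (m + n)) (mo (comm g h)) (mo g \<otimes>\<^bsub>R\<^esub> mo h \<ominus>\<^bsub>R\<^esub> mo h \<otimes>\<^bsub>R\<^esub> mo g)"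
    and "comm g h \<in> F (m + n)"
proof -
  have c: "g \<in> carrier G" "h \<in> carrier G" using g h F_carrier by auto
  define D where "D = mo g \<otimes>\<^bsub>R\<^esub> mo h \<ominus>\<^bsub>R\<^esub> mo h \<otimes>\<^bsub>R\<^esub> mo g"
  define w where "w = ge (inv (h \<otimes> g))"
  have D: "D \<in> Aln (m + n)"
    using g h Al_mult[of "mo g" m "mo h" n] Al_mult[of "mo h" n "mo g" m]
    unfolding D_def F_iff by (intro Al_minus) (simp_all add: add.commute)
  have DR: "D \<in> carrier R" using D Al_carrier by blast
  have w: "w \<in> carrier R" "w \<ominus>\<^bsub>R\<^esub> \<one>\<^bsub>R\<^esub> \<in> I"
    using c mo_I[of "inv (h \<otimes> g)"] by (auto simp: w_def mo_def)
  have "D = ge (g \<otimes> h) \<ominus>\<^bsub>R\<^esub> ge (h \<otimes> g)"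
    using c by (simp add: D_def mo_def ge_mult R.commutator_minus_one_expand)
  hence eq: "mo (comm g h) = D \<otimes>\<^bsub>R\<^esub> w"
    using c unfolding w_def comm_def by (simp add: R.mult_diff_right ge_mult[symmetric] el_one mo_def)
  have "D \<otimes>\<^bsub>R\<^esub> w \<ominus>\<^bsub>R\<^esub> D = D \<otimes>\<^bsub>R\<^esub> (w \<ominus>\<^bsub>R\<^esub> \<one>\<^bsub>R\<^esub>)" using DR w by (simp add: R.mult_diff_one)
  also have "\<dots> \<in> Aln (Suc (m + n))" by (rule Al_mult_I[OF D w(2)])
  finally show "cg (Suc (m + n)) (mo (comm g h)) (mo g \<otimes>\<^bsub>R\<^esub> mo h \<ominus>\<^bsub>R\<^esub> mo h \<otimes>\<^bsub>R\<^esub> mo g)"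
    using DR w by (simp add: cg_def eq D_def[symmetric] del: Al.simps)
  show "comm g h \<in> F (m + n)" using c D w eq by (simp add: F_iff Al_r)
qed

lemma act_mo: "cont_aut \<gamma> \<Longrightarrow> g \<in> carrier G \<Longrightarrow> act \<gamma> (mo (\<gamma> g)) = mo g"
proof -
  assume \<gamma>: "cont_aut \<gamma>" and g: "g \<in> carrier G"
  note c = cont_autD(5)[OF \<gamma> g]
  have one: "act \<gamma> \<one>\<^bsub>R\<^esub> = \<one>\<^bsub>R\<^esub>"
    using act_el[OF \<gamma> one_closed one_in] cont_autD(8)[OF \<gamma>] by (simp add: el_one)
  have "mo (\<gamma> g) \<oplus>\<^bsub>R\<^esub> \<one>\<^bsub>R\<^esub> = ge (\<gamma> g)"
    using c by (simp add: mo_def R.minus_eq R.a_assoc R.l_neg)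
  hence "act \<gamma> (mo (\<gamma> g)) \<oplus>\<^bsub>R\<^esub> \<one>\<^bsub>R\<^esub> = ge g"
    using act_add[OF \<gamma>, of "mo (\<gamma> g)" "\<one>\<^bsub>R\<^esub>"] c act_el[OF \<gamma> g one_in] one by simp
  hence "mo g = (act \<gamma> (mo (\<gamma> g)) \<oplus>\<^bsub>R\<^esub> \<one>\<^bsub>R\<^esub>) \<ominus>\<^bsub>R\<^esub> \<one>\<^bsub>R\<^esub>" by (simp add: mo_def)
  thus ?thesis using c by (simp add: R.add_diff_cancel_left act_closed[OF \<gamma>])
qed

text \<open>\<open>act\<close> pulls back, which gives this implication only; the converse uses the
  inverse automorphism and is \<open>aut_pair_F_iff\<close>.\<close>

lemma cont_aut_F: "cont_aut \<gamma> \<Longrightarrow> g \<in> carrier G \<Longrightarrow> \<gamma> g \<in> F n \<Longrightarrow> g \<in> F n"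
  using act_Al[of \<gamma> "mo (\<gamma> g)" n] act_mo[of \<gamma> g] by (simp add: F_iff)

lemma act_sc: 
  "cont_aut \<gamma> \<Longrightarrow> a \<in> carrier A \<Longrightarrow> x \<in> carrier R \<Longrightarrow> act \<gamma> (sc a \<otimes>\<^bsub>R\<^esub> x) = sc a \<otimes>\<^bsub>R\<^esub> act \<gamma> x"
  using act_el[of \<gamma> \<one> a] cont_autD(8)[of \<gamma>] by (simp add: act_mult)

end

section \<open>Powers with exponents in the coefficient ring\<close>

lemma sum_lessThan_add: "(\<Sum>i<m + n. f i) = (\<Sum>i<m. f i) + (\<Sum>i<n. f (i + m))" for f :: "nat \<Rightarrow> 'a::comm_monoid_add"
  by (induction n) (auto simp: add_ac)

context pro_p
begin

text \<open>The coefficient of the coset C in the image of 1 + g + ... + g^(n-1) in the integral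
  group ring of G/U.\<close>

definition cnt :: "'g \<Rightarrow> 'g set \<Rightarrow> 'g set \<Rightarrow> nat \<Rightarrow> int" where
  "cnt g U C n = (\<Sum>i<n. if U #> (g [^] i) = C then 1 else 0)"

lemma pow_coset:
  assumes U: "U \<in> ON" and f: "order (G Mod U) = p ^ f" and g: "g \<in> carrier G"
    and mn: "[m = n] (mod p ^ f)"
  shows "U #> (g [^] (m::nat)) = U #> (g [^] n)"
proof -
  interpret Q: group "G Mod U" by (rule ON_D(4)[OF U])
  have gU: "U #> g \<in> carrier (G Mod U)" using g by (auto simp: carrier_FactGroup)
  have pw: "(U #> g) [^]\<^bsub>G Mod U\<^esub> k = U #> (g [^] k)" for k :: nat
    by (rule normal.FactGroup_pow[OF ON_D(1)[OF U] g])
  have "(U #> g) [^]\<^bsub>G Mod U\<^esub> m = (U #> g) [^]\<^bsub>G Mod U\<^esub> n"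
  proof -
    have *: "(U #> g) [^]\<^bsub>G Mod U\<^esub> k = (U #> g) [^]\<^bsub>G Mod U\<^esub> (k mod p ^ f)" for k :: nat
    proof -
      have "(U #> g) [^]\<^bsub>G Mod U\<^esub> k = (U #> g) [^]\<^bsub>G Mod U\<^esub> (p ^ f * (k div p ^ f) + k mod p ^ f)" by simp
      also have "\<dots> = (U #> g) [^]\<^bsub>G Mod U\<^esub> (p ^ f * (k div p ^ f)) \<otimes>\<^bsub>G Mod U\<^esub> (U #> g) [^]\<^bsub>G Mod U\<^esub> (k mod p ^ f)"
        by (rule Q.nat_pow_mult[OF gU, symmetric])
      also have "(U #> g) [^]\<^bsub>G Mod U\<^esub> (p ^ f * (k div p ^ f)) = \<one>\<^bsub>G Mod U\<^esub>"
        unfolding Q.nat_pow_pow[OF gU, symmetric] f[symmetric] Q.pow_order_eq_1[OF gU] by (rule Q.nat_pow_one)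
      also have "\<one>\<^bsub>G Mod U\<^esub> \<otimes>\<^bsub>G Mod U\<^esub> (U #> g) [^]\<^bsub>G Mod U\<^esub> (k mod p ^ f) = (U #> g) [^]\<^bsub>G Mod U\<^esub> (k mod p ^ f)"
        by (intro Q.l_one Q.nat_pow_closed gU)
      finally show ?thesis .
    qed
    show ?thesis using *[of m] *[of n] mn by (simp add: cong_def)
  qed
  thus ?thesis by (simp add: pw)
qed

lemma cnt_add_period:
  assumes U: "U \<in> ON" and f: "order (G Mod U) = p ^ f" and g: "g \<in> carrier G"
  shows "cnt g U C (n + m * p ^ f) = cnt g U C n + int m * cnt g U C (p ^ f)"
proof (induction m)
  case (Suc m)
  have "cnt g U C (p ^ f + k) = cnt g U C (p ^ f) + cnt g U C k" for k
    unfolding cnt_def sum_lessThan_add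
    by (intro arg_cong2[of _ _ _ _ "(+)"] sum.cong refl if_cong arg_cong[of _ _ "\<lambda>x. x = C"] pow_coset[OF U f g])
       (simp add: cong_def)
  from this[of "n + m * p ^ f"] show ?case using Suc by (simp add: algebra_simps)
qed (simp add: cnt_def)

text \<open>The powers of g modulo U have period \<open>p ^ f\<close>, so lengthening the sum by a
  multiple of \<open>p ^ (r + f)\<close> terms adds a multiple of \<open>p ^ r\<close> full periods
  to the count. The precision f is lost to the period.\<close>

lemma cnt_cong:
  assumes U: "U \<in> ON" and f: "order (G Mod U) = p ^ f" and g: "g \<in> carrier G"
    and mn: "[int m = int n] (mod int p ^ (r + f))"
  shows "[cnt g U C m = cnt g U C n] (mod int p ^ r)"
proof -
  have *: "[cnt g U C m = cnt g U C n] (mod int p ^ r)" if le: "n \<le> m" and mn: "[int m = int n] (mod int p ^ (r + f))" for m n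
  proof -
    have "int p ^ (r + f) dvd int m - int n" using mn by (simp add: cong_iff_dvd_diff)
    hence "p ^ (r + f) dvd m - n" using le by (metis of_nat_diff of_nat_power int_dvd_int_iff)
    then obtain k where "m - n = p ^ (r + f) * k" by (elim dvdE)
    moreover have "m = n + (m - n)" using le by simp
    ultimately have "m = n + (p ^ r * k) * p ^ f" by (simp add: power_add mult_ac)
    hence "cnt g U C m = cnt g U C n + int p ^ r * (int k * cnt g U C (p ^ f))"
      using cnt_add_period[OF U f g, of C n "p ^ r * k"] by (simp add: mult.assoc)
    thus ?thesis by (simp add: cong_iff_dvd_diff)
  qed
  show ?thesis using *[of n m] *[of m n] mn by (meson cong_sym nat_le_linear)
qed

end

context completed
begin

text \<open>Shifting the index by f compensates the precision lost in \<open>cnt_cong\<close>. As f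
  depends on U, the conclusion is phrased with eventual congruence, from which the shift has
  disappeared.\<close>

lemma cnt_limit:
  assumes U: "U \<in> ON" and g: "g \<in> carrier G"
    and j: "\<And>r s. r \<le> s \<Longrightarrow> [int (j r) = int (j s)] (mod int p ^ r)"
  shows "\<exists>b\<in>carrier A. \<forall>k. \<forall>\<^sub>F r in sequentially. [cnt g U C (j r) = red k b] (mod md k)"
proof -
  obtain f where f: "order (G Mod U) = p ^ f" using order_quotient[OF U] by blast
  have "[cnt g U C (j (r + f)) = cnt g U C (j (s + f))] (mod int p ^ r)" if "r \<le> s" for r s
    using j[of "r + f" "s + f"] that by (intro cnt_cong[OF U f g]) simp
  then obtain b where b: "b \<in> carrier A" "\<And>k r. e k \<le> r \<Longrightarrow> [cnt g U C (j (r + f)) = red k b] (mod md k)"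
    using red_limit[of "\<lambda>r. cnt g U C (j (r + f))"] by blast
  have "\<forall>\<^sub>F r in sequentially. [cnt g U C (j r) = red k b] (mod md k)" for k
    unfolding eventually_sequentially
  proof (intro exI allI impI)
    fix n assume n: "n \<ge> e k + f"
    thus "[cnt g U C (j n) = red k b] (mod md k)" using b(2)[of k "n - f"] by simp
  qed
  thus ?thesis using b(1) by blast
qed

lemma eventually_sequentially_ex: "\<forall>\<^sub>F r in sequentially. P (r::nat) \<Longrightarrow> \<exists>r. P r"
  by (auto simp: eventually_sequentially)

text \<open>
  If \<open>j\<^sub>r\<close> are natural numbers converging to a, then \<open>g\<^sup>a - 1 = (g - 1) N\<close>, where N is the limit of
  the sums of the \<open>g\<^sup>i\<close> for \<open>i < j\<^sub>r\<close>. The augmentation of N is a.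
\<close>

lemma power_exists:
  assumes g: "g \<in> carrier G" and a: "a \<in> carrier A"
  obtains h t where "h \<in> carrier G" "t \<in> I" "mo h = sc a \<otimes>\<^bsub>R\<^esub> mo g \<oplus>\<^bsub>R\<^esub> mo g \<otimes>\<^bsub>R\<^esub> t"
    "\<And>U. U \<in> ON \<Longrightarrow> \<exists>j::nat. [int j = red 0 a] (mod int p) \<and> U #> h = U #> (g [^] j)"
proof -
  obtain j :: "nat \<Rightarrow> nat" where j: "\<And>r s. r \<le> s \<Longrightarrow> [int (j r) = int (j s)] (mod int p ^ r)"
    and ja: "\<And>k r. e k \<le> r \<Longrightarrow> [int (j r) = red k a] (mod md k)"
    using nat_approx[OF a] by blast
  have ja_ev: "\<forall>\<^sub>F r in sequentially. [int (j r) = red k a] (mod md k)" for k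
    unfolding eventually_sequentially using ja by blast
  have ev: "\<exists>n0. \<forall>n\<ge>n0. U #> (g [^] j n) = U #> (g [^] j n0)" if U: "U \<in> ON" for U
  proof -
    obtain f where f: "order (G Mod U) = p ^ f" using order_quotient[OF U] by blast
    have "U #> (g [^] j n) = U #> (g [^] j f)" if "n \<ge> f" for n
      using j[OF that] by (intro pow_coset[OF U f g]) (metis cong_int_iff cong_sym of_nat_power)
    thus ?thesis by blast
  qed
  obtain h where h: "h \<in> carrier G" "\<And>U. U \<in> ON \<Longrightarrow> \<exists>n0. \<forall>n\<ge>n0. U #> (g [^] j n) = U #> h"
    using eventually_constant_limit[of "\<lambda>n. g [^] j n"] ev g by auto
  have h_ev: "\<forall>\<^sub>F r in sequentially. U #> (g [^] j r) = U #> h" if "U \<in> ON" for U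
    using h(2)[OF that] by (simp add: eventually_sequentially)
  \<comment> \<open>The coefficient at C of the limit N is the limit of the integer counts. It
    exists by \<open>cnt_limit\<close> and is chosen for every U and C at once.\<close>
  define b where "b = (\<lambda>U C. SOME b. b \<in> carrier A \<and> (\<forall>k. \<forall>\<^sub>F r in sequentially. [cnt g U C (j r) = red k b] (mod md k)))"
  have b: "b U C \<in> carrier A" "\<forall>\<^sub>F r in sequentially. [cnt g U C (j r) = red k (b U C)] (mod md k)" if U: "U \<in> ON" for U C k
  proof -
    have "b U C \<in> carrier A \<and> (\<forall>k. \<forall>\<^sub>F r in sequentially. [cnt g U C (j r) = red k (b U C)] (mod md k))"
      unfolding b_def by (rule someI_ex) (use cnt_limit[OF U g j] in blast)
    thus "b U C \<in> carrier A" "\<forall>\<^sub>F r in sequentially. [cnt g U C (j r) = red k (b U C)] (mod md k)" by auto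
  qed
  define N where "N = (\<lambda>U\<in>ON. \<lambda>C\<in>quot U. b U C)"
  have NU: "N U \<in> carrier (ga U)" if "U \<in> ON" for U
    using that b(1)[OF that] by (simp add: N_def group_algebra_def)
  have Nred: "\<forall>\<^sub>F r in sequentially. [cnt g U C (j r) = red k (N U C)] (mod md k)" if "U \<in> ON" "C \<in> quot U" for U C k
    using b(2)[OF that(1)] that by (simp add: N_def)
  have "group_algebra_proj A G U V (N U) = N V" if U: "U \<in> ON" and V: "V \<in> ON" and UV: "U \<subseteq> V" for U V
  proof (rule group_algebra_eqI)
    fix C k assume C: "C \<in> quot V"
    have fin: "finite {D \<in> quot U. D \<subseteq> C}" using finite_quotient[OF U] by simp
    \<comment> \<open>Compatibility holds already for the counts: a power of g that lies in C lies
      in exactly one of the cosets D inside C. It passes to the limit because only finitely many D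
      occur, so one index r approximates them all.\<close>
    have sm: "(\<Sum>D\<in>{D \<in> quot U. D \<subseteq> C}. cnt g U D n) = cnt g V C n" for n
      unfolding cnt_def
    proof (subst sum.swap, rule sum.cong)
      fix i :: nat
      have gi: "g [^] i \<in> carrier G" using g by simp
      show "(\<Sum>D\<in>{D \<in> quot U. D \<subseteq> C}. if U #> g [^] i = D then 1 else 0) = (if V #> g [^] i = C then 1 else (0::int))"
        using fin quot_coset[OF gi, of U] coset_subset_iff[OF U V UV gi C] by simp
    qed simp
    have "\<forall>\<^sub>F r in sequentially. \<forall>D\<in>{D \<in> quot U. D \<subseteq> C}. [cnt g U D (j r) = red k (N U D)] (mod md k)"
      using Nred[OF U] by (intro eventually_ball_finite fin) auto
    with Nred[OF V C, of k]
    have "\<forall>\<^sub>F r in sequentially. [red k (group_algebra_proj A G U V (N U) C) = red k (N V C)] (mod md k)"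
    proof eventually_elim
      case (elim r)
      have "[red k (group_algebra_proj A G U V (N U) C) = (\<Sum>D\<in>{D \<in> quot U. D \<subseteq> C}. red k (N U D))] (mod md k)"
        by (rule red_proj[OF U NU[OF U] C])
      moreover have "[(\<Sum>D\<in>{D \<in> quot U. D \<subseteq> C}. cnt g U D (j r)) = (\<Sum>D\<in>{D \<in> quot U. D \<subseteq> C}. red k (N U D))] (mod md k)"
        using elim by (intro cong_sum) blast
      ultimately show ?case using elim(1) unfolding sm by (simp add: cong_def)
    qed
    thus "[red k (group_algebra_proj A G U V (N U) C) = red k (N V C)] (mod md k)" by simp
  qed (rule proj_closed[OF U NU[OF U]], rule NU[OF V])
  hence NR: "N \<in> carrier R" using NU by (simp add: R_carrier) (simp add: N_def)
  have N_aug: "augmentation G N = a"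
  proof (rule cong_red_eq)
    fix k
    have "carrier G #> (g [^] i) = carrier G" for i :: nat
      using g by (intro coset_join2 subgroup_self) auto
    hence "cnt g (carrier G) (carrier G) n = int n" for n by (simp add: cnt_def)
    hence "\<forall>\<^sub>F r in sequentially. [int (j r) = red k (augmentation G N)] (mod md k)"
      using Nred[OF carrier_ON, of "carrier G" k] by (simp add: quot_carrier augmentation_def)
    with ja_ev[of k] have "\<forall>\<^sub>F r in sequentially. [red k (augmentation G N) = red k a] (mod md k)"
      by eventually_elim (simp add: cong_def)
    thus "[red k (augmentation G N) = red k a] (mod md k)" by simp
  qed (use NR a in auto)
  have Nmo: "mo g \<otimes>\<^bsub>R\<^esub> N = mo h"
  proof -
    \<comment> \<open>The limit of g (1 + ... + g^(n-1)) + 1 = (1 + ... + g^(n-1)) + g^n along n =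
      \<open>j r\<close>. Written without subtraction it can be compared coefficient by coefficient
      using sums only.\<close>
    have "ge g \<otimes>\<^bsub>R\<^esub> N \<oplus>\<^bsub>R\<^esub> \<one>\<^bsub>R\<^esub> = N \<oplus>\<^bsub>R\<^esub> ge h"
    proof (rule R_eqI2)
      fix U C assume U: "U \<in> ON" and "C \<in> quot U"
      then obtain y where y: "y \<in> carrier G" "C = U #> y" by (auto elim: quot_cases)
      have gy: "inv g \<otimes> y \<in> carrier G" using g y by simp
      have C: "C \<in> quot U" using y by simp
      define C' where "C' = U #> (inv g \<otimes> y)"
      have C': "C' \<in> quot U" using gy by (simp add: C'_def)
      have step: "U #> (g [^] i) = C' \<longleftrightarrow> U #> (g [^] Suc i) = C" for i :: nat
      proof -
        have gi: "g [^] i \<in> carrier G" using g by simp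
        have c: "g \<otimes> g [^] i = g [^] Suc i" using g by (rule nat_pow_Suc2[symmetric])
        show ?thesis
        proof
          assume "U #> (g [^] i) = C'"
          hence "(U #> g) <#> (U #> (g [^] i)) = (U #> g) <#> (U #> (inv g \<otimes> y))" by (simp add: C'_def)
          thus "U #> (g [^] Suc i) = C" using g gi gy y by (simp add: coset_mult U m_assoc[symmetric] c)
        next
          assume "U #> (g [^] Suc i) = C"
          hence "(U #> inv g) <#> (U #> (g \<otimes> g [^] i)) = (U #> inv g) <#> (U #> y)" using y c by simp
          thus "U #> (g [^] i) = C'" using g gi y by (simp add: coset_mult U m_assoc[symmetric] C'_def)
        qed
      qed
      \<comment> \<open>The telescoping identity for the counts: C' is the coset g^(-1) C, so
        \<open>cnt g U C' n\<close> counts those exponents among 1, ..., n that lead to C.\<close>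
      have tele: "cnt g U C' n + (if U #> \<one> = C then 1 else 0) = cnt g U C n + (if U #> (g [^] n) = C then 1 else 0)" for n
        by (induction n) (auto simp: cnt_def step simp del: nat_pow_Suc)
      have Rl: "ge g \<otimes>\<^bsub>R\<^esub> N \<oplus>\<^bsub>R\<^esub> \<one>\<^bsub>R\<^esub> \<in> carrier R" and Rr: "N \<oplus>\<^bsub>R\<^esub> ge h \<in> carrier R"
        using g h NR by auto
      have l: "(ge g \<otimes>\<^bsub>R\<^esub> N \<oplus>\<^bsub>R\<^esub> \<one>\<^bsub>R\<^esub>) U C = N U C' \<oplus>\<^bsub>A\<^esub> (if U #> \<one> = C then \<one>\<^bsub>A\<^esub> else \<zero>\<^bsub>A\<^esub>)"
        using el_mult_apply(1)[OF U g y(1) one_in NR] R_mem2[OF NR U C'] U C y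
          coset_mult_one[OF ON_sub[OF U]]
        by (auto simp: C'_def)
      have r: "(N \<oplus>\<^bsub>R\<^esub> ge h) U C = N U C \<oplus>\<^bsub>A\<^esub> (if C = U #> h then \<one>\<^bsub>A\<^esub> else \<zero>\<^bsub>A\<^esub>)"
        using U C by simp
      show "(ge g \<otimes>\<^bsub>R\<^esub> N \<oplus>\<^bsub>R\<^esub> \<one>\<^bsub>R\<^esub>) U C = (N \<oplus>\<^bsub>R\<^esub> ge h) U C"
      proof (rule cong_red_eq[OF R_mem2[OF Rl U C] R_mem2[OF Rr U C]])
        fix k
        have "[red k ((ge g \<otimes>\<^bsub>R\<^esub> N \<oplus>\<^bsub>R\<^esub> \<one>\<^bsub>R\<^esub>) U C) = red k (N U C') + (if U #> \<one> = C then 1 else 0)] (mod md k)"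
          unfolding l using red_add_cong[OF R_mem2[OF NR U C'] one_in, of k] red_add_cong[OF R_mem2[OF NR U C'] zero_in, of k]
          by (simp add: red_one red_zero)
        moreover have "[red k ((N \<oplus>\<^bsub>R\<^esub> ge h) U C) = red k (N U C) + (if C = U #> h then 1 else 0)] (mod md k)"
          unfolding r using red_add_cong[OF R_mem2[OF NR U C] one_in, of k] red_add_cong[OF R_mem2[OF NR U C] zero_in, of k]
          by (cases "C = U #> h") (simp_all only: if_True if_False red_one red_zero simp_thms)
        moreover have "[red k (N U C') + (if U #> \<one> = C then 1 else 0) = red k (N U C) + (if C = U #> h then 1 else 0)] (mod md k)"
        proof -
          have "\<forall>\<^sub>F r in sequentially. [red k (N U C') + (if U #> \<one> = C then 1 else 0) = red k (N U C) + (if C = U #> h then 1 else 0)] (mod md k)"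
            using Nred[OF U C, of k] Nred[OF U C', of k] h_ev[OF U]
          proof eventually_elim
            case (elim r)
            have "[red k (N U C') + (if U #> \<one> = C then 1 else 0) = cnt g U C' (j r) + (if U #> \<one> = C then 1 else 0)] (mod md k)"
              using elim(2) by (intro cong_add cong_refl) (rule cong_sym)
            moreover have "[cnt g U C (j r) + (if U #> h = C then 1 else 0) = red k (N U C) + (if U #> h = C then 1 else 0)] (mod md k)"
              using elim(1) by (intro cong_add cong_refl)
            ultimately show ?case using tele[of "j r"] elim(3) by (simp add: cong_def eq_commute[of C])
          qed
          thus ?thesis by simp
        qed
        ultimately show "[red k ((ge g \<otimes>\<^bsub>R\<^esub> N \<oplus>\<^bsub>R\<^esub> \<one>\<^bsub>R\<^esub>) U C) = red k ((N \<oplus>\<^bsub>R\<^esub> ge h) U C)] (mod md k)"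
          by (meson cong_sym cong_trans)
      qed
    qed (use g h NR in auto)
    have c: "ge g \<in> carrier R" "ge h \<in> carrier R" "\<one>\<^bsub>R\<^esub> \<in> carrier R" using g h by auto
    have "mo g \<otimes>\<^bsub>R\<^esub> N = (ge g \<otimes>\<^bsub>R\<^esub> N \<oplus>\<^bsub>R\<^esub> \<one>\<^bsub>R\<^esub>) \<ominus>\<^bsub>R\<^esub> (N \<oplus>\<^bsub>R\<^esub> \<one>\<^bsub>R\<^esub>)"
    proof -
      have "mo g \<otimes>\<^bsub>R\<^esub> N = ge g \<otimes>\<^bsub>R\<^esub> N \<ominus>\<^bsub>R\<^esub> N"
        unfolding mo_def using c NR by (simp add: R.mult_diff_right)
      also have "\<dots> = (ge g \<otimes>\<^bsub>R\<^esub> N \<oplus>\<^bsub>R\<^esub> \<one>\<^bsub>R\<^esub>) \<ominus>\<^bsub>R\<^esub> (N \<oplus>\<^bsub>R\<^esub> \<one>\<^bsub>R\<^esub>)"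
        using c NR by (subst R.diff_add) (simp_all add: R.minus_eq R.r_neg)
      finally show ?thesis .
    qed
    also have "\<dots> = (N \<oplus>\<^bsub>R\<^esub> ge h) \<ominus>\<^bsub>R\<^esub> (N \<oplus>\<^bsub>R\<^esub> \<one>\<^bsub>R\<^esub>)" using \<open>_ = N \<oplus>\<^bsub>R\<^esub> ge h\<close> by simp
    also have "\<dots> = mo h" unfolding mo_def using c NR by (subst R.diff_add) (simp_all add: R.minus_eq R.r_neg)
    finally show ?thesis .
  qed
  \<comment> \<open>N and the scalar a have the same augmentation, so their difference lies in
    \<open>I\<close>; it becomes the error factor in the expression of h - 1 by a (g - 1).\<close>
  define t where "t = N \<ominus>\<^bsub>R\<^esub> sc a"
  have t: "t \<in> I" using NR a N_aug unfolding t_def I_iff a_minus_def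
    by (simp add: aug_add aug_neg aug_el A.r_neg)
  have Nt: "N = sc a \<oplus>\<^bsub>R\<^esub> t"
    using NR a el_closed[OF one_closed a] unfolding t_def a_minus_def by (simp add: R.r_neg1 R.a_lcomm R.r_neg)
  have "mo h = sc a \<otimes>\<^bsub>R\<^esub> mo g \<oplus>\<^bsub>R\<^esub> mo g \<otimes>\<^bsub>R\<^esub> t"
    using t a g unfolding Nmo[symmetric] Nt I_iff by (simp add: R.r_distr sc_comm)
  \<comment> \<open>One r large enough for both conditions. This is how homomorphisms to Z/p will be
    evaluated at h.\<close>
  moreover have "\<exists>i::nat. [int i = red 0 a] (mod int p) \<and> U #> h = U #> (g [^] i)" if U: "U \<in> ON" for U
  proof -
    have "\<forall>\<^sub>F r in sequentially. [int (j r) = red 0 a] (mod int p) \<and> U #> h = U #> (g [^] j r)"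
      using ja_ev[of 0] h_ev[OF U] by eventually_elim (simp add: e_0)
    from eventually_sequentially_ex[OF this] show ?thesis by (elim exE) (rule exI)
  qed
  ultimately show thesis by (rule that[OF h(1) t])
qed

end

section \<open>The graded module and its eigenspaces\<close>

context completed
begin

abbreviation L :: "nat \<Rightarrow> 'g set monoid" where "L \<equiv> Lie_layer A G T"
abbreviation M :: "('r, nat \<Rightarrow> 'g set) module" where "M \<equiv> Lie_module A G T"

definition cs :: "nat \<Rightarrow> 'g \<Rightarrow> 'g set" where "cs n g = F (Suc n) #> g"

lemma mem_cs: "g \<in> carrier G \<Longrightarrow> h \<in> cs n g \<longleftrightarrow> h \<in> carrier G \<and> cg (Suc n) (mo h) (mo g)"
proof -
  assume g: "g \<in> carrier G"
  have "h \<in> cs n g \<Longrightarrow> h \<in> carrier G"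
    unfolding cs_def using r_coset_subset_G[OF subgroup.subset[OF F_subgroup] g] by blast
  moreover have "h \<in> carrier G \<Longrightarrow> h \<in> cs n g \<longleftrightarrow> h \<otimes> inv g \<in> F (Suc n)"
    unfolding cs_def by (rule subgroup.rcos_module[OF F_subgroup group_axioms g])
  ultimately show ?thesis using F_mult_inv_iff[OF _ g] by blast
qed

lemma cs_eq_iff: "g \<in> carrier G \<Longrightarrow> h \<in> carrier G \<Longrightarrow> cs n g = cs n h \<longleftrightarrow> cg (Suc n) (mo g) (mo h)"
proof -
  assume g: "g \<in> carrier G" and h: "h \<in> carrier G"
  show ?thesis
  proof
    assume "cs n g = cs n h"
    moreover have "g \<in> cs n g" using g by (simp add: mem_cs cg_refl del: Al.simps)
    ultimately show "cg (Suc n) (mo g) (mo h)" using mem_cs[OF h] by blast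
  next
    assume "cg (Suc n) (mo g) (mo h)"
    hence "x \<in> cs n g \<longleftrightarrow> x \<in> cs n h" for x
      unfolding mem_cs[OF g] mem_cs[OF h] using cg_trans cg_sym by blast
    thus "cs n g = cs n h" by blast
  qed
qed

lemma cs_one: "cs n \<one> = F (Suc n)"
  unfolding cs_def by (rule coset_mult_one) (rule subgroup.subset[OF F_subgroup])

lemma cs_mult: "g \<in> carrier G \<Longrightarrow> h \<in> carrier G \<Longrightarrow> cs n g <#> cs n h = cs n (g \<otimes> h)"
  unfolding cs_def by (rule normal.rcos_sum[OF F_normal])

lemma L_carrier: "x \<in> carrier (L n) \<longleftrightarrow> (\<exists>g\<in>F n. x = cs n g)"
  unfolding Lie_layer_def carrier_FactGroup cs_def by auto

lemma L_mult [simp]: "x \<otimes>\<^bsub>L n\<^esub> y = x <#> y"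
  by (simp add: Lie_layer_def)

lemma L_one [simp]: "\<one>\<^bsub>L n\<^esub> = F (Suc n)"
  by (simp add: Lie_layer_def)

lemma F_mult: "g \<in> F n \<Longrightarrow> h \<in> F n \<Longrightarrow> g \<otimes> h \<in> F n"
  by (rule subgroup.m_closed[OF F_subgroup])

lemma F_unit: "\<one> \<in> F n"
  by (rule subgroup.one_closed[OF F_subgroup])

text \<open>In degree n \<ge> 1 the product (g-1)(h-1) lies in \<open>Aln (n + n)\<close>, hence in
  \<open>Aln (Suc n)\<close>, so multiplication in the layer becomes addition of the classes of g -
  1.\<close>

lemma mo_mult_cg:
  assumes g: "g \<in> F n" and h: "h \<in> F n" and n: "n \<ge> 1"
  shows "cg (Suc n) (mo (g \<otimes> h)) (mo g \<oplus>\<^bsub>R\<^esub> mo h)"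
proof -
  have c: "g \<in> carrier G" "h \<in> carrier G" using g h F_carrier by auto
  have "mo g \<otimes>\<^bsub>R\<^esub> mo h \<in> Aln (n + n)" using g h by (intro Al_mult) (auto simp: F_iff)
  hence "mo g \<otimes>\<^bsub>R\<^esub> mo h \<in> Aln (Suc n)" using n subsetD[OF Al_mono[of "Suc n" "n + n"]] by simp
  moreover have "mo (g \<otimes> h) \<ominus>\<^bsub>R\<^esub> (mo g \<oplus>\<^bsub>R\<^esub> mo h) = mo g \<otimes>\<^bsub>R\<^esub> mo h"
    using c by (simp add: mo_mult R.add_diff_cancel_left R.a_assoc)
  ultimately show ?thesis using c by (simp add: cg_def del: Al.simps)
qed

lemma cs_commute:
  assumes g: "g \<in> F n" and h: "h \<in> F n" and n: "n \<ge> 1"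
  shows "cs n (g \<otimes> h) = cs n (h \<otimes> g)"
proof -
  have c: "g \<in> carrier G" "h \<in> carrier G" using g h F_carrier by auto
  have "cg (Suc n) (mo (g \<otimes> h)) (mo (h \<otimes> g))"
    using cg_trans[OF mo_mult_cg[OF g h n] cg_sym[OF mo_mult_cg[OF h g n, unfolded R.a_comm[OF mo_closed[OF c(2)] mo_closed[OF c(1)]]]]] .
  thus ?thesis using c by (simp add: cs_eq_iff del: Al.simps)
qed

text \<open>The factor t in \<open>power_exists\<close> lies in \<open>I\<close>, so the error (g-1)
  t is one power deeper than g - 1. This makes the layers closed under the action of A.\<close>

lemma power_F:
  assumes g: "g \<in> F n" and a: "a \<in> carrier A"
  obtains h where "h \<in> F n" "cg (Suc n) (mo h) (sc a \<otimes>\<^bsub>R\<^esub> mo g)"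
proof -
  have gc: "g \<in> carrier G" using g F_carrier by blast
  obtain h t where h: "h \<in> carrier G" "t \<in> I" "mo h = sc a \<otimes>\<^bsub>R\<^esub> mo g \<oplus>\<^bsub>R\<^esub> mo g \<otimes>\<^bsub>R\<^esub> t"
    using power_exists[OF gc a] by metis
  have "mo g \<otimes>\<^bsub>R\<^esub> t \<in> Aln (Suc n)" using g h by (intro Al_mult_I) (auto simp: F_iff)
  moreover have tR: "t \<in> carrier R" using h by (simp add: I_iff)
  moreover have "mo h \<ominus>\<^bsub>R\<^esub> sc a \<otimes>\<^bsub>R\<^esub> mo g = mo g \<otimes>\<^bsub>R\<^esub> t"
  proof -
    have "mo h = mo g \<otimes>\<^bsub>R\<^esub> t \<oplus>\<^bsub>R\<^esub> sc a \<otimes>\<^bsub>R\<^esub> mo g"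
      unfolding h(3) using gc a tR by (intro R.a_comm) auto
    thus ?thesis using gc a tR by (simp add: R.add_diff_cancel_left)
  qed
  ultimately have cg: "cg (Suc n) (mo h) (sc a \<otimes>\<^bsub>R\<^esub> mo g)"
    using gc a h by (simp add: cg_def del: Al.simps)
  moreover have "mo h \<in> Aln n"
    using cg_Al[OF cg_mono[OF cg, of n]] g a by (simp add: F_iff Al_l)
  ultimately show thesis using that h(1) by (simp add: F_iff)
qed

text \<open>The set in \<open>layer_smult\<close> is one whole coset: multiplication by
  \<open>sc a\<close> respects congruence, so neither the choice of the representative g nor that of
  the solution h matters.\<close>

lemma layer_smult_cs:
  assumes g: "g \<in> F n" and h: "h \<in> F n" and a: "a \<in> carrier A"
    and gh: "cg (Suc n) (mo h) (sc a \<otimes>\<^bsub>R\<^esub> mo g)"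
  shows "layer_smult A G T n a (cs n g) = cs n h"
proof -
  have c: "g \<in> carrier G" "h \<in> carrier G" using g h F_carrier by auto
  have iff: "(minus_one A G T h' \<ominus>\<^bsub>R\<^esub> completed_smult A G T a (mo g') \<in> Aln (Suc n)) \<longleftrightarrow> cg (Suc n) (mo h') (sc a \<otimes>\<^bsub>R\<^esub> mo g')"
    if "h' \<in> carrier G" "g' \<in> carrier G" for h' g'
    using that a by (simp add: cg_def completed_smult_eq del: Al.simps)
  show ?thesis
  proof (intro equalityI subsetI)
    fix h' assume "h' \<in> layer_smult A G T n a (cs n g)"
    then obtain g' where g': "h' \<in> F n" "g' \<in> cs n g"
        "mo h' \<ominus>\<^bsub>R\<^esub> completed_smult A G T a (mo g') \<in> Aln (Suc n)"
      by (auto simp: layer_smult_def simp del: Al.simps)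
    have c': "g' \<in> carrier G" "cg (Suc n) (mo g') (mo g)" "h' \<in> carrier G"
      using g' mem_cs[OF c(1)] F_carrier by blast+
    have "cg (Suc n) (mo h') (sc a \<otimes>\<^bsub>R\<^esub> mo g')" using g'(3) iff c' by blast
    hence "cg (Suc n) (mo h') (mo h)" using cg_sc[OF a c'(2)] gh cg_trans cg_sym by blast
    thus "h' \<in> cs n h" using c' c by (simp add: mem_cs del: Al.simps)
  next
    fix h' assume "h' \<in> cs n h"
    hence h': "h' \<in> carrier G" "cg (Suc n) (mo h') (mo h)" using mem_cs[OF c(2)] by blast+
    have "h' \<in> F n" using cg_Al[OF cg_mono[OF h'(2), of n]] h h'(1) by (simp add: F_iff)
    moreover have "g \<in> cs n g" using c by (simp add: mem_cs cg_refl del: Al.simps)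
    moreover have "mo h' \<ominus>\<^bsub>R\<^esub> completed_smult A G T a (mo g) \<in> Aln (Suc n)"
      using iff[OF h'(1) c(1)] cg_trans[OF h'(2) gh] by blast
    ultimately show "h' \<in> layer_smult A G T n a (cs n g)"
      unfolding layer_smult_def by blast
  qed
qed

lemma layer_smult_one: "a \<in> carrier A \<Longrightarrow> layer_smult A G T n a (F (Suc n)) = F (Suc n)"
  using layer_smult_cs[OF F_unit F_unit, of a n] cs_one[of n] cg_refl[OF R.zero_closed]
  by (simp add: mo_one del: Al.simps)

lemma M_carrier: "x \<in> carrier M \<longleftrightarrow> x \<in> extensional {1..} \<and> (\<forall>n\<ge>1. \<exists>g\<in>F n. x n = cs n g) \<and>
    finite {n \<in> {1..}. x n \<noteq> F (Suc n)}"
  by (auto simp: Lie_module_def PiE_def Pi_def L_carrier)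

lemma M_ops:
  "(x \<oplus>\<^bsub>M\<^esub> y) = (\<lambda>n\<in>{1..}. x n <#> y n)" "\<zero>\<^bsub>M\<^esub> = (\<lambda>n\<in>{1..}. F (Suc n))"
  "a \<odot>\<^bsub>M\<^esub> x = (\<lambda>n\<in>{1..}. layer_smult A G T n a (x n))"
  by (simp_all add: Lie_module_def)

lemma M_cs:
  assumes "x \<in> carrier M" "n \<ge> 1" obtains g where "g \<in> F n" "x n = cs n g"
  using assms by (auto simp: M_carrier)

lemma M_add_closed: 
  assumes x: "x \<in> carrier M" and y: "y \<in> carrier M" shows "x \<oplus>\<^bsub>M\<^esub> y \<in> carrier M"
proof -
  have "\<exists>g\<in>F n. (x \<oplus>\<^bsub>M\<^esub> y) n = cs n g" if n: "n \<ge> 1" for n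
  proof -
    obtain g h where "g \<in> F n" "x n = cs n g" "h \<in> F n" "y n = cs n h" using M_cs[OF x n] M_cs[OF y n] by metis
    thus ?thesis using n by (intro bexI[of _ "g \<otimes> h"]) (auto simp: M_ops cs_mult F_carrier F_mult)
  qed
  moreover have "{n \<in> {1..}. (x \<oplus>\<^bsub>M\<^esub> y) n \<noteq> F (Suc n)} \<subseteq> {n \<in> {1..}. x n \<noteq> F (Suc n)} \<union> {n \<in> {1..}. y n \<noteq> F (Suc n)}"
    using cs_mult[OF one_closed one_closed] by (auto simp: M_ops cs_one)
  hence "finite {n \<in> {1..}. (x \<oplus>\<^bsub>M\<^esub> y) n \<noteq> F (Suc n)}"
    using x y unfolding M_carrier by (elim finite_subset) (intro finite_UnI, auto)
  moreover have "x \<oplus>\<^bsub>M\<^esub> y \<in> extensional {1..}" by (simp add: M_ops)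
  ultimately show ?thesis unfolding M_carrier by blast
qed

lemma M_smult_closed:
  assumes x: "x \<in> carrier M" and a: "a \<in> carrier A" shows "a \<odot>\<^bsub>M\<^esub> x \<in> carrier M"
proof -
  have "\<exists>g\<in>F n. (a \<odot>\<^bsub>M\<^esub> x) n = cs n g" if n: "n \<ge> 1" for n
  proof -
    obtain g where g: "g \<in> F n" "x n = cs n g" using M_cs[OF x n] by metis
    obtain h where h: "h \<in> F n" "cg (Suc n) (mo h) (sc a \<otimes>\<^bsub>R\<^esub> mo g)" by (rule power_F[OF g(1) a])
    thus ?thesis using n g layer_smult_cs[OF g(1) h(1) a h(2)] by (auto simp: M_ops)
  qed
  moreover have "{n \<in> {1..}. (a \<odot>\<^bsub>M\<^esub> x) n \<noteq> F (Suc n)} \<subseteq> {n \<in> {1..}. x n \<noteq> F (Suc n)}"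
    by (auto simp: M_ops layer_smult_one[OF a])
  hence "finite {n \<in> {1..}. (a \<odot>\<^bsub>M\<^esub> x) n \<noteq> F (Suc n)}"
    using x unfolding M_carrier by (elim finite_subset) auto
  moreover have "a \<odot>\<^bsub>M\<^esub> x \<in> extensional {1..}" by (simp add: M_ops)
  ultimately show ?thesis unfolding M_carrier by blast
qed

lemma M_zero_closed: "\<zero>\<^bsub>M\<^esub> \<in> carrier M"
  using F_unit cs_one by (auto simp: M_carrier M_ops)

lemma M_ext: 
  assumes "x \<in> carrier M" "y \<in> carrier M" "\<And>n. n \<ge> 1 \<Longrightarrow> x n = y n" shows "x = y"
  by (rule extensionalityI[of _ "{1..}"]) (use assms in \<open>auto simp: M_carrier\<close>)

lemma M_add_zero: "x \<in> carrier M \<Longrightarrow> \<zero>\<^bsub>M\<^esub> \<oplus>\<^bsub>M\<^esub> x = x"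
proof (rule M_ext)
  fix n :: nat assume x: "x \<in> carrier M" and n: "n \<ge> 1"
  obtain g where g: "g \<in> F n" "x n = cs n g" using M_cs[OF x n] by metis
  thus "(\<zero>\<^bsub>M\<^esub> \<oplus>\<^bsub>M\<^esub> x) n = x n"
    using n cs_mult[OF one_closed F_carrier[OF g(1)], of n] F_carrier[OF g(1)] by (simp add: M_ops cs_one)
qed (auto intro: M_add_closed M_zero_closed)

lemma M_add_comm: "x \<in> carrier M \<Longrightarrow> y \<in> carrier M \<Longrightarrow> x \<oplus>\<^bsub>M\<^esub> y = y \<oplus>\<^bsub>M\<^esub> x"
proof (rule M_ext)
  fix n :: nat assume x: "x \<in> carrier M" and y: "y \<in> carrier M" and n: "n \<ge> 1"
  obtain g h where "g \<in> F n" "x n = cs n g" "h \<in> F n" "y n = cs n h" using M_cs[OF x n] M_cs[OF y n] by metis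
  thus "(x \<oplus>\<^bsub>M\<^esub> y) n = (y \<oplus>\<^bsub>M\<^esub> x) n"
    using n cs_commute[of g n h] by (simp add: M_ops cs_mult F_carrier)
qed (auto intro: M_add_closed)

lemma M_add_assoc: "x \<in> carrier M \<Longrightarrow> y \<in> carrier M \<Longrightarrow> z \<in> carrier M \<Longrightarrow> x \<oplus>\<^bsub>M\<^esub> y \<oplus>\<^bsub>M\<^esub> z = x \<oplus>\<^bsub>M\<^esub> (y \<oplus>\<^bsub>M\<^esub> z)"
proof (rule M_ext)
  fix n :: nat assume x: "x \<in> carrier M" and y: "y \<in> carrier M" and z: "z \<in> carrier M" and n: "n \<ge> 1"
  obtain g h k where "g \<in> F n" "x n = cs n g" "h \<in> F n" "y n = cs n h" "k \<in> F n" "z n = cs n k"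
    using M_cs[OF x n] M_cs[OF y n] M_cs[OF z n] by metis
  thus "(x \<oplus>\<^bsub>M\<^esub> y \<oplus>\<^bsub>M\<^esub> z) n = (x \<oplus>\<^bsub>M\<^esub> (y \<oplus>\<^bsub>M\<^esub> z)) n"
    using n by (simp add: M_ops cs_mult F_carrier m_assoc)
qed (auto intro: M_add_closed)

text \<open>An automorphism together with its inverse. Both directions occur, because
  \<open>\<gamma>\<close> acts on group elements through \<open>act \<gamma>'\<close>.\<close>

definition aut_pair :: "('g \<Rightarrow> 'g) \<Rightarrow> ('g \<Rightarrow> 'g) \<Rightarrow> bool" where
  "aut_pair \<gamma> \<gamma>' \<longleftrightarrow> cont_aut \<gamma> \<and> cont_aut \<gamma>' \<and> (\<forall>g\<in>carrier G. \<gamma> (\<gamma>' g) = g \<and> \<gamma>' (\<gamma> g) = g)"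

lemma aut_pair_F_iff: "aut_pair \<gamma> \<gamma>' \<Longrightarrow> g \<in> carrier G \<Longrightarrow> \<gamma> g \<in> F n \<longleftrightarrow> g \<in> F n"
  using cont_aut_F[of \<gamma> g n] cont_aut_F[of \<gamma>' "\<gamma> g" n] cont_autD(5)[of \<gamma> g] unfolding aut_pair_def by auto

lemma aut_pair_image_F: 
  assumes "aut_pair \<gamma> \<gamma>'" shows "\<gamma> ` F n = F n"
proof -
  have g: "cont_aut \<gamma>" using assms by (simp add: aut_pair_def)
  show ?thesis
  proof (intro equalityI subsetI)
    fix h assume h: "h \<in> F n"
    then obtain k where "k \<in> carrier G" "h = \<gamma> k" using cont_autD(3)[OF g] F_carrier by blast
    thus "h \<in> \<gamma> ` F n" using aut_pair_F_iff[OF assms] h by blast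
  qed (use aut_pair_F_iff[OF assms] F_carrier in blast)
qed

lemma aut_pair_image_cs: "aut_pair \<gamma> \<gamma>' \<Longrightarrow> g \<in> carrier G \<Longrightarrow> \<gamma> ` cs n g = cs n (\<gamma> g)"
  unfolding cs_def using cont_aut_coset[of \<gamma> "F (Suc n)" g] aut_pair_image_F[of \<gamma> \<gamma>' "Suc n"]
  by (simp add: aut_pair_def subgroup.subset[OF F_subgroup])

lemma aut_pair_mo: "aut_pair \<gamma> \<gamma>' \<Longrightarrow> g \<in> carrier G \<Longrightarrow> mo (\<gamma> g) = act \<gamma>' (mo g)"
  using act_mo[of \<gamma>' "\<gamma> g"] cont_autD(5)[of \<gamma> g] by (simp add: aut_pair_def)

end

section \<open>Eigenspaces of the graded module\<close>

locale eigen_setting = completed A p e red G T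
  for A :: "'r ring" and p e red and G :: "'g monoid" (structure) and T +
  fixes D :: "('g \<Rightarrow> 'g) monoid" and chi :: "('g \<Rightarrow> 'g) \<Rightarrow> 'r"
  assumes inverses: "\<delta> \<in> carrier D \<Longrightarrow> \<exists>\<delta>'. aut_pair \<delta> \<delta>'"
    and chi: "\<delta> \<in> carrier D \<Longrightarrow> chi \<delta> \<in> carrier A"
begin

abbreviation E :: "('r, nat \<Rightarrow> 'g set) module" where "E \<equiv> eigenspace M D Lie_action chi"

definition eig :: "nat \<Rightarrow> 'g \<Rightarrow> bool" where
  "eig n g \<longleftrightarrow> g \<in> F n \<and> (\<forall>\<delta>\<in>carrier D. cg (Suc n) (mo (\<delta> g)) (sc (chi \<delta>) \<otimes>\<^bsub>R\<^esub> mo g))"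

lemma E_ops: "a \<odot>\<^bsub>E\<^esub> x = a \<odot>\<^bsub>M\<^esub> x" "x \<oplus>\<^bsub>E\<^esub> y = x \<oplus>\<^bsub>M\<^esub> y" "\<zero>\<^bsub>E\<^esub> = \<zero>\<^bsub>M\<^esub>"
  by (simp_all add: eigenspace_def)

lemma smult_eq_iff:
  assumes d: "\<delta> \<in> carrier D" and g: "g \<in> F n"
  shows "\<delta> ` cs n g = layer_smult A G T n (chi \<delta>) (cs n g) \<longleftrightarrow> cg (Suc n) (mo (\<delta> g)) (sc (chi \<delta>) \<otimes>\<^bsub>R\<^esub> mo g)"
proof -
  obtain \<delta>' where p: "aut_pair \<delta> \<delta>'" using inverses[OF d] by blast
  have gc: "g \<in> carrier G" using g F_carrier by blast
  have dg: "\<delta> g \<in> carrier G" using p gc cont_autD(5) by (auto simp: aut_pair_def)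
  obtain h where h: "h \<in> F n" "cg (Suc n) (mo h) (sc (chi \<delta>) \<otimes>\<^bsub>R\<^esub> mo g)" by (rule power_F[OF g chi[OF d]])
  have hc: "h \<in> carrier G" using h F_carrier by blast
  show ?thesis
    unfolding aut_pair_image_cs[OF p gc] layer_smult_cs[OF g h(1) chi[OF d] h(2)] cs_eq_iff[OF dg hc]
    using h(2) cg_trans cg_sym by blast
qed

text \<open>The eigenvalue equation splits into degrees, and in degree n it is the congruence
  \<open>eig\<close> for any representative of the component.\<close>

lemma E_carrier: "x \<in> carrier E \<longleftrightarrow> x \<in> carrier M \<and> (\<forall>n\<ge>1. \<forall>g\<in>F n. x n = cs n g \<longrightarrow> eig n g)"
proof -
  have "(\<forall>\<delta>\<in>carrier D. Lie_action \<delta> x = chi \<delta> \<odot>\<^bsub>M\<^esub> x) \<longleftrightarrow>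
     (\<forall>n\<ge>1. \<forall>g\<in>F n. x n = cs n g \<longrightarrow> eig n g)" if x: "x \<in> carrier M"
  proof
    assume *: "\<forall>\<delta>\<in>carrier D. Lie_action \<delta> x = chi \<delta> \<odot>\<^bsub>M\<^esub> x"
    show "\<forall>n\<ge>1. \<forall>g\<in>F n. x n = cs n g \<longrightarrow> eig n g"
    proof (intro allI impI ballI)
      fix n :: nat and g assume n: "n \<ge> 1" and g: "g \<in> F n" "x n = cs n g"
      have "\<delta> ` cs n g = layer_smult A G T n (chi \<delta>) (cs n g)" if "\<delta> \<in> carrier D" for \<delta>
        using fun_cong[OF bspec[OF * that], of n] n g by (simp add: Lie_action_def M_ops)
      thus "eig n g" using smult_eq_iff g by (simp add: eig_def del: Al.simps)
    qed
  next
    assume *: "\<forall>n\<ge>1. \<forall>g\<in>F n. x n = cs n g \<longrightarrow> eig n g"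
    show "\<forall>\<delta>\<in>carrier D. Lie_action \<delta> x = chi \<delta> \<odot>\<^bsub>M\<^esub> x"
    proof
      fix \<delta> assume d: "\<delta> \<in> carrier D"
      show "Lie_action \<delta> x = chi \<delta> \<odot>\<^bsub>M\<^esub> x"
      proof
        fix n show "Lie_action \<delta> x n = (chi \<delta> \<odot>\<^bsub>M\<^esub> x) n"
        proof (cases "n \<ge> 1")
          case True
          obtain g where g: "g \<in> F n" "x n = cs n g" using M_cs[OF x True] by metis
          hence "eig n g" using * True by blast
          thus ?thesis using smult_eq_iff[OF d g(1)] True g(2) d by (simp add: Lie_action_def M_ops eig_def del: Al.simps)
        qed (simp add: Lie_action_def M_ops)
      qed
    qed
  qed
  thus ?thesis by (auto simp: eigenspace_def)
qed

lemma eig_cong: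
  assumes g: "eig n g" and h: "h \<in> carrier G" and c: "cg (Suc n) (mo h) (mo g)"
  shows "eig n h"
proof -
  have gc: "g \<in> carrier G" using g F_carrier by (auto simp: eig_def)
  have "h \<in> F n" using cg_Al[OF cg_mono[OF c, of n]] g h by (simp add: F_iff eig_def)
  moreover have "cg (Suc n) (mo (\<delta> h)) (sc (chi \<delta>) \<otimes>\<^bsub>R\<^esub> mo h)" if d: "\<delta> \<in> carrier D" for \<delta>
  proof -
    obtain \<delta>' where p: "aut_pair \<delta> \<delta>'" using inverses[OF d] by blast
    have "cg (Suc n) (mo (\<delta> h)) (mo (\<delta> g))"
      using act_cg[OF _ c, of \<delta>'] p gc h by (simp add: aut_pair_mo[OF p] aut_pair_def del: Al.simps)
    moreover have "cg (Suc n) (mo (\<delta> g)) (sc (chi \<delta>) \<otimes>\<^bsub>R\<^esub> mo g)" using g d by (simp add: eig_def del: Al.simps)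
    moreover have "cg (Suc n) (sc (chi \<delta>) \<otimes>\<^bsub>R\<^esub> mo g) (sc (chi \<delta>) \<otimes>\<^bsub>R\<^esub> mo h)"
      by (rule cg_sc[OF chi[OF d] cg_sym[OF c]])
    ultimately show ?thesis using cg_trans by blast
  qed
  ultimately show ?thesis by (simp add: eig_def del: Al.simps)
qed

lemma E_carrierI:
  assumes "x \<in> carrier M" "\<And>n. n \<ge> 1 \<Longrightarrow> \<exists>g. eig n g \<and> x n = cs n g"
  shows "x \<in> carrier E"
  unfolding E_carrier
proof (intro conjI allI impI ballI)
  fix n :: nat and h assume n: "n \<ge> 1" and h: "h \<in> F n" "x n = cs n h"
  obtain g where g: "eig n g" "x n = cs n g" using assms(2)[OF n] by blast
  have c: "g \<in> carrier G" "h \<in> carrier G" using g h F_carrier by (auto simp: eig_def)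
  hence "cg (Suc n) (mo h) (mo g)" using cs_eq_iff[OF c(2,1), of n] h(2) g(2) by simp
  thus "eig n h" by (rule eig_cong[OF g(1) c(2)])
qed (rule assms(1))

lemma E_eig:
  assumes "x \<in> carrier E" "n \<ge> 1" obtains g where "eig n g" "x n = cs n g" "g \<in> F n"
  using assms M_cs[of x n] unfolding E_carrier by metis

lemma eig_one: "n \<ge> 1 \<Longrightarrow> eig n \<one>"
proof -
  have "cg (Suc n) (mo (\<delta> \<one>)) (sc (chi \<delta>) \<otimes>\<^bsub>R\<^esub> mo \<one>)" if d: "\<delta> \<in> carrier D" for \<delta>
  proof -
    have "cont_aut \<delta>" using inverses[OF d] by (auto simp: aut_pair_def)
    thus ?thesis using chi[OF d] by (simp add: cont_autD(8) mo_one cg_refl del: Al.simps)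
  qed
  thus ?thesis using F_unit by (simp add: eig_def del: Al.simps)
qed

lemma eig_mult:
  assumes g: "eig n g" and h: "eig n h" and n: "n \<ge> 1"
  shows "eig n (g \<otimes> h)"
proof -
  have f: "g \<in> F n" "h \<in> F n" using g h by (auto simp: eig_def)
  have c: "g \<in> carrier G" "h \<in> carrier G" using f F_carrier by auto
  have "cg (Suc n) (mo (\<delta> (g \<otimes> h))) (sc (chi \<delta>) \<otimes>\<^bsub>R\<^esub> mo (g \<otimes> h))" if d: "\<delta> \<in> carrier D" for \<delta>
  proof -
    obtain \<delta>' where p: "aut_pair \<delta> \<delta>'" using inverses[OF d] by blast
    have dc: "cont_aut \<delta>" using p by (simp add: aut_pair_def)
    have df: "\<delta> g \<in> F n" "\<delta> h \<in> F n" using aut_pair_F_iff[OF p] c f by auto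
    have "cg (Suc n) (mo (\<delta> (g \<otimes> h))) (mo (\<delta> g) \<oplus>\<^bsub>R\<^esub> mo (\<delta> h))"
      using mo_mult_cg[OF df n] cont_autD(6)[OF dc c] by simp
    moreover have "cg (Suc n) (mo (\<delta> g) \<oplus>\<^bsub>R\<^esub> mo (\<delta> h)) (sc (chi \<delta>) \<otimes>\<^bsub>R\<^esub> mo g \<oplus>\<^bsub>R\<^esub> sc (chi \<delta>) \<otimes>\<^bsub>R\<^esub> mo h)"
      using g h d by (intro cg_add) (auto simp: eig_def simp del: Al.simps)
    moreover have "sc (chi \<delta>) \<otimes>\<^bsub>R\<^esub> mo g \<oplus>\<^bsub>R\<^esub> sc (chi \<delta>) \<otimes>\<^bsub>R\<^esub> mo h = sc (chi \<delta>) \<otimes>\<^bsub>R\<^esub> (mo g \<oplus>\<^bsub>R\<^esub> mo h)"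
      using c chi[OF d] by (simp add: R.r_distr)
    moreover have "cg (Suc n) (sc (chi \<delta>) \<otimes>\<^bsub>R\<^esub> (mo g \<oplus>\<^bsub>R\<^esub> mo h)) (sc (chi \<delta>) \<otimes>\<^bsub>R\<^esub> mo (g \<otimes> h))"
      by (rule cg_sc[OF chi[OF d] cg_sym[OF mo_mult_cg[OF f n]]])
    ultimately show ?thesis using cg_trans by metis
  qed
  thus ?thesis using F_mult[OF f] by (simp add: eig_def del: Al.simps)
qed

lemma eig_power:
  assumes g: "eig n g" and a: "a \<in> carrier A" and h: "h \<in> F n" and c: "cg (Suc n) (mo h) (sc a \<otimes>\<^bsub>R\<^esub> mo g)"
  shows "eig n h"
proof -
  have gc: "g \<in> carrier G" "h \<in> carrier G" using g h F_carrier by (auto simp: eig_def)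
  have "cg (Suc n) (mo (\<delta> h)) (sc (chi \<delta>) \<otimes>\<^bsub>R\<^esub> mo h)" if d: "\<delta> \<in> carrier D" for \<delta>
  proof -
    obtain \<delta>' where p: "aut_pair \<delta> \<delta>'" using inverses[OF d] by blast
    have dc: "cont_aut \<delta>'" using p by (simp add: aut_pair_def)
    have "cg (Suc n) (mo (\<delta> h)) (act \<delta>' (sc a \<otimes>\<^bsub>R\<^esub> mo g))"
      using act_cg[OF dc c] by (simp add: aut_pair_mo[OF p gc(2)] del: Al.simps)
    moreover have "act \<delta>' (sc a \<otimes>\<^bsub>R\<^esub> mo g) = sc a \<otimes>\<^bsub>R\<^esub> mo (\<delta> g)"
      using gc a by (simp add: act_sc[OF dc] aut_pair_mo[OF p])
    moreover have "cg (Suc n) (sc a \<otimes>\<^bsub>R\<^esub> mo (\<delta> g)) (sc a \<otimes>\<^bsub>R\<^esub> (sc (chi \<delta>) \<otimes>\<^bsub>R\<^esub> mo g))"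
      using g d by (intro cg_sc a) (simp add: eig_def del: Al.simps)
    moreover have "sc a \<otimes>\<^bsub>R\<^esub> (sc (chi \<delta>) \<otimes>\<^bsub>R\<^esub> mo g) = sc (chi \<delta>) \<otimes>\<^bsub>R\<^esub> (sc a \<otimes>\<^bsub>R\<^esub> mo g)"
    proof -
      note c = el_closed[OF one_closed a] el_closed[OF one_closed chi[OF d]] mo_closed[OF gc(1)]
      have "sc a \<otimes>\<^bsub>R\<^esub> (sc (chi \<delta>) \<otimes>\<^bsub>R\<^esub> mo g) = (sc a \<otimes>\<^bsub>R\<^esub> sc (chi \<delta>)) \<otimes>\<^bsub>R\<^esub> mo g"
        by (rule R.m_assoc[OF c, symmetric])
      also have "\<dots> = (sc (chi \<delta>) \<otimes>\<^bsub>R\<^esub> sc a) \<otimes>\<^bsub>R\<^esub> mo g" using sc_comm[OF a c(2)] by simp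
      also have "\<dots> = sc (chi \<delta>) \<otimes>\<^bsub>R\<^esub> (sc a \<otimes>\<^bsub>R\<^esub> mo g)" by (rule R.m_assoc[OF c(2,1,3)])
      finally show ?thesis .
    qed
    moreover have "cg (Suc n) (sc (chi \<delta>) \<otimes>\<^bsub>R\<^esub> (sc a \<otimes>\<^bsub>R\<^esub> mo g)) (sc (chi \<delta>) \<otimes>\<^bsub>R\<^esub> mo h)"
      by (rule cg_sc[OF chi[OF d] cg_sym[OF c]])
    ultimately show ?thesis using cg_trans by metis
  qed
  thus ?thesis using h by (simp add: eig_def del: Al.simps)
qed

lemma E_sub: "x \<in> carrier E \<Longrightarrow> x \<in> carrier M"
  by (simp add: E_carrier)

lemma E_smult_closed: "x \<in> carrier E \<Longrightarrow> a \<in> carrier A \<Longrightarrow> a \<odot>\<^bsub>E\<^esub> x \<in> carrier E"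
proof (rule E_carrierI)
  fix n :: nat assume x: "x \<in> carrier E" and a: "a \<in> carrier A" and n: "n \<ge> 1"
  obtain g where g: "eig n g" "x n = cs n g" "g \<in> F n" using E_eig[OF x n] .
  obtain h where h: "h \<in> F n" "cg (Suc n) (mo h) (sc a \<otimes>\<^bsub>R\<^esub> mo g)" by (rule power_F[OF g(3) a])
  show "\<exists>g. eig n g \<and> (a \<odot>\<^bsub>E\<^esub> x) n = cs n g"
    using eig_power[OF g(1) a h] layer_smult_cs[OF g(3) h(1) a h(2)] n g(2) by (auto simp: E_ops M_ops)
qed (auto simp: E_ops intro: M_smult_closed E_sub)

text \<open>Finite sums in the eigenspace are \<open>finsum\<close> over its own carrier, so sums of
  eigenvectors must be known to stay in it.\<close>

lemma abelian_monoid_E: "abelian_monoid E"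
proof (rule abelian_monoidI)
  show "\<zero>\<^bsub>E\<^esub> \<in> carrier E"
    using eig_one cs_one M_zero_closed by (intro E_carrierI) (auto simp: E_ops M_ops(2))
  fix x y assume x: "x \<in> carrier E" and y: "y \<in> carrier E"
  show "x \<oplus>\<^bsub>E\<^esub> y \<in> carrier E"
  proof (rule E_carrierI)
    fix n :: nat assume n: "n \<ge> 1"
    obtain g where g: "eig n g" "x n = cs n g" "g \<in> F n" using E_eig[OF x n] .
    obtain h where h: "eig n h" "y n = cs n h" "h \<in> F n" using E_eig[OF y n] .
    show "\<exists>g. eig n g \<and> (x \<oplus>\<^bsub>E\<^esub> y) n = cs n g"
      using eig_mult[OF g(1) h(1) n] n g h by (auto simp: E_ops M_ops cs_mult F_carrier)
  qed (use x y in \<open>auto simp: E_ops intro: M_add_closed E_sub\<close>)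
qed (auto simp: E_ops M_add_zero M_add_comm M_add_assoc E_sub)

text \<open>One homogeneous vector is taken in each of infinitely many degrees. A linear relation
  splits into its homogeneous components, so it suffices that no single vector is annihilated by a
  nonzero scalar.\<close>

theorem infinite_rank_eigenspace:
  assumes J: "infinite J" and J1: "\<And>n. n \<in> J \<Longrightarrow> n \<ge> 1" and g: "\<And>n. n \<in> J \<Longrightarrow> eig n (g n)"
    and free: "\<And>n a. n \<in> J \<Longrightarrow> a \<in> carrier A \<Longrightarrow> sc a \<otimes>\<^bsub>R\<^esub> mo (g n) \<in> Aln (Suc n) \<Longrightarrow> a = \<zero>\<^bsub>A\<^esub>"
  shows "infinite_rank A E"
proof -
  interpret E: abelian_monoid E by (rule abelian_monoid_E)
  \<comment> \<open>\<open>v n\<close> has the class of \<open>g n\<close> in degree n and zero in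
    all other positive degrees; it is \<open>undefined\<close> in degree 0, as the elements of the
    module are extensional on the positive degrees.\<close>
  define v where "v = (\<lambda>n m. if m \<ge> 1 then (if m = n then cs n (g n) else F (Suc m)) else undefined)"
  have gF: "g n \<in> F n" "g n \<in> carrier G" if "n \<in> J" for n using g[OF that] F_carrier by (auto simp: eig_def)
  have ne: "cs n (g n) \<noteq> F (Suc n)" if n: "n \<in> J" for n
  proof
    assume "cs n (g n) = F (Suc n)"
    hence "cg (Suc n) (mo (g n)) (mo \<one>)"
      using cs_eq_iff[OF gF(2)[OF n] one_closed] by (simp add: cs_one)
    hence "mo (g n) \<in> Aln (Suc n)" using cg_Al Al_zero mo_one by metis
    hence "sc \<one>\<^bsub>A\<^esub> \<otimes>\<^bsub>R\<^esub> mo (g n) \<in> Aln (Suc n)" using gF[OF n] by (simp add: el_one del: Al.simps)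
    hence "\<one>\<^bsub>A\<^esub> = \<zero>\<^bsub>A\<^esub>" using free[OF n one_in] by simp
    hence "red 0 \<one>\<^bsub>A\<^esub> = red 0 \<zero>\<^bsub>A\<^esub>" by simp
    thus False by (simp add: red_one red_zero)
  qed
  have vE: "v n \<in> carrier E" if n: "n \<in> J" for n
  proof (rule E_carrierI)
    have "{m \<in> {1..}. v n m \<noteq> F (Suc m)} \<subseteq> {n}" by (auto simp: v_def)
    hence "finite {m \<in> {1..}. v n m \<noteq> F (Suc m)}" by (rule finite_subset) simp
    moreover have "\<exists>h\<in>F m. v n m = cs m h" if "m \<ge> 1" for m
      using that gF[OF n] F_unit cs_one by (auto simp: v_def)
    ultimately show "v n \<in> carrier M" by (auto simp: M_carrier extensional_def v_def)
    show "\<exists>h. eig m h \<and> v n m = cs m h" if "m \<ge> 1" for m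
      using that g[OF n] eig_one[OF that] cs_one[of m] by (auto simp: v_def)
  qed
  have inj: "inj_on v J"
  proof (rule inj_onI)
    fix m n assume m: "m \<in> J" and n: "n \<in> J" and eq: "v m = v n"
    show "m = n"
    proof (rule ccontr)
      assume "m \<noteq> n"
      hence "v m m \<noteq> v n m" using ne[OF m] J1[OF m] by (simp add: v_def)
      thus False using eq by simp
    qed
  qed
  \<comment> \<open>The degree m component of a linear combination receives only the term with index
    m, and that only if m belongs to K.\<close>
  have sum: "finsum E (\<lambda>x. c x \<odot>\<^bsub>E\<^esub> x) (v ` K) m = (if m \<in> K then layer_smult A G T m (c (v m)) (cs m (g m)) else F (Suc m))"
    if K: "finite K" "K \<subseteq> J" and c: "c \<in> v ` K \<rightarrow> carrier A" and m: "m \<ge> 1" for K c m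
    using K c
  proof (induction K)
    case empty
    show ?case using m by (simp add: E_ops M_ops)
  next
    case (insert n K)
    have n: "n \<in> J" and KJ: "K \<subseteq> J" using insert by auto
    have cn: "c (v n) \<in> carrier A" and cK: "c \<in> v ` K \<rightarrow> carrier A" using insert.prems by auto
    have nK: "v n \<notin> v ` K" using insert.hyps(2) inj n KJ by (auto simp: inj_on_def)
    have f1: "c (v n) \<odot>\<^bsub>E\<^esub> v n \<in> carrier E" by (rule E_smult_closed[OF vE[OF n] cn])
    have f2: "(\<lambda>x. c x \<odot>\<^bsub>E\<^esub> x) \<in> v ` K \<rightarrow> carrier E"
      using cK KJ by (auto intro!: E_smult_closed vE)
    have "finsum E (\<lambda>x. c x \<odot>\<^bsub>E\<^esub> x) (v ` insert n K) = (c (v n) \<odot>\<^bsub>E\<^esub> v n) \<oplus>\<^bsub>E\<^esub> finsum E (\<lambda>x. c x \<odot>\<^bsub>E\<^esub> x) (v ` K)"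
      using E.finsum_insert[OF finite_imageI[OF insert.hyps(1)] nK f2] f1 by simp
    moreover have "((c (v n) \<odot>\<^bsub>E\<^esub> v n) \<oplus>\<^bsub>E\<^esub> z) m = layer_smult A G T m (c (v n)) (v n m) <#> z m" for z
      using m by (simp add: E_ops M_ops)
    ultimately have key: "finsum E (\<lambda>x. c x \<odot>\<^bsub>E\<^esub> x) (v ` insert n K) m =
        layer_smult A G T m (c (v n)) (v n m) <#> (if m \<in> K then layer_smult A G T m (c (v m)) (cs m (g m)) else F (Suc m))"
      by (simp only: insert.IH[OF KJ cK])
    have ls: "\<exists>h\<in>carrier G. layer_smult A G T m a (cs m (g m)) = cs m h" if mJ: "m \<in> J" and aA: "a \<in> carrier A" for a
    proof -
      obtain h where "h \<in> F m" "cg (Suc m) (mo h) (sc a \<otimes>\<^bsub>R\<^esub> mo (g m))" by (rule power_F[OF gF(1)[OF mJ] aA])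
      thus ?thesis using layer_smult_cs[OF gF(1)[OF mJ] _ aA] F_carrier by blast
    qed
    have one: "cs m h <#> F (Suc m) = cs m h" "F (Suc m) <#> cs m h = cs m h" if "h \<in> carrier G" for h
      using cs_mult[OF that one_closed, of m] cs_mult[OF one_closed that, of m] that by (simp_all add: cs_one)
    have oo: "F (Suc m) <#> F (Suc m) = F (Suc m)" using one(1)[OF one_closed] by (simp add: cs_one)
    show ?case
    proof (cases "m = n")
      case True
      obtain h where h: "h \<in> carrier G" "layer_smult A G T m (c (v n)) (cs m (g m)) = cs m h"
        using ls[of "c (v n)"] n cn True by blast
      have "v n m = cs m (g m)" using True m by (simp add: v_def)
      thus ?thesis using key h(2) True insert.hyps(2) one(1)[OF h(1)] by simp
    next
      case False
      hence "v n m = F (Suc m)" using m by (simp add: v_def)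
      hence "layer_smult A G T m (c (v n)) (v n m) = F (Suc m)" using layer_smult_one[OF cn] by simp
      moreover have "F (Suc m) <#> (if m \<in> K then layer_smult A G T m (c (v m)) (cs m (g m)) else F (Suc m)) =
          (if m \<in> K then layer_smult A G T m (c (v m)) (cs m (g m)) else F (Suc m))"
      proof (cases "m \<in> K")
        case True
        then obtain h where "h \<in> carrier G" "layer_smult A G T m (c (v m)) (cs m (g m)) = cs m h"
          using ls[of "c (v m)"] KJ cK by blast
        thus ?thesis using True one(2) by simp
      qed (use oo in simp)
      ultimately show ?thesis using key False by simp
    qed
  qed
  have "linearly_independent A E (v ` J)"
    unfolding linearly_independent_def
  proof (intro conjI allI impI ballI)
    show "v ` J \<subseteq> carrier E" using vE by blast
    fix S c x
    assume *: "finite S \<and> S \<subseteq> v ` J \<and> c \<in> S \<rightarrow> carrier A \<and> (\<Oplus>\<^bsub>E\<^esub>x\<in>S. c x \<odot>\<^bsub>E\<^esub> x) = \<zero>\<^bsub>E\<^esub>" and x: "x \<in> S"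
    obtain K where K: "finite K" "K \<subseteq> J" "S = v ` K" using * by (meson finite_subset_image)
    obtain n where n: "n \<in> K" "x = v n" using x K by blast
    have nJ: "n \<in> J" using n K by blast
    have c: "c \<in> v ` K \<rightarrow> carrier A" and cx: "c x \<in> carrier A" using * K x by auto
    have "layer_smult A G T n (c x) (cs n (g n)) = F (Suc n)"
      using sum[OF K(1,2) c J1[OF nJ]] * K(3) n J1[OF nJ] by (simp add: E_ops M_ops)
    moreover obtain h where h: "h \<in> F n" "cg (Suc n) (mo h) (sc (c x) \<otimes>\<^bsub>R\<^esub> mo (g n))"
      by (rule power_F[OF gF(1)[OF nJ] cx])
    ultimately have "cs n h = cs n \<one>"
      using layer_smult_cs[OF gF(1)[OF nJ] h(1) cx h(2)] by (simp add: cs_one)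
    hence "cg (Suc n) (mo h) (mo \<one>)" using cs_eq_iff[OF F_carrier[OF h(1)] one_closed] by blast
    hence "mo h \<in> Aln (Suc n)" using cg_Al Al_zero mo_one by metis
    hence "sc (c x) \<otimes>\<^bsub>R\<^esub> mo (g n) \<in> Aln (Suc n)" using cg_Al[OF h(2)] by blast
    thus "c x = \<zero>\<^bsub>A\<^esub>" by (rule free[OF nJ cx])
  qed
  moreover have "infinite (v ` J)" using J inj finite_imageD by blast
  ultimately show ?thesis unfolding infinite_rank_def by blast
qed

end

section \<open>Homomorphisms to finite p-groups\<close>

text \<open>The universal property speaks of targets on the type
  \<open>nat \<Rightarrow> nat\<close>. A finite group is carried there by an injection into the
  naturals followed by constant functions, and it is pro-p in the discrete topology.\<close>

lemma finite_group_embedding: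
  assumes H: "group (H :: 'h monoid)" and k: "order H = p ^ k" and p: "prime p"
  obtains K :: "(nat \<Rightarrow> nat) monoid" and \<iota>
  where "\<iota> \<in> iso H K" "pro_p_group p K (discrete_topology (carrier K))"
proof -
  interpret H: group H by fact
  have fin: "finite (carrier H)" using k prime_gt_0_nat[OF p] H.order_gt_0_iff_finite by simp
  then obtain f :: "'h \<Rightarrow> nat" where f: "inj_on f (carrier H)"
    using finite_imp_inj_to_nat_seg by meson
  define \<iota> where "\<iota> = (\<lambda>x (_::nat). f x)"
  have inj: "inj_on \<iota> (carrier H)" using f by (auto simp: \<iota>_def inj_on_def fun_eq_iff)
  define K where "K = image_group \<iota> H"
  have iso: "\<iota> \<in> iso H K" unfolding K_def by (rule inj_imp_image_group_iso[OF inj])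
  have K: "group K" unfolding K_def by (rule H.inj_imp_image_group_is_group[OF inj])
  interpret K: group K by (rule K)
  have ordK: "order K = p ^ k" using iso_same_order[OF iso] k by simp
  have finK: "finite (carrier K)" using ordK prime_gt_0_nat[OF p] K.order_gt_0_iff_finite by simp
  have "top_group K (discrete_topology (carrier K))"
    unfolding top_group_def using K
    by (auto simp flip: prod_topology_discrete_topology)
  moreover have "totally_disconnected (discrete_topology (carrier K))"
    unfolding totally_disconnected_def connectedin_discrete_topology by blast
  moreover have "\<exists>k. order (K Mod U) = p ^ k" if "U \<in> open_normal K (discrete_topology (carrier K))" for U
  proof -
    have "subgroup U K" using that by (simp add: open_normal_def normal_imp_subgroup)
    hence "card (rcosets\<^bsub>K\<^esub> U) * card U = p ^ k" using K.lagrange ordK by simp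
    hence "card (rcosets\<^bsub>K\<^esub> U) dvd p ^ k" by (metis dvd_triv_left)
    thus ?thesis using p by (auto simp: order_def FactGroup_def divides_primepow_nat)
  qed
  ultimately have "pro_p_group p K (discrete_topology (carrier K))"
    unfolding pro_p_group_def profinite_group_def
    using finK by (auto simp: compact_space_discrete_topology Hausdorff_space_discrete_topology)
  with iso show thesis by (rule that)
qed

section \<open>Maps from a free pro-p group to finite p-groups of any type\<close>

locale free_pro_p = pro_p +
  fixes X assumes free: "free_pro_p_on p G T X"
begin

lemma X_sub: "X \<subseteq> carrier G"
  using free by (auto simp: free_pro_p_on_def)

lemma X_converges: "U \<in> ON \<Longrightarrow> finite {x \<in> X. x \<notin> U}"
  using free by (auto simp: free_pro_p_on_def converges_to_one_def)

text \<open>Continuity into a discrete target is expressed from here on by an open normal subgroup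
  that is mapped to 1: the map is then constant on the cosets of U, which are open.\<close>

lemma hom_continuous:
  assumes "group K" "f \<in> hom G K" "U \<in> ON" "\<And>u. u \<in> U \<Longrightarrow> f u = \<one>\<^bsub>K\<^esub>"
  shows "continuous_map T (discrete_topology (carrier K)) f"
  unfolding continuous_map
proof (intro conjI allI impI)
  interpret f: group_hom G K f by (intro group_hom.intro group_hom_axioms.intro group_axioms assms)
  show "f ` topspace T \<subseteq> topspace (discrete_topology (carrier K))" by (auto simp: topspace)
  fix S assume "openin (discrete_topology (carrier K)) S"
  show "openin T {x \<in> topspace T. f x \<in> S}"
  proof (subst openin_subopen, intro ballI)
    fix x assume x: "x \<in> {x \<in> topspace T. f x \<in> S}"
    hence xG: "x \<in> carrier G" by (simp add: topspace)
    have "f y = f x" if y: "y \<in> U #> x" for y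
    proof -
      obtain u where "u \<in> U" "y = u \<otimes> x" using y by (auto simp: r_coset_def)
      thus ?thesis using assms(4) ON_sub[OF assms(3)] xG by (auto simp: subset_iff)
    qed
    hence "U #> x \<subseteq> {x \<in> topspace T. f x \<in> S}"
      using x r_coset_subset_G[OF ON_sub[OF assms(3)] xG] by (auto simp: topspace)
    thus "\<exists>V. openin T V \<and> x \<in> V \<and> V \<subseteq> {x \<in> topspace T. f x \<in> S}"
      using coset_open[OF assms(3) xG] rcos_self[OF xG ON_D(3)[OF assms(3)]] by blast
  qed
qed

text \<open>The finiteness hypothesis is convergence to 1 in a discrete target, and U is the kernel
  of the lift, open by continuity.\<close>

lemma free_lift:
  fixes H :: "'h monoid"
  assumes H: "group H" "order H = p ^ k" and \<mu>: "\<mu> \<in> X \<rightarrow> carrier H" "finite {x \<in> X. \<mu> x \<noteq> \<one>\<^bsub>H\<^esub>}"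
  obtains f U where "f \<in> hom G H" "U \<in> ON" "\<And>u. u \<in> U \<Longrightarrow> f u = \<one>\<^bsub>H\<^esub>" "\<And>x. x \<in> X \<Longrightarrow> f x = \<mu> x"
proof -
  obtain K :: "(nat \<Rightarrow> nat) monoid" and \<iota> where \<iota>: "\<iota> \<in> iso H K"
    and K: "pro_p_group p K (discrete_topology (carrier K))"
    by (rule finite_group_embedding[OF H p_prime])
  have gK: "group K" using K by (auto simp: pro_p_group_def profinite_group_def top_group_def)
  have hom\<iota>: "\<iota> \<in> hom H K" and bij: "bij_betw \<iota> (carrier H) (carrier K)" using \<iota> by (auto simp: iso_def)
  interpret \<iota>: group_hom H K \<iota> by (intro group_hom.intro group_hom_axioms.intro H(1) gK hom\<iota>)
  have "\<iota> (\<mu> x) = \<one>\<^bsub>K\<^esub>" if "\<mu> x = \<one>\<^bsub>H\<^esub>" for x using that by simp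
  hence "{x \<in> X. \<iota> (\<mu> x) \<notin> U} \<subseteq> {x \<in> X. \<mu> x \<noteq> \<one>\<^bsub>H\<^esub>}" if "U \<in> open_normal K (discrete_topology (carrier K))" for U
    using that subgroup.one_closed[OF normal_imp_subgroup, of U K] by (auto simp: open_normal_def)
  hence conv: "converges_to_one X (\<lambda>x. \<iota> (\<mu> x)) K (discrete_topology (carrier K))"
    unfolding converges_to_one_def using \<mu>(2) finite_subset by blast
  have cl: "(\<lambda>x. \<iota> (\<mu> x)) \<in> X \<rightarrow> carrier K" using \<mu>(1) by (auto simp: Pi_iff)
  from free K cl conv have "\<exists>f \<in> cont_hom G T K (discrete_topology (carrier K)). (\<forall>x \<in> X. f x = \<iota> (\<mu> x))"
    unfolding free_pro_p_on_def by blast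
  then obtain f where f: "f \<in> hom G K" "continuous_map T (discrete_topology (carrier K)) f" "\<And>x. x \<in> X \<Longrightarrow> f x = \<iota> (\<mu> x)"
    by (auto simp: cont_hom_def)
  interpret f: group_hom G K f by (intro group_hom.intro group_hom_axioms.intro group_axioms gK f)
  have ker: "kernel G K f \<in> ON"
  proof -
    have "kernel G K f = {x \<in> topspace T. f x \<in> {\<one>\<^bsub>K\<^esub>}}" by (auto simp: kernel_def topspace)
    moreover have "openin T \<dots>" by (rule openin_continuous_map_preimage[OF f(2)]) auto
    ultimately show ?thesis using f.normal_kernel by (simp add: open_normal_def)
  qed
  define g where "g = (\<lambda>x. inv_into (carrier H) \<iota> (f x))"
  have inv\<iota>: "inv_into (carrier H) \<iota> \<in> hom K H"
    using group.iso_set_sym[OF H(1) \<iota>] by (simp add: iso_def)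
  show thesis
  proof (rule that[of g "kernel G K f"])
    show "g \<in> hom G H" unfolding g_def
      using Group.hom_compose[OF f(1) inv\<iota>] by (simp add: o_def)
    show "g x = \<mu> x" if "x \<in> X" for x
      using that f(3) \<mu>(1) bij by (auto simp: g_def bij_betw_def Pi_iff)
    show "g u = \<one>\<^bsub>H\<^esub>" if "u \<in> kernel G K f" for u
      using that hom_one[OF inv\<iota> gK H(1)] by (simp add: g_def kernel_def)
  qed (rule ker)
qed

text \<open>Both maps extend their common restriction to X, and the uniqueness clause compares each
  with the one extension \<open>h0\<close>. This restriction converges to 1 because X converges in G
  and the generators in U are sent to 1.\<close>

lemma free_unique:
  fixes H :: "'h monoid"
  assumes H: "group H" "order H = p ^ k"
    and f: "f \<in> hom G H" "\<And>u. u \<in> U \<Longrightarrow> f u = \<one>\<^bsub>H\<^esub>" and f': "f' \<in> hom G H" "\<And>u. u \<in> U \<Longrightarrow> f' u = \<one>\<^bsub>H\<^esub>"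
    and U: "U \<in> ON" and eq: "\<And>x. x \<in> X \<Longrightarrow> f x = f' x" and g: "g \<in> carrier G"
  shows "f g = f' g"
proof -
  obtain K :: "(nat \<Rightarrow> nat) monoid" and \<iota> where \<iota>: "\<iota> \<in> iso H K"
    and K: "pro_p_group p K (discrete_topology (carrier K))"
    by (rule finite_group_embedding[OF H p_prime])
  have gK: "group K" using K by (auto simp: pro_p_group_def profinite_group_def top_group_def)
  have hom\<iota>: "\<iota> \<in> hom H K" and inj: "inj_on \<iota> (carrier H)" using \<iota> by (auto simp: iso_def bij_betw_def)
  have one\<iota>: "\<iota> \<one>\<^bsub>H\<^esub> = \<one>\<^bsub>K\<^esub>" by (rule hom_one[OF hom\<iota> H(1) gK])
  let ?f = "\<lambda>x. \<iota> (f x)" and ?f' = "\<lambda>x. \<iota> (f' x)"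
  have h: "?f \<in> hom G K" "?f' \<in> hom G K"
    using Group.hom_compose[OF f(1) hom\<iota>] Group.hom_compose[OF f'(1) hom\<iota>] by (simp_all add: o_def)
  have c: "?f \<in> cont_hom G T K (discrete_topology (carrier K))" "?f' \<in> cont_hom G T K (discrete_topology (carrier K))"
    using h hom_continuous[OF gK h(1) U] hom_continuous[OF gK h(2) U] f(2) f'(2) one\<iota> by (auto simp: cont_hom_def)
  have cl: "?f \<in> X \<rightarrow> carrier K" using h(1) X_sub by (auto simp: hom_def)
  have "{x \<in> X. ?f x \<notin> V} \<subseteq> {x \<in> X. x \<notin> U}" if "V \<in> open_normal K (discrete_topology (carrier K))" for V
    using that subgroup.one_closed[OF normal_imp_subgroup, of V K] f(2) one\<iota> by (auto simp: open_normal_def)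
  hence conv: "converges_to_one X ?f K (discrete_topology (carrier K))"
    unfolding converges_to_one_def using X_converges[OF U] finite_subset by blast
  from free K cl conv have "\<exists>h0\<in>cont_hom G T K (discrete_topology (carrier K)). (\<forall>x \<in> X. h0 x = ?f x) \<and>
      (\<forall>h \<in> cont_hom G T K (discrete_topology (carrier K)). (\<forall>x \<in> X. h x = ?f x) \<longrightarrow> (\<forall>g\<in>carrier G. h g = h0 g))"
    unfolding free_pro_p_on_def by blast
  then obtain h0 where h0: "\<forall>h \<in> cont_hom G T K (discrete_topology (carrier K)). (\<forall>x \<in> X. h x = ?f x) \<longrightarrow> (\<forall>g\<in>carrier G. h g = h0 g)"
    by (elim bexE conjE)
  have e1: "\<iota> (f g) = h0 g" using bspec[OF h0 c(1)] g by simp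
  have e2: "\<iota> (f' g) = h0 g" using bspec[OF h0 c(2)] g eq by simp
  have "\<iota> (f g) = \<iota> (f' g)" using e1 e2 by simp
  moreover have "f g \<in> carrier H" "f' g \<in> carrier H" using f(1) f'(1) g by (auto simp: hom_def)
  ultimately show ?thesis using inj by (auto simp: inj_on_def)
qed

end

section \<open>Unitriangular matrices\<close>

text \<open>Entries are canonical residues and vanish below the diagonal and outside the n by n
  block, so two matrices are equal exactly when the functions are equal.\<close>

definition unitriangular :: "nat \<Rightarrow> int \<Rightarrow> (nat \<Rightarrow> nat \<Rightarrow> int) monoid" where
  "unitriangular n m = \<lparr>carrier = {a. \<forall>i j. a i j mod m = a i j \<and> (i < n \<longrightarrow> a i i = 1) \<and> (\<not> (i \<le> j \<and> j < n) \<longrightarrow> a i j = 0)},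
     monoid.mult = (\<lambda>a b i j. (\<Sum>l<n. a i l * b l j) mod m),
     one = (\<lambda>i j. if i = j \<and> i < n then 1 else 0)\<rparr>"

context
  fixes n :: nat and m :: int assumes m: "m > 1"
begin

lemma ut_mem: 
  assumes "a \<in> carrier (unitriangular n m)"
  shows "a i j mod m = a i j" "i < n \<Longrightarrow> a i i = 1" "\<not> (i \<le> j \<and> j < n) \<Longrightarrow> a i j = 0"
  using assms by (auto simp: unitriangular_def)

lemma ut_mult: "(a \<otimes>\<^bsub>unitriangular n m\<^esub> b) i j = (\<Sum>l<n. a i l * b l j) mod m"
  by (simp add: unitriangular_def)

lemma ut_one: "\<one>\<^bsub>unitriangular n m\<^esub> i j = (if i = j \<and> i < n then 1 else 0)"
  by (simp add: unitriangular_def)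

lemma ut_one_closed: "\<one>\<^bsub>unitriangular n m\<^esub> \<in> carrier (unitriangular n m)"
  using m by (auto simp: unitriangular_def)

lemma ut_mult_closed:
  assumes a: "a \<in> carrier (unitriangular n m)" and b: "b \<in> carrier (unitriangular n m)"
  shows "a \<otimes>\<^bsub>unitriangular n m\<^esub> b \<in> carrier (unitriangular n m)"
proof -
  note A = ut_mem[OF a] and B = ut_mem[OF b]
  have "(\<Sum>l<n. a i l * b l i) = 1" if i: "i < n" for i
  proof -
    have "(\<Sum>l<n. a i l * b l i) = (\<Sum>l<n. if l = i then 1 else 0)"
    proof (rule sum.cong)
      fix l show "a i l * b l i = (if l = i then 1 else 0)"
        using A(2)[OF i] B(2)[OF i] A(3)[of i l] B(3)[of l i] by (cases l i rule: linorder_cases) auto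
    qed simp
    thus ?thesis using i by simp
  qed
  moreover have "(\<Sum>l<n. a i l * b l j) = 0" if ij: "\<not> (i \<le> j \<and> j < n)" for i j
  proof (rule sum.neutral, intro ballI)
    fix l show "a i l * b l j = 0"
      using ij A(3)[of i l] B(3)[of l j] by (cases "i \<le> l \<and> l < n") auto
  qed
  ultimately show ?thesis using m by (auto simp: unitriangular_def)
qed

lemma ut_ext:
  assumes "\<And>i j. i < n \<Longrightarrow> j < n \<Longrightarrow> a i j = b i j" "a \<in> carrier (unitriangular n m)" "b \<in> carrier (unitriangular n m)"
  shows "a = b"
proof (intro ext)
  fix i j show "a i j = b i j"
    using assms(1)[of i j] ut_mem(3)[OF assms(2), of i j] ut_mem(3)[OF assms(3), of i j]
    by (cases "i \<le> j \<and> j < n") auto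
qed

text \<open>A matrix is a free choice of the entries above the diagonal, so the order is a power of
  m. For m a power of p the group is therefore a finite p-group.\<close>

lemma ut_finite_order: "finite (carrier (unitriangular n m))" 
  "\<exists>k. order (unitriangular n m) = nat m ^ k"
proof -
  define S where "S = {(i, j). i < j \<and> j < n}"
  have finS: "finite S" unfolding S_def by (rule finite_subset[of _ "{..<n} \<times> {..<n}"]) auto
  define P where "P = (\<Pi>\<^sub>E s\<in>S. {0..<m})"
  define f where "f = (\<lambda>a :: nat \<Rightarrow> nat \<Rightarrow> int. \<lambda>s\<in>S. a (fst s) (snd s))"
  define g where "g = (\<lambda>b i j. if i = j \<and> i < n then 1 else if (i, j) \<in> S then b (i, j) else (0::int))"
  have "bij_betw f (carrier (unitriangular n m)) P"
  proof (rule bij_betw_byWitness[where f' = g])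
    show "\<forall>a\<in>carrier (unitriangular n m). g (f a) = a"
    proof (intro ballI ext)
      fix a i j assume a: "a \<in> carrier (unitriangular n m)"
      show "g (f a) i j = a i j"
        using ut_mem(2,3)[OF a] by (cases "i < j") (auto simp: g_def f_def S_def)
    qed
    show "\<forall>b\<in>P. f (g b) = b"
    proof
      fix b assume b: "b \<in> P"
      show "f (g b) = b"
      proof
        fix s show "f (g b) s = b s"
          using b PiE_arb[of b S _ s] unfolding P_def f_def g_def S_def by (cases s) auto
      qed
    qed
    show "f ` carrier (unitriangular n m) \<subseteq> P"
    proof
      fix b assume "b \<in> f ` carrier (unitriangular n m)"
      then obtain a where a: "a \<in> carrier (unitriangular n m)" "b = f a" by blast
      have "0 \<le> a i j" "a i j < m" for i j
        using ut_mem(1)[OF a(1), of i j] m pos_mod_sign[of m "a i j"] pos_mod_bound[of m "a i j"] by auto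
      thus "b \<in> P" unfolding a(2) P_def f_def by auto
    qed
    show "g ` P \<subseteq> carrier (unitriangular n m)"
    proof
      fix a assume "a \<in> g ` P"
      then obtain b where b: "b \<in> P" "a = g b" by blast
      have "b s mod m = b s" if "s \<in> S" for s
        using PiE_mem[OF b(1)[unfolded P_def] that] by simp
      thus "a \<in> carrier (unitriangular n m)"
        unfolding b(2) unitriangular_def g_def S_def using m by auto
    qed
  qed
  moreover have "finite P" "card P = nat m ^ card S"
    unfolding P_def using finS by (auto intro: finite_PiE simp: card_PiE)
  ultimately show "finite (carrier (unitriangular n m))" "\<exists>k. order (unitriangular n m) = nat m ^ k"
    using bij_betw_finite[of f] bij_betw_same_card[of f] by (auto simp: order_def)
qed

text \<open>The columns are compared from left to right: since x has 1 on its diagonal, column j of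
  the product determines column j of the left factor once the earlier columns are known.\<close>

lemma ut_right_cancel:
  assumes a: "a \<in> carrier (unitriangular n m)" and b: "b \<in> carrier (unitriangular n m)" and x: "x \<in> carrier (unitriangular n m)"
    and eq: "a \<otimes>\<^bsub>unitriangular n m\<^esub> x = b \<otimes>\<^bsub>unitriangular n m\<^esub> x"
  shows "a = b"
proof (rule ut_ext[OF _ a b])
  fix i j assume "i < n" "j < n"
  show "a i j = b i j" using \<open>j < n\<close>
  proof (induction j rule: less_induct)
    case (less j)
    have s: "(\<Sum>l<n. c i l * x l j) = (\<Sum>l<j. c i l * x l j) + c i j" for c :: "nat \<Rightarrow> nat \<Rightarrow> int"
    proof -
      have "(\<Sum>l<n. c i l * x l j) = (\<Sum>l<Suc j. c i l * x l j)"
        using less.prems ut_mem(3)[OF x] by (intro sum.mono_neutral_right) auto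
      thus ?thesis using ut_mem(2)[OF x less.prems] by simp
    qed
    have "(\<Sum>l<n. a i l * x l j) mod m = (\<Sum>l<n. b i l * x l j) mod m"
      using fun_cong[OF fun_cong[OF eq, of i], of j] by (simp only: ut_mult)
    moreover have "(\<Sum>l<j. a i l * x l j) = (\<Sum>l<j. b i l * x l j)"
      using less by (intro sum.cong) auto
    ultimately have "[(\<Sum>l<j. b i l * x l j) + a i j = (\<Sum>l<j. b i l * x l j) + b i j] (mod m)"
      unfolding s by (simp add: cong_def)
    hence "[a i j = b i j] (mod m)" by (simp only: cong_add_lcancel)
    thus ?case using ut_mem(1)[OF a, of i j] ut_mem(1)[OF b, of i j] by (simp add: cong_def)
  qed
qed

lemma ut_group: "group (unitriangular n m)"
proof (rule groupI)
  let ?U = "unitriangular n m"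
  fix a b c assume a: "a \<in> carrier ?U" and b: "b \<in> carrier ?U" and c: "c \<in> carrier ?U"
  show "a \<otimes>\<^bsub>?U\<^esub> b \<otimes>\<^bsub>?U\<^esub> c = a \<otimes>\<^bsub>?U\<^esub> (b \<otimes>\<^bsub>?U\<^esub> c)"
  proof (intro ext)
    fix i j
    have "(a \<otimes>\<^bsub>?U\<^esub> b \<otimes>\<^bsub>?U\<^esub> c) i j = (\<Sum>l<n. (\<Sum>k<n. a i k * b k l) * c l j) mod m"
      unfolding ut_mult by (subst mod_sum_eq[symmetric], subst mod_mult_left_eq, subst mod_sum_eq) (rule refl)
    also have "(\<Sum>l<n. (\<Sum>k<n. a i k * b k l) * c l j) = (\<Sum>k<n. a i k * (\<Sum>l<n. b k l * c l j))"
      by (simp add: sum_distrib_left sum_distrib_right mult.assoc) (rule sum.swap)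
    also have "\<dots> mod m = (a \<otimes>\<^bsub>?U\<^esub> (b \<otimes>\<^bsub>?U\<^esub> c)) i j"
      unfolding ut_mult by (subst (2) mod_sum_eq[symmetric], subst mod_mult_right_eq, subst mod_sum_eq) (rule refl)
    finally show "(a \<otimes>\<^bsub>?U\<^esub> b \<otimes>\<^bsub>?U\<^esub> c) i j = (a \<otimes>\<^bsub>?U\<^esub> (b \<otimes>\<^bsub>?U\<^esub> c)) i j" .
  qed
next
  let ?U = "unitriangular n m"
  fix a assume a: "a \<in> carrier ?U"
  show "\<one>\<^bsub>?U\<^esub> \<otimes>\<^bsub>?U\<^esub> a = a"
  proof (rule ut_ext[OF _ ut_mult_closed[OF ut_one_closed a] a])
    fix i j assume ij: "i < n" "j < n"
    have "(\<Sum>l<n. \<one>\<^bsub>?U\<^esub> i l * a l j) = (\<Sum>l<n. if l = i then a i j else 0)"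
      by (intro sum.cong) (auto simp: ut_one)
    thus "(\<one>\<^bsub>?U\<^esub> \<otimes>\<^bsub>?U\<^esub> a) i j = a i j" using ij ut_mem(1)[OF a] by (simp add: ut_mult)
  qed
  \<comment> \<open>Inverses are not computed: right multiplication by a is injective on a finite
    set, hence reaches the identity.\<close>
  have "inj_on (\<lambda>y. y \<otimes>\<^bsub>?U\<^esub> a) (carrier ?U)" using ut_right_cancel[OF _ _ a] by (auto intro!: inj_onI)
  hence "(\<lambda>y. y \<otimes>\<^bsub>?U\<^esub> a) ` carrier ?U = carrier ?U"
    using ut_finite_order(1) ut_mult_closed[OF _ a] by (intro endo_inj_surj) auto
  thus "\<exists>y\<in>carrier ?U. y \<otimes>\<^bsub>?U\<^esub> a = \<one>\<^bsub>?U\<^esub>" using ut_one_closed by (metis (no_types, lifting) image_iff)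
qed (auto intro: ut_mult_closed ut_one_closed)

end

section \<open>Unitriangular representations of the completed group algebra\<close>

context completed
begin

text \<open>The (i, j) entry of the linear extension of \<open>\<rho>\<close> to the completed
  algebra, computed in G/U with coefficients reduced modulo \<open>md k\<close>. The choice of a
  representative is harmless by \<open>rep_coset\<close>. The integer sum is not reduced, so
  identities for it are congruences.\<close>

definition rep_fun :: "nat \<Rightarrow> 'g set \<Rightarrow> ('g \<Rightarrow> nat \<Rightarrow> nat \<Rightarrow> int) \<Rightarrow> nat \<Rightarrow> nat \<Rightarrow> ('g, 'r) completed \<Rightarrow> int" where
  "rep_fun k U \<rho> i j f = (\<Sum>C\<in>quot U. red k (f U C) * \<rho> (SOME g. g \<in> C) i j)"

context
  fixes k n :: nat and U :: "'g set" and \<rho> :: "'g \<Rightarrow> nat \<Rightarrow> nat \<Rightarrow> int"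
  assumes U: "U \<in> ON" and \<rho>: "\<rho> \<in> hom G (unitriangular n (md k))"
    and \<rho>U: "\<And>u. u \<in> U \<Longrightarrow> \<rho> u = \<one>\<^bsub>unitriangular n (md k)\<^esub>"
begin

abbreviation \<Phi> where "\<Phi> \<equiv> rep_fun k U \<rho>"

lemma rep_closed: "g \<in> carrier G \<Longrightarrow> \<rho> g \<in> carrier (unitriangular n (md k))"
  using \<rho> by (auto simp: hom_def)

lemma rep_coset: 
  assumes g: "g \<in> carrier G" shows "\<rho> (SOME h. h \<in> U #> g) = \<rho> g"
proof -
  have "g \<in> U #> g" using rcos_self[OF g ON_D(3)[OF U]] .
  hence "(SOME h. h \<in> U #> g) \<in> U #> g" by (rule someI)
  then obtain u where u: "u \<in> U" "(SOME h. h \<in> U #> g) = u \<otimes> g" by (auto simp: r_coset_def)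
  interpret H: group "unitriangular n (md k)" by (rule ut_group[OF md_gt_1])
  show ?thesis using u \<rho> \<rho>U[OF u(1)] g ON_sub[OF U] rep_closed[OF g] by (auto simp: hom_mult[OF \<rho>] subset_iff)
qed

lemma rep_fun_el: 
  assumes g: "g \<in> carrier G"
  shows "\<Phi> i j (el g a) = red k a * \<rho> g i j"
proof -
  have "\<Phi> i j (el g a) = (\<Sum>C\<in>quot U. if C = U #> g then red k a * \<rho> g i j else 0)"
    unfolding rep_fun_def using U g by (intro sum.cong) (auto simp: red_zero rep_coset)
  thus ?thesis using finite_quotient[OF U] g by simp
qed

lemma rep_fun_add:
  assumes f: "f \<in> carrier R" and g: "g \<in> carrier R"
  shows "[\<Phi> i j (f \<oplus>\<^bsub>R\<^esub> g) = \<Phi> i j f + \<Phi> i j g] (mod md k)"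
proof -
  have "[\<Phi> i j (f \<oplus>\<^bsub>R\<^esub> g) = (\<Sum>C\<in>quot U. (red k (f U C) + red k (g U C)) * \<rho> (SOME g. g \<in> C) i j)] (mod md k)"
    unfolding rep_fun_def
    by (intro cong_sum cong_mult cong_refl) (use red_add_cong R_mem2[OF f U] R_mem2[OF g U] U in auto)
  thus ?thesis by (simp add: rep_fun_def distrib_right sum.distrib)
qed

lemma rep_fun_mult:
  assumes f: "f \<in> carrier R" and g: "g \<in> carrier R"
  shows "[\<Phi> i j (f \<otimes>\<^bsub>R\<^esub> g) = (\<Sum>l<n. \<Phi> i l f * \<Phi> l j g)] (mod md k)"
proof -
  interpret Q: group "G Mod U" by (rule ON_D(4)[OF U])
  define r where "r = (\<lambda>C. \<rho> (SOME g. g \<in> C))"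
  have rm: "[r (C \<otimes>\<^bsub>G Mod U\<^esub> D) i j = (\<Sum>l<n. r C i l * r D l j)] (mod md k)"
    if CD: "C \<in> quot U" "D \<in> quot U" for C D
  proof -
    obtain c where c: "c \<in> carrier G" "C = U #> c" by (rule quot_cases[OF CD(1)])
    obtain d where "d \<in> carrier G" "D = U #> d" by (rule quot_cases[OF CD(2)])
    note cd = c this
    hence "r (C \<otimes>\<^bsub>G Mod U\<^esub> D) = \<rho> c \<otimes>\<^bsub>unitriangular n (md k)\<^esub> \<rho> d"
      using coset_mult[OF U cd(1,3)] by (simp add: r_def rep_coset hom_mult[OF \<rho>])
    thus ?thesis using cd by (simp add: ut_mult[OF md_gt_1] r_def rep_coset)
  qed
  let ?f = "\<lambda>C. red k (f U C)" and ?g = "\<lambda>C. red k (g U C)"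
  have "[\<Phi> i j (f \<otimes>\<^bsub>R\<^esub> g) = (\<Sum>C\<in>quot U. (\<Sum>D\<in>quot U. ?f D * ?g (inv\<^bsub>G Mod U\<^esub> D \<otimes>\<^bsub>G Mod U\<^esub> C)) * r C i j)] (mod md k)"
    unfolding rep_fun_def r_def R_ops(2)[OF U]
    by (intro cong_sum cong_mult cong_refl red_group_algebra_mult Q.is_group finite_quotient R_mem f g U)
  also have "(\<Sum>C\<in>quot U. (\<Sum>D\<in>quot U. ?f D * ?g (inv\<^bsub>G Mod U\<^esub> D \<otimes>\<^bsub>G Mod U\<^esub> C)) * r C i j) =
      (\<Sum>D\<in>quot U. \<Sum>C\<in>quot U. ?f D * ?g (inv\<^bsub>G Mod U\<^esub> D \<otimes>\<^bsub>G Mod U\<^esub> C) * r C i j)"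
    by (simp add: sum_distrib_right) (rule sum.swap)
  \<comment> \<open>Substituting D C for C separates the convolution, so that the matrix product of
    \<open>r\<close> can be inserted.\<close>
  also have "\<dots> = (\<Sum>D\<in>quot U. \<Sum>C\<in>quot U. ?f D * ?g C * r (D \<otimes>\<^bsub>G Mod U\<^esub> C) i j)"
  proof (rule sum.cong[OF refl])
    fix D assume D: "D \<in> quot U"
    show "(\<Sum>C\<in>quot U. ?f D * ?g (inv\<^bsub>G Mod U\<^esub> D \<otimes>\<^bsub>G Mod U\<^esub> C) * r C i j) = (\<Sum>C\<in>quot U. ?f D * ?g C * r (D \<otimes>\<^bsub>G Mod U\<^esub> C) i j)"
      by (rule sum.reindex_bij_witness[where i = "\<lambda>C. D \<otimes>\<^bsub>G Mod U\<^esub> C" and j = "\<lambda>C. inv\<^bsub>G Mod U\<^esub> D \<otimes>\<^bsub>G Mod U\<^esub> C"])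
         (use D in \<open>auto simp: Q.m_assoc[symmetric]  simp del: mult_FactGroup one_FactGroup\<close>)
  qed
  also have "[(\<Sum>D\<in>quot U. \<Sum>C\<in>quot U. ?f D * ?g C * r (D \<otimes>\<^bsub>G Mod U\<^esub> C) i j) =
     (\<Sum>D\<in>quot U. \<Sum>C\<in>quot U. ?f D * ?g C * (\<Sum>l<n. r D i l * r C l j))] (mod md k)"
    by (intro cong_sum cong_mult cong_refl rm)
  also have "(\<Sum>D\<in>quot U. \<Sum>C\<in>quot U. ?f D * ?g C * (\<Sum>l<n. r D i l * r C l j)) =
     (\<Sum>D\<in>quot U. \<Sum>l<n. \<Sum>C\<in>quot U. (?f D * r D i l) * (?g C * r C l j))"
    by (subst sum.swap) (simp add: sum_distrib_left mult_ac)
  also have "\<dots> = (\<Sum>l<n. \<Sum>D\<in>quot U. \<Sum>C\<in>quot U. (?f D * r D i l) * (?g C * r C l j))"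
    by (rule sum.swap)
  also have "\<dots> = (\<Sum>l<n. \<Phi> i l f * \<Phi> l j g)"
    by (simp add: rep_fun_def r_def sum_product)
  finally show ?thesis .
qed

lemma rep_fun_below:
  assumes "j < i" "i < n" shows "\<Phi> i j f = 0"
proof -
  have "\<rho> (SOME g. g \<in> C) i j = 0" if C: "C \<in> quot U" for C
  proof -
    obtain g where "g \<in> carrier G" "C = U #> g" using C quot_cases by blast
    thus ?thesis using ut_mem(3)[OF md_gt_1 rep_closed, of g i j] assms by (simp add: rep_coset)
  qed
  thus ?thesis by (simp add: rep_fun_def)
qed

text \<open>The diagonal of \<open>\<rho>\<close> is 1, so a diagonal entry of the extension is the
  sum of all coefficients, that is, the augmentation.\<close>

lemma rep_fun_diagonal:
  assumes g: "g \<in> I" and l: "l < n"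
  shows "[\<Phi> l l g = 0] (mod md k)"
proof -
  have c: "g \<in> carrier R" using g by (simp add: I_iff)
  have "\<rho> (SOME g. g \<in> C) l l = 1" if C: "C \<in> quot U" for C
  proof -
    obtain g where "g \<in> carrier G" "C = U #> g" using C quot_cases by blast
    thus ?thesis using ut_mem(2)[OF md_gt_1 rep_closed, of g l] l by (simp add: rep_coset)
  qed
  hence "\<Phi> l l g = (\<Sum>C\<in>quot U. red k (g U C))" by (simp add: rep_fun_def)
  also have "quot U = {D \<in> quot U. D \<subseteq> carrier G}"
    using r_coset_subset_G[OF ON_sub[OF U]] by (auto elim!: quot_cases)
  also have "[(\<Sum>C\<in>\<dots>. red k (g U C)) = red k (group_algebra_proj A G U (carrier G) (g U) (carrier G))] (mod md k)"
    by (rule cong_sym, rule red_proj[OF U R_mem[OF c U]]) (simp add: quot_carrier)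
  also have "red k (group_algebra_proj A G U (carrier G) (g U) (carrier G)) = red k (augmentation G g)"
    using R_proj[OF c U carrier_ON ON_sub[OF U]] by (simp add: augmentation_def)
  also have "\<dots> = 0" using g by (simp add: I_iff red_zero)
  finally show ?thesis .
qed

text \<open>\<open>I\<close> is sent to strictly upper triangular matrices, and products of m of
  them start at the m-th superdiagonal. A nonzero entry before it refutes membership in the m-th
  power of \<open>I\<close>.\<close>

lemma rep_fun_Al:
  assumes "f \<in> Aln m" "j < i + m" "i < n"
  shows "[\<Phi> i j f = 0] (mod md k)"
  using assms
proof (induction m arbitrary: f i j)
  case 0
  thus ?case by (simp add: rep_fun_below)
next
  case (Suc m)
  from Suc.prems(1) have "f \<in> Aln m \<cdot>\<^bsub>R\<^esub> I" by simp
  thus ?case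
  proof (induction f rule: ideal_prod.induct)
    case (prod f g)
    have c: "f \<in> carrier R" "g \<in> carrier R" using prod Al_carrier I_iff by auto
    have low: "[\<Phi> l j g = 0] (mod md k)" if "l < n" "j \<le> l" for l
      using that rep_fun_diagonal[OF prod(2)] rep_fun_below[of j l] by (cases "j = l") auto
    have "[(\<Sum>l<n. \<Phi> i l f * \<Phi> l j g) = (\<Sum>l<n. 0)] (mod md k)"
    proof (rule cong_sum)
      fix l assume "l \<in> {..<n}"
      hence l: "l < n" by simp
      show "[\<Phi> i l f * \<Phi> l j g = 0] (mod md k)"
      proof (cases "l < i + m")
        case True
        from cong_mult[OF Suc.IH[OF prod(1) this Suc.prems(3)] cong_refl] show ?thesis by simp
      next
        case False
        hence "j \<le> l" using Suc.prems by simp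
        from cong_mult[OF cong_refl low[OF l this]] show ?thesis by simp
      qed
    qed
    thus ?case using rep_fun_mult[OF c, of i j] cong_trans by fastforce
  next
    case (sum s1 s2)
    have "s1 \<in> carrier R" "s2 \<in> carrier R"
      using sum(1,2) R.ideal_prod_in_carrier[OF ideal_Al ideal_I] by auto
    thus ?case using cong_trans[OF rep_fun_add cong_add[OF sum(3,4)]] by simp
  qed
qed

text \<open>On the first superdiagonal that may be nonzero the matrix product has one term: a middle
  index below i + m kills the entry of f, one above kills that of g.\<close>

lemma rep_fun_mult_Al:
  assumes f: "f \<in> Aln m" and g: "g \<in> Aln r" and i: "i + m < n"
  shows "[\<Phi> i (i + m + r) (f \<otimes>\<^bsub>R\<^esub> g) = \<Phi> i (i + m) f * \<Phi> (i + m) (i + m + r) g] (mod md k)"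
proof -
  have "[(\<Sum>l<n. \<Phi> i l f * \<Phi> l (i + m + r) g) = (\<Sum>l<n. if l = i + m then \<Phi> i (i + m) f * \<Phi> (i + m) (i + m + r) g else 0)] (mod md k)"
  proof (rule cong_sum)
    fix l assume l: "l \<in> {..<n}"
    consider "l < i + m" | "l = i + m" | "l > i + m" by linarith
    thus "[\<Phi> i l f * \<Phi> l (i + m + r) g = (if l = i + m then \<Phi> i (i + m) f * \<Phi> (i + m) (i + m + r) g else 0)] (mod md k)"
    proof cases
      case 1
      from cong_mult[OF rep_fun_Al[OF f 1] cong_refl] show ?thesis using 1 i by simp
    next
      case 3
      have "[\<Phi> l (i + m + r) g = 0] (mod md k)" by (rule rep_fun_Al[OF g]) (use 3 l in auto)
      from cong_mult[OF cong_refl this] show ?thesis using 3 by simp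
    qed simp
  qed
  hence "[(\<Sum>l<n. \<Phi> i l f * \<Phi> l (i + m + r) g) = \<Phi> i (i + m) f * \<Phi> (i + m) (i + m + r) g] (mod md k)"
    using i by simp
  thus ?thesis using rep_fun_mult[of f g] Al_carrier[OF f] Al_carrier[OF g] cong_trans by blast
qed

lemma rep_fun_cg:
  assumes "cg m f g" "j < i + m" "i < n"
  shows "[\<Phi> i j f = \<Phi> i j g] (mod md k)"
proof -
  have "f = (f \<ominus>\<^bsub>R\<^esub> g) \<oplus>\<^bsub>R\<^esub> g" using cgD[OF assms(1)] by (simp add: R.minus_eq R.a_assoc R.l_neg)
  hence "[\<Phi> i j f = \<Phi> i j (f \<ominus>\<^bsub>R\<^esub> g) + \<Phi> i j g] (mod md k)"
    using rep_fun_add[of "f \<ominus>\<^bsub>R\<^esub> g" g i j] cgD[OF assms(1)] by simp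
  also have "[\<Phi> i j (f \<ominus>\<^bsub>R\<^esub> g) + \<Phi> i j g = 0 + \<Phi> i j g] (mod md k)"
    by (intro cong_add rep_fun_Al[OF cgD(3)[OF assms(1)] assms(2,3)] cong_refl)
  finally show ?thesis by simp
qed

lemma rep_fun_diff:
  assumes f: "f \<in> carrier R" and g: "g \<in> carrier R"
  shows "[\<Phi> i j (f \<ominus>\<^bsub>R\<^esub> g) = \<Phi> i j f - \<Phi> i j g] (mod md k)"
proof -
  have "f = (f \<ominus>\<^bsub>R\<^esub> g) \<oplus>\<^bsub>R\<^esub> g" using assms by (simp add: R.minus_eq R.a_assoc R.l_neg)
  hence "[\<Phi> i j f = \<Phi> i j (f \<ominus>\<^bsub>R\<^esub> g) + \<Phi> i j g] (mod md k)"
    using rep_fun_add[of "f \<ominus>\<^bsub>R\<^esub> g" g i j] assms by simp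
  thus ?thesis by (metis add_diff_cancel_right' cong_diff cong_refl cong_sym)
qed

lemma rep_fun_mo:
  assumes g: "g \<in> carrier G" and ij: "i < j"
  shows "[\<Phi> i j (mo g) = \<rho> g i j] (mod md k)"
proof -
  have "[\<Phi> i j (ge g \<ominus>\<^bsub>R\<^esub> ge \<one>) = red k \<one>\<^bsub>A\<^esub> * \<rho> g i j - red k \<one>\<^bsub>A\<^esub> * \<rho> \<one> i j] (mod md k)"
    using rep_fun_diff[of "ge g" "ge \<one>" i j] g by (simp add: rep_fun_el)
  moreover have "\<rho> \<one> i j = 0" using \<rho>U[OF ON_one[OF U]] ij by (simp add: ut_one[OF md_gt_1])
  ultimately show ?thesis by (simp add: mo_def el_one red_one)
qed

lemma rep_fun_sc:
  assumes a: "a \<in> carrier A" and f: "f \<in> carrier R" and i: "i < n"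
  shows "[\<Phi> i j (sc a \<otimes>\<^bsub>R\<^esub> f) = red k a * \<Phi> i j f] (mod md k)"
proof -
  have "(\<Sum>l<n. \<Phi> i l (sc a) * \<Phi> l j f) = (\<Sum>l<n. if l = i then red k a * \<Phi> i j f else 0)"
    using \<rho>U[OF ON_one[OF U]] by (intro sum.cong) (auto simp: rep_fun_el ut_one[OF md_gt_1])
  thus ?thesis using rep_fun_mult[of "sc a" f i j] a f i by simp
qed

end
end

section \<open>Nonvanishing of iterated commutators in a free pro-p group\<close>

context pro_p
begin

text \<open>The continuous homomorphisms to Z/p, called forms below. Continuity is encoded by an
  open normal subgroup on which the form vanishes modulo p.\<close>

definition cont_mod_hom :: "('g \<Rightarrow> int) \<Rightarrow> bool" where
  "cont_mod_hom l \<longleftrightarrow> mod_hom p G l \<and> (\<exists>U\<in>ON. \<forall>u\<in>U. [l u = 0] (mod int p))"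

lemma cont_mod_hom_mult:
  "cont_mod_hom l \<Longrightarrow> g \<in> carrier G \<Longrightarrow> h \<in> carrier G \<Longrightarrow> [l (g \<otimes> h) = l g + l h] (mod int p)"
  by (simp add: cont_mod_hom_def mod_hom_def)

lemma cont_mod_hom_one: "cont_mod_hom l \<Longrightarrow> [l \<one> = 0] (mod int p)"
  using ON_one by (auto simp: cont_mod_hom_def)

lemma cont_mod_hom_coset: 
  assumes l: "cont_mod_hom l"
  obtains U where "U \<in> ON" "\<And>g h. g \<in> carrier G \<Longrightarrow> h \<in> carrier G \<Longrightarrow> U #> g = U #> h \<Longrightarrow> [l g = l h] (mod int p)"
proof -
  obtain U where U: "U \<in> ON" "\<forall>u\<in>U. [l u = 0] (mod int p)" using l by (auto simp: cont_mod_hom_def)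
  show thesis
  proof (rule that[OF U(1)])
    fix g h assume g: "g \<in> carrier G" and h: "h \<in> carrier G" and eq: "U #> g = U #> h"
    have "g \<in> U #> h" using rcos_self[OF g ON_D(3)[OF U(1)]] eq by simp
    then obtain u where u: "u \<in> U" "g = u \<otimes> h" by (auto simp: r_coset_def)
    have "[l g = l u + l h] (mod int p)"
      using cont_mod_hom_mult[OF l _ h] u ON_sub[OF U(1)] by blast
    also have "[l u + l h = 0 + l h] (mod int p)" using U u by (intro cong_add) auto
    finally show "[l g = l h] (mod int p)" by simp
  qed
qed

lemma cont_mod_hom_pow:
  assumes l: "cont_mod_hom l" and g: "g \<in> carrier G"
  shows "[l (g [^] (j::nat)) = int j * l g] (mod int p)"
proof (induction j)
  case 0
  thus ?case using cont_mod_hom_one[OF l] by simp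
next
  case (Suc j)
  have "[l (g [^] j \<otimes> g) = l (g [^] j) + l g] (mod int p)" using l g by (intro cont_mod_hom_mult) auto
  also have "[l (g [^] j) + l g = int j * l g + l g] (mod int p)" by (intro cong_add Suc cong_refl)
  finally show ?case by (simp add: algebra_simps)
qed

end

text \<open>Only the middle indices i and i + 1 contribute, each with a 1 from one of the diagonals.
  Hence every superdiagonal entry of a representation is an additive character.\<close>

lemma unitriangular_superdiagonal:
  assumes m: "m > 1" and a: "a \<in> carrier (unitriangular n m)" and b: "b \<in> carrier (unitriangular n m)" and i: "Suc i < n"
  shows "[(a \<otimes>\<^bsub>unitriangular n m\<^esub> b) i (Suc i) = a i (Suc i) + b i (Suc i)] (mod m)"
proof -
  have "(\<Sum>l<n. a i l * b l (Suc i)) = (\<Sum>l\<in>{i, Suc i}. a i l * b l (Suc i))"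
  proof (rule sum.mono_neutral_right)
    show "\<forall>l\<in>{..<n} - {i, Suc i}. a i l * b l (Suc i) = 0"
    proof
      fix l assume "l \<in> {..<n} - {i, Suc i}"
      hence "\<not> i \<le> l \<or> \<not> l \<le> Suc i" by auto
      thus "a i l * b l (Suc i) = 0" using ut_mem(3)[OF m a, of i l] ut_mem(3)[OF m b, of l "Suc i"] by auto
    qed
  qed (use i in auto)
  also have "\<dots> = a i (Suc i) + b i (Suc i)"
    using ut_mem(2)[OF m a, of i] ut_mem(2)[OF m b, of "Suc i"] i by simp
  finally show ?thesis by (simp add: ut_mult[OF m])
qed

context free_pro_p
begin

text \<open>Reduction modulo p turns both forms into homomorphisms to a finite p-group, and
  \<open>free_unique\<close> applies with the intersection of their two open subgroups.\<close>

lemma cont_mod_hom_unique: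
  assumes l: "cont_mod_hom l" and l': "cont_mod_hom l'" and eq: "\<And>x. x \<in> X \<Longrightarrow> [l x = l' x] (mod int p)"
    and g: "g \<in> carrier G"
  shows "[l g = l' g] (mod int p)"
proof -
  let ?H = "integer_mod_group p"
  have p0: "p > 0" using prime_gt_0_nat[OF p_prime] .
  have hom: "(\<lambda>g. k g mod int p) \<in> hom G ?H" if "cont_mod_hom k" for k
    using cont_mod_hom_mult[OF that] p0
    by (intro homI) (auto simp: carrier_integer_mod_group mult_integer_mod_group cong_def mod_simps)
  obtain U where U: "U \<in> ON" "\<forall>u\<in>U. [l u = 0] (mod int p)" using l by (auto simp: cont_mod_hom_def)
  obtain V where V: "V \<in> ON" "\<forall>u\<in>V. [l' u = 0] (mod int p)" using l' by (auto simp: cont_mod_hom_def)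
  have "order ?H = p ^ 1" using p0 by (simp add: order_def carrier_integer_mod_group)
  from free_unique[OF group_integer_mod_group this hom[OF l] _ hom[OF l'] _ Int_ON[OF U(1) V(1)] _ g]
  have "l g mod int p = l' g mod int p" using U(2) V(2) eq by (simp add: cong_def one_integer_mod_group)
  thus ?thesis by (simp add: cong_def)
qed

text \<open>The superdiagonal is prescribed on the generators and then compared with s on all of G:
  both are continuous homomorphisms to Z/p, so agreement on X suffices. Thus s may be chosen with a
  view to arbitrary elements of G rather than to generators.\<close>

lemma unitriangular_representation:
  fixes s :: "nat \<Rightarrow> 'a \<Rightarrow> int"
  assumes s: "\<And>i. mod_hom p G (s i)" and W: "W \<in> ON" "\<And>i u. u \<in> W \<Longrightarrow> [s i u = 0] (mod int p)"
    and e: "e \<ge> 1"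
  obtains \<rho> U where "U \<in> ON" "\<rho> \<in> hom G (unitriangular n (int p ^ e))"
    "\<And>u. u \<in> U \<Longrightarrow> \<rho> u = \<one>\<^bsub>unitriangular n (int p ^ e)\<^esub>"
    "\<And>g i. g \<in> carrier G \<Longrightarrow> Suc i < n \<Longrightarrow> [\<rho> g i (Suc i) = s i g] (mod int p)"
proof -
  let ?m = "int p ^ e"
  let ?H = "unitriangular n ?m"
  have p: "int p > 1" using prime_gt_1_nat[OF p_prime] by simp
  have m: "?m > 1" using e p by (intro one_less_power) auto
  have pm: "int p \<le> ?m" "int p dvd ?m" using e p by (auto intro: self_le_power dvd_power)
  define E where "E = (\<lambda>x i j. if i = j \<and> i < n then 1 else if j = Suc i \<and> j < n then s i x mod int p else 0)"
  have red: "s i x mod int p mod ?m = s i x mod int p" for i x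
    using p pm(1) pos_mod_bound[of "int p" "s i x"] pos_mod_sign[of "int p" "s i x"]
    by (intro mod_pos_pos_trivial) linarith+
  have E: "E x \<in> carrier ?H" for x
    using m by (auto simp: unitriangular_def E_def red)
  \<comment> \<open>One open subgroup W serves all i, so E is the identity matrix on almost all
    generators, as the lift demands.\<close>
  have "E x = \<one>\<^bsub>?H\<^esub>" if "x \<in> W" for x
    using W(2)[OF that] by (auto simp: E_def ut_one[OF m] cong_def fun_eq_iff)
  hence "{x \<in> X. E x \<noteq> \<one>\<^bsub>?H\<^esub>} \<subseteq> {x \<in> X. x \<notin> W}" by auto
  hence fin: "finite {x \<in> X. E x \<noteq> \<one>\<^bsub>?H\<^esub>}" using X_converges[OF W(1)] finite_subset by blast
  obtain k where "order ?H = nat ?m ^ k" using ut_finite_order(2)[OF m] by blast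
  hence ord: "order ?H = p ^ (e * k)" by (simp add: nat_power_eq power_mult)
  obtain \<rho> U where \<rho>: "\<rho> \<in> hom G ?H" "U \<in> ON" "\<And>u. u \<in> U \<Longrightarrow> \<rho> u = \<one>\<^bsub>?H\<^esub>" "\<And>x. x \<in> X \<Longrightarrow> \<rho> x = E x"
    by (rule free_lift[OF ut_group[OF m] ord, of E]) (use E fin in auto)
  show thesis
  proof (rule that[OF \<rho>(2,1,3)])
    fix g i assume g: "g \<in> carrier G" and i: "Suc i < n"
    have "cont_mod_hom (\<lambda>g. \<rho> g i (Suc i))"
      unfolding cont_mod_hom_def mod_hom_def
    proof (intro conjI ballI bexI[of _ U])
      fix x y assume x: "x \<in> carrier G" and y: "y \<in> carrier G"
      have "[(\<rho> x \<otimes>\<^bsub>?H\<^esub> \<rho> y) i (Suc i) = \<rho> x i (Suc i) + \<rho> y i (Suc i)] (mod ?m)"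
        using \<rho>(1) x y by (intro unitriangular_superdiagonal[OF m] i) (auto simp: hom_def)
      thus "[\<rho> (x \<otimes> y) i (Suc i) = \<rho> x i (Suc i) + \<rho> y i (Suc i)] (mod int p)"
        using cong_dvd_modulus[OF _ pm(2)] by (simp add: hom_mult[OF \<rho>(1) x y])
    qed (use \<rho> in \<open>auto simp: ut_one[OF m]\<close>)
    moreover have "cont_mod_hom (s i)" using s W by (auto simp: cont_mod_hom_def)
    ultimately show "[\<rho> g i (Suc i) = s i g] (mod int p)"
      by (rule cont_mod_hom_unique) (use \<rho>(4) i g in \<open>auto simp: E_def\<close>)
  qed
qed

end

context completed
begin

primrec iterated_comm :: "'g \<Rightarrow> 'g \<Rightarrow> nat \<Rightarrow> 'g" where
  "iterated_comm y x 0 = x"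
| "iterated_comm y x (Suc b) = comm y (iterated_comm y x b)"

lemma iterated_comm_F:
  assumes "y \<in> carrier G" "x \<in> carrier G"
  shows "iterated_comm y x b \<in> F (Suc b)"
proof (induction b)
  case (Suc b)
  from mo_comm(2)[of y "Suc 0", OF _ Suc] assms F_one show ?case by simp
qed (use assms F_one in simp)

end

locale completed_free = completed A p e red G T + free_pro_p G p T X
  for A :: "'r ring" and p e red and G :: "'g monoid" (structure) and T X
begin

text \<open>
  For the superdiagonal \<open>(l, \<dots>, l, m)\<close> the corner entry is \<open>l(y)\<^sup>B m(x)\<close>: all the other terms of the
  expanded commutator have a letter y in the last place and m(y) = 0.
\<close>

lemma iterated_comm_free:
  assumes c: "y \<in> carrier G" "x \<in> carrier G" and l: "cont_mod_hom l" "\<not> int p dvd l y"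
    and m: "cont_mod_hom m" "int p dvd m y" "\<not> int p dvd m x"
    and a: "a \<in> carrier A" and in_Al: "sc a \<otimes>\<^bsub>R\<^esub> mo (iterated_comm y x B) \<in> Aln (Suc (Suc B))"
  shows "a = \<zero>\<^bsub>A\<^esub>"
proof (rule red_inj[OF a zero_in])
  fix k
  \<comment> \<open>The superdiagonal of a matrix of size B + 2 has the B + 1 places 0, ..., B; the
    last one carries m.\<close>
  define s where "s = (\<lambda>i. if i < B then l else m)"
  obtain V1 where V1: "V1 \<in> ON" "\<forall>u\<in>V1. [l u = 0] (mod int p)" using l by (auto simp: cont_mod_hom_def)
  obtain V2 where V2: "V2 \<in> ON" "\<forall>u\<in>V2. [m u = 0] (mod int p)" using m by (auto simp: cont_mod_hom_def)
  have sm: "\<And>i. mod_hom p G (s i)" using l m by (simp add: s_def cont_mod_hom_def)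
  let ?n = "B + 2"
  obtain \<rho> U where U: "U \<in> ON" and \<rho>: "\<rho> \<in> hom G (unitriangular ?n (md k))"
    and \<rho>U: "\<And>u. u \<in> U \<Longrightarrow> \<rho> u = \<one>\<^bsub>unitriangular ?n (md k)\<^esub>"
    and \<rho>s: "\<And>g i. g \<in> carrier G \<Longrightarrow> Suc i < ?n \<Longrightarrow> [\<rho> g i (Suc i) = s i g] (mod int p)"
    by (rule unitriangular_representation[where s = s and n = ?n, OF sm Int_ON[OF V1(1) V2(1)] _ e_ge_1[of k]])
       (use V1 V2 in \<open>auto simp: s_def\<close>)
  note to_p = cong_dvd_modulus[OF _ p_dvd_md[of k]]
  let ?\<Phi> = "rep_fun k U \<rho>"
  have mo1: "mo g \<in> Aln (Suc 0)" if "g \<in> carrier G" for g unfolding I_eq_Al[symmetric] using that by (rule mo_I)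
  have diag: "[?\<Phi> i (Suc i) (mo g) = s i g] (mod int p)" if "g \<in> carrier G" "Suc i < ?n" for g i
    using cong_trans[OF to_p[OF rep_fun_mo[OF U \<rho> \<rho>U that(1), of i "Suc i"]] \<rho>s[OF that]] by simp
  \<comment> \<open>The commutator with b letters y is read in the last b + 1 superdiagonal places,
    from row B - b to the last column, so each further commutator moves the row up by one.\<close>
  have main: "[?\<Phi> (B - b) (Suc B) (mo (iterated_comm y x b)) = l y ^ b * m x] (mod int p)" if "b \<le> B" for b
    using that
  proof (induction b)
    case 0
    show ?case using diag[OF c(2), of B] by (simp add: s_def)
  next
    case (Suc b)
    define z where "z = iterated_comm y x b"
    have z: "z \<in> F (Suc b)" unfolding z_def by (rule iterated_comm_F[OF c])
    hence zc: "z \<in> carrier G" and zA: "mo z \<in> Aln (Suc b)" by (simp_all only: F_iff)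
    define i where "i = B - Suc b"
    have i: "i + Suc b = B" "Suc (i + b) = B" "B - b = Suc i" using Suc.prems by (auto simp: i_def)
    have yF: "y \<in> F (Suc 0)" using c F_one by simp
    have "[?\<Phi> i (Suc B) (mo (comm y z)) = ?\<Phi> i (Suc B) (mo y \<otimes>\<^bsub>R\<^esub> mo z \<ominus>\<^bsub>R\<^esub> mo z \<otimes>\<^bsub>R\<^esub> mo y)] (mod md k)"
      by (rule rep_fun_cg[OF U \<rho> \<rho>U mo_comm(1)[OF yF z]]) (use i in auto)
    also have "[?\<Phi> i (Suc B) (mo y \<otimes>\<^bsub>R\<^esub> mo z \<ominus>\<^bsub>R\<^esub> mo z \<otimes>\<^bsub>R\<^esub> mo y) = ?\<Phi> i (Suc B) (mo y \<otimes>\<^bsub>R\<^esub> mo z) - ?\<Phi> i (Suc B) (mo z \<otimes>\<^bsub>R\<^esub> mo y)] (mod md k)"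
      by (rule rep_fun_diff[OF U \<rho> \<rho>U]) (use c zc in auto)
    also have "[?\<Phi> i (Suc B) (mo y \<otimes>\<^bsub>R\<^esub> mo z) - ?\<Phi> i (Suc B) (mo z \<otimes>\<^bsub>R\<^esub> mo y) = ?\<Phi> i (Suc i) (mo y) * ?\<Phi> (Suc i) (Suc B) (mo z) - ?\<Phi> i B (mo z) * ?\<Phi> B (Suc B) (mo y)] (mod md k)"
      using rep_fun_mult_Al[OF U \<rho> \<rho>U mo1[OF c(1)] zA, of i] rep_fun_mult_Al[OF U \<rho> \<rho>U zA mo1[OF c(1)], of i] i
      by (intro cong_diff) (auto simp del: Al.simps)
    finally have "[?\<Phi> i (Suc B) (mo (comm y z)) = ?\<Phi> i (Suc i) (mo y) * ?\<Phi> (Suc i) (Suc B) (mo z) - ?\<Phi> i B (mo z) * ?\<Phi> B (Suc B) (mo y)] (mod int p)"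
      by (rule to_p)
    also have "[?\<Phi> i (Suc i) (mo y) * ?\<Phi> (Suc i) (Suc B) (mo z) - ?\<Phi> i B (mo z) * ?\<Phi> B (Suc B) (mo y) =
       l y * (l y ^ b * m x) - ?\<Phi> i B (mo z) * 0] (mod int p)"
    proof (intro cong_diff cong_mult cong_refl)
      show "[?\<Phi> i (Suc i) (mo y) = l y] (mod int p)" using diag[OF c(1), of i] i by (simp add: s_def)
      show "[?\<Phi> (Suc i) (Suc B) (mo z) = l y ^ b * m x] (mod int p)" using Suc i by (simp add: z_def)
      show "[?\<Phi> B (Suc B) (mo y) = 0] (mod int p)"
        using cong_trans[OF diag[OF c(1), of B], of 0] m(2) by (simp add: s_def cong_0_iff)
    qed
    finally show ?case by (simp add: z_def i_def mult_ac)
  qed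
  let ?w = "?\<Phi> 0 (Suc B) (mo (iterated_comm y x B))"
  have pp: "prime (int p)" using prime_p by simp
  have "\<not> int p dvd l y ^ B * m x" using l(2) m(3) prime_dvd_multD[OF pp, of "l y ^ B" "m x"] prime_dvd_power[OF pp, of "l y" B] by blast
  hence "\<not> int p dvd ?w" using main[of B] by (simp add: cong_dvd_iff)
  \<comment> \<open>The corner entry is a unit modulo \<open>md k\<close> although it is known only
    modulo p, so it can be cancelled from its product with a.\<close>
  hence cop: "coprime ?w (md k)" using pp by (simp add: prime_imp_coprime coprime_commute)
  have gc: "iterated_comm y x B \<in> carrier G" using iterated_comm_F[OF c] F_carrier by blast
  have "[red k a * ?w = 0] (mod md k)"
    by (rule cong_trans[OF cong_sym[OF rep_fun_sc[OF U \<rho> \<rho>U a mo_closed[OF gc]]] rep_fun_Al[OF U \<rho> \<rho>U in_Al]]) auto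
  hence "md k dvd red k a" using cop by (simp add: cong_0_iff coprime_commute coprime_dvd_mult_left_iff)
  thus "red k a = red k \<zero>\<^bsub>A\<^esub>" using red_range[OF a, of k] by (simp add: red_zero dvd_eq_mod_eq_0)
qed

end

section \<open>Roots of unity\<close>

text \<open>u^p - v^p = (u - v) (u^(p-1) + ... + v^(p-1)), and for u \<equiv> v modulo p the second
  factor is p v^(p-1) \<equiv> 0 modulo p. So each p-th power gains one factor p.\<close>

lemma cong_power_prime_power:
  fixes a b :: int
  assumes p: "prime p" and ab: "[a = b] (mod int p)"
  shows "[a ^ (p ^ n) = b ^ (p ^ n)] (mod int p ^ Suc n)"
proof (induction n)
  case (Suc n)
  let ?u = "a ^ (p ^ n)" and ?v = "b ^ (p ^ n)"
  have uv: "[?u = ?v] (mod int p)"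
    using cong_dvd_modulus[OF Suc.IH, of "int p"] by simp
  have "[(\<Sum>i<p. ?v ^ (p - Suc i) * ?u ^ i) = (\<Sum>i<p. ?v ^ (p - Suc i) * ?v ^ i)] (mod int p)"
    by (intro cong_sum cong_mult cong_refl cong_pow uv)
  also have "(\<Sum>i<p. ?v ^ (p - Suc i) * ?v ^ i) = (\<Sum>i<p. ?v ^ (p - 1))"
    by (intro sum.cong) (auto simp flip: power_add)
  also have "[\<dots> = 0] (mod int p)" by (simp add: cong_0_iff)
  finally have "int p dvd (\<Sum>i<p. ?v ^ (p - Suc i) * ?u ^ i)" by (simp add: cong_0_iff)
  moreover have "int p ^ Suc n dvd ?u - ?v" using Suc.IH by (simp add: cong_iff_dvd_diff)
  ultimately have "int p ^ Suc n * int p dvd (?u - ?v) * (\<Sum>i<p. ?v ^ (p - Suc i) * ?u ^ i)"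
    by (rule mult_dvd_mono[rotated])
  hence "int p ^ Suc (Suc n) dvd ?u ^ p - ?v ^ p"
    by (simp add: power_diff_sumr2 mult_ac)
  thus ?case by (simp add: cong_iff_dvd_diff power_mult[symmetric] mult.commute)
qed (use ab in simp)

lemma cong_power_of_period:
  fixes z m :: int
  assumes z: "[z ^ q = 1] (mod m)" and ab: "[a = b] (mod q)"
  shows "[z ^ a = z ^ b] (mod m)"
proof -
  have "[z ^ a = z ^ (a mod q)] (mod m)" for a
  proof -
    have "z ^ a = (z ^ q) ^ (a div q) * z ^ (a mod q)"
      by (metis mult_div_mod_eq power_add power_mult)
    also have "[\<dots> = 1 ^ (a div q) * z ^ (a mod q)] (mod m)"
      by (intro cong_mult cong_pow z cong_refl)
    finally show ?thesis by simp
  qed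
  from this[of a] this[of b] show ?thesis using ab by (metis cong_def)
qed

text \<open>p \<equiv> 1 modulo q, so p-th powers fix the q-th roots of unity. Combined with
  \<open>cong_power_prime_power\<close> this identifies such roots with their residues modulo
  p.\<close>

lemma cong_power_prime_base:
  fixes z m :: int
  assumes "[z ^ q = 1] (mod m)" "q dvd p - 1" "p > 0"
  shows "[z ^ (p ^ n) = z] (mod m)"
proof -
  have "[p = 1] (mod q)" using assms(2,3) by (metis Suc_leI One_nat_def cong_altdef_nat cong_sym_eq)
  hence "[p ^ n = 1] (mod q)" using cong_pow[of p 1 q n] by simp
  from cong_power_of_period[OF assms(1) this] show ?thesis by simp
qed

lemma power_cong_1_imp:
  fixes z m :: int
  assumes q: "prime q" and z: "[z ^ q = 1] (mod m)" and i: "[z ^ i = 1] (mod m)" "\<not> q dvd i"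
  shows "[z = 1] (mod m)"
proof -
  have "coprime i q" using prime_imp_coprime[OF q i(2)] by (simp add: coprime_commute)
  then obtain x where "[i * x = 1] (mod q)" using cong_solve_coprime_nat by auto
  hence "[z ^ (i * x) = z ^ 1] (mod m)" by (rule cong_power_of_period[OF z])
  moreover have "[z ^ (i * x) = 1] (mod m)" using cong_pow[OF i(1), of x] by (simp add: power_mult)
  ultimately show ?thesis using cong_sym cong_trans by (metis power_one_right)
qed

text \<open>The geometric sum is annihilated modulo p by z^i - 1, and this factor is invertible
  modulo p, because z has order exactly q and q does not divide i.\<close>

lemma sum_powers_root_of_unity:
  fixes z :: int
  assumes p: "prime p" and q: "prime q" and z: "[z ^ q = 1] (mod int p)" "\<not> [z = 1] (mod int p)" and i: "\<not> q dvd i"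
  shows "[(\<Sum>j<q. z ^ (j * i)) = 0] (mod int p)"
proof -
  have pp: "prime (int p)" using p by simp
  have "(z ^ i - 1) * (\<Sum>j<q. (z ^ i) ^ j) = (z ^ i) ^ q - 1"
    by (simp add: power_diff_1_eq)
  also have "(z ^ i) ^ q = (z ^ q) ^ i" by (simp add: mult.commute flip: power_mult)
  also have "[(z ^ q) ^ i - 1 = 1 ^ i - 1] (mod int p)" by (intro cong_diff cong_pow z(1) cong_refl)
  finally have "int p dvd (z ^ i - 1) * (\<Sum>j<q. (z ^ i) ^ j)" by (simp add: cong_0_iff)
  moreover have "\<not> int p dvd z ^ i - 1"
    using power_cong_1_imp[OF q z(1) _ i] z(2) by (auto simp: cong_iff_dvd_diff)
  ultimately have "int p dvd (\<Sum>j<q. (z ^ i) ^ j)" using prime_dvd_multD[OF pp] by blast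
  thus ?thesis by (simp add: cong_0_iff power_mult[symmetric] mult.commute)
qed

lemma primitive_root_int:
  assumes p: "prime p"
  obtains g :: nat where "ord p g = p - 1" "coprime p g" "\<And>c :: int. coprime c (int p) \<Longrightarrow> \<exists>i. [c = int g ^ i] (mod int p)"
proof -
  obtain g where g: "residue_primroot p g" using prime_primitive_root_exists[of p] p prime_gt_1_nat by blast
  have "\<exists>i. [c = int g ^ i] (mod int p)" if c: "coprime c (int p)" for c
  proof -
    have p1: "p > 1" using p prime_gt_1_nat by blast
    define d where "d = nat (c mod int p)"
    have d: "int d = c mod int p" using p1 by (simp add: d_def)
    have "\<not> int p dvd c" using c p1 by (auto dest: coprime_common_divisor[of c "int p" "int p"])
    hence "d \<noteq> 0" using d by (simp add: dvd_eq_mod_eq_0 flip: of_nat_eq_0_iff)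
    moreover have "d < p" using d p1 by (metis of_nat_0_less_iff of_nat_less_iff order.strict_trans pos_mod_bound zero_less_one)
    ultimately have "d \<in> totatives p" using p by (auto simp: totatives_prime)
    then obtain i where "d = g ^ i mod p"
      using residue_primroot_is_generator[OF p1 g] by (auto simp: bij_betw_def)
    hence "int d = int g ^ i mod int p" by (simp add: of_nat_mod)
    thus ?thesis using d by (auto simp: cong_def)
  qed
  moreover have "ord p g = p - 1" "coprime p g" using g p by (auto simp: residue_primroot_def totient_prime)
  ultimately show thesis using that by blast
qed

text \<open>For a primitive root g the element g^((p-1)/q) has order q.\<close>

lemma root_of_unity_mod_prime_exists:
  assumes p: "prime p" and q: "prime q" "q dvd p - 1"
  shows "\<exists>z::int. [z ^ q = 1] (mod int p) \<and> \<not> [z = 1] (mod int p)"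
proof -
  obtain g :: nat where g: "ord p g = p - 1" using primitive_root_int[OF p] by metis
  define r where "r = (p - 1) div q"
  have r: "p - 1 = r * q" "r > 0" using q p prime_gt_1_nat[OF p] by (auto simp: r_def dvd_div_eq_0_iff intro: Nat.gr0I)
  have "[(g ^ r) ^ q = 1] (mod p)" using g r ord_divides[of g "r * q" p] by (simp add: power_mult)
  moreover have "\<not> [g ^ r = 1] (mod p)"
  proof
    assume "[g ^ r = 1] (mod p)"
    hence "r * q dvd r" using g r ord_divides[of g r p] by simp
    thus False using r q prime_gt_1_nat[of q] by (simp add: dvd_mult_cancel1)
  qed
  ultimately show ?thesis
    by (intro exI[of _ "int (g ^ r)"]) (metis cong_int_iff of_nat_1 of_nat_power)
qed

text \<open>Both roots are powers of g^r with r = (p-1)/q and g a primitive root, say with exponents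
  a for z and b for c. As z is not 1, a is prime to q, and its inverse x modulo q gives the exponent
  x b.\<close>

lemma root_of_unity_mod_prime_power:
  fixes z c :: int
  assumes p: "prime p" and q: "prime q" "q dvd p - 1"
    and z: "[z ^ q = 1] (mod int p)" "\<not> [z = 1] (mod int p)" and c: "[c ^ q = 1] (mod int p)"
  shows "\<exists>i. [c = z ^ i] (mod int p)"
proof -
  obtain g :: nat where g: "ord p g = p - 1" "coprime p g" "\<And>c :: int. coprime c (int p) \<Longrightarrow> \<exists>i. [c = int g ^ i] (mod int p)"
    using primitive_root_int[OF p] by metis
  define r where "r = (p - 1) div q"
  have r: "p - 1 = r * q" using q by (simp add: r_def)
  have r0: "r > 0" using r prime_gt_1_nat[OF p] by (intro Nat.gr0I) auto
  have *: "\<exists>a. [x = int g ^ (r * a)] (mod int p)" if x: "[x ^ q = 1] (mod int p)" for x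
  proof -
    have "\<not> int p dvd x" 
    proof
      assume "int p dvd x"
      hence "int p dvd x ^ q" using prime_gt_0_nat[OF q(1)] dvd_power[of q x] dvd_trans by blast
      hence "int p dvd 1" using x cong_dvd_iff by blast
      thus False using prime_gt_1_nat[OF p] by auto
    qed
    hence "coprime x (int p)" using p prime_imp_coprime[of "int p" x] by (simp add: coprime_commute)
    then obtain i where i: "[x = int g ^ i] (mod int p)" using g(3) by blast
    have "[(int g ^ i) ^ q = 1] (mod int p)" using cong_trans[OF cong_sym[OF cong_pow[OF i, of q]] x] .
    hence "[g ^ (i * q) = 1] (mod p)" by (metis cong_int_iff of_nat_1 of_nat_power power_mult)
    hence "r * q dvd i * q" using ord_divides g(1) r by metis
    hence "r dvd i" using prime_gt_0_nat[OF q(1)] by simp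
    thus ?thesis using i by (auto elim!: dvdE)
  qed
  obtain a where a: "[z = int g ^ (r * a)] (mod int p)" using *[OF z(1)] by blast
  obtain b where b: "[c = int g ^ (r * b)] (mod int p)" using *[OF c] by blast
  have per: "[int g ^ (r * q) = 1] (mod int p)"
    using g(1) r ord_divides[of g "r * q" p] by (metis cong_int_iff of_nat_1 of_nat_power dvd_refl)
  have "\<not> q dvd a"
  proof
    assume "q dvd a"
    hence "[r * a = 0] (mod r * q)" by (simp add: cong_0_iff)
    from cong_trans[OF a cong_power_of_period[OF per this]] show False using z(2) by simp
  qed
  hence "coprime a q" using prime_imp_coprime[OF q(1)] by (simp add: coprime_commute)
  then obtain x where x: "[a * x = 1] (mod q)" using cong_solve_coprime_nat by auto
  hence "[a * x * b = 1 * b] (mod q)" by (intro cong_mult cong_refl)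
  hence "[r * (a * (x * b)) = r * b] (mod r * q)"
    using cong_cmult_leftI[of "a * (x * b)" b q r] by (simp add: mult.assoc)
  hence "[int g ^ (r * (a * (x * b))) = int g ^ (r * b)] (mod int p)" by (rule cong_power_of_period[OF per])
  moreover have "[z ^ (x * b) = int g ^ (r * (a * (x * b)))] (mod int p)"
    using cong_pow[OF a, of "x * b"] by (simp add: mult.assoc flip: power_mult)
  ultimately show ?thesis using b cong_sym cong_trans by blast
qed

section \<open>Roots of unity in the coefficient ring\<close>

context coeff_ring
begin

lemma red_power: "a \<in> carrier A \<Longrightarrow> [red k (a [^]\<^bsub>A\<^esub> n) = red k a ^ n] (mod md k)"
proof (induction n)
  case 0
  thus ?case by (simp add: red_one)
next
  case (Suc n)
  have "[red k (a [^]\<^bsub>A\<^esub> n \<otimes>\<^bsub>A\<^esub> a) = red k (a [^]\<^bsub>A\<^esub> n) * red k a] (mod md k)"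
    using Suc by (intro red_mult_cong) auto
  also have "[red k (a [^]\<^bsub>A\<^esub> n) * red k a = red k a ^ n * red k a] (mod md k)"
    using Suc by (intro cong_mult cong_refl)
  finally show ?case by (simp add: mult.commute)
qed

lemma red_root_of_unity:
  assumes "a \<in> carrier A" "a [^]\<^bsub>A\<^esub> q = \<one>\<^bsub>A\<^esub>"
  shows "[red k a ^ q = 1] (mod md k)"
  using red_power[OF assms(1), of k q] assms(2) by (simp add: red_one cong_sym_eq)

text \<open>Raising to the power \<open>p ^ e k\<close> turns the congruence modulo p into one
  modulo \<open>md k\<close> and leaves q-th roots of unity unchanged.\<close>

lemma root_of_unity_eqI:
  assumes a: "a \<in> carrier A" "a [^]\<^bsub>A\<^esub> q = \<one>\<^bsub>A\<^esub>" and b: "b \<in> carrier A" "b [^]\<^bsub>A\<^esub> q = \<one>\<^bsub>A\<^esub>"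
    and q: "q dvd p - 1" and ab: "[red 0 a = red 0 b] (mod int p)"
  shows "a = b"
proof (rule cong_red_eq[OF a(1) b(1)])
  fix k
  have p0: "p > 0" using prime_gt_0_nat[OF prime_p] .
  have 0: "[red k x = red 0 x] (mod int p)" if "x \<in> carrier A" for x
    using red_le[OF that, of 0 k] red_range[OF that, of 0] e_0 by (simp add: cong_def)
  have "[red k a = red k b] (mod int p)" using 0[OF a(1)] 0[OF b(1)] ab cong_trans cong_sym by meson
  from cong_power_prime_power[OF prime_p this, of "e k"]
  have "[red k a ^ (p ^ e k) = red k b ^ (p ^ e k)] (mod md k)"
    by (rule cong_dvd_modulus) simp
  moreover have "[red k x ^ (p ^ e k) = red k x] (mod md k)" if "x \<in> carrier A" "x [^]\<^bsub>A\<^esub> q = \<one>\<^bsub>A\<^esub>" for x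
    by (rule cong_power_prime_base[OF red_root_of_unity[OF that] q p0])
  ultimately show "[red k a = red k b] (mod md k)" using a b cong_trans cong_sym by meson
qed

text \<open>Teichmueller lift: the component at level k is \<open>z ^ (p ^ e k)\<close>, and these
  are compatible because z^(p^j) \<equiv> z modulo p.\<close>

lemma root_of_unity_lift:
  assumes q: "q dvd p - 1" and z: "[z ^ q = 1] (mod int p)"
  obtains a where "a \<in> carrier A" "a [^]\<^bsub>A\<^esub> q = \<one>\<^bsub>A\<^esub>" "[red 0 a = z] (mod int p)"
proof -
  have p0: "p > 0" using prime_gt_0_nat[OF prime_p] .
  have "(z ^ (p ^ e (Suc k))) mod md k = (z ^ (p ^ e k)) mod md k" for k
  proof -
    obtain j where j: "e (Suc k) = j + e k" using e_mono by (metis monoD le_add_diff_inverse2 le_SucI order_refl)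
    have "[z ^ (p ^ j) = z] (mod int p)" by (rule cong_power_prime_base[OF z q p0])
    from cong_power_prime_power[OF prime_p this, of "e k"]
    have "[(z ^ (p ^ j)) ^ (p ^ e k) = z ^ (p ^ e k)] (mod md k)" by (rule cong_dvd_modulus) simp
    thus ?thesis by (simp add: cong_def j power_add power_mult)
  qed
  then obtain a where a: "a \<in> carrier A" "\<And>k. red k a = z ^ (p ^ e k) mod md k"
    using red_complete[of "\<lambda>k. z ^ (p ^ e k)"] by blast
  show thesis
  proof (rule that[OF a(1)])
    show "a [^]\<^bsub>A\<^esub> q = \<one>\<^bsub>A\<^esub>"
    proof (rule cong_red_eq)
      fix k
      have "[red k (a [^]\<^bsub>A\<^esub> q) = red k a ^ q] (mod md k)" by (rule red_power[OF a(1)])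
      also have "[red k a ^ q = (z ^ (p ^ e k)) ^ q] (mod md k)" by (intro cong_pow) (simp add: a(2))
      also have "(z ^ (p ^ e k)) ^ q = (z ^ q) ^ (p ^ e k)" by (simp add: mult.commute flip: power_mult)
      also have "[(z ^ q) ^ (p ^ e k) = 1 ^ (p ^ e k)] (mod md k)"
        using cong_power_prime_power[OF prime_p z, of "e k"] by (rule cong_dvd_modulus) simp
      finally show "[red k (a [^]\<^bsub>A\<^esub> q) = red k \<one>\<^bsub>A\<^esub>] (mod md k)" by (simp add: red_one)
    qed (use a one_in in auto)
    show "[red 0 a = z] (mod int p)"
      using cong_power_prime_base[OF z q p0, of 1] by (simp add: a(2) e_0)
  qed
qed

lemma root_of_unity_power:
  assumes q: "prime q" "q dvd p - 1"
    and a: "a \<in> carrier A" "a [^]\<^bsub>A\<^esub> q = \<one>\<^bsub>A\<^esub>" "\<not> [red 0 a = 1] (mod int p)" and c: "c \<in> carrier A" "c [^]\<^bsub>A\<^esub> q = \<one>\<^bsub>A\<^esub>"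
  obtains i :: nat where "c = a [^]\<^bsub>A\<^esub> i"
proof -
  have z: "[red 0 a ^ q = 1] (mod int p)" "[red 0 c ^ q = 1] (mod int p)"
    using red_root_of_unity[OF a(1,2), of 0] red_root_of_unity[OF c, of 0] e_0 by simp_all
  obtain i where i: "[red 0 c = red 0 a ^ i] (mod int p)"
    using root_of_unity_mod_prime_power[OF prime_p q z(1) a(3) z(2)] by blast
  have "(a [^]\<^bsub>A\<^esub> i) [^]\<^bsub>A\<^esub> q = (a [^]\<^bsub>A\<^esub> q) [^]\<^bsub>A\<^esub> i"
    using a(1) by (simp add: A.nat_pow_pow mult.commute)
  hence "c = a [^]\<^bsub>A\<^esub> i"
    using cong_trans[OF i cong_sym[OF red_power[OF a(1), of 0 i, unfolded e_0 power_one_right]]] a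
    by (intro root_of_unity_eqI[OF c _ _ q(2)]) auto
  thus thesis by (rule that)
qed

end

section \<open>Eigenvectors for an automorphism of prime order\<close>

locale cyclic_action = completed A p e red G T
  for A :: "'r ring" and p e red and G :: "'g monoid" (structure) and T +
  fixes q :: nat and \<delta> \<delta>' :: "'g \<Rightarrow> 'g"
  assumes q: "prime q" "q dvd p - 1" and pair: "aut_pair \<delta> \<delta>'"
    and period: "g \<in> carrier G \<Longrightarrow> (\<delta> ^^ q) g = g"
begin

lemma \<delta>: "cont_aut \<delta>" and \<delta>': "cont_aut \<delta>'"
  using pair by (auto simp: aut_pair_def)

lemma \<delta>_closed [simp]: "g \<in> carrier G \<Longrightarrow> \<delta> g \<in> carrier G"
  by (rule cont_autD(5)[OF \<delta>])

lemma \<delta>_pow_closed [simp]: "g \<in> carrier G \<Longrightarrow> (\<delta> ^^ i) g \<in> carrier G"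
  by (induction i) auto

lemma q_not_dvd: "\<not> int p dvd int q"
proof -
  have "q \<le> p - 1" using q prime_gt_1_nat[OF prime_p] by (intro dvd_imp_le) auto
  hence "q < p" using prime_gt_1_nat[OF prime_p] by simp
  thus ?thesis using prime_gt_0_nat[OF q(1)] by (auto dest: dvd_imp_le)
qed

text \<open>The condition \<open>eig\<close> for the generator alone; by \<open>eigv_pow\<close> it
  extends to the powers of \<delta>, hence to all of \<Delta>.\<close>

definition eigv :: "nat \<Rightarrow> 'r \<Rightarrow> 'g \<Rightarrow> bool" where
  "eigv n a g \<longleftrightarrow> g \<in> F n \<and> cg (Suc n) (mo (\<delta> g)) (sc a \<otimes>\<^bsub>R\<^esub> mo g)"

lemma sc_mult: "a \<in> carrier A \<Longrightarrow> b \<in> carrier A \<Longrightarrow> sc a \<otimes>\<^bsub>R\<^esub> sc b = sc (a \<otimes>\<^bsub>A\<^esub> b)"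
  using el_mult[of \<one> \<one> a b] by simp

lemma sc_mult_sc_mult:
  assumes "a \<in> carrier A" "b \<in> carrier A" "x \<in> carrier R" "y \<in> carrier R"
  shows "(sc a \<otimes>\<^bsub>R\<^esub> x) \<otimes>\<^bsub>R\<^esub> (sc b \<otimes>\<^bsub>R\<^esub> y) = sc (a \<otimes>\<^bsub>A\<^esub> b) \<otimes>\<^bsub>R\<^esub> (x \<otimes>\<^bsub>R\<^esub> y)"
proof -
  note c = el_closed[OF one_closed assms(1)] el_closed[OF one_closed assms(2)] assms(3,4)
  have "(sc a \<otimes>\<^bsub>R\<^esub> x) \<otimes>\<^bsub>R\<^esub> (sc b \<otimes>\<^bsub>R\<^esub> y) = sc a \<otimes>\<^bsub>R\<^esub> (x \<otimes>\<^bsub>R\<^esub> sc b) \<otimes>\<^bsub>R\<^esub> y"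
    using c by (simp add: R.m_assoc)
  also have "\<dots> = (sc a \<otimes>\<^bsub>R\<^esub> sc b) \<otimes>\<^bsub>R\<^esub> (x \<otimes>\<^bsub>R\<^esub> y)"
    using c sc_comm[OF assms(2,3)] by (simp add: R.m_assoc)
  finally show ?thesis using sc_mult assms by simp
qed

lemma cg_mult:
  assumes "cg (Suc m) x x'" "cg (Suc n) y y'" "x \<in> Aln m" "y' \<in> Aln n"
  shows "cg (Suc (m + n)) (x \<otimes>\<^bsub>R\<^esub> y) (x' \<otimes>\<^bsub>R\<^esub> y')"
  using cg_trans[OF cg_mult_left[OF assms(3,2)] ] cg_mult_right[OF assms(4,1)] by simp

text \<open>Modulo the next power the commutator is the Lie bracket of the classes of g - 1 and h -
  1, which is bilinear over A, and \<delta> respects it. Hence eigenvalues multiply.\<close>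

lemma eigv_comm:
  assumes g: "eigv m a g" and h: "eigv n b h" and a: "a \<in> carrier A" and b: "b \<in> carrier A"
  shows "eigv (m + n) (a \<otimes>\<^bsub>A\<^esub> b) (comm g h)"
proof -
  have F: "g \<in> F m" "h \<in> F n" "\<delta> g \<in> F m" "\<delta> h \<in> F n"
    using g h aut_pair_F_iff[OF pair] F_carrier by (auto simp: eigv_def)
  have c: "g \<in> carrier G" "h \<in> carrier G" using F F_carrier by auto
  have Al: "mo g \<in> Aln m" "mo h \<in> Aln n" "mo (\<delta> g) \<in> Aln m" "mo (\<delta> h) \<in> Aln n"
    using F by (simp_all only: F_iff)
  have sc: "sc a \<in> carrier R" "sc b \<in> carrier R" "sc (a \<otimes>\<^bsub>A\<^esub> b) \<in> carrier R" using a b mult_in by auto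
  let ?X = "mo g \<otimes>\<^bsub>R\<^esub> mo h" and ?Y = "mo h \<otimes>\<^bsub>R\<^esub> mo g"
  have X: "?X \<in> carrier R" "?Y \<in> carrier R" using c by auto
  have gc: "cg (Suc m) (mo (\<delta> g)) (sc a \<otimes>\<^bsub>R\<^esub> mo g)" "cg (Suc n) (mo (\<delta> h)) (sc b \<otimes>\<^bsub>R\<^esub> mo h)"
    using g h by (simp_all only: eigv_def)
  have 1: "cg (Suc (m + n)) (mo (\<delta> g) \<otimes>\<^bsub>R\<^esub> mo (\<delta> h)) (sc (a \<otimes>\<^bsub>A\<^esub> b) \<otimes>\<^bsub>R\<^esub> ?X)"
    using cg_mult[OF gc Al(3) Al_l[OF Al(2) sc(2)]] sc_mult_sc_mult[OF a b, of "mo g" "mo h"] c by simp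
  have 2: "cg (Suc (m + n)) (mo (\<delta> h) \<otimes>\<^bsub>R\<^esub> mo (\<delta> g)) (sc (a \<otimes>\<^bsub>A\<^esub> b) \<otimes>\<^bsub>R\<^esub> ?Y)"
    using cg_mult[OF gc(2,1) Al(4) Al_l[OF Al(1) sc(1)]] sc_mult_sc_mult[OF b a, of "mo h" "mo g"] c A.m_comm[OF a b]
    by (simp add: add.commute)
  have 3: "\<delta> (comm g h) = comm (\<delta> g) (\<delta> h)"
    using c by (simp add: comm_def cont_autD(6,7)[OF \<delta>])
  have "cg (Suc (m + n)) (mo (\<delta> (comm g h))) (mo (\<delta> g) \<otimes>\<^bsub>R\<^esub> mo (\<delta> h) \<ominus>\<^bsub>R\<^esub> mo (\<delta> h) \<otimes>\<^bsub>R\<^esub> mo (\<delta> g))"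
    unfolding 3 by (rule mo_comm(1)[OF F(3,4)])
  moreover have "cg (Suc (m + n)) (mo (\<delta> g) \<otimes>\<^bsub>R\<^esub> mo (\<delta> h) \<ominus>\<^bsub>R\<^esub> mo (\<delta> h) \<otimes>\<^bsub>R\<^esub> mo (\<delta> g))
      (sc (a \<otimes>\<^bsub>A\<^esub> b) \<otimes>\<^bsub>R\<^esub> (?X \<ominus>\<^bsub>R\<^esub> ?Y))"
    using cg_diff[OF 1 2] R.mult_diff_left[OF X sc(3)] by simp
  moreover have "cg (Suc (m + n)) (sc (a \<otimes>\<^bsub>A\<^esub> b) \<otimes>\<^bsub>R\<^esub> (?X \<ominus>\<^bsub>R\<^esub> ?Y)) (sc (a \<otimes>\<^bsub>A\<^esub> b) \<otimes>\<^bsub>R\<^esub> mo (comm g h))"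
    by (rule cg_sc[OF mult_in[OF a b] cg_sym[OF mo_comm(1)[OF F(1,2)]]])
  ultimately show ?thesis unfolding eigv_def using mo_comm(2)[OF F(1,2)] cg_trans by blast
qed

lemma eigv_iterated_comm:
  assumes y: "eigv (Suc 0) \<eta> y" and x: "eigv (Suc 0) \<psi> x" and c: "\<eta> \<in> carrier A" "\<psi> \<in> carrier A"
  shows "eigv (Suc b) (\<eta> [^]\<^bsub>A\<^esub> b \<otimes>\<^bsub>A\<^esub> \<psi>) (iterated_comm y x b)"
proof (induction b)
  case 0
  thus ?case using x c by simp
next
  case (Suc b)
  have "eigv (Suc 0 + Suc b) (\<eta> \<otimes>\<^bsub>A\<^esub> (\<eta> [^]\<^bsub>A\<^esub> b \<otimes>\<^bsub>A\<^esub> \<psi>)) (comm y (iterated_comm y x b))"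
    using c by (intro eigv_comm[OF y Suc]) auto
  moreover have "\<eta> \<otimes>\<^bsub>A\<^esub> (\<eta> [^]\<^bsub>A\<^esub> b \<otimes>\<^bsub>A\<^esub> \<psi>) = \<eta> [^]\<^bsub>A\<^esub> Suc b \<otimes>\<^bsub>A\<^esub> \<psi>"
    using c by (simp add: A.m_ac)
  ultimately show ?case by (simp del: A.nat_pow_Suc)
qed

text \<open>A form l factors through some G/U, where the A-power h of g agrees with a natural power
  g^j such that j \<equiv> a modulo p.\<close>

lemma cont_mod_hom_power:
  assumes g: "g \<in> carrier G" and a: "a \<in> carrier A"
  obtains h where "h \<in> carrier G" "cg 2 (mo h) (sc a \<otimes>\<^bsub>R\<^esub> mo g)"
    "\<And>l. cont_mod_hom l \<Longrightarrow> [l h = red 0 a * l g] (mod int p)"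
proof -
  obtain h t where h: "h \<in> carrier G" and t: "t \<in> I" and eq: "mo h = sc a \<otimes>\<^bsub>R\<^esub> mo g \<oplus>\<^bsub>R\<^esub> mo g \<otimes>\<^bsub>R\<^esub> t"
    and j: "\<And>U. U \<in> ON \<Longrightarrow> \<exists>j::nat. [int j = red 0 a] (mod int p) \<and> U #> h = U #> (g [^] j)"
    using power_exists[OF g a] by blast
  have Al: "mo g \<otimes>\<^bsub>R\<^esub> t \<in> Aln 2"
    using Al_mult_I[of "mo g" "Suc 0" t] mo_I[OF g] t unfolding I_eq_Al[symmetric] by (simp add: numeral_2_eq_2 del: Al.simps)
  have "t \<in> carrier R" using t by (simp add: I_iff)
  hence "mo h \<ominus>\<^bsub>R\<^esub> sc a \<otimes>\<^bsub>R\<^esub> mo g = mo g \<otimes>\<^bsub>R\<^esub> t"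
    using g a R.add_diff_cancel_left[of "mo g \<otimes>\<^bsub>R\<^esub> t" "sc a \<otimes>\<^bsub>R\<^esub> mo g"] by (simp add: eq R.a_comm)
  hence cgh: "cg 2 (mo h) (sc a \<otimes>\<^bsub>R\<^esub> mo g)" using Al g h a by (simp add: cg_def del: Al.simps)
  show thesis
  proof (rule that[OF h cgh])
    fix l assume l: "cont_mod_hom l"
    obtain U where U: "U \<in> ON" "\<And>g h. g \<in> carrier G \<Longrightarrow> h \<in> carrier G \<Longrightarrow> U #> g = U #> h \<Longrightarrow> [l g = l h] (mod int p)"
      using cont_mod_hom_coset[OF l] by blast
    obtain j :: nat where j: "[int j = red 0 a] (mod int p)" "U #> h = U #> (g [^] j)" using j[OF U(1)] by blast
    have "[l h = l (g [^] j)] (mod int p)" by (rule U(2)[OF h _ j(2)]) (use g in auto)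
    also have "[l (g [^] j) = int j * l g] (mod int p)" by (rule cont_mod_hom_pow[OF l g])
    also have "[int j * l g = red 0 a * l g] (mod int p)" by (intro cong_mult j cong_refl)
    finally show "[l h = red 0 a * l g] (mod int p)" .
  qed
qed

text \<open>The element y realizes in G the sum of w^i (\<delta>^i(g) - 1) over i < q, which is q
  times a spectral projection. Applying \<delta> and multiplying by w shifts this sum cyclically, so
  its eigenvalue is w^(-1) = w^(q-1).\<close>

lemma eigenvector_exists:
  assumes w: "w \<in> carrier A" "w [^]\<^bsub>A\<^esub> q = \<one>\<^bsub>A\<^esub>" and g: "g \<in> carrier G"
  obtains y where "y \<in> carrier G" "eigv (Suc 0) (w [^]\<^bsub>A\<^esub> (q - 1)) y"
    "\<And>l. cont_mod_hom l \<Longrightarrow> [l y = (\<Sum>i<q. red 0 w ^ i * l ((\<delta> ^^ i) g))] (mod int p)"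
proof -
  define tm where "tm = (\<lambda>i. sc (w [^]\<^bsub>A\<^esub> i) \<otimes>\<^bsub>R\<^esub> mo ((\<delta> ^^ i) g))"
  \<comment> \<open>Partial sums in the ring, built by recursion so that each can be matched modulo
    \<open>Aln 2\<close> with a product of powers in G.\<close>
  define Y where "Y = rec_nat \<zero>\<^bsub>R\<^esub> (\<lambda>i Z. Z \<oplus>\<^bsub>R\<^esub> tm i)"
  have Y: "Y 0 = \<zero>\<^bsub>R\<^esub>" "\<And>n. Y (Suc n) = Y n \<oplus>\<^bsub>R\<^esub> tm n" by (simp_all add: Y_def)
  have tc: "tm i \<in> carrier R" for i using w g by (simp add: tm_def)
  have Yc: "Y n \<in> carrier R" for n by (induction n) (auto simp: Y tc)
  have "\<exists>y\<in>carrier G. cg 2 (mo y) (Y n) \<and>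
      (\<forall>l. cont_mod_hom l \<longrightarrow> [l y = (\<Sum>i<n. red 0 w ^ i * l ((\<delta> ^^ i) g))] (mod int p))" for n
  proof (induction n)
    case 0
    have "cg 2 (mo \<one>) (Y 0)" by (simp add: Y mo_one cg_refl)
    thus ?case using cont_mod_hom_one by (intro bexI[of _ \<one>]) auto
  next
    case (Suc n)
    obtain y where y: "y \<in> carrier G" "cg 2 (mo y) (Y n)"
      "\<And>l. cont_mod_hom l \<Longrightarrow> [l y = (\<Sum>i<n. red 0 w ^ i * l ((\<delta> ^^ i) g))] (mod int p)" using Suc by blast
    obtain h where h: "h \<in> carrier G" "cg 2 (mo h) (tm n)"
      "\<And>l. cont_mod_hom l \<Longrightarrow> [l h = red 0 (w [^]\<^bsub>A\<^esub> n) * l ((\<delta> ^^ n) g)] (mod int p)"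
      unfolding tm_def by (rule cont_mod_hom_power[of "(\<delta> ^^ n) g" "w [^]\<^bsub>A\<^esub> n"]) (use g w in auto)
    have "cg 2 (mo (y \<otimes> h)) (mo y \<oplus>\<^bsub>R\<^esub> mo h)"
      using mo_mult_cg[of y "Suc 0" h] y h F_one by (simp add: numeral_2_eq_2)
    hence "cg 2 (mo (y \<otimes> h)) (Y (Suc n))" unfolding Y(2) using cg_trans cg_add[OF y(2) h(2)] by blast
    moreover have "[l (y \<otimes> h) = (\<Sum>i<Suc n. red 0 w ^ i * l ((\<delta> ^^ i) g))] (mod int p)" if l: "cont_mod_hom l" for l
    proof -
      have "[l (y \<otimes> h) = l y + l h] (mod int p)" by (rule cont_mod_hom_mult[OF l y(1) h(1)])
      also have "[l y + l h = (\<Sum>i<n. red 0 w ^ i * l ((\<delta> ^^ i) g)) + red 0 (w [^]\<^bsub>A\<^esub> n) * l ((\<delta> ^^ n) g)] (mod int p)"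
        by (intro cong_add y h l)
      also have "[(\<Sum>i<n. red 0 w ^ i * l ((\<delta> ^^ i) g)) + red 0 (w [^]\<^bsub>A\<^esub> n) * l ((\<delta> ^^ n) g) =
          (\<Sum>i<n. red 0 w ^ i * l ((\<delta> ^^ i) g)) + red 0 w ^ n * l ((\<delta> ^^ n) g)] (mod int p)"
        using red_power[OF w(1), of 0 n] e_0 by (intro cong_add cong_mult cong_refl) simp
      finally show ?thesis by simp
    qed
    ultimately show ?case using y h by (intro bexI[of _ "y \<otimes> h"]) auto
  qed
  then obtain y where y: "y \<in> carrier G" "cg 2 (mo y) (Y q)"
      "\<And>l. cont_mod_hom l \<Longrightarrow> [l y = (\<Sum>i<q. red 0 w ^ i * l ((\<delta> ^^ i) g))] (mod int p)" by blast
  have act_tm: "sc w \<otimes>\<^bsub>R\<^esub> act \<delta>' (tm n) = tm (Suc n)" for n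
  proof -
    have "act \<delta>' (tm n) = sc (w [^]\<^bsub>A\<^esub> n) \<otimes>\<^bsub>R\<^esub> mo (\<delta> ((\<delta> ^^ n) g))"
      unfolding tm_def using w g act_sc[OF \<delta>', of "w [^]\<^bsub>A\<^esub> n" "mo ((\<delta> ^^ n) g)"] by (simp add: aut_pair_mo[OF pair])
    thus ?thesis using w g by (simp add: tm_def sc_mult R.m_assoc[symmetric] A.m_comm)
  qed
  \<comment> \<open>The cyclic shift: \<delta> followed by w turns the terms 0, ..., n-1 into 1,
    ..., n, and \<open>mo g\<close> is the term 0. For n = q the extra term is again
    \<open>mo g\<close>, since w^q = 1 and \<delta>^q = 1, and can be cancelled.\<close>
  have "sc w \<otimes>\<^bsub>R\<^esub> act \<delta>' (Y n) \<oplus>\<^bsub>R\<^esub> mo g = Y (Suc n)" for n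
  proof (induction n)
    case 0
    have "act \<delta>' \<zero>\<^bsub>R\<^esub> = \<zero>\<^bsub>R\<^esub>"
      using act_el[OF \<delta>' one_closed zero_in] cont_autD(8)[OF \<delta>'] by (simp add: el_zero)
    thus ?case using w g by (simp add: Y tm_def el_one)
  next
    case (Suc n)
    have c: "sc w \<in> carrier R" "act \<delta>' (Y n) \<in> carrier R" "act \<delta>' (tm n) \<in> carrier R" "mo g \<in> carrier R"
      using w g Yc tc act_closed[OF \<delta>'] by auto
    have "sc w \<otimes>\<^bsub>R\<^esub> act \<delta>' (Y (Suc n)) \<oplus>\<^bsub>R\<^esub> mo g = (sc w \<otimes>\<^bsub>R\<^esub> act \<delta>' (Y n) \<oplus>\<^bsub>R\<^esub> mo g) \<oplus>\<^bsub>R\<^esub> sc w \<otimes>\<^bsub>R\<^esub> act \<delta>' (tm n)"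
      using c by (simp add: Y(2) act_add[OF \<delta>' Yc tc] R.r_distr R.a_ac)
    thus ?case by (simp add: Suc act_tm Y(2))
  qed
  hence "sc w \<otimes>\<^bsub>R\<^esub> act \<delta>' (Y q) \<oplus>\<^bsub>R\<^esub> mo g = Y q \<oplus>\<^bsub>R\<^esub> mo g"
    using w g by (simp add: Y(2) tm_def period el_one)
  hence fix1: "sc w \<otimes>\<^bsub>R\<^esub> act \<delta>' (Y q) = Y q"
    using w g Yc act_closed[OF \<delta>'] by simp
  have q1: "w [^]\<^bsub>A\<^esub> (q - 1) \<otimes>\<^bsub>A\<^esub> w = \<one>\<^bsub>A\<^esub>"
    using w prime_gt_0_nat[OF q(1)] A.nat_pow_Suc[of w "q - 1"] by simp
  have "act \<delta>' (Y q) = (sc (w [^]\<^bsub>A\<^esub> (q - 1)) \<otimes>\<^bsub>R\<^esub> sc w) \<otimes>\<^bsub>R\<^esub> act \<delta>' (Y q)"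
    using w Yc act_closed[OF \<delta>'] q1 by (simp add: sc_mult el_one)
  also have "\<dots> = sc (w [^]\<^bsub>A\<^esub> (q - 1)) \<otimes>\<^bsub>R\<^esub> Y q"
    using w Yc act_closed[OF \<delta>'] by (simp add: R.m_assoc fix1)
  finally have actY: "act \<delta>' (Y q) = sc (w [^]\<^bsub>A\<^esub> (q - 1)) \<otimes>\<^bsub>R\<^esub> Y q" .
  have wq: "w [^]\<^bsub>A\<^esub> (q - 1) \<in> carrier A" using w by simp
  have "cg 2 (mo (\<delta> y)) (sc (w [^]\<^bsub>A\<^esub> (q - 1)) \<otimes>\<^bsub>R\<^esub> mo y)"
    using cg_trans[OF act_cg[OF \<delta>' y(2), unfolded actY] cg_sc[OF wq cg_sym[OF y(2)]]] 
    by (simp add: aut_pair_mo[OF pair y(1)])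
  hence "eigv (Suc 0) (w [^]\<^bsub>A\<^esub> (q - 1)) y" using y(1) F_one by (simp add: eigv_def numeral_2_eq_2)
  thus thesis using that y by blast
qed

end

section \<open>Detection of a nontrivial action by homomorphisms to Z/p\<close>

context completed
begin

lemma cont_mod_hom_quotient:
  assumes W: "W \<in> ON" and l: "mod_hom p (G Mod W) l" and W0: "l W = 0"
  shows "cont_mod_hom (\<lambda>g. l (W #> g))"
  unfolding cont_mod_hom_def mod_hom_def
proof (intro conjI ballI bexI[OF _ W])
  fix x y assume "x \<in> carrier G" "y \<in> carrier G"
  thus "[l (W #> (x \<otimes> y)) = l (W #> x) + l (W #> y)] (mod int p)"
    using l coset_mult[OF W, of x y] quot_coset[of x W] quot_coset[of y W] unfolding mod_hom_def by fastforce
next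
  fix u assume "u \<in> W"
  hence "W #> u = W" using coset_join2[OF _ ON_D(3)[OF W]] ON_sub[OF W] by blast
  thus "[l (W #> u) = 0] (mod int p)" using W0 by simp
qed

end

context cyclic_action
begin

text \<open>The intersection of the q images of U under the powers of \<delta> is invariant, because
  these images are permuted cyclically.\<close>

lemma invariant_open_normal:
  assumes U: "U \<in> ON"
  obtains W where "W \<in> ON" "W \<subseteq> U" "\<delta> ` W = W"
proof -
  define W where "W = (\<Inter>i\<in>{..<q}. (\<delta> ^^ i) ` U)"
  have q0: "q > 0" using prime_gt_0_nat[OF q(1)] .
  have "(\<delta> ^^ i) ` U \<in> ON" for i
  proof (induction i)
    case (Suc i)
    have "(\<delta> ^^ Suc i) ` U = \<delta> ` ((\<delta> ^^ i) ` U)" by (simp add: image_image)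
    thus ?case using cont_aut_ON[OF \<delta> Suc] by simp
  qed (simp add: U)
  hence W: "W \<in> ON" unfolding W_def using q0 by (intro finite_INT_ON) auto
  have sub: "\<delta> x \<in> W" if x: "x \<in> W" for x
  proof -
    have "\<delta> x \<in> (\<delta> ^^ i) ` U" if i: "i < q" for i
    proof (cases i)
      \<comment> \<open>The image with index 0 is reached from the one with index q - 1, because
        \<delta>^q = 1.\<close>
      case 0
      have "x \<in> (\<delta> ^^ (q - 1)) ` U" using x q0 by (simp add: W_def)
      then obtain u where u: "u \<in> U" "x = (\<delta> ^^ (q - 1)) u" by blast
      have "\<delta> x = (\<delta> ^^ Suc (q - 1)) u" by (simp add: u)
      also have "\<dots> = u" using period[of u] u ON_sub[OF U] q0 by (auto simp del: funpow.simps)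
      finally show ?thesis using u 0 by simp
    next
      case (Suc j)
      have "x \<in> (\<delta> ^^ j) ` U" using x i Suc by (simp add: W_def)
      then obtain u where u: "u \<in> U" "x = (\<delta> ^^ j) u" by blast
      thus ?thesis using Suc by auto
    qed
    thus ?thesis by (auto simp: W_def)
  qed
  have pow: "(\<delta> ^^ i) x \<in> W" if "x \<in> W" for x i by (induction i) (use that sub in auto)
  have "W \<subseteq> \<delta> ` W"
  proof
    fix x assume x: "x \<in> W"
    have "\<delta> ((\<delta> ^^ (q - 1)) x) = (\<delta> ^^ Suc (q - 1)) x" by simp
    also have "\<dots> = x" using period[of x] x ON_sub[OF W] q0 by (auto simp del: funpow.simps)
    finally show "x \<in> \<delta> ` W" using pow[OF x, of "q - 1"] by (metis image_eqI)
  qed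
  hence "\<delta> ` W = W" using sub by blast
  moreover have "W \<subseteq> U" using q0 INT_lower[of 0 "{..<q}" "\<lambda>i. (\<delta> ^^ i) ` U"] by (simp add: W_def)
  ultimately show thesis using that W by blast
qed

text \<open>
  Otherwise the fixed points of \<open>\<delta>\<close> in some finite quotient form a proper subgroup, which is killed by
  a nonzero homomorphism l. The order q of \<open>\<delta>\<close> does not divide the size of a fibre of l, so every fibre
  contains a fixed point.
\<close>

lemma trivial_if_mod_homs_invariant:
  assumes inv: "\<And>l g. cont_mod_hom l \<Longrightarrow> g \<in> carrier G \<Longrightarrow> [l (\<delta> g) = l g] (mod int p)"
    and g0: "g0 \<in> carrier G"
  shows "\<delta> g0 = g0"
proof (rule ccontr)
  assume ne: "\<delta> g0 \<noteq> g0"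
  have "\<delta> g0 \<otimes> inv g0 \<noteq> \<one>" using ne g0 inv_equality[of "\<delta> g0" "inv g0"] by auto
  then obtain U where U: "U \<in> ON" "\<delta> g0 \<otimes> inv g0 \<notin> U" using open_normal_separates[of "\<delta> g0 \<otimes> inv g0"] g0 by auto
  obtain W where W: "W \<in> ON" "W \<subseteq> U" "\<delta> ` W = W" using invariant_open_normal[OF U(1)] .
  interpret P: group "G Mod W" by (rule ON_D(4)[OF W(1)])
  have im: "\<delta> ` (W #> g) = W #> \<delta> g" if "g \<in> carrier G" for g
    using cont_aut_coset[OF \<delta> ON_sub[OF W(1)] that] W(3) by simp
  define C where "C = {D \<in> quot W. \<delta> ` D = D}"
  have "subgroup C (G Mod W)"
  proof (rule P.subgroupI)
    show "C \<subseteq> quot W" by (auto simp: C_def)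
    have "W \<in> C" using W by (simp add: C_def)
    thus "C \<noteq> {}" by blast
  next
    fix D assume D: "D \<in> C"
    then obtain g where g: "g \<in> carrier G" "D = W #> g" by (auto simp: C_def elim: quot_cases)
    hence "W #> \<delta> g = W #> g" using D im by (simp add: C_def)
    hence "inv\<^bsub>G Mod W\<^esub> (W #> \<delta> g) = inv\<^bsub>G Mod W\<^esub> (W #> g)" by simp
    hence "W #> \<delta> (inv g) = W #> inv g" using g by (simp add: quot_inv[OF W(1)] cont_autD(7)[OF \<delta>])
    thus "inv\<^bsub>G Mod W\<^esub> D \<in> C" using g by (simp add: C_def quot_inv[OF W(1)] im)
  next
    fix D E assume D: "D \<in> C" and E: "E \<in> C"
    then obtain g where g: "g \<in> carrier G" "D = W #> g" by (auto simp: C_def elim: quot_cases)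
    obtain h where h: "h \<in> carrier G" "E = W #> h" using E by (auto simp: C_def elim: quot_cases)
    have "W #> \<delta> g = W #> g" "W #> \<delta> h = W #> h" using D E g h im by (simp_all add: C_def)
    hence "W #> (\<delta> g \<otimes> \<delta> h) = W #> (g \<otimes> h)" using g h coset_mult[OF W(1)] by (metis \<delta>_closed)
    thus "D \<otimes>\<^bsub>G Mod W\<^esub> E \<in> C"
      using g h by (simp add: C_def coset_mult[OF W(1)] im cont_autD(6)[OF \<delta>])
  qed
  moreover have "C \<noteq> quot W"
  proof
    assume "C = quot W"
    hence "W #> g0 \<in> C" using quot_coset[OF g0, of W] by simp
    hence "W #> \<delta> g0 = W #> g0" using im[OF g0] by (simp add: C_def)
    thus False using coset_eq_iff[OF W(1), of "\<delta> g0" g0] g0 U(2) W(2) by auto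
  qed
  moreover obtain k where k: "order (G Mod W) = p ^ k" using order_quotient[OF W(1)] by blast
  ultimately obtain l where l: "mod_hom p (G Mod W) l" "\<And>D. D \<in> C \<Longrightarrow> l D = 0" "\<exists>x\<in>quot W. \<not> int p dvd l x"
    using P.proper_subgroup_killed_by_mod_hom[OF prime_p k] by blast
  obtain x where x: "x \<in> quot W" "\<not> int p dvd l x" using l(3) by blast
  have L: "cont_mod_hom (\<lambda>g. l (W #> g))"
    using W by (intro cont_mod_hom_quotient l(1,2)) (simp_all add: C_def)
  \<comment> \<open>A fibre of l on which l is nonzero modulo p. Fixed cosets lie in C, where l
    vanishes, so this fibre has none and its size is divisible by q.\<close>
  define Z where "Z = {D \<in> quot W. [l D = l x] (mod int p)}"
  have lm: "[l (D \<otimes>\<^bsub>G Mod W\<^esub> E) = l D + l E] (mod int p)" if "D \<in> quot W" "E \<in> quot W" for D E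
    using l(1) that unfolding mod_hom_def by blast
  have "[card {D \<in> Z. \<delta> ` D = D} = card Z] (mod q)"
  proof (rule card_fixed_points_of_period_prime[OF q(1)])
    show "finite Z" using finite_quotient[OF W(1)] by (simp add: Z_def)
  next
    fix D assume D: "D \<in> Z"
    then obtain g where g: "g \<in> carrier G" "D = W #> g" by (auto simp: Z_def elim: quot_cases)
    have "[l (W #> \<delta> g) = l x] (mod int p)" using cong_trans[OF inv[OF L g(1)]] D g by (simp add: Z_def)
    thus "\<delta> ` D \<in> Z" using g by (simp add: Z_def im)
    have "(((`) \<delta>) ^^ i) (W #> g) = W #> (\<delta> ^^ i) g" for i
      by (induction i) (use g im in auto)
    thus "(((`) \<delta>) ^^ q) D = D" using g period by simp
  qed
  moreover have "{D \<in> Z. \<delta> ` D = D} = {}"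
  proof (rule ccontr)
    assume "{D \<in> Z. \<delta> ` D = D} \<noteq> {}"
    then obtain D where D: "D \<in> Z" "\<delta> ` D = D" by blast
    hence "l D = 0" using l(2) by (simp add: C_def Z_def)
    moreover have "[l D = l x] (mod int p)" using D by (simp add: Z_def)
    ultimately have "[l x = 0] (mod int p)" by (metis cong_sym)
    thus False using x(2) by (simp add: cong_0_iff)
  qed
  ultimately have "[card Z = 0] (mod q)" by (metis card.empty cong_sym)
  hence "q dvd card Z" by (simp add: cong_0_iff)
  \<comment> \<open>The fibre is a translate of the kernel K, so its size divides
    \<open>p ^ k\<close>.\<close>
  define K where "K = {D \<in> quot W. [l D = 0] (mod int p)}"
  have l1: "l \<one>\<^bsub>G Mod W\<^esub> = 0" using W l(2) by (simp add: C_def)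
  have linv: "[l (inv\<^bsub>G Mod W\<^esub> D) = - l D] (mod int p)" if "D \<in> quot W" for D
  proof -
    have "[l (inv\<^bsub>G Mod W\<^esub> D) + l D = 0] (mod int p)"
      using cong_sym[OF lm[OF P.inv_closed[OF that] that]] unfolding P.l_inv[OF that] l1 .
    thus ?thesis by (simp add: cong_iff_dvd_diff)
  qed
  have K: "subgroup K (G Mod W)"
  proof (rule P.subgroupI)
    have "\<one>\<^bsub>G Mod W\<^esub> \<in> K" using l1 P.one_closed unfolding K_def by simp
    thus "K \<noteq> {}" by blast
    fix D assume D: "D \<in> K"
    hence "[- l D = - 0] (mod int p)" using cong_minus_minus_iff[of "l D" 0 "int p"] by (simp add: K_def)
    thus "inv\<^bsub>G Mod W\<^esub> D \<in> K" using cong_trans[OF linv, of D 0] D by (simp add: K_def)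
    fix E assume E: "E \<in> K"
    have "[l D + l E = 0 + 0] (mod int p)" using D E by (intro cong_add) (auto simp: K_def)
    thus "D \<otimes>\<^bsub>G Mod W\<^esub> E \<in> K" using cong_trans[OF lm[of D E]] D E P.m_closed unfolding K_def by simp
  qed (simp add: K_def)
  have "bij_betw (\<lambda>D. D \<otimes>\<^bsub>G Mod W\<^esub> x) K Z"
  proof (rule bij_betw_byWitness[where f' = "\<lambda>D. D \<otimes>\<^bsub>G Mod W\<^esub> inv\<^bsub>G Mod W\<^esub> x"])
    show "(\<lambda>D. D \<otimes>\<^bsub>G Mod W\<^esub> x) ` K \<subseteq> Z"
    proof (intro image_subsetI)
      fix D assume D: "D \<in> K"
      have "[l D + l x = 0 + l x] (mod int p)" using D by (intro cong_add) (auto simp: K_def)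
      thus "D \<otimes>\<^bsub>G Mod W\<^esub> x \<in> Z" using cong_trans[OF lm[of D x]] D x P.m_closed unfolding Z_def K_def by simp
    qed
    show "(\<lambda>D. D \<otimes>\<^bsub>G Mod W\<^esub> inv\<^bsub>G Mod W\<^esub> x) ` Z \<subseteq> K"
    proof (intro image_subsetI)
      fix D assume D: "D \<in> Z"
      have "[l D + l (inv\<^bsub>G Mod W\<^esub> x) = l x + - l x] (mod int p)" using D x linv by (intro cong_add) (auto simp: Z_def)
      thus "D \<otimes>\<^bsub>G Mod W\<^esub> inv\<^bsub>G Mod W\<^esub> x \<in> K"
        using cong_trans[OF lm[of D "inv\<^bsub>G Mod W\<^esub> x"]] D x P.m_closed P.inv_closed unfolding Z_def K_def by simp
    qed
  qed (use x in \<open>auto simp: K_def Z_def P.m_assoc simp del: mult_FactGroup one_FactGroup\<close>)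
  hence "card Z = card K" by (simp add: bij_betw_same_card)
  moreover have "card K dvd p ^ k" using P.lagrange[OF K] k by (metis dvd_triv_right)
  ultimately have "q dvd p ^ k" using \<open>q dvd card Z\<close> dvd_trans by metis
  hence "q dvd p" using prime_dvd_power[OF q(1)] by blast
  hence "q = p" using primes_dvd_imp_eq[OF q(1) prime_p] by simp
  thus False using q_not_dvd by simp
qed

text \<open>Orthogonality of characters: summed over j, the coefficients z^(j i) vanish modulo p
  unless i = 0. Since q is prime to p, the values of l on the projections of g therefore determine
  l(g) modulo p.\<close>

lemma sum_of_projections:
  assumes z: "[z ^ q = 1] (mod int p)" "\<not> [z = 1] (mod int p)" and g: "g \<in> carrier G"
  shows "[(\<Sum>j<q. \<Sum>i<q. z ^ (j * i) * l ((\<delta> ^^ i) g)) = int q * l g] (mod int p)"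
proof -
  have q0: "q > 0" using prime_gt_0_nat[OF q(1)] .
  have "(\<Sum>j<q. \<Sum>i<q. z ^ (j * i) * l ((\<delta> ^^ i) g)) = (\<Sum>i<q. (\<Sum>j<q. z ^ (j * i)) * l ((\<delta> ^^ i) g))"
    by (subst sum.swap) (simp add: sum_distrib_right)
  also have "[\<dots> = (\<Sum>i<q. if i = 0 then int q * l g else 0)] (mod int p)"
  proof (rule cong_sum)
    fix i assume i: "i \<in> {..<q}"
    show "[(\<Sum>j<q. z ^ (j * i)) * l ((\<delta> ^^ i) g) = (if i = 0 then int q * l g else 0)] (mod int p)"
    proof (cases "i = 0")
      case False
      hence "\<not> q dvd i" using i by (auto dest: dvd_imp_le)
      from cong_mult[OF sum_powers_root_of_unity[OF prime_p q(1) z this] cong_refl[of "l ((\<delta> ^^ i) g)"]]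
      show ?thesis using False by simp
    qed simp
  qed
  finally show ?thesis using q0 by simp
qed

text \<open>\<open>eigenvector_exists\<close> for w = \<zeta>^j, with the values of l brought into
  the shape summed in \<open>sum_of_projections\<close>.\<close>

lemma projections:
  assumes \<zeta>: "\<zeta> \<in> carrier A" "\<zeta> [^]\<^bsub>A\<^esub> q = \<one>\<^bsub>A\<^esub>" and g: "g \<in> carrier G"
  obtains x where "x \<in> carrier G" "eigv (Suc 0) ((\<zeta> [^]\<^bsub>A\<^esub> j) [^]\<^bsub>A\<^esub> (q - 1)) x"
    "\<And>l. cont_mod_hom l \<Longrightarrow> [l x = (\<Sum>i<q. red 0 \<zeta> ^ (j * i) * l ((\<delta> ^^ i) g))] (mod int p)"
proof -
  have wq: "(\<zeta> [^]\<^bsub>A\<^esub> j) [^]\<^bsub>A\<^esub> q = \<one>\<^bsub>A\<^esub>"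
    using \<zeta> A.nat_pow_pow[of \<zeta> j q] A.nat_pow_pow[of \<zeta> q j] by (simp add: mult.commute)
  obtain x where x: "x \<in> carrier G" "eigv (Suc 0) ((\<zeta> [^]\<^bsub>A\<^esub> j) [^]\<^bsub>A\<^esub> (q - 1)) x"
    "\<And>l. cont_mod_hom l \<Longrightarrow> [l x = (\<Sum>i<q. red 0 (\<zeta> [^]\<^bsub>A\<^esub> j) ^ i * l ((\<delta> ^^ i) g))] (mod int p)"
    by (rule eigenvector_exists[OF _ wq g]) (use \<zeta> in auto)
  have "[red 0 (\<zeta> [^]\<^bsub>A\<^esub> j) = red 0 \<zeta> ^ j] (mod int p)" using red_power[OF \<zeta>(1), of 0 j] e_0 by simp
  hence "[(\<Sum>i<q. red 0 (\<zeta> [^]\<^bsub>A\<^esub> j) ^ i * l ((\<delta> ^^ i) g)) = (\<Sum>i<q. (red 0 \<zeta> ^ j) ^ i * l ((\<delta> ^^ i) g))] (mod int p)" for l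
    by (intro cong_sum cong_mult cong_pow cong_refl)
  hence "[l x = (\<Sum>i<q. red 0 \<zeta> ^ (j * i) * l ((\<delta> ^^ i) g))] (mod int p)" if "cont_mod_hom l" for l
    using cong_trans[OF x(3)[OF that]] by (simp add: power_mult)
  with x show thesis using that by blast
qed

lemma primitive_root_of_unity:
  obtains \<zeta> where "\<zeta> \<in> carrier A" "\<zeta> [^]\<^bsub>A\<^esub> q = \<one>\<^bsub>A\<^esub>" "[red 0 \<zeta> ^ q = 1] (mod int p)" "\<not> [red 0 \<zeta> = 1] (mod int p)"
proof -
  obtain z :: int where z: "[z ^ q = 1] (mod int p)" "\<not> [z = 1] (mod int p)"
    using root_of_unity_mod_prime_exists[OF prime_p q] by blast
  obtain \<zeta> where \<zeta>: "\<zeta> \<in> carrier A" "\<zeta> [^]\<^bsub>A\<^esub> q = \<one>\<^bsub>A\<^esub>" "[red 0 \<zeta> = z] (mod int p)"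
    using root_of_unity_lift[OF q(2) z(1)] .
  have "[red 0 \<zeta> ^ q = 1] (mod int p)" using red_root_of_unity[OF \<zeta>(1,2), of 0] e_0 by simp
  moreover have "\<not> [red 0 \<zeta> = 1] (mod int p)" using z(2) cong_trans[OF cong_sym[OF \<zeta>(3)]] by blast
  ultimately show thesis using that \<zeta> by blast
qed

text \<open>Some form l is not invariant under \<delta>. If l vanished on all projections with j
  \<noteq> 0, then q l would be its value on the projection for j = 0, which is invariant.\<close>

lemma nontrivial_eigenvector:
  assumes g0: "g0 \<in> carrier G" "\<delta> g0 \<noteq> g0"
  obtains \<eta> y l where "\<eta> \<in> carrier A" "\<eta> [^]\<^bsub>A\<^esub> q = \<one>\<^bsub>A\<^esub>" "\<not> [red 0 \<eta> = 1] (mod int p)"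
    "y \<in> carrier G" "eigv (Suc 0) \<eta> y" "cont_mod_hom l" "\<not> int p dvd l y"
proof -
  obtain \<zeta> where \<zeta>: "\<zeta> \<in> carrier A" "\<zeta> [^]\<^bsub>A\<^esub> q = \<one>\<^bsub>A\<^esub>" and z: "[red 0 \<zeta> ^ q = 1] (mod int p)" "\<not> [red 0 \<zeta> = 1] (mod int p)"
    using primitive_root_of_unity .
  obtain l g where l: "cont_mod_hom l" and g: "g \<in> carrier G" and lg: "\<not> [l (\<delta> g) = l g] (mod int p)"
    using trivial_if_mod_homs_invariant[OF _ g0(1)] g0(2) by blast
  let ?S = "\<lambda>j g. \<Sum>i<q. red 0 \<zeta> ^ (j * i) * l ((\<delta> ^^ i) g)"
  have q0: "q > 0" using prime_gt_0_nat[OF q(1)] .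
  have "\<exists>j g. 0 < j \<and> j < q \<and> g \<in> carrier G \<and> \<not> [?S j g = 0] (mod int p)"
  proof (rule ccontr)
    assume "\<not> ?thesis"
    hence S: "[?S j h = 0] (mod int p)" if "0 < j" "j < q" "h \<in> carrier G" for j h using that by blast
    have ql: "[int q * l h = ?S 0 h] (mod int p)" if h: "h \<in> carrier G" for h
    proof -
      have "[(\<Sum>j<q. ?S j h) = (\<Sum>j<q. if j = 0 then ?S 0 h else 0)] (mod int p)"
        by (rule cong_sum) (use S h in auto)
      hence "[(\<Sum>j<q. ?S j h) = ?S 0 h] (mod int p)" using q0 by simp
      thus ?thesis using sum_of_projections[OF z h, of l] cong_sym cong_trans by blast
    qed
    \<comment> \<open>Replacing g by \<delta> g shifts the summation by one, and \<delta>^q = 1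
      closes the cycle.\<close>
    have "?S 0 (\<delta> g) = (\<Sum>i<q. l ((\<delta> ^^ Suc i) g))" by (simp add: funpow_swap1)
    also have "\<dots> = (\<Sum>i<Suc q. l ((\<delta> ^^ i) g)) - l g" by (subst sum.lessThan_Suc_shift) simp
    also have "\<dots> = ?S 0 g" using period[OF g] by simp
    finally have "[int q * l (\<delta> g) = int q * l g] (mod int p)"
      using ql[of "\<delta> g"] ql[OF g] g cong_sym cong_trans by (metis \<delta>_closed)
    moreover have "coprime (int q) (int p)"
      using prime_imp_coprime[of "int p" "int q"] prime_p q_not_dvd by (simp add: coprime_commute)
    ultimately have "[l (\<delta> g) = l g] (mod int p)" by (simp add: cong_mult_lcancel)
    thus False using lg by blast
  qed
  then obtain j h where j: "0 < j" "j < q" and h: "h \<in> carrier G" and S: "\<not> [?S j h = 0] (mod int p)" by blast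
  obtain y where y: "y \<in> carrier G" "eigv (Suc 0) ((\<zeta> [^]\<^bsub>A\<^esub> j) [^]\<^bsub>A\<^esub> (q - 1)) y" "[l y = ?S j h] (mod int p)"
    using projections[OF \<zeta> h, of j] l by metis
  have eq: "(\<zeta> [^]\<^bsub>A\<^esub> j) [^]\<^bsub>A\<^esub> (q - 1) = \<zeta> [^]\<^bsub>A\<^esub> (j * (q - 1))" using \<zeta> by (simp add: A.nat_pow_pow)
  have "(\<zeta> [^]\<^bsub>A\<^esub> (j * (q - 1))) [^]\<^bsub>A\<^esub> q = \<one>\<^bsub>A\<^esub>"
    using \<zeta> A.nat_pow_pow[of \<zeta> "j * (q - 1)" q] A.nat_pow_pow[of \<zeta> q "j * (q - 1)"] by (simp add: mult.commute)
  moreover have "\<not> [red 0 (\<zeta> [^]\<^bsub>A\<^esub> (j * (q - 1))) = 1] (mod int p)"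
  proof
    assume "[red 0 (\<zeta> [^]\<^bsub>A\<^esub> (j * (q - 1))) = 1] (mod int p)"
    hence "[red 0 \<zeta> ^ (j * (q - 1)) = 1] (mod int p)"
      using cong_trans[OF cong_sym[OF red_power[OF \<zeta>(1), of 0 "j * (q - 1)", unfolded e_0 power_one_right]]] by blast
    \<comment> \<open>The eigenvalue is \<zeta>^(-j), written with the exponent j (q - 1); as 0 < j
      < q and q is prime, it is not 1.\<close>
    moreover have "\<not> q dvd j * (q - 1)"
      using q(1) j prime_gt_1_nat[OF q(1)] by (auto simp: prime_dvd_mult_iff dest: dvd_imp_le)
    ultimately show False using power_cong_1_imp[OF q(1) z(1)] z(2) by blast
  qed
  moreover have "\<not> int p dvd l y" using S y(3) cong_trans by (auto simp: cong_0_iff cong_dvd_iff)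
  ultimately show thesis using that[of "\<zeta> [^]\<^bsub>A\<^esub> (j * (q - 1))" y l] \<zeta> y l eq by simp
qed

text \<open>A finite quotient in which two elements fail to commute is not cyclic, so y generates a
  proper subgroup of it, and some form m kills y but not some h. As q m(h) is the sum of m over the
  projections of h, one of these is not killed by m and serves as x.\<close>

lemma second_eigenvector:
  assumes y: "y \<in> carrier G" and nc: "\<not> comm_group G"
  obtains \<psi> x m where "\<psi> \<in> carrier A" "\<psi> [^]\<^bsub>A\<^esub> q = \<one>\<^bsub>A\<^esub>"
    "x \<in> carrier G" "eigv (Suc 0) \<psi> x" "cont_mod_hom m" "int p dvd m y" "\<not> int p dvd m x"
proof -
  obtain \<zeta> where \<zeta>: "\<zeta> \<in> carrier A" "\<zeta> [^]\<^bsub>A\<^esub> q = \<one>\<^bsub>A\<^esub>" and z: "[red 0 \<zeta> ^ q = 1] (mod int p)" "\<not> [red 0 \<zeta> = 1] (mod int p)"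
    using primitive_root_of_unity .
  obtain a b where ab: "a \<in> carrier G" "b \<in> carrier G" "a \<otimes> b \<noteq> b \<otimes> a"
    using nc group_comm_groupI by blast
  have "a \<otimes> b \<otimes> inv (b \<otimes> a) \<noteq> \<one>" using ab inv_equality[of "a \<otimes> b" "inv (b \<otimes> a)"] by auto
  then obtain U where U: "U \<in> ON" "a \<otimes> b \<otimes> inv (b \<otimes> a) \<notin> U"
    using open_normal_separates[of "a \<otimes> b \<otimes> inv (b \<otimes> a)"] ab by auto
  interpret P: group "G Mod U" by (rule ON_D(4)[OF U(1)])
  define C where "C = generate (G Mod U) {U #> y}"
  have yU: "U #> y \<in> quot U" using y by simp
  have "C \<noteq> quot U"
  proof
    assume "C = quot U"
    hence "U #> a \<in> C" "U #> b \<in> C" using ab by simp_all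
    then obtain i j :: int where "U #> a = (U #> y) [^]\<^bsub>G Mod U\<^esub> i" "U #> b = (U #> y) [^]\<^bsub>G Mod U\<^esub> j"
      unfolding C_def P.generate_pow[OF yU] by blast
    hence "(U #> a) \<otimes>\<^bsub>G Mod U\<^esub> (U #> b) = (U #> b) \<otimes>\<^bsub>G Mod U\<^esub> (U #> a)"
      using P.int_pow_mult[OF yU, of i j] P.int_pow_mult[OF yU, of j i] by (simp add: add.commute del: mult_FactGroup)
    hence "U #> (a \<otimes> b) = U #> (b \<otimes> a)" using ab by (simp add: coset_mult[OF U(1)])
    thus False using coset_eq_iff[OF U(1), of "a \<otimes> b" "b \<otimes> a"] ab U(2) by simp
  qed
  moreover have "subgroup C (G Mod U)" unfolding C_def using yU by (intro P.generate_is_subgroup) auto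
  moreover obtain k where k: "order (G Mod U) = p ^ k" using order_quotient[OF U(1)] by blast
  ultimately obtain l where l: "mod_hom p (G Mod U) l" "\<And>D. D \<in> C \<Longrightarrow> l D = 0" "\<exists>x\<in>quot U. \<not> int p dvd l x"
    using P.proper_subgroup_killed_by_mod_hom[OF prime_p k] by blast
  obtain D where "D \<in> quot U" "\<not> int p dvd l D" using l(3) by blast
  then obtain h where h: "h \<in> carrier G" "\<not> int p dvd l (U #> h)" by (auto elim: quot_cases)
  define m where "m = (\<lambda>g. l (U #> g))"
  have "\<one>\<^bsub>G Mod U\<^esub> \<in> C" unfolding C_def by (rule generate.one)
  hence m: "cont_mod_hom m" unfolding m_def by (intro cont_mod_hom_quotient U(1) l(1) l(2)) simp
  have my: "m y = 0" using l(2)[of "U #> y"] generate.incl[of "U #> y" "{U #> y}" "G Mod U"] by (simp add: m_def C_def)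
  let ?S = "\<lambda>j. \<Sum>i<q. red 0 \<zeta> ^ (j * i) * m ((\<delta> ^^ i) h)"
  have "\<exists>j<q. \<not> [?S j = 0] (mod int p)"
  proof (rule ccontr)
    assume "\<not> ?thesis"
    hence "[(\<Sum>j<q. ?S j) = (\<Sum>j<q. 0)] (mod int p)" by (intro cong_sum) auto
    hence "[(\<Sum>j<q. ?S j) = 0] (mod int p)" by simp
    hence "[int q * m h = 0] (mod int p)" by (rule cong_trans[OF cong_sym[OF sum_of_projections[OF z h(1), of m]]])
    hence "int p dvd int q \<or> int p dvd m h" using prime_dvd_multD[of "int p" "int q" "m h"] prime_p by (simp add: cong_0_iff)
    thus False using q_not_dvd h(2) by (simp add: m_def)
  qed
  then obtain j where j: "\<not> [?S j = 0] (mod int p)" by blast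
  obtain x where x: "x \<in> carrier G" "eigv (Suc 0) ((\<zeta> [^]\<^bsub>A\<^esub> j) [^]\<^bsub>A\<^esub> (q - 1)) x" "[m x = ?S j] (mod int p)"
    using projections[OF \<zeta> h(1), of j] m by metis
  have "((\<zeta> [^]\<^bsub>A\<^esub> j) [^]\<^bsub>A\<^esub> (q - 1)) [^]\<^bsub>A\<^esub> q = \<one>\<^bsub>A\<^esub>"
    using \<zeta> A.nat_pow_pow[of \<zeta> q "j * (q - 1)"] by (simp add: A.nat_pow_pow mult_ac)
  moreover have "\<not> int p dvd m x" using j x(3) by (auto simp: cong_0_iff cong_dvd_iff)
  ultimately show thesis using that[of "(\<zeta> [^]\<^bsub>A\<^esub> j) [^]\<^bsub>A\<^esub> (q - 1)" x m] x m my \<zeta> by simp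
qed

end

section \<open>Infinite rank of the eigenspaces\<close>

context pro_p
begin

lemma top_AutoGroup_carrier: "f \<in> carrier (top_AutoGroup G T) \<longleftrightarrow> cont_aut f"
  by (auto simp: top_AutoGroup_def cont_aut_def)

lemma cont_aut_Bij: "cont_aut f \<Longrightarrow> f \<in> Bij (carrier G)"
  by (simp add: cont_aut_def auto_def)

lemma top_AutoGroup_ops:
  "\<one>\<^bsub>top_AutoGroup G T\<^esub> = (\<lambda>x\<in>carrier G. x)"
  "cont_aut f \<Longrightarrow> cont_aut g \<Longrightarrow> f \<otimes>\<^bsub>top_AutoGroup G T\<^esub> g = compose (carrier G) f g"
  by (auto simp: top_AutoGroup_def AutoGroup_def BijGroup_def cont_aut_Bij)

text \<open>The point is closure under inverses. The inverse in \<open>AutoGroup\<close> is an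
  extensional function that agrees on the carrier with the continuous inverse, and being a
  homeomorphism depends only on the values there.\<close>

lemma group_top_AutoGroup: "group (top_AutoGroup G T)"
proof -
  interpret Aut: group "AutoGroup G" by (rule AutoGroup)
  interpret Bij: group "BijGroup (carrier G)" by (rule group_BijGroup)
  let ?C = "{f \<in> auto G. homeomorphic_map T T f}"
  have mult: "f \<otimes>\<^bsub>AutoGroup G\<^esub> g = compose (carrier G) f g" if "f \<in> auto G" "g \<in> auto G" for f g
    using that by (simp add: AutoGroup_def BijGroup_def auto_def)
  have "subgroup ?C (AutoGroup G)"
  proof (rule Aut.subgroupI)
    show "?C \<subseteq> carrier (AutoGroup G)" by (auto simp: AutoGroup_def)
    have "homeomorphic_map T T (\<lambda>x\<in>carrier G. x)"
      by (rule homeomorphic_map_eq[of T T id]) (auto simp: topspace)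
    hence "(\<lambda>x\<in>carrier G. x) \<in> ?C" using id_in_auto by simp
    thus "?C \<noteq> {}" by blast
  next
    fix f assume f: "f \<in> ?C"
    have i: "inv\<^bsub>AutoGroup G\<^esub> f = (\<lambda>x\<in>carrier G. inv_into (carrier G) f x)"
      using f Bij.m_inv_consistent[OF subgroup_auto, of f] inv_BijGroup[of f "carrier G"] by (simp add: AutoGroup_def auto_def)
    obtain g where g: "homeomorphic_maps T T f g" using f homeomorphic_map_maps by blast
    have "inv_into (carrier G) f x = g x" if x: "x \<in> carrier G" for x
    proof (rule inv_into_f_eq)
      show "inj_on f (carrier G)" using f by (auto simp: auto_def Bij_def bij_betw_def)
      show "g x \<in> carrier G" using g x by (auto simp: homeomorphic_maps_def continuous_map_def topspace)
      show "f (g x) = x" using g x by (auto simp: homeomorphic_maps_def topspace)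
    qed
    hence eq: "g x = (\<lambda>x\<in>carrier G. inv_into (carrier G) f x) x" if "x \<in> topspace T" for x
      using that by (simp add: topspace)
    have "homeomorphic_maps T T g f" using g homeomorphic_maps_sym by blast
    hence "homeomorphic_map T T (\<lambda>x\<in>carrier G. inv_into (carrier G) f x)"
      by (rule homeomorphic_map_eq[OF homeomorphic_maps_imp_map eq])
    moreover have "inv\<^bsub>AutoGroup G\<^esub> f \<in> auto G" using Aut.inv_closed[of f] f by (simp add: AutoGroup_def)
    ultimately show "inv\<^bsub>AutoGroup G\<^esub> f \<in> ?C" unfolding i by simp
  next
    fix f g assume f: "f \<in> ?C" and g: "g \<in> ?C"
    have "homeomorphic_map T T (compose (carrier G) f g)"
      by (rule homeomorphic_map_eq[of T T "f \<circ> g"]) (use f g in \<open>auto simp: compose_def topspace intro: homeomorphic_map_compose\<close>)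
    moreover have "f \<otimes>\<^bsub>AutoGroup G\<^esub> g \<in> auto G" using Aut.m_closed[of f g] f g by (simp add: AutoGroup_def)
    ultimately show "f \<otimes>\<^bsub>AutoGroup G\<^esub> g \<in> ?C" using f g by (simp add: mult)
  qed
  from Aut.subgroup_imp_group[OF this] show ?thesis by (simp add: top_AutoGroup_def)
qed

text \<open>The generator is unpacked from the group of extensional maps: its powers in the group
  are iterates on the carrier, and its finite order replaces integer exponents by natural
  ones.\<close>

lemma cyclic_aut_subgroup:
  assumes sub: "subgroup \<Delta> (top_AutoGroup G T)" and cyc: "cyclic_group (aut_subgroup G T \<Delta>)"
    and ord: "order (aut_subgroup G T \<Delta>) = q" and q: "prime q"
  obtains \<delta> \<delta>' where "\<delta> \<in> \<Delta>" "cont_aut \<delta>" "cont_aut \<delta>'" "\<And>g. g \<in> carrier G \<Longrightarrow> \<delta> (\<delta>' g) = g \<and> \<delta>' (\<delta> g) = g"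
    "\<And>g. g \<in> carrier G \<Longrightarrow> (\<delta> ^^ q) g = g" "\<exists>g\<in>carrier G. \<delta> g \<noteq> g"
    "\<And>d. d \<in> \<Delta> \<Longrightarrow> \<exists>n::nat. d = \<delta> [^]\<^bsub>aut_subgroup G T \<Delta>\<^esub> n"
    "\<And>g n. g \<in> carrier G \<Longrightarrow> (\<delta> [^]\<^bsub>aut_subgroup G T \<Delta>\<^esub> (n::nat)) g = (\<delta> ^^ n) g"
proof -
  interpret TA: group "top_AutoGroup G T" by (rule group_top_AutoGroup)
  let ?D = "aut_subgroup G T \<Delta>"
  have "group ?D" unfolding aut_subgroup_def by (rule TA.subgroup_imp_group[OF sub])
  then interpret D: group ?D .
  have cD: "carrier ?D = \<Delta>" by (simp add: aut_subgroup_def)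
  have ca: "cont_aut f" if "f \<in> \<Delta>" for f using that subgroup.subset[OF sub] top_AutoGroup_carrier by blast
  have one: "\<one>\<^bsub>?D\<^esub> = (\<lambda>x\<in>carrier G. x)" by (simp add: aut_subgroup_def top_AutoGroup_ops)
  have mult: "f \<otimes>\<^bsub>?D\<^esub> g = compose (carrier G) f g" if "f \<in> \<Delta>" "g \<in> \<Delta>" for f g
    using that ca by (simp add: aut_subgroup_def top_AutoGroup_ops)
  obtain \<delta> where d: "\<delta> \<in> \<Delta>" and gen: "\<Delta> = range (\<lambda>n::int. \<delta> [^]\<^bsub>?D\<^esub> n)"
    using cyc D.cyclic_group cD by auto
  define \<delta>' where "\<delta>' = inv\<^bsub>?D\<^esub> \<delta>"
  have d': "\<delta>' \<in> \<Delta>" using D.inv_closed d cD by (simp add: \<delta>'_def)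
  have pow: "(\<delta> [^]\<^bsub>?D\<^esub> n) g = (\<delta> ^^ n) g" if g: "g \<in> carrier G" for g and n :: nat
    using g
  proof (induction n arbitrary: g)
    case (Suc n)
    have "\<delta> [^]\<^bsub>?D\<^esub> n \<in> \<Delta>" using D.nat_pow_closed[of \<delta> n] d cD by simp
    hence "(\<delta> [^]\<^bsub>?D\<^esub> Suc n) g = (\<delta> [^]\<^bsub>?D\<^esub> n) (\<delta> g)" using Suc.prems d by (simp add: mult compose_def)
    also have "\<dots> = (\<delta> ^^ Suc n) g" using Suc.IH[of "\<delta> g"] cont_autD(5)[OF ca[OF d] Suc.prems] by (simp add: funpow_swap1)
    finally show ?case .
  qed (simp add: one)
  have ordq: "\<delta> [^]\<^bsub>?D\<^esub> q = \<one>\<^bsub>?D\<^esub>" using D.pow_order_eq_1[of \<delta>] ord d cD by simp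
  have q0: "q > 0" using prime_gt_0_nat[OF q] .
  have inv: "\<delta> (\<delta>' g) = g \<and> \<delta>' (\<delta> g) = g" if g: "g \<in> carrier G" for g
  proof -
    have "compose (carrier G) \<delta> \<delta>' = (\<lambda>x\<in>carrier G. x)" "compose (carrier G) \<delta>' \<delta> = (\<lambda>x\<in>carrier G. x)"
      using D.r_inv[of \<delta>] D.l_inv[of \<delta>] d d' cD mult[OF d d'] mult[OF d' d] by (simp_all add: one \<delta>'_def)
    from fun_cong[OF this(1), of g] fun_cong[OF this(2), of g] show ?thesis using g by (simp add: compose_def)
  qed
  \<comment> \<open>Otherwise every power of \<delta> is the identity, and the order would be 1
    instead of the prime q.\<close>
  have "\<exists>g\<in>carrier G. \<delta> g \<noteq> g"
  proof (rule ccontr)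
    assume "\<not> ?thesis"
    hence "\<delta> = \<one>\<^bsub>?D\<^esub>" unfolding one using cont_autD(9)[OF ca[OF d]] by (intro extensionalityI[of _ "carrier G"]) auto
    hence "\<Delta> = {\<one>\<^bsub>?D\<^esub>}" using gen D.int_pow_one by auto
    hence "card \<Delta> = card {\<one>\<^bsub>?D\<^esub>}" by (rule arg_cong)
    hence "order ?D = 1" by (simp add: order_def cD)
    thus False using ord q by simp
  qed
  moreover have "\<exists>n::nat. x = \<delta> [^]\<^bsub>?D\<^esub> n" if x: "x \<in> \<Delta>" for x
  proof -
    obtain i :: int where i: "x = \<delta> [^]\<^bsub>?D\<^esub> i" using x gen by blast
    have dc: "\<delta> \<in> carrier ?D" using d cD by simp
    have "\<delta> [^]\<^bsub>?D\<^esub> (int q * (i div int q)) = \<one>\<^bsub>?D\<^esub>"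
      using D.int_pow_pow[OF dc, of "int q" "i div int q"] ordq by (simp add: int_pow_int D.int_pow_one)
    hence "\<delta> [^]\<^bsub>?D\<^esub> (int q * (i div int q) + i mod int q) = \<delta> [^]\<^bsub>?D\<^esub> (i mod int q)"
      using D.int_pow_mult[OF dc, of "int q * (i div int q)" "i mod int q"] D.int_pow_closed[OF dc] by simp
    hence "x = \<delta> [^]\<^bsub>?D\<^esub> (i mod int q)" by (simp add: i)
    also have "\<dots> = \<delta> [^]\<^bsub>?D\<^esub> int (nat (i mod int q))" using q0 by simp
    finally show ?thesis unfolding int_pow_int by blast
  qed
  moreover have "(\<delta> ^^ q) g = g" if "g \<in> carrier G" for g
    using pow[OF that, of q] that by (simp add: ordq one)
  ultimately show thesis using that[of \<delta> \<delta>'] d ca[OF d] ca[OF d'] inv pow by blast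
qed

end

lemma (in cyclic_action) eigv_pow:
  assumes g: "eigv n a g" and a: "a \<in> carrier A"
  shows "cg (Suc n) (mo ((\<delta> ^^ i) g)) (sc (a [^]\<^bsub>A\<^esub> i) \<otimes>\<^bsub>R\<^esub> mo g)"
proof (induction i)
  have gc: "g \<in> carrier G" using g F_carrier unfolding eigv_def by blast
  case 0
  show ?case using gc by (simp add: el_one cg_refl del: Al.simps)
next
  have gc: "g \<in> carrier G" using g F_carrier unfolding eigv_def by blast
  case (Suc i)
  have ai: "a [^]\<^bsub>A\<^esub> i \<in> carrier A" using a by simp
  have "cg (Suc n) (mo ((\<delta> ^^ Suc i) g)) (sc (a [^]\<^bsub>A\<^esub> i) \<otimes>\<^bsub>R\<^esub> mo (\<delta> g))"
    using act_cg[OF \<delta>' Suc] gc a by (simp add: aut_pair_mo[OF pair] act_sc[OF \<delta>'] del: Al.simps)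
  moreover have "cg (Suc n) (sc (a [^]\<^bsub>A\<^esub> i) \<otimes>\<^bsub>R\<^esub> mo (\<delta> g)) (sc (a [^]\<^bsub>A\<^esub> i) \<otimes>\<^bsub>R\<^esub> (sc a \<otimes>\<^bsub>R\<^esub> mo g))"
    using g by (intro cg_sc[OF ai]) (simp add: eigv_def del: Al.simps)
  moreover have "sc (a [^]\<^bsub>A\<^esub> i) \<otimes>\<^bsub>R\<^esub> (sc a \<otimes>\<^bsub>R\<^esub> mo g) = sc (a [^]\<^bsub>A\<^esub> Suc i) \<otimes>\<^bsub>R\<^esub> mo g"
    using gc a by (simp add: R.m_assoc[symmetric] sc_mult)
  ultimately show ?case using cg_trans by metis
qed

text \<open>
  The commutators \<open>[y, \<dots>, [y, x]]\<close> of eigenvectors with eigenvalues \<open>\<eta> \<noteq> 1\<close> of y and \<open>\<psi>\<close> of x have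
  eigenvalue \<open>\<eta>\<^sup>b \<psi>\<close> when y occurs b times, and \<open>\<eta>\<^sup>b\<close> runs periodically through all q-th roots of unity.
\<close>

theorem (in completed_free) eigenspaces_infinite_rank:
  assumes q: "prime q" "q dvd p - 1" and nc: "\<not> comm_group G"
    and sub: "subgroup \<Delta> (top_AutoGroup G T)" and cyc: "cyclic_group (aut_subgroup G T \<Delta>)"
    and ord: "order (aut_subgroup G T \<Delta>) = q"
    and chi: "chi \<in> Irr A (aut_subgroup G T \<Delta>)"
  shows "infinite_rank A (eigenspace (Lie_module A G T) (aut_subgroup G T \<Delta>) Lie_action chi)"
proof -
  let ?D = "aut_subgroup G T \<Delta>"
  obtain \<delta> \<delta>' where d: "\<delta> \<in> \<Delta>" "cont_aut \<delta>" "cont_aut \<delta>'" "\<And>g. g \<in> carrier G \<Longrightarrow> \<delta> (\<delta>' g) = g \<and> \<delta>' (\<delta> g) = g"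
    "\<And>g. g \<in> carrier G \<Longrightarrow> (\<delta> ^^ q) g = g" "\<exists>g\<in>carrier G. \<delta> g \<noteq> g"
    and gen: "\<And>d. d \<in> \<Delta> \<Longrightarrow> \<exists>n::nat. d = \<delta> [^]\<^bsub>?D\<^esub> n"
    and pow: "\<And>g n. g \<in> carrier G \<Longrightarrow> (\<delta> [^]\<^bsub>?D\<^esub> (n::nat)) g = (\<delta> ^^ n) g"
    using cyclic_aut_subgroup[OF sub cyc ord q(1)] by blast
  interpret cyclic_action A p e red G T q \<delta> \<delta>'
    by unfold_locales (use q d in \<open>auto simp: aut_pair_def\<close>)
  interpret TA: group "top_AutoGroup G T" by (rule group_top_AutoGroup)
  have cD: "carrier ?D = \<Delta>" by (simp add: aut_subgroup_def)
  have "group ?D" unfolding aut_subgroup_def by (rule TA.subgroup_imp_group[OF sub])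
  then interpret D: group ?D .
  interpret UA: group "units_of A" by (rule A.units_group)
  interpret chi: group_hom ?D "units_of A" chi
    using chi by unfold_locales (simp add: Irr_def)
  have chi_pow: "chi (\<delta> [^]\<^bsub>?D\<^esub> n) = chi \<delta> [^]\<^bsub>A\<^esub> n" for n :: nat
    using chi.hom_nat_pow[of \<delta> n] chi.hom_closed[of \<delta>] d(1) cD by (simp add: A.units_of_pow units_of_carrier)
  have chi_closed: "chi f \<in> carrier A" if "f \<in> carrier ?D" for f
    using chi.hom_closed[OF that] A.Units_closed by (simp add: units_of_carrier)
  interpret eigen_setting A p e red G T ?D chi
  proof unfold_locales
    fix f assume f: "f \<in> carrier ?D"
    hence "inv\<^bsub>?D\<^esub> f \<in> carrier ?D" by simp
    have ca: "cont_aut h" if "h \<in> carrier ?D" for h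
      using that subgroup.subset[OF sub] top_AutoGroup_carrier cD by blast
    have m: "h \<otimes>\<^bsub>?D\<^esub> k = compose (carrier G) h k" if "h \<in> carrier ?D" "k \<in> carrier ?D" for h k
      using ca[OF that(1)] ca[OF that(2)] by (simp add: aut_subgroup_def top_AutoGroup_ops)
    have "compose (carrier G) f (inv\<^bsub>?D\<^esub> f) = (\<lambda>x\<in>carrier G. x)" "compose (carrier G) (inv\<^bsub>?D\<^esub> f) f = (\<lambda>x\<in>carrier G. x)"
      using D.r_inv[OF f] D.l_inv[OF f] f by (simp_all add: m) (simp_all add: aut_subgroup_def top_AutoGroup_ops)
    from fun_cong[OF this(1)] fun_cong[OF this(2)] have "f ((inv\<^bsub>?D\<^esub> f) g) = g \<and> (inv\<^bsub>?D\<^esub> f) (f g) = g" if "g \<in> carrier G" for g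
      using that by (metis compose_eq restrict_apply')
    thus "\<exists>f'. aut_pair f f'" using ca[OF f] ca[OF D.inv_closed[OF f]] by (auto simp: aut_pair_def)
  qed (rule chi_closed)
  define c where "c = chi \<delta>"
  have c: "c \<in> carrier A" using chi_closed d(1) cD by (simp add: c_def)
  have cq: "c [^]\<^bsub>A\<^esub> q = \<one>\<^bsub>A\<^esub>"
    using chi_pow[of q] D.pow_order_eq_1[of \<delta>] ord d(1) cD chi.hom_one by (simp add: c_def units_of_one)
  \<comment> \<open>Every element of \<Delta> is a power of \<delta>, and its character value is the
    same power of c.\<close>
  have eig: "eig n g" if g: "eigv n c g" for n g
    unfolding eig_def
  proof (intro conjI ballI)
    show gF: "g \<in> F n" using g by (simp add: eigv_def)
    fix f assume "f \<in> carrier ?D"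
    then obtain i :: nat where i: "f = \<delta> [^]\<^bsub>?D\<^esub> i" using gen cD by blast
    show "cg (Suc n) (mo (f g)) (sc (chi f) \<otimes>\<^bsub>R\<^esub> mo g)"
      using eigv_pow[OF g c, of i] F_carrier[OF gF] by (simp add: i pow chi_pow c_def del: Al.simps)
  qed
  obtain g0 where g0: "g0 \<in> carrier G" "\<delta> g0 \<noteq> g0" using d(6) by blast
  obtain \<eta> y l where \<eta>: "\<eta> \<in> carrier A" "\<eta> [^]\<^bsub>A\<^esub> q = \<one>\<^bsub>A\<^esub>" "\<not> [red 0 \<eta> = 1] (mod int p)"
    and y: "y \<in> carrier G" "eigv (Suc 0) \<eta> y" and l: "cont_mod_hom l" "\<not> int p dvd l y"
    by (rule nontrivial_eigenvector[OF g0])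
  obtain \<psi> x m where \<psi>: "\<psi> \<in> carrier A" "\<psi> [^]\<^bsub>A\<^esub> q = \<one>\<^bsub>A\<^esub>"
    and x: "x \<in> carrier G" "eigv (Suc 0) \<psi> x" and m: "cont_mod_hom m" "int p dvd m y" "\<not> int p dvd m x"
    by (rule second_eigenvector[OF y(1) nc])
  have q0: "q > 0" using prime_gt_0_nat[OF q(1)] .
  \<comment> \<open>r is c divided by \<psi>, since \<psi>^(q-1) is the inverse of \<psi>; the
    number b of letters y has to satisfy \<eta>^b = r.\<close>
  define r where "r = c \<otimes>\<^bsub>A\<^esub> \<psi> [^]\<^bsub>A\<^esub> (q - 1)"
  have r: "r \<in> carrier A" using c \<psi> by (simp add: r_def)
  have "(\<psi> [^]\<^bsub>A\<^esub> (q - 1)) [^]\<^bsub>A\<^esub> q = \<one>\<^bsub>A\<^esub>"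
    using \<psi> A.nat_pow_pow[of \<psi> "q - 1" q] A.nat_pow_pow[of \<psi> q "q - 1"] by (simp add: mult.commute)
  hence rq: "r [^]\<^bsub>A\<^esub> q = \<one>\<^bsub>A\<^esub>" using c cq \<psi> by (simp add: r_def A.nat_pow_distrib)
  obtain i :: nat where i: "r = \<eta> [^]\<^bsub>A\<^esub> i" using root_of_unity_power[OF q \<eta> r rq] .
  have val: "\<eta> [^]\<^bsub>A\<^esub> (i + q * t) \<otimes>\<^bsub>A\<^esub> \<psi> = c" for t
  proof -
    have "\<eta> [^]\<^bsub>A\<^esub> (i + q * t) = \<eta> [^]\<^bsub>A\<^esub> i \<otimes>\<^bsub>A\<^esub> (\<eta> [^]\<^bsub>A\<^esub> q) [^]\<^bsub>A\<^esub> t"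
      using \<eta>(1) by (simp add: A.nat_pow_mult A.nat_pow_pow)
    also have "\<dots> = r" using \<eta> by (simp add: i)
    finally have "\<eta> [^]\<^bsub>A\<^esub> (i + q * t) \<otimes>\<^bsub>A\<^esub> \<psi> = c \<otimes>\<^bsub>A\<^esub> (\<psi> [^]\<^bsub>A\<^esub> (q - 1) \<otimes>\<^bsub>A\<^esub> \<psi>)"
      using c \<psi> by (simp add: r_def A.m_assoc)
    also have "\<psi> [^]\<^bsub>A\<^esub> (q - 1) \<otimes>\<^bsub>A\<^esub> \<psi> = \<one>\<^bsub>A\<^esub>"
      using \<psi> q0 A.nat_pow_Suc[of \<psi> "q - 1"] by simp
    finally show ?thesis using c by simp
  qed
  \<comment> \<open>The degree of a commutator with b letters y is b + 1, and b runs through the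
    numbers i + q t, on which \<eta>^b is constant.\<close>
  define J where "J = range (\<lambda>t. Suc (i + q * t))"
  have "inj (\<lambda>t. Suc (i + q * t))" using q0 by (auto intro!: injI)
  hence inf: "infinite J" unfolding J_def by (rule range_inj_infinite)
  show ?thesis
  proof (rule infinite_rank_eigenspace[OF inf])
    show "n \<ge> 1" if "n \<in> J" for n using that by (auto simp: J_def)
    show "eig n (iterated_comm y x (n - 1))" if n: "n \<in> J" for n
    proof -
      obtain t where t: "n = Suc (i + q * t)" using n by (auto simp: J_def)
      show ?thesis using eig[of n "iterated_comm y x (n - 1)"] eigv_iterated_comm[OF y(2) x(2) \<eta>(1) \<psi>(1), of "i + q * t"]
        by (simp add: t val)
    qed
    show "a = \<zero>\<^bsub>A\<^esub>" if "n \<in> J" "a \<in> carrier A" "sc a \<otimes>\<^bsub>R\<^esub> mo (iterated_comm y x (n - 1)) \<in> Aln (Suc n)" for n a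
    proof (rule iterated_comm_free[OF y(1) x(1) l m that(2)])
      show "sc a \<otimes>\<^bsub>R\<^esub> mo (iterated_comm y x (n - 1)) \<in> Aln (Suc (Suc (n - 1)))"
        using that(1,3) by (auto simp: J_def simp del: Al.simps)
    qed
  qed
qed

lemma eigenspaces_infinite_rank_of_free_pro_p_group:
  fixes G :: "'g monoid"
  assumes A: "coeff_ring A p e red" and G: "free_pro_p_group p G T" and q: "prime q" "q dvd p - 1" and nc: "\<not> comm_group G"
    and sub: "subgroup \<Delta> (top_AutoGroup G T)" and cyc: "cyclic_group (aut_subgroup G T \<Delta>)"
    and ord: "order (aut_subgroup G T \<Delta>) = q"
    and chi: "chi \<in> Irr A (aut_subgroup G T \<Delta>)"
  shows "infinite_rank A (eigenspace (Lie_module A G T) (aut_subgroup G T \<Delta>) Lie_action chi)"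
proof -
  obtain X where X: "free_pro_p_on p G T X" using G by (auto simp: free_pro_p_group_def)
  interpret A: coeff_ring A p e red by (rule A)
  have pp: "pro_p_group p G T" using X by (simp add: free_pro_p_on_def)
  hence "group G" by (simp add: pro_p_group_def profinite_group_def top_group_def)
  then interpret group G .
  interpret completed_free A p e red G T X
    by unfold_locales (use A.prime_p pp X in auto)
  show ?thesis by (rule eigenspaces_infinite_rank[OF q nc sub cyc ord chi])
qed

theorem theorem3p12:
  fixes p q :: nat and G :: "'g monoid" and T :: "'g topology" and \<Delta> :: "('g \<Rightarrow> 'g) set"
  assumes "prime p" and "odd p"
    and "prime q" and "q dvd p - 1"
    and "free_pro_p_group p G T" and "top_finitely_generated G T" and "\<not> comm_group G"
    and "subgroup \<Delta> (top_AutoGroup G T)" and "cyclic_group (aut_subgroup G T \<Delta>)" and "order (aut_subgroup G T \<Delta>) = q"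
  shows "(\<forall>chi \<in> Irr (residue_ring (int p)) (aut_subgroup G T \<Delta>).
            infinite_rank (residue_ring (int p))
              (eigenspace (Lie_module (residue_ring (int p)) G T) (aut_subgroup G T \<Delta>) Lie_action chi))
       \<and> (\<forall>chi \<in> Irr (padic_int_ring p) (aut_subgroup G T \<Delta>).
            infinite_rank (padic_int_ring p)
              (eigenspace (Lie_module (padic_int_ring p) G T) (aut_subgroup G T \<Delta>) Lie_action chi))"
  using eigenspaces_infinite_rank_of_free_pro_p_group[OF coeff_ring_residue_ring[OF assms(1)] assms(5,3,4,7-10)]
    eigenspaces_infinite_rank_of_free_pro_p_group[OF coeff_ring_padic_int_ring[OF assms(1)] assms(5,3,4,7-10)]
  by blast

end
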